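(* For every $K\ge1$, $$\max_{[\alpha]_{K\times K}\in\mathcal A_{\mathrm{CTIN}}}\frac{\mathcal D_{\Sigma,\mathrm{BC}}}{\mathcal D_{\Sigma,\mathrm{TINA}}}=\max_{[\alpha]_{K\times K}\in\mathcal A_{\mathrm{CTIN}}}\frac{\mathcal D_{\Sigma,\mathrm{BC}}}{\mathcal D_{\Sigma,\mathrm{IC}}}=2-\frac1K,$$ where the maxima are over matrices with nonzero denominators (i.e., not all $\alpha_{ii}=0$).
   Context: Channel model: for $k\in[K]$, $Y_k(t)=\sum_{i=1}^K \bar P^{\alpha_{ki}}G_{ki}(t)X_i(t)+Z_k(t)$, $\bar P=\sqrt P$, unit power constraints on $X_i(t)\in\mathbb C$, $Z_k(t)$ zero-mean unit-variance complex AWGN, $\alpha_{ki}\ge0$ known to all. $G_{ki}(t)$ are known perfectly at receivers and only to finite precision at transmitters (transmitters know only a distribution with joint/conditional densities bounded by a constant independent of $P$, magnitudes bounded above and away from zero independently of $P$; transmitted symbols are independent of the channel realizations). In the $K$ user interference channel (IC), message $k$ (for Receiver $k$) is encoded only by Transmitter $k$; in the $K$ user MISO broadcast channel (BC), all $K$ messages are jointly encoded by all $K$ transmitters. GDoF region: $\{(d_k): d_k=\lim_{P\to\infty}R_k(P)/\log P\text{ for achievable }(R_k(P))\}$. $\mathcal D_{\Sigma,\mathrm{IC}}$, $\mathcal D_{\Sigma,\mathrm{BC}}$ denote the maximum sum-GDoF of the IC and BC. CTIN regime: $\mathcal{A}_{\mathrm{CTIN}}=\{[\alpha]\in\mathbb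 R_+^{K\times K}:\ \alpha_{ii}\ge\max(\alpha_{ij}+\alpha_{ji},\ \alpha_{ik}+\alpha_{ji}-\alpha_{jk})\ \forall i,j,k\in[K],\ i\notin\{j,k\}\}$. Cycles: a cycle $\pi=(i_1\to\cdots\to i_M)$, $M\ge1$, is an ordered list of distinct indices of $[K]$, read cyclically ($i_{M+1}=i_1$); $\{\pi\}$ its set; $\Pi$ the set of all cycles. $\delta_{ij}=\alpha_{ii}-\alpha_{ji}$ ($i\neq j$), $\delta_{ii}=0$; $\Delta_\pi=\sum_{m=1}^M\delta_{i_mi_{m+1}}$ if $M>1$, $\Delta_\pi=\alpha_{i_1i_1}$ if $M=1$. For $S\subseteq[K]$, $\mathcal D_{\mathrm{P\text{-}TIN}}(S)=\{(d_k)_{k\in[K]}: d_k=0\ (k\notin S),\ d_k\ge0\ (k\in S),\ \sum_{k\in\{\pi\}}d_k\le\Delta_\pi\ \forall \pi\in\Pi,\ \{\pi\}\subseteq S\}$; $\mathcal D_{\mathrm{TINA}}=\bigcup_{S\subseteq[K]}\mathcal D_{\mathrm{P\text{-}TIN}}(S)$ and $\mathcal D_{\Sigma,\mathrm{TINA}}$ is its maximum coordinate sum. *)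

theory Defs
  imports "HOL-Probability.Probability"
begin

text \<open>Users/antennas are indexed by 0..K-1 (i.e. k < K) instead of 1..K.
  A K x K matrix alpha is a function nat => nat => real of which only the
  entries with indices < K matter.  Channel realisations over time are
  functions g :: nat => nat => nat => complex, g t k i = G_ki(t).\<close>

definition A_CTIN :: "nat \<Rightarrow> (nat \<Rightarrow> nat \<Rightarrow> real) set" where
  "A_CTIN K = {\<alpha>. (\<forall>i<K. \<forall>j<K. \<alpha> i j \<ge> 0) \<and>
     (\<forall>i<K. \<forall>j<K. \<forall>k<K. i \<noteq> j \<and> i \<noteq> k \<longrightarrow>
        \<alpha> i i \<ge> max (\<alpha> i j + \<alpha> j i) (\<alpha> i k + \<alpha> j i - \<alpha> j k))}"

definition is_cycle :: "nat \<Rightarrow> nat list \<Rightarrow> bool" where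
  "is_cycle K \<pi> \<longleftrightarrow> \<pi> \<noteq> [] \<and> distinct \<pi> \<and> set \<pi> \<subseteq> {..<K}"

definition delta :: "(nat \<Rightarrow> nat \<Rightarrow> real) \<Rightarrow> nat \<Rightarrow> nat \<Rightarrow> real" where
  "delta \<alpha> i j = (if i = j then 0 else \<alpha> i i - \<alpha> j i)"

definition Delta :: "(nat \<Rightarrow> nat \<Rightarrow> real) \<Rightarrow> nat list \<Rightarrow> real" where
  "Delta \<alpha> \<pi> = (if length \<pi> = 1 then \<alpha> (\<pi> ! 0) (\<pi> ! 0)
      else (\<Sum>m<length \<pi>. delta \<alpha> (\<pi> ! m) (\<pi> ! ((m + 1) mod length \<pi>))))"

definition D_PTIN :: "nat \<Rightarrow> (nat \<Rightarrow> nat \<Rightarrow> real) \<Rightarrow> nat set \<Rightarrow> (nat \<Rightarrow> real) set" where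
  "D_PTIN K \<alpha> S = {d. (\<forall>k. k \<ge> K \<longrightarrow> d k = 0) \<and>
      (\<forall>k<K. k \<notin> S \<longrightarrow> d k = 0) \<and> (\<forall>k\<in>S. d k \<ge> 0) \<and>
      (\<forall>\<pi>. is_cycle K \<pi> \<and> set \<pi> \<subseteq> S \<longrightarrow> (\<Sum>k\<in>set \<pi>. d k) \<le> Delta \<alpha> \<pi>)}"

definition D_TINA_region :: "nat \<Rightarrow> (nat \<Rightarrow> nat \<Rightarrow> real) \<Rightarrow> (nat \<Rightarrow> real) set" where
  "D_TINA_region K \<alpha> = (\<Union>S\<in>Pow {..<K}. D_PTIN K \<alpha> S)"

definition D_sum_TINA :: "nat \<Rightarrow> (nat \<Rightarrow> nat \<Rightarrow> real) \<Rightarrow> real" where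
  "D_sum_TINA K \<alpha> = Sup {(\<Sum>k<K. d k) | d. d \<in> D_TINA_region K \<alpha>}"

definition coords :: "nat \<Rightarrow> (nat \<times> nat \<times> nat) set" where
  "coords K = {(t, k, i). k < K \<and> i < K}"

definition chan_marg ::
  "(nat \<Rightarrow> nat \<Rightarrow> nat \<Rightarrow> complex) measure \<Rightarrow> (nat \<times> nat \<times> nat) set
     \<Rightarrow> ((nat \<times> nat \<times> nat) \<Rightarrow> complex) measure" where
  "chan_marg G S = distr G (PiM S (\<lambda>_. (borel :: complex measure)))
      (\<lambda>g. restrict (\<lambda>(t, k, i). g t k i) S)"

text \<open>Gm P is the law of the channel process (G_ki(t)) at power P.  Admissible:
  magnitudes bounded above and away from zero, and all joint and conditional
  densities (w.r.t. Lebesgue measure) bounded, with constants independent of P.\<close>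
definition admissible_channel ::
  "nat \<Rightarrow> (real \<Rightarrow> (nat \<Rightarrow> nat \<Rightarrow> nat \<Rightarrow> complex) measure) \<Rightarrow> bool" where
  "admissible_channel K Gm \<longleftrightarrow> (\<exists>fmax dmin dmax. fmax > 0 \<and> dmin > 0 \<and> dmin \<le> dmax \<and>
     (\<forall>P>1. prob_space (Gm P) \<and>
       (\<forall>t k i. k < K \<longrightarrow> i < K \<longrightarrow> (\<lambda>g. g t k i) \<in> borel_measurable (Gm P)) \<and>
       (\<forall>t k i. k < K \<longrightarrow> i < K \<longrightarrow>
          (AE g in Gm P. dmin \<le> cmod (g t k i) \<and> cmod (g t k i) \<le> dmax)) \<and>
       (\<forall>A B. finite A \<and> finite B \<and> A \<subseteq> coords K \<and> B \<subseteq> coords K \<and> A \<inter> B = {} \<longrightarrow>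
          (\<exists>f h. f \<in> borel_measurable (PiM (A \<union> B) (\<lambda>_. (lborel :: complex measure))) \<and>
                 h \<in> borel_measurable (PiM B (\<lambda>_. (lborel :: complex measure))) \<and>
                 chan_marg (Gm P) (A \<union> B) = density (PiM (A \<union> B) (\<lambda>_. lborel)) f \<and>
                 chan_marg (Gm P) B = density (PiM B (\<lambda>_. lborel)) h \<and>
                 (AE x in PiM (A \<union> B) (\<lambda>_. lborel).
                    f x \<le> ennreal (fmax ^ card A) * h (restrict x B))))))"

definition CN01 :: "complex measure" where
  "CN01 = density lborel (\<lambda>z. ennreal (exp (- (cmod z)\<^sup>2) / pi))"

definition noise :: "nat \<Rightarrow> nat \<Rightarrow> (nat \<times> nat \<Rightarrow> complex) measure" where
  "noise n K = PiM ({..<n} \<times> {..<K}) (\<lambda>_. CN01)"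

definition msg_set :: "nat \<Rightarrow> (nat \<Rightarrow> nat) \<Rightarrow> (nat \<Rightarrow> nat) set" where
  "msg_set K M = PiE {..<K} (\<lambda>k. {..<M k})"

text \<open>Received signal of receiver k over the block (zero outside the block).
  E w i t is the symbol X_i(t) sent by transmitter i for message tuple w.\<close>
definition rx_signal :: "nat \<Rightarrow> (nat \<Rightarrow> nat \<Rightarrow> real) \<Rightarrow> real \<Rightarrow> nat
    \<Rightarrow> ((nat \<Rightarrow> nat) \<Rightarrow> nat \<Rightarrow> nat \<Rightarrow> complex) \<Rightarrow> (nat \<Rightarrow> nat)
    \<Rightarrow> (nat \<Rightarrow> nat \<Rightarrow> nat \<Rightarrow> complex) \<Rightarrow> (nat \<times> nat \<Rightarrow> complex) \<Rightarrow> nat \<Rightarrow> nat \<Rightarrow> complex" where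
  "rx_signal K \<alpha> P n E w g z k = (\<lambda>t. if t < n then
      (\<Sum>i<K. complex_of_real (sqrt P powr \<alpha> k i) * g t k i * E w i t) + z (t, k) else 0)"

definition restrict_time :: "nat \<Rightarrow> (nat \<Rightarrow> nat \<Rightarrow> nat \<Rightarrow> complex) \<Rightarrow> nat \<Rightarrow> nat \<Rightarrow> nat \<Rightarrow> complex" where
  "restrict_time n g = (\<lambda>t. if t < n then g t else (\<lambda>_ _. 0))"

text \<open>Probability that all receivers decode correctly (uniform independent
  messages, independent channel and noise).  Receiver k's decoder sees its
  own output and the channel realisation.  The (lower) integral of the
  indicator is used, so no measurability of decoders has to be assumed.\<close>
definition success_prob :: "nat \<Rightarrow> (nat \<Rightarrow> nat \<Rightarrow> real) \<Rightarrow> real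
    \<Rightarrow> (nat \<Rightarrow> nat \<Rightarrow> nat \<Rightarrow> complex) measure \<Rightarrow> nat \<Rightarrow> (nat \<Rightarrow> nat)
    \<Rightarrow> ((nat \<Rightarrow> nat) \<Rightarrow> nat \<Rightarrow> nat \<Rightarrow> complex)
    \<Rightarrow> (nat \<Rightarrow> (nat \<Rightarrow> complex) \<Rightarrow> (nat \<Rightarrow> nat \<Rightarrow> nat \<Rightarrow> complex) \<Rightarrow> nat) \<Rightarrow> ennreal" where
  "success_prob K \<alpha> P G n M E dec =
     (\<Sum>w\<in>msg_set K M. \<integral>\<^sup>+ gz. indicator
         {gz. \<forall>k<K. dec k (rx_signal K \<alpha> P n E w (fst gz) (snd gz) k)
                          (restrict_time n (fst gz)) = w k} gz
       \<partial>(G \<Otimes>\<^sub>M noise n K)) / of_nat (card (msg_set K M))"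

text \<open>Achievability of rate tuple R (bits per channel use) at power P.
  is_bc = True: MISO BC (every transmitter may use all messages);
  is_bc = False: IC (transmitter i's symbols depend only on message i).\<close>
definition achievable :: "bool \<Rightarrow> nat \<Rightarrow> (nat \<Rightarrow> nat \<Rightarrow> real)
    \<Rightarrow> (nat \<Rightarrow> nat \<Rightarrow> nat \<Rightarrow> complex) measure \<Rightarrow> real \<Rightarrow> (nat \<Rightarrow> real) \<Rightarrow> bool" where
  "achievable is_bc K \<alpha> G P R \<longleftrightarrow> (\<forall>k<K. R k \<ge> 0) \<and>
     (\<forall>\<epsilon>>0. \<exists>N. \<forall>n\<ge>N. \<exists>M E dec.
        (\<forall>k<K. 2 powr (real n * R k) \<le> real (M k)) \<and>
        (\<forall>w\<in>msg_set K M. \<forall>i<K. (\<Sum>t<n. (cmod (E w i t))\<^sup>2) \<le> real n) \<and>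
        (\<not> is_bc \<longrightarrow> (\<forall>w\<in>msg_set K M. \<forall>w'\<in>msg_set K M. \<forall>i<K.
             w i = w' i \<longrightarrow> E w i = E w' i)) \<and>
        ennreal (1 - \<epsilon>) \<le> success_prob K \<alpha> P G n M E dec)"

definition GDoF_region :: "bool \<Rightarrow> nat \<Rightarrow> (nat \<Rightarrow> nat \<Rightarrow> real)
    \<Rightarrow> (real \<Rightarrow> (nat \<Rightarrow> nat \<Rightarrow> nat \<Rightarrow> complex) measure) \<Rightarrow> (nat \<Rightarrow> real) set" where
  "GDoF_region is_bc K \<alpha> Gm = {d. (\<forall>k. k \<ge> K \<longrightarrow> d k = 0) \<and>
     (\<exists>R :: real \<Rightarrow> nat \<Rightarrow> real. (\<forall>P>1. achievable is_bc K \<alpha> (Gm P) P (R P)) \<and>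
        (\<forall>k<K. ((\<lambda>P. R P k / log 2 P) \<longlongrightarrow> d k) at_top))}"

definition D_sum_BC :: "nat \<Rightarrow> (nat \<Rightarrow> nat \<Rightarrow> real)
    \<Rightarrow> (real \<Rightarrow> (nat \<Rightarrow> nat \<Rightarrow> nat \<Rightarrow> complex) measure) \<Rightarrow> real" where
  "D_sum_BC K \<alpha> Gm = Sup {(\<Sum>k<K. d k) | d. d \<in> GDoF_region True K \<alpha> Gm}"

definition D_sum_IC :: "nat \<Rightarrow> (nat \<Rightarrow> nat \<Rightarrow> real)
    \<Rightarrow> (real \<Rightarrow> (nat \<Rightarrow> nat \<Rightarrow> nat \<Rightarrow> complex) measure) \<Rightarrow> real" where
  "D_sum_IC K \<alpha> Gm = Sup {(\<Sum>k<K. d k) | d. d \<in> GDoF_region False K \<alpha> Gm}"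

definition is_max :: "real set \<Rightarrow> real \<Rightarrow> bool" where
  "is_max S m \<longleftrightarrow> m \<in> S \<and> (\<forall>x\<in>S. x \<le> m)"

end

theory Submission
  imports Defs
begin

text \<open>Converse: fix a code and let the other codewords be weighted by their likelihood at a receiver;
  with high probability a receiver that decodes is confident, i.e. its own class of codewords carries most of the
  likelihood. Averaging the likelihood at receiver \<open>kb\<close> over its channel coefficients, whose conditional density is
  bounded, turns each Gaussian factor into a Cauchy-type factor in the difference of the codewords, and such a
  factor is dominated by a logarithmic number of Gaussians of the scale \<open>D\<close> by which receiver \<open>ka\<close> is stronger (aligned images).
  Hence passing from one receiver to the next along a path \<open>i\<^sub>1 \<rightarrow> \<dots> \<rightarrow> i\<^sub>M\<close> costs at most the weights \<open>delta\<close>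
  of its edges, and the sum of the broadcast GDoF over the path is at most \<open>\<alpha> i\<^sub>M i\<^sub>M\<close> plus its length.

  The CTIN conditions make \<open>delta\<close> a directed metric with \<open>\<alpha> i i \<le> delta i j + delta j i\<close>. Dropping the longest edge of a
  cycle therefore bounds the broadcast sum over the cycle by \<open>2 - 1 / K\<close> times its weight: a broadcast tuple divided by
  \<open>2 - 1 / K\<close> satisfies the inequalities of the TIN polyhedron, and these tuples are achieved in the interference
  channel by codes of large minimum distance with powers given by shortest-path potentials.

  Equality holds for the cyclic channel \<open>cyc K\<close>: its interference channel has sum GDoF 1, whereas a common codeword of
  GDoF \<open>1 - 1 / K\<close> above \<open>K\<close> private ones of GDoF \<open>1 / K\<close> reaches \<open>2 - 1 / K\<close> in the broadcast channel.\<close>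

subsection \<open>Gaussian integrals and finite products of Lebesgue measure\<close>

text \<open>Sums of likelihoods over the message tuples that agree on what is already decoded take
  the place of conditional entropies. The number of codewords is exponential in \<open>n\<close>,
  which rules out a union bound over them. Instead the transmitted tuple is averaged too: passing
  from noise to output turns this average into posterior weights, which sum to one, and each
  comparison of likelihoods then fails with probability at most \<open>1 / (16 * K)\<close>. There
  are at most \<open>2 * K + 1\<close> bad events, so one tuple and one realisation avoid them all,
  and there the comparisons are multiplied. Constants to the power \<open>n\<close> and powers of
  \<open>log P\<close> are lost, which GDoF does not see; hence one block length for each power
  suffices. A path bound cannot give 1 for the cyclic interference channel, because its broadcast
  channel attains more. There the decoded message moves only the own input, and this makes it a
  factor \<open>M k\<close> in the count of interference patterns. Achievability asks for minimum
  distance uniformly over all coefficients with magnitudes between \<open>dmin\<close> and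
  \<open>dmax\<close>, so fading enters only through these two constants.\<close>

definition gam :: "complex \<Rightarrow> real" where
  "gam z = exp (- (cmod z)\<^sup>2) / pi"

lemma gam_pos [simp]: "gam z > 0" and gam_nonneg [simp]: "gam z \<ge> 0"
  by (simp_all add: gam_def)

lemma gam_le_1: "gam z \<le> 1"
proof -
  have "exp (- (cmod z)\<^sup>2) \<le> 1" by simp
  also have "1 \<le> pi" using pi_gt3 by linarith
  finally show ?thesis by (simp add: gam_def)
qed

lemma borel_measurable_gam [measurable]: "gam \<in> borel_measurable borel"
  unfolding gam_def by measurable

lemma nn_integral_gaussian_real:
  assumes "s > 0"
  shows "(\<integral>\<^sup>+x. ennreal (exp (- (x - c)\<^sup>2 / s)) \<partial>lborel) = ennreal (sqrt (pi * s))"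
proof -
  define \<sigma> where "\<sigma> = sqrt (s / 2)"
  have \<sigma>: "\<sigma> > 0" "2 * \<sigma>\<^sup>2 = s" using assms by (auto simp: \<sigma>_def)
  interpret prob_space "density lborel (normal_density c \<sigma>)"
    using \<sigma>(1) by (rule prob_space_normal_density)
  have "(\<integral>\<^sup>+x. ennreal (normal_density c \<sigma> x) \<partial>lborel) = 1"
    using emeasure_space_1 by (simp add: emeasure_density)
  moreover have "ennreal (exp (- (x - c)\<^sup>2 / s)) = ennreal (sqrt (pi * s)) * ennreal (normal_density c \<sigma> x)" for x
  proof -
    have "normal_density c \<sigma> x = exp (- (x - c)\<^sup>2 / s) / sqrt (pi * s)"
      unfolding normal_density_def \<sigma>(2)[symmetric] by (simp add: mult_ac)
    then show ?thesis
      using assms by (subst ennreal_mult[symmetric]) simp_all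
  qed
  ultimately show ?thesis
    by (simp add: nn_integral_cmult)
qed

lemma nn_integral_gaussian_complex:
  assumes "s > 0"
  shows "(\<integral>\<^sup>+z. ennreal (exp (- (cmod (z - c))\<^sup>2 / s)) \<partial>lborel) = ennreal (pi * s)"
proof -
  let ?f = "\<lambda>b x. ennreal (exp (- (x - c \<bullet> b)\<^sup>2 / s))"
  have "ennreal (exp (- (cmod (z - c))\<^sup>2 / s)) = (\<Prod>b\<in>Basis. ?f b (z \<bullet> b))" for z
  proof -
    have "(cmod (z - c))\<^sup>2 = (Re z - Re c)\<^sup>2 + (Im z - Im c)\<^sup>2"
      by (simp add: cmod_power2)
    then show ?thesis
      by (simp add: Basis_complex_def inner_complex_def ennreal_mult[symmetric] exp_add[symmetric] diff_divide_distrib)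
  qed
  then have "(\<integral>\<^sup>+z. ennreal (exp (- (cmod (z - c))\<^sup>2 / s)) \<partial>lborel)
      = (\<integral>\<^sup>+z. (\<Prod>b\<in>Basis. ?f b (z \<bullet> b)) \<partial>lborel)" by simp
  also have "\<dots> = (\<Prod>b\<in>(Basis::complex set). (\<integral>\<^sup>+x. ?f b x \<partial>lborel))"
    by (rule nn_integral_lborel_prod) auto
  also have "\<dots> = (\<Prod>b\<in>(Basis::complex set). ennreal (sqrt (pi * s)))"
    using assms by (simp only: nn_integral_gaussian_real)
  also have "\<dots> = ennreal (pi * s)"
    using assms by (simp add: Basis_complex_def ennreal_mult[symmetric])
  finally show ?thesis .
qed

text \<open>Complex multiplication by \<open>h\<close> scales area by
  \<open>(cmod h)\<^sup>2\<close>. With \<open>x\<close> an unknown fading coefficient and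
  \<open>h\<close> a difference of two inputs, this is the decay in the codeword difference on which
  aligned images rest.\<close>

lemma nn_integral_gam_affine:
  assumes "h \<noteq> 0"
  shows "(\<integral>\<^sup>+x. ennreal (gam (c - h * x)) \<partial>lborel) = ennreal (1 / (cmod h)\<^sup>2)"
proof -
  have "ennreal (gam (c - h * x)) = ennreal (1 / pi) * ennreal (exp (- (cmod (x - c / h))\<^sup>2 / (1 / (cmod h)\<^sup>2)))" for x
  proof -
    have "c - h * x = - h * (x - c / h)" using assms by (simp add: field_simps)
    then have "(cmod (c - h * x))\<^sup>2 = (cmod (x - c / h))\<^sup>2 * (cmod h)\<^sup>2"
      by (simp only: norm_mult power_mult_distrib norm_minus_cancel mult.commute)
    then show ?thesis
      by (subst ennreal_mult[symmetric]) (simp_all add: gam_def)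
  qed
  then have "(\<integral>\<^sup>+x. ennreal (gam (c - h * x)) \<partial>lborel)
      = ennreal (1 / pi) * (\<integral>\<^sup>+x. ennreal (exp (- (cmod (x - c / h))\<^sup>2 / (1 / (cmod h)\<^sup>2))) \<partial>lborel)"
    by (simp only: nn_integral_cmult) (rule nn_integral_cmult, measurable)
  also have "\<dots> = ennreal (1 / pi) * ennreal (pi * (1 / (cmod h)\<^sup>2))"
    using assms by (subst nn_integral_gaussian_complex) simp_all
  also have "\<dots> = ennreal (1 / (cmod h)\<^sup>2)"
    by (subst ennreal_mult[symmetric]) simp_all
  finally show ?thesis .
qed

lemma CN01_eq: "CN01 = density lborel (\<lambda>z. ennreal (gam z))"
  by (simp add: CN01_def gam_def)

lemma sets_CN01 [simp, measurable_cong]: "sets CN01 = sets borel" and space_CN01 [simp]: "space CN01 = UNIV"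
  by (simp_all add: CN01_eq)

lemma prob_space_CN01: "prob_space CN01"
proof
  have "(\<integral>\<^sup>+z. ennreal (gam (0 - 1 * z)) \<partial>lborel) = ennreal (1 / (cmod 1)\<^sup>2)"
    by (rule nn_integral_gam_affine) simp
  then show "emeasure CN01 (space CN01) = 1"
    by (simp add: CN01_eq emeasure_density gam_def)
qed

lemma product_sigma_finite_lborel: "product_sigma_finite (\<lambda>_::'i. lborel :: complex measure)"
  by (standard) (rule lborel.sigma_finite_countable)

lemma product_sigma_finite_CN01: "product_sigma_finite (\<lambda>_::'i. CN01)"
proof -
  interpret prob_space CN01 by (rule prob_space_CN01)
  show ?thesis by standard (rule sigma_finite_countable)
qed

lemma PiM_CN01:
  assumes [simp]: "finite J"
  shows "PiM J (\<lambda>_. CN01) = density (PiM J (\<lambda>_. lborel)) (\<lambda>x. ennreal (\<Prod>j\<in>J. gam (x j)))"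
proof -
  interpret C: product_sigma_finite "\<lambda>_. CN01" by (rule product_sigma_finite_CN01)
  interpret L: product_sigma_finite "\<lambda>_. lborel :: complex measure" by (rule product_sigma_finite_lborel)
  show ?thesis
  proof (rule C.PiM_eqI[symmetric])
    show "sets (density (PiM J (\<lambda>_. lborel)) (\<lambda>x. ennreal (\<Prod>j\<in>J. gam (x j)))) = sets (PiM J (\<lambda>_. CN01))"
      by (simp cong: sets_PiM_cong)
    fix A :: "'a \<Rightarrow> complex set" assume A: "\<And>i. i \<in> J \<Longrightarrow> A i \<in> sets CN01"
    then have A': "\<And>i. i \<in> J \<Longrightarrow> A i \<in> sets borel" by simp
    have "emeasure (density (PiM J (\<lambda>_. lborel)) (\<lambda>x. ennreal (\<Prod>j\<in>J. gam (x j)))) (Pi\<^sub>E J A)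
       = (\<integral>\<^sup>+x. ennreal (\<Prod>j\<in>J. gam (x j)) * indicator (Pi\<^sub>E J A) x \<partial>PiM J (\<lambda>_. lborel))"
      using A' by (intro emeasure_density) (auto intro!: sets_PiM_I_finite)
    also have "\<dots> = (\<integral>\<^sup>+x. (\<Prod>j\<in>J. ennreal (gam (x j)) * indicator (A j) (x j)) \<partial>PiM J (\<lambda>_. lborel))"
    proof (intro nn_integral_cong)
      fix x assume "x \<in> space (PiM J (\<lambda>_. lborel :: complex measure))"
      then have x: "x \<in> extensional J" by (simp add: space_PiM PiE_def)
      have "indicator (Pi\<^sub>E J A) x = (\<Prod>j\<in>J. indicator (A j) (x j) :: ennreal)"
        using x by (auto simp: indicator_def PiE_def Pi_def)
      then show "ennreal (\<Prod>j\<in>J. gam (x j)) * indicator (Pi\<^sub>E J A) x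
          = (\<Prod>j\<in>J. ennreal (gam (x j)) * indicator (A j) (x j))"
        by (simp add: prod.distrib prod_ennreal)
    qed
    also have "\<dots> = (\<Prod>j\<in>J. \<integral>\<^sup>+z. ennreal (gam z) * indicator (A j) z \<partial>lborel)"
      using A' by (intro L.product_nn_integral_prod) auto
    also have "\<dots> = (\<Prod>j\<in>J. emeasure CN01 (A j))"
      using A' by (intro prod.cong) (auto simp: CN01_eq emeasure_density)
    finally show "emeasure (density (PiM J (\<lambda>_. lborel)) (\<lambda>x. ennreal (\<Prod>j\<in>J. gam (x j)))) (Pi\<^sub>E J A)
       = (\<Prod>j\<in>J. emeasure CN01 (A j))" .
  qed simp
qed

text \<open>Codewords are compared at a common output, so integrals over noise have to become
  integrals over outputs; invariance of Lebesgue measure under translation by a codeword does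
  this.\<close>

lemma nn_integral_PiM_lborel_translate:
  fixes J :: "'i set" and c :: "'i \<Rightarrow> complex"
  assumes [simp]: "finite J" and f: "f \<in> borel_measurable (PiM J (\<lambda>_. lborel))"
  shows "(\<integral>\<^sup>+x. f (\<lambda>j\<in>J. x j + c j) \<partial>PiM J (\<lambda>_. lborel)) = (\<integral>\<^sup>+x. f x \<partial>PiM J (\<lambda>_. lborel))"
proof -
  interpret L: product_sigma_finite "\<lambda>_::'i. lborel :: complex measure" by (rule product_sigma_finite_lborel)
  let ?T = "\<lambda>x. \<lambda>j\<in>J. x j + c j"
  have T [measurable]: "?T \<in> measurable (PiM J (\<lambda>_. lborel)) (PiM J (\<lambda>_. lborel))"
    by (rule measurable_restrict) simp
  have "distr (PiM J (\<lambda>_. lborel)) (PiM J (\<lambda>_. lborel)) ?T = PiM J (\<lambda>_. lborel)"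
  proof (rule L.PiM_eqI)
    fix A :: "'i \<Rightarrow> complex set" assume "\<And>i. i \<in> J \<Longrightarrow> A i \<in> sets lborel"
    then have A': "\<And>i. i \<in> J \<Longrightarrow> A i \<in> sets borel" by simp
    have pre: "?T -` (Pi\<^sub>E J A) \<inter> space (PiM J (\<lambda>_. lborel)) = Pi\<^sub>E J (\<lambda>j. (+) (c j) -` A j)"
      by (auto simp: space_PiM PiE_def Pi_def extensional_def add.commute)
    have "emeasure (distr (PiM J (\<lambda>_. lborel)) (PiM J (\<lambda>_. lborel)) ?T) (Pi\<^sub>E J A)
        = emeasure (PiM J (\<lambda>_. lborel)) (Pi\<^sub>E J (\<lambda>j. (+) (c j) -` A j))"
      using A' by (subst emeasure_distr[OF T]) (auto intro!: sets_PiM_I_finite simp: pre)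
    also have "\<dots> = (\<Prod>j\<in>J. emeasure lborel ((+) (c j) -` A j))"
    proof (rule L.emeasure_PiM)
      fix i assume "i \<in> J"
      then have "(+) (c i) -` A i \<inter> space lborel \<in> sets lborel"
        using A' by (intro measurable_sets[where A = borel]) auto
      then show "(+) (c i) -` A i \<in> sets lborel" by simp
    qed simp
    also have "\<dots> = (\<Prod>j\<in>J. emeasure (distr lborel borel ((+) (c j))) (A j))"
      using A' by (intro prod.cong refl, subst emeasure_distr) auto
    finally show "emeasure (distr (PiM J (\<lambda>_. lborel)) (PiM J (\<lambda>_. lborel)) ?T) (Pi\<^sub>E J A)
        = (\<Prod>j\<in>J. emeasure lborel (A j))"
      by (simp add: lborel_distr_plus)
  qed simp_all
  then have "(\<integral>\<^sup>+x. f x \<partial>PiM J (\<lambda>_. lborel)) = (\<integral>\<^sup>+x. f x \<partial>distr (PiM J (\<lambda>_. lborel)) (PiM J (\<lambda>_. lborel)) ?T)"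
    by simp
  also have "\<dots> = (\<integral>\<^sup>+x. f (?T x) \<partial>PiM J (\<lambda>_. lborel))"
    by (rule nn_integral_distr[OF T]) (use f in simp)
  finally show ?thesis ..
qed

lemma prob_space_noise: "prob_space (noise n K)"
  unfolding noise_def by (rule prob_space_PiM) (rule prob_space_CN01)

lemma measurable_noise_component:
  assumes "j \<in> {..<n} \<times> {..<K}"
  shows "(\<lambda>z. z j) \<in> borel_measurable (noise n K)"
proof -
  have "(\<lambda>z. z j) \<in> measurable (noise n K) CN01"
    unfolding noise_def using assms by (rule measurable_component_singleton)
  then show ?thesis unfolding measurable_cong_sets[OF refl sets_CN01] .
qed

definition rx_rows :: "nat \<Rightarrow> nat \<Rightarrow> (nat \<times> nat) set" where
  "rx_rows n k = {..<n} \<times> {k}"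

lemma finite_rx_rows [simp]: "finite (rx_rows n k)"
  by (simp add: rx_rows_def)

lemma prod_rx_rows: "(\<Prod>j\<in>rx_rows n k. F j) = (\<Prod>t<n. F (t, k))"
proof -
  have "rx_rows n k = (\<lambda>t. (t, k)) ` {..<n}" by (auto simp: rx_rows_def)
  then show ?thesis by (simp add: prod.reindex inj_on_def)
qed

lemma measurable_rx_rows_component [measurable]:
  "t \<in> {..<n} \<Longrightarrow> (\<lambda>x. x (t, k)) \<in> borel_measurable (PiM (rx_rows n k) (\<lambda>_. lborel :: complex measure))"
  using measurable_component_singleton[of "(t,k)" "rx_rows n k" "\<lambda>_. lborel :: complex measure"]
  by (simp add: rx_rows_def)

lemma nn_integral_rx_rows_prod:
  assumes "\<And>t. t < n \<Longrightarrow> f t \<in> borel_measurable borel"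
  shows "(\<integral>\<^sup>+x. (\<Prod>t<n. f t (x (t, k))) \<partial>PiM (rx_rows n k) (\<lambda>_. lborel :: complex measure))
     = (\<Prod>t<n. \<integral>\<^sup>+z. f t z \<partial>lborel)"
proof -
  interpret L: product_sigma_finite "\<lambda>_::nat \<times> nat. lborel :: complex measure" by (rule product_sigma_finite_lborel)
  have "(\<integral>\<^sup>+x. (\<Prod>j\<in>rx_rows n k. f (fst j) (x j)) \<partial>PiM (rx_rows n k) (\<lambda>_. lborel :: complex measure))
     = (\<Prod>j\<in>rx_rows n k. \<integral>\<^sup>+z. f (fst j) z \<partial>lborel)"
    using assms by (intro L.product_nn_integral_prod) (auto simp: rx_rows_def)
  then show ?thesis by (simp add: prod_rx_rows)
qed

text \<open>Only the noise row of receiver \<open>k\<close> becomes a Gaussian weight on Lebesgue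
  measure. The other rows stay random, since the event that all receivers decode correctly depends
  on them as well.\<close>

lemma nn_integral_noise_split:
  assumes k: "k < K" and F: "F \<in> borel_measurable (noise n K)"
  shows "(\<integral>\<^sup>+z. F z \<partial>noise n K) =
    (\<integral>\<^sup>+z'. (\<integral>\<^sup>+x. ennreal (\<Prod>t<n. gam (x (t, k))) * F (merge ({..<n} \<times> {..<K} - rx_rows n k) (rx_rows n k) (z', x))
        \<partial>PiM (rx_rows n k) (\<lambda>_. lborel)) \<partial>PiM ({..<n} \<times> {..<K} - rx_rows n k) (\<lambda>_. CN01))"
proof -
  interpret C: product_sigma_finite "\<lambda>_::nat \<times> nat. CN01" by (rule product_sigma_finite_CN01)
  define J' where "J' = {..<n} \<times> {..<K} - rx_rows n k"
  have U: "J' \<union> rx_rows n k = {..<n} \<times> {..<K}" and dj: "J' \<inter> rx_rows n k = {}" and fin: "finite J'"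
    using k by (auto simp: J'_def rx_rows_def)
  have F': "F \<in> borel_measurable (PiM (J' \<union> rx_rows n k) (\<lambda>_. CN01))"
    using F by (simp add: U noise_def)
  have mg: "(\<lambda>x. F (merge J' (rx_rows n k) (z', x))) \<in> borel_measurable (PiM (rx_rows n k) (\<lambda>_. lborel))"
    if z': "z' \<in> space (PiM J' (\<lambda>_. CN01))" for z'
  proof -
    have "(\<lambda>x. merge J' (rx_rows n k) (z', x)) \<in> measurable (PiM (rx_rows n k) (\<lambda>_. CN01)) (PiM (J' \<union> rx_rows n k) (\<lambda>_. CN01))"
      using z' by measurable
    then have "(\<lambda>x. F (merge J' (rx_rows n k) (z', x))) \<in> borel_measurable (PiM (rx_rows n k) (\<lambda>_. CN01))"
      using F' by (rule measurable_compose)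
    then show ?thesis by (simp cong: measurable_cong_sets sets_PiM_cong)
  qed
  have "(\<integral>\<^sup>+z. F z \<partial>noise n K) = (\<integral>\<^sup>+z. F z \<partial>PiM (J' \<union> rx_rows n k) (\<lambda>_. CN01))"
    by (simp add: U noise_def)
  also have "\<dots> = (\<integral>\<^sup>+z'. (\<integral>\<^sup>+x. F (merge J' (rx_rows n k) (z', x)) \<partial>PiM (rx_rows n k) (\<lambda>_. CN01)) \<partial>PiM J' (\<lambda>_. CN01))"
    by (rule C.product_nn_integral_fold[OF dj fin _ F']) simp
  also have "\<dots> = (\<integral>\<^sup>+z'. (\<integral>\<^sup>+x. ennreal (\<Prod>t<n. gam (x (t, k))) * F (merge J' (rx_rows n k) (z', x))
       \<partial>PiM (rx_rows n k) (\<lambda>_. lborel)) \<partial>PiM J' (\<lambda>_. CN01))"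
  proof (rule nn_integral_cong)
    fix z' assume "z' \<in> space (PiM J' (\<lambda>_. CN01))"
    from mg[OF this] show "(\<integral>\<^sup>+x. F (merge J' (rx_rows n k) (z', x)) \<partial>PiM (rx_rows n k) (\<lambda>_. CN01)) =
        (\<integral>\<^sup>+x. ennreal (\<Prod>t<n. gam (x (t, k))) * F (merge J' (rx_rows n k) (z', x)) \<partial>PiM (rx_rows n k) (\<lambda>_. lborel))"
      by (simp only: PiM_CN01 finite_rx_rows prod_rx_rows) (subst nn_integral_density, measurable, simp_all)
  qed
  finally show ?thesis by (simp add: J'_def)
qed

lemma nn_integral_noise_row:
  assumes k: "k < K" and F: "F \<in> borel_measurable (PiM (rx_rows n k) (\<lambda>_. lborel))"
  shows "(\<integral>\<^sup>+z. F (restrict z (rx_rows n k)) \<partial>noise n K) =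
    (\<integral>\<^sup>+x. ennreal (\<Prod>t<n. gam (x (t, k))) * F x \<partial>PiM (rx_rows n k) (\<lambda>_. lborel))"
proof -
  define J' where "J' = {..<n} \<times> {..<K} - rx_rows n k"
  interpret prob_space "PiM J' (\<lambda>_. CN01)" by (rule prob_space_PiM) (rule prob_space_CN01)
  have sub: "rx_rows n k \<subseteq> {..<n} \<times> {..<K}" using k by (auto simp: rx_rows_def)
  have F': "F \<in> borel_measurable (PiM (rx_rows n k) (\<lambda>_. CN01))"
    using F by (simp cong: measurable_cong_sets sets_PiM_cong)
  have "(\<lambda>z. F (restrict z (rx_rows n k))) \<in> borel_measurable (noise n K)"
    unfolding noise_def by (rule measurable_compose[OF measurable_restrict_subset[OF sub] F'])
  then have "(\<integral>\<^sup>+z. F (restrict z (rx_rows n k)) \<partial>noise n K) =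
    (\<integral>\<^sup>+z'. (\<integral>\<^sup>+x. ennreal (\<Prod>t<n. gam (x (t, k))) * F (restrict (merge J' (rx_rows n k) (z', x)) (rx_rows n k))
        \<partial>PiM (rx_rows n k) (\<lambda>_. lborel)) \<partial>PiM J' (\<lambda>_. CN01))"
    unfolding J'_def by (rule nn_integral_noise_split[OF k])
  also have "\<dots> = (\<integral>\<^sup>+z'. (\<integral>\<^sup>+x. ennreal (\<Prod>t<n. gam (x (t, k))) * F x
        \<partial>PiM (rx_rows n k) (\<lambda>_. lborel)) \<partial>PiM J' (\<lambda>_. CN01))"
  proof (intro nn_integral_cong)
    fix z' x assume "x \<in> space (PiM (rx_rows n k) (\<lambda>_. lborel :: complex measure))"
    then have "restrict (merge J' (rx_rows n k) (z', x)) (rx_rows n k) = x"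
      by (auto simp: space_PiM PiE_def extensional_def restrict_def merge_def fun_eq_iff J'_def)
    then show "ennreal (\<Prod>t<n. gam (x (t, k))) * F (restrict (merge J' (rx_rows n k) (z', x)) (rx_rows n k))
       = ennreal (\<Prod>t<n. gam (x (t, k))) * F x" by simp
  qed
  also have "\<dots> = (\<integral>\<^sup>+x. ennreal (\<Prod>t<n. gam (x (t, k))) * F x \<partial>PiM (rx_rows n k) (\<lambda>_. lborel))"
    by (simp add: emeasure_space_1)
  finally show ?thesis .
qed

text \<open>Chernoff bound with exponent 1/2: the moment generating function of a unit-mean
  exponential variable at 1/2 equals 2.\<close>
lemma noise_tail:
  assumes k: "k < K"
  shows "emeasure (noise n K) {z \<in> space (noise n K). (\<Sum>t<n. (cmod (z (t, k)))\<^sup>2) > c * real n}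
     \<le> ennreal ((2 * exp (- c / 2)) ^ n)"
proof -
  define F where "F x = ennreal (exp (((\<Sum>t<n. (cmod (x (t, k)))\<^sup>2) - c * real n) / 2))" for x :: "nat \<times> nat \<Rightarrow> complex"
  have Fm: "F \<in> borel_measurable (PiM (rx_rows n k) (\<lambda>_. lborel))"
    unfolding F_def by measurable
  have [measurable]: "(\<lambda>z. z (t, k)) \<in> borel_measurable (noise n K)" if "t \<in> {..<n}" for t
    using that k by (intro measurable_noise_component) auto
  have "emeasure (noise n K) {z \<in> space (noise n K). (\<Sum>t<n. (cmod (z (t, k)))\<^sup>2) > c * real n}
     = (\<integral>\<^sup>+z. indicator {z \<in> space (noise n K). (\<Sum>t<n. (cmod (z (t, k)))\<^sup>2) > c * real n} z \<partial>noise n K)"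
    by (rule nn_integral_indicator[symmetric]) measurable
  also have "\<dots> \<le> (\<integral>\<^sup>+z. F (restrict z (rx_rows n k)) \<partial>noise n K)"
  proof (intro nn_integral_mono)
    fix z
    have "(\<Sum>t<n. (cmod (restrict z (rx_rows n k) (t, k)))\<^sup>2) = (\<Sum>t<n. (cmod (z (t, k)))\<^sup>2)"
      by (intro sum.cong) (auto simp: rx_rows_def)
    then show "indicator {z \<in> space (noise n K). (\<Sum>t<n. (cmod (z (t, k)))\<^sup>2) > c * real n} z \<le> F (restrict z (rx_rows n k))"
      by (auto simp: F_def indicator_def)
  qed
  also have "\<dots> = (\<integral>\<^sup>+x. ennreal (\<Prod>t<n. gam (x (t, k))) * F x \<partial>PiM (rx_rows n k) (\<lambda>_. lborel))"
    by (rule nn_integral_noise_row[OF k Fm])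
  also have "\<dots> = (\<integral>\<^sup>+x. ennreal (exp (- c / 2) ^ n) *
       (\<Prod>t<n. ennreal (1 / pi) * ennreal (exp (- (cmod (x (t, k) - 0))\<^sup>2 / 2))) \<partial>PiM (rx_rows n k) (\<lambda>_. lborel))"
  proof (intro nn_integral_cong)
    fix x :: "nat \<times> nat \<Rightarrow> complex"
    have "((\<Sum>t<n. (cmod (x (t, k)))\<^sup>2) - c * real n) / 2 = real n * (- c / 2) + (\<Sum>t<n. (cmod (x (t, k)))\<^sup>2 / 2)"
      by (simp add: sum_divide_distrib[symmetric] field_simps)
    then have "exp (((\<Sum>t<n. (cmod (x (t, k)))\<^sup>2) - c * real n) / 2)
        = exp (- c / 2) ^ n * (\<Prod>t<n. exp ((cmod (x (t, k)))\<^sup>2 / 2))"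
      by (simp only: exp_add exp_of_nat_mult exp_sum finite_lessThan)
    then have "(\<Prod>t<n. gam (x (t, k))) * exp (((\<Sum>t<n. (cmod (x (t, k)))\<^sup>2) - c * real n) / 2)
       = exp (- c / 2) ^ n * (\<Prod>t<n. gam (x (t, k)) * exp ((cmod (x (t, k)))\<^sup>2 / 2))"
      by (simp add: prod.distrib)
    also have "\<dots> = exp (- c / 2) ^ n * (\<Prod>t<n. (1 / pi) * exp (- (cmod (x (t, k)))\<^sup>2 / 2))"
    proof -
      have "gam u * exp ((cmod u)\<^sup>2 / 2) = (1 / pi) * exp (- (cmod u)\<^sup>2 / 2)" for u
        by (simp add: gam_def exp_add[symmetric])
      then show ?thesis by simp
    qed
    finally show "ennreal (\<Prod>t<n. gam (x (t, k))) * F x = ennreal (exp (- c / 2) ^ n) *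
       (\<Prod>t<n. ennreal (1 / pi) * ennreal (exp (- (cmod (x (t, k) - 0))\<^sup>2 / 2)))"
      unfolding F_def
      by (simp add: ennreal_mult[symmetric] prod_ennreal prod_nonneg)
  qed
  also have "\<dots> = ennreal (exp (- c / 2) ^ n) *
       (\<Prod>t<n. (\<integral>\<^sup>+z. ennreal (1 / pi) * ennreal (exp (- (cmod (z - 0))\<^sup>2 / 2)) \<partial>lborel))"
    by (subst nn_integral_cmult) (measurable, subst nn_integral_rx_rows_prod, simp_all)
  also have "\<dots> = ennreal (exp (- c / 2) ^ n) * (\<Prod>t<n. ennreal 2)"
    by (subst nn_integral_cmult) (simp_all add: nn_integral_gaussian_complex[where c = 0, simplified] ennreal_mult[symmetric])
  also have "\<dots> = ennreal ((2 * exp (- c / 2)) ^ n)"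
    by (simp only: prod_constant card_lessThan ennreal_power zero_le_numeral)
      (subst ennreal_mult[symmetric], simp_all add: power_mult_distrib)
  finally show ?thesis .
qed

subsection \<open>Posterior sums over classes of codewords\<close>

text \<open>In each class of \<open>r\<close> the quotients of \<open>\<Phi> w\<close> by the class
  total add up to one, as posterior probabilities do. Spreading the class total of \<open>H\<close>
  over the members by these weights therefore keeps the overall sum.\<close>

lemma sum_posterior:
  fixes \<Phi> H :: "'w \<Rightarrow> real"
  assumes fin: "finite W" and r: "equivp r" and pos: "\<And>w. w \<in> W \<Longrightarrow> \<Phi> w > 0"
  shows "(\<Sum>w\<in>W. \<Phi> w * (\<Sum>w'\<in>{w' \<in> W. r w w'}. H w') / (\<Sum>w'\<in>{w' \<in> W. r w w'}. \<Phi> w')) = (\<Sum>w\<in>W. H w)"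
proof -
  define Q where "Q w = (\<Sum>w'\<in>{w' \<in> W. r w w'}. \<Phi> w')" for w
  have Qpos: "Q w > 0" if "w \<in> W" for w
    unfolding Q_def using fin pos that r by (intro sum_pos) (auto simp: equivp_reflp)
  have Qeq: "Q w = Q w'" if "r w w'" for w w'
    using that r unfolding Q_def by (metis (no_types, lifting) equivp_def)
  \<comment> \<open>The class total \<open>Q\<close> is the same for both members of a related pair,
    so the denominator can be handed from one to the other before the sums are exchanged.\<close>
  have swap: "(if r w w' then \<Phi> w * H w' / Q w else 0) = (if r w' w then \<Phi> w * (H w' / Q w') else 0)" for w w'
    using Qeq[of w w'] equivp_symp[OF r] by auto
  have "(\<Sum>w\<in>W. \<Phi> w * (\<Sum>w'\<in>{w' \<in> W. r w w'}. H w') / Q w)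
      = (\<Sum>w\<in>W. \<Sum>w'\<in>W. if r w w' then \<Phi> w * H w' / Q w else 0)"
    using fin by (simp only: sum_distrib_left sum_divide_distrib sum.inter_filter[symmetric])
  also have "\<dots> = (\<Sum>w'\<in>W. \<Sum>w\<in>W. if r w w' then \<Phi> w * H w' / Q w else 0)"
    by (rule sum.swap)
  also have "\<dots> = (\<Sum>w'\<in>W. \<Sum>w\<in>W. if r w' w then \<Phi> w * (H w' / Q w') else 0)"
    by (intro sum.cong refl) (use swap in simp)
  also have "\<dots> = (\<Sum>w'\<in>W. Q w' * (H w' / Q w'))"
    using fin unfolding Q_def by (simp only: sum_distrib_right sum.inter_filter[symmetric])
  also have "\<dots> = (\<Sum>w\<in>W. H w)"
    using Qpos by (intro sum.cong refl) (simp add: less_imp_neq[symmetric])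
  finally show ?thesis by (simp add: Q_def)
qed

text \<open>Class by class: the part of \<open>B\<close> in a class of \<open>r\<close> lies in a
  single subclass, because \<open>lab\<close> is constant on \<open>B\<close>, and that subclass
  weighs less than the fraction \<open>c\<close> of the class. In use, \<open>B\<close> collects the
  tuples that explain one given output by a correct but unconfident decoding.\<close>

lemma sum_confident:
  fixes \<Phi> :: "'w \<Rightarrow> real"
  assumes fin: "finite W" and r: "equivp r" and pos: "\<And>w. w \<in> W \<Longrightarrow> \<Phi> w > 0" and c: "c \<ge> 0"
    and B: "B \<subseteq> W" and same: "\<And>w w'. w \<in> B \<Longrightarrow> w' \<in> B \<Longrightarrow> lab w = lab w'"
    and small: "\<And>w. w \<in> B \<Longrightarrow> (\<Sum>w'\<in>{w' \<in> W. r w w' \<and> lab w = lab w'}. \<Phi> w') < c * (\<Sum>w'\<in>{w' \<in> W. r w w'}. \<Phi> w')"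
  shows "(\<Sum>w\<in>B. \<Phi> w) \<le> c * (\<Sum>w\<in>W. \<Phi> w)"
proof -
  define Q where "Q w = (\<Sum>w'\<in>{w' \<in> B. r w w'}. \<Phi> w')" for w
  have finB: "finite B" using fin B finite_subset by blast
  have Qpos: "Q w > 0" if "w \<in> B" for w
    unfolding Q_def using finB B pos that r by (intro sum_pos) (auto simp: equivp_reflp)
  have Qeq: "Q w = Q w'" if "r w w'" for w w'
    using that r unfolding Q_def by (metis (no_types, lifting) equivp_def)
  have swap: "(if r w w' then \<Phi> w * \<Phi> w' / Q w else 0) = (if r w' w then \<Phi> w * (\<Phi> w' / Q w') else 0)" for w w'
    using Qeq[of w w'] equivp_symp[OF r] by auto
  have Qle: "Q w \<le> c * (\<Sum>w'\<in>{w' \<in> W. r w w'}. \<Phi> w')" if "w \<in> B" for w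
  proof -
    have "Q w \<le> (\<Sum>w'\<in>{w' \<in> W. r w w' \<and> lab w = lab w'}. \<Phi> w')"
      unfolding Q_def
    proof (rule sum_mono2)
      show "{w' \<in> B. r w w'} \<subseteq> {w' \<in> W. r w w' \<and> lab w = lab w'}"
        using same[OF that] B by blast
    qed (use fin pos in \<open>auto intro: less_imp_le\<close>)
    with small[OF that] show ?thesis by linarith
  qed
  have "(\<Sum>w\<in>B. \<Phi> w) \<le> (\<Sum>w\<in>B. \<Phi> w * (c * (\<Sum>w'\<in>{w' \<in> W. r w w'}. \<Phi> w')) / Q w)"
  proof (rule sum_mono)
    fix w assume w: "w \<in> B"
    have "\<Phi> w * Q w \<le> \<Phi> w * (c * (\<Sum>w'\<in>{w' \<in> W. r w w'}. \<Phi> w'))"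
      using Qle[OF w] pos B w by (intro mult_left_mono) (auto intro: less_imp_le)
    then show "\<Phi> w \<le> \<Phi> w * (c * (\<Sum>w'\<in>{w' \<in> W. r w w'}. \<Phi> w')) / Q w"
      using Qpos[OF w] by (simp add: field_simps)
  qed
  also have "\<dots> = c * (\<Sum>w\<in>B. \<Sum>w'\<in>W. if r w w' then \<Phi> w * \<Phi> w' / Q w else 0)"
  proof -
    have "\<Phi> w * (c * (\<Sum>w'\<in>{w' \<in> W. r w w'}. \<Phi> w')) / Q w
        = c * (\<Sum>w'\<in>W. if r w w' then \<Phi> w * \<Phi> w' / Q w else 0)" for w
    proof -
      have "(\<Sum>w'\<in>W. if r w w' then \<Phi> w * \<Phi> w' / Q w else 0) = (\<Sum>w'\<in>{w' \<in> W. r w w'}. \<Phi> w * \<Phi> w' / Q w)"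
        using fin by (simp only: sum.inter_filter)
      also have "\<dots> = \<Phi> w * (\<Sum>w'\<in>{w' \<in> W. r w w'}. \<Phi> w') / Q w"
        by (simp only: sum_distrib_left sum_divide_distrib)
      finally show ?thesis by simp
    qed
    then show ?thesis by (simp add: sum_distrib_left)
  qed
  also have "(\<Sum>w\<in>B. \<Sum>w'\<in>W. if r w w' then \<Phi> w * \<Phi> w' / Q w else 0)
      = (\<Sum>w'\<in>W. \<Sum>w\<in>B. if r w w' then \<Phi> w * \<Phi> w' / Q w else 0)"
    by (rule sum.swap)
  also have "\<dots> = (\<Sum>w'\<in>W. \<Sum>w\<in>B. if r w' w then \<Phi> w * (\<Phi> w' / Q w') else 0)"
    by (intro sum.cong refl) (use swap in simp)
  also have "\<dots> = (\<Sum>w'\<in>W. Q w' * (\<Phi> w' / Q w'))"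
    using finB unfolding Q_def by (simp only: sum_distrib_right sum.inter_filter[symmetric])
  \<comment> \<open>Classes that miss \<open>B\<close> have \<open>Q w' = 0\<close>, and their terms
    are 0 by the convention for division; hence an inequality.\<close>
  also have "\<dots> \<le> (\<Sum>w'\<in>W. \<Phi> w')"
    using pos by (intro sum_mono) (auto intro: less_imp_le)
  finally show ?thesis using c by (simp add: mult_left_mono)
qed

text \<open>\<open>lik n k s W r w x\<close> is the total likelihood of the class of \<open>w\<close> at receiver \<open>k\<close>, when
  \<open>w\<close> is sent (producing the noiseless block \<open>s w\<close>) and the noise block is \<open>x\<close>.\<close>
definition lik :: "nat \<Rightarrow> nat \<Rightarrow> ('w \<Rightarrow> nat \<Rightarrow> complex) \<Rightarrow> 'w set \<Rightarrow> ('w \<Rightarrow> 'w \<Rightarrow> bool) \<Rightarrow> 'w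
    \<Rightarrow> (nat \<times> nat \<Rightarrow> complex) \<Rightarrow> real" where
  "lik n k s W r w x = (\<Sum>w'\<in>{w' \<in> W. r w w'}. \<Prod>t<n. gam (x (t, k) + s w t - s w' t))"

lemma lik_pos: "finite W \<Longrightarrow> w \<in> W \<Longrightarrow> r w w \<Longrightarrow> lik n k s W r w x > 0"
  unfolding lik_def by (intro sum_pos prod_pos) auto

text \<open>Turns the noise block of receiver \<open>k\<close> into its output block when
  \<open>c\<close> is the noiseless signal. The restriction keeps the result in the product space
  over the row.\<close>

definition shift_row :: "nat \<Rightarrow> nat \<Rightarrow> (nat \<Rightarrow> complex) \<Rightarrow> (nat \<times> nat \<Rightarrow> complex) \<Rightarrow> nat \<times> nat \<Rightarrow> complex" where
  "shift_row n k c x = (\<lambda>j\<in>rx_rows n k. x j + c (fst j))"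

lemma shift_row_apply [simp]: "t < n \<Longrightarrow> shift_row n k c x (t, k) = x (t, k) + c t"
  by (simp add: shift_row_def rx_rows_def)

lemma measurable_shift_row [measurable]:
  "shift_row n k c \<in> measurable (PiM (rx_rows n k) (\<lambda>_. lborel)) (PiM (rx_rows n k) (\<lambda>_. lborel))"
  unfolding shift_row_def
proof (rule measurable_restrict)
  fix j assume "j \<in> rx_rows n k"
  then obtain t where [simp]: "j = (t, k)" and [measurable]: "t \<in> {..<n}" by (auto simp: rx_rows_def)
  show "(\<lambda>x. x j + c (fst j)) \<in> measurable (PiM (rx_rows n k) (\<lambda>_. lborel)) lborel"
    by simp
qed

lemma nn_integral_shift_row:
  assumes "f \<in> borel_measurable (PiM (rx_rows n k) (\<lambda>_. lborel))"
  shows "(\<integral>\<^sup>+x. f (shift_row n k c x) \<partial>PiM (rx_rows n k) (\<lambda>_. lborel)) = (\<integral>\<^sup>+x. f x \<partial>PiM (rx_rows n k) (\<lambda>_. lborel))"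
  unfolding shift_row_def using assms by (intro nn_integral_PiM_lborel_translate) auto

lemma nn_integral_gam_rows:
  "(\<integral>\<^sup>+x. ennreal (\<Prod>t<n. gam (x (t, k) - s t)) \<partial>PiM (rx_rows n k) (\<lambda>_. lborel)) = 1"
proof -
  have "(\<integral>\<^sup>+x. (\<Prod>t<n. ennreal (gam (x (t, k) - s t))) \<partial>PiM (rx_rows n k) (\<lambda>_. lborel))
      = (\<Prod>t<n. \<integral>\<^sup>+z. ennreal (gam (z - s t)) \<partial>lborel)"
    by (rule nn_integral_rx_rows_prod) measurable
  also have "\<dots> = (\<Prod>t<n. \<integral>\<^sup>+z. ennreal (gam (s t - 1 * z)) \<partial>lborel)"
    by (simp add: gam_def norm_minus_commute)
  also have "\<dots> = 1"
    by (subst nn_integral_gam_affine) simp_all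
  finally show ?thesis by (simp add: prod_ennreal)
qed

text \<open>Shifting the integral for \<open>w\<close> by \<open>s w\<close> makes its variable the
  output, at which all members of a class have the same denominator. Then
  \<open>sum_posterior\<close> applies pointwise: the mean ratio of \<open>H\<close> to the
  likelihood, added over the transmitted tuples, is the total mass of \<open>H\<close>.\<close>

lemma nn_integral_posterior:
  fixes W :: "'w set" and s :: "'w \<Rightarrow> nat \<Rightarrow> complex" and H :: "'w \<Rightarrow> (nat \<times> nat \<Rightarrow> complex) \<Rightarrow> real"
  assumes fin: "finite W" and r: "equivp r"
    and H [measurable]: "\<And>w. w \<in> W \<Longrightarrow> H w \<in> borel_measurable (PiM (rx_rows n k) (\<lambda>_. lborel))"
    and Hpos: "\<And>w x. w \<in> W \<Longrightarrow> H w x \<ge> 0"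
  shows "(\<Sum>w\<in>W. \<integral>\<^sup>+x. ennreal ((\<Prod>t<n. gam (x (t, k))) * (\<Sum>w'\<in>{w' \<in> W. r w w'}. H w' (shift_row n k (s w) x))
        / lik n k s W r w x) \<partial>PiM (rx_rows n k) (\<lambda>_. lborel))
     = (\<Sum>w\<in>W. \<integral>\<^sup>+y. ennreal (H w y) \<partial>PiM (rx_rows n k) (\<lambda>_. lborel))"
proof -
  let ?L = "PiM (rx_rows n k) (\<lambda>_. lborel :: complex measure)"
  define \<Phi> where "\<Phi> w y = (\<Prod>t<n. gam (y (t, k) - s w t))" for w and y :: "nat \<times> nat \<Rightarrow> complex"
  define F where "F w y = \<Phi> w y * (\<Sum>w'\<in>{w' \<in> W. r w w'}. H w' y) / (\<Sum>w'\<in>{w' \<in> W. r w w'}. \<Phi> w' y)" for w y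
  have \<Phi>m [measurable]: "\<Phi> w \<in> borel_measurable ?L" for w
    unfolding \<Phi>_def by measurable
  have \<Phi>pos: "\<Phi> w y > 0" for w y
    unfolding \<Phi>_def by (intro prod_pos) simp
  have sm: "(\<lambda>y. \<Sum>w'\<in>{w' \<in> W. r w w'}. H w' y) \<in> borel_measurable ?L" for w
    by (intro borel_measurable_sum H) simp
  have Fm: "F w \<in> borel_measurable ?L" for w
    unfolding F_def using sm by measurable
  have Fpos: "F w y \<ge> 0" for w y
    unfolding F_def using \<Phi>pos Hpos
    by (intro divide_nonneg_nonneg mult_nonneg_nonneg sum_nonneg) (auto intro: less_imp_le)
  have "(\<integral>\<^sup>+x. ennreal ((\<Prod>t<n. gam (x (t, k))) * (\<Sum>w'\<in>{w' \<in> W. r w w'}. H w' (shift_row n k (s w) x))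
        / lik n k s W r w x) \<partial>?L) = (\<integral>\<^sup>+y. ennreal (F w y) \<partial>?L)" for w
  proof -
    have "(\<integral>\<^sup>+y. ennreal (F w y) \<partial>?L) = (\<integral>\<^sup>+x. ennreal (F w (shift_row n k (s w) x)) \<partial>?L)"
      using Fm by (subst nn_integral_shift_row) auto
    also have "\<dots> = (\<integral>\<^sup>+x. ennreal ((\<Prod>t<n. gam (x (t, k))) * (\<Sum>w'\<in>{w' \<in> W. r w w'}. H w' (shift_row n k (s w) x))
        / lik n k s W r w x) \<partial>?L)"
      by (simp add: F_def \<Phi>_def lik_def)
    finally show ?thesis ..
  qed
  then have "(\<Sum>w\<in>W. \<integral>\<^sup>+x. ennreal ((\<Prod>t<n. gam (x (t, k))) * (\<Sum>w'\<in>{w' \<in> W. r w w'}. H w' (shift_row n k (s w) x))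
        / lik n k s W r w x) \<partial>?L) = (\<Sum>w\<in>W. \<integral>\<^sup>+y. ennreal (F w y) \<partial>?L)"
    by simp
  also have "\<dots> = (\<integral>\<^sup>+y. (\<Sum>w\<in>W. ennreal (F w y)) \<partial>?L)"
    using Fm by (subst nn_integral_sum) auto
  also have "\<dots> = (\<integral>\<^sup>+y. (\<Sum>w\<in>W. ennreal (H w y)) \<partial>?L)"
  proof (rule nn_integral_cong)
    fix y
    have "(\<Sum>w\<in>W. F w y) = (\<Sum>w\<in>W. H w y)"
      unfolding F_def using fin r \<Phi>pos by (intro sum_posterior) auto
    then show "(\<Sum>w\<in>W. ennreal (F w y)) = (\<Sum>w\<in>W. ennreal (H w y))"
      using Fpos Hpos by (simp add: sum_ennreal)
  qed
  also have "\<dots> = (\<Sum>w\<in>W. \<integral>\<^sup>+y. ennreal (H w y) \<partial>?L)"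
    by (rule nn_integral_sum) measurable
  finally show ?thesis .
qed

text \<open>At a fixed output the successful tuples share a label, by \<open>same\<close>: a decoder
  that sees only this output cannot be right for two labels. Hence \<open>sum_confident\<close>
  applies output by output, and each \<open>\<Phi> w\<close> integrates to 1.\<close>

lemma nn_integral_unconfident:
  fixes W :: "'w set" and s :: "'w \<Rightarrow> nat \<Rightarrow> complex" and T :: "'w \<Rightarrow> (nat \<times> nat \<Rightarrow> complex) set"
  assumes fin: "finite W" and r: "equivp r" and c: "c \<ge> 0"
    and T [measurable]: "\<And>w. w \<in> W \<Longrightarrow> T w \<in> sets (PiM (rx_rows n k) (\<lambda>_. lborel))"
    and same: "\<And>w w' x x'. w \<in> W \<Longrightarrow> w' \<in> W \<Longrightarrow> x \<in> T w \<Longrightarrow> x' \<in> T w' \<Longrightarrow>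
        (\<And>t. t < n \<Longrightarrow> x (t, k) + s w t = x' (t, k) + s w' t) \<Longrightarrow> lab w = lab w'"
  shows "(\<Sum>w\<in>W. \<integral>\<^sup>+x. ennreal (\<Prod>t<n. gam (x (t, k))) * (indicator (T w) x *
        indicator {x. lik n k s W (\<lambda>w w'. r w w' \<and> lab w = lab w') w x < c * lik n k s W r w x} x) \<partial>PiM (rx_rows n k) (\<lambda>_. lborel))
     \<le> ennreal (c * real (card W))"
proof -
  let ?L = "PiM (rx_rows n k) (\<lambda>_. lborel :: complex measure)"
  define \<Phi> where "\<Phi> w y = (\<Prod>t<n. gam (y (t, k) - s w t))" for w and y :: "nat \<times> nat \<Rightarrow> complex"
  define bad where "bad w y \<longleftrightarrow> shift_row n k (\<lambda>t. - s w t) y \<in> T w \<and>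
      (\<Sum>w'\<in>{w' \<in> W. r w w' \<and> lab w = lab w'}. \<Phi> w' y) < c * (\<Sum>w'\<in>{w' \<in> W. r w w'}. \<Phi> w' y)" for w y
  define F where "F w y = ennreal (\<Phi> w y) * (indicator {y. bad w y} y)" for w y
  have \<Phi>m [measurable]: "\<Phi> w \<in> borel_measurable ?L" for w
    unfolding \<Phi>_def by measurable
  have \<Phi>pos: "\<Phi> w y > 0" for w y
    unfolding \<Phi>_def by (intro prod_pos) simp
  have Fm [measurable]: "F w \<in> borel_measurable ?L" if [simp]: "w \<in> W" for w
    unfolding F_def bad_def by measurable
  have "(\<integral>\<^sup>+x. ennreal (\<Prod>t<n. gam (x (t, k))) * (indicator (T w) x *
        indicator {x. lik n k s W (\<lambda>w w'. r w w' \<and> lab w = lab w') w x < c * lik n k s W r w x} x) \<partial>?L)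
      = (\<integral>\<^sup>+y. F w y \<partial>?L)" if w: "w \<in> W" for w
  proof -
    have "(\<integral>\<^sup>+y. F w y \<partial>?L) = (\<integral>\<^sup>+x. F w (shift_row n k (s w) x) \<partial>?L)"
      using Fm[OF w] by (subst nn_integral_shift_row) auto
    also have "\<dots> = (\<integral>\<^sup>+x. ennreal (\<Prod>t<n. gam (x (t, k))) * (indicator (T w) x *
        indicator {x. lik n k s W (\<lambda>w w'. r w w' \<and> lab w = lab w') w x < c * lik n k s W r w x} x) \<partial>?L)"
    proof (rule nn_integral_cong)
      fix x assume "x \<in> space ?L"
      then have "shift_row n k (\<lambda>t. - s w t) (shift_row n k (s w) x) = x"
        by (auto simp: shift_row_def space_PiM PiE_def extensional_def fun_eq_iff)
      then show "F w (shift_row n k (s w) x) = ennreal (\<Prod>t<n. gam (x (t, k))) * (indicator (T w) x *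
        indicator {x. lik n k s W (\<lambda>w w'. r w w' \<and> lab w = lab w') w x < c * lik n k s W r w x} x)"
        by (simp add: F_def \<Phi>_def lik_def bad_def indicator_def)
    qed
    finally show ?thesis ..
  qed
  then have "(\<Sum>w\<in>W. \<integral>\<^sup>+x. ennreal (\<Prod>t<n. gam (x (t, k))) * (indicator (T w) x *
        indicator {x. lik n k s W (\<lambda>w w'. r w w' \<and> lab w = lab w') w x < c * lik n k s W r w x} x) \<partial>?L)
      = (\<Sum>w\<in>W. \<integral>\<^sup>+y. F w y \<partial>?L)"
    by simp
  also have "\<dots> = (\<integral>\<^sup>+y. (\<Sum>w\<in>W. F w y) \<partial>?L)"
    using Fm by (subst nn_integral_sum) auto
  also have "\<dots> \<le> (\<integral>\<^sup>+y. ennreal c * (\<Sum>w\<in>W. ennreal (\<Phi> w y)) \<partial>?L)"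
  proof (rule nn_integral_mono)
    fix y
    have "(\<Sum>w\<in>W. F w y) = (\<Sum>w\<in>{w \<in> W. bad w y}. ennreal (\<Phi> w y))"
      using fin by (simp only: sum.inter_filter) (rule sum.cong, simp, simp add: F_def indicator_def)
    also have "\<dots> = ennreal (\<Sum>w\<in>{w \<in> W. bad w y}. \<Phi> w y)"
      using \<Phi>pos by (intro sum_ennreal) (auto intro: less_imp_le)
    also have "\<dots> \<le> ennreal (c * (\<Sum>w\<in>W. \<Phi> w y))"
    proof (intro ennreal_leI sum_confident[where r = r and lab = lab] fin r \<Phi>pos c)
      fix w w' assume "w \<in> {w \<in> W. bad w y}" "w' \<in> {w \<in> W. bad w y}"
      then show "lab w = lab w'"
        by (intro same[of w w' "shift_row n k (\<lambda>t. - s w t) y" "shift_row n k (\<lambda>t. - s w' t) y"])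
           (auto simp: bad_def)
    qed (auto simp: bad_def)
    also have "\<dots> = ennreal c * (\<Sum>w\<in>W. ennreal (\<Phi> w y))"
      using c \<Phi>pos by (simp add: ennreal_mult' sum_ennreal less_imp_le)
    finally show "(\<Sum>w\<in>W. F w y) \<le> ennreal c * (\<Sum>w\<in>W. ennreal (\<Phi> w y))" .
  qed
  also have "\<dots> = ennreal c * (\<Sum>w\<in>W. \<integral>\<^sup>+y. ennreal (\<Phi> w y) \<partial>?L)"
    by (subst nn_integral_cmult, measurable, subst nn_integral_sum) auto
  also have "\<dots> = ennreal c * (\<Sum>w\<in>W. 1)"
    by (simp only: \<Phi>_def nn_integral_gam_rows)
  also have "\<dots> = ennreal (c * real (card W))"
    using c by (simp add: ennreal_mult' ennreal_of_nat_eq_real_of_nat)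
  finally show ?thesis .
qed

subsection \<open>Averaging over channels of bounded density\<close>

definition hat :: "(nat \<Rightarrow> nat \<Rightarrow> nat \<Rightarrow> complex) \<Rightarrow> nat \<times> nat \<times> nat \<Rightarrow> complex" where
  "hat g = (\<lambda>(t, k, i). g t k i)"

lemma hat_apply [simp]: "hat g (t, k, i) = g t k i"
  by (simp add: hat_def)

lemma measurable_indicator_cball [measurable]:
  "(indicator (cball (0::complex) d) :: complex \<Rightarrow> ennreal) \<in> borel_measurable borel"
  by (intro borel_measurable_indicator borel_closed) simp

text \<open>Given the coefficients in \<open>B\<close>, those in \<open>A\<close> have conditional
  density at most \<open>c\<close>, so averaging over them costs at most the factor \<open>c\<close>
  against Lebesgue measure on a polydisc of radius \<open>dmax\<close>. The coefficients in
  \<open>B\<close> keep their true law.\<close>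

lemma nn_integral_bounded_density:
  fixes G :: "(nat \<Rightarrow> nat \<Rightarrow> nat \<Rightarrow> complex) measure"
  assumes fin: "finite A" "finite B" and dj: "A \<inter> B = {}"
    and meas: "\<And>t k i. (t, k, i) \<in> A \<union> B \<Longrightarrow> (\<lambda>g. g t k i) \<in> borel_measurable G"
    and bnd: "\<And>t k i. (t, k, i) \<in> A \<Longrightarrow> AE g in G. cmod (g t k i) \<le> dmax"
    and f: "f \<in> borel_measurable (PiM (A \<union> B) (\<lambda>_. lborel))"
    and h: "h \<in> borel_measurable (PiM B (\<lambda>_. lborel))"
    and fG: "chan_marg G (A \<union> B) = density (PiM (A \<union> B) (\<lambda>_. lborel)) f"
    and hG: "chan_marg G B = density (PiM B (\<lambda>_. lborel)) h"
    and fh: "AE x in PiM (A \<union> B) (\<lambda>_. lborel). f x \<le> ennreal c * h (restrict x B)"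
    and F: "F \<in> borel_measurable (PiM (A \<union> B) (\<lambda>_. lborel))"
  shows "(\<integral>\<^sup>+g. F (restrict (hat g) (A \<union> B)) \<partial>G) \<le> ennreal c * (\<integral>\<^sup>+g. (\<integral>\<^sup>+x. (\<Prod>j\<in>A. indicator (cball 0 dmax) (x j))
      * F (merge B A (restrict (hat g) B, x)) \<partial>PiM A (\<lambda>_. lborel)) \<partial>G)"
proof -
  interpret L: product_sigma_finite "\<lambda>_::nat \<times> nat \<times> nat. lborel :: complex measure" by (rule product_sigma_finite_lborel)
  interpret LA: finite_product_sigma_finite "\<lambda>_::nat \<times> nat \<times> nat. lborel :: complex measure" A by standard (rule fin)
  define I where "I x = (\<Prod>j\<in>A. indicator (cball 0 dmax) (x j) :: ennreal)" for x :: "nat \<times> nat \<times> nat \<Rightarrow> complex"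
  have hatm: "(\<lambda>g. restrict (hat g) S) \<in> measurable G (PiM S (\<lambda>_. borel))" if "S \<subseteq> A \<union> B" for S
    using meas that by (intro measurable_restrict) (auto simp: hat_def)
  have lb: "measurable (PiM S (\<lambda>_. lborel :: complex measure)) N = measurable (PiM S (\<lambda>_. borel)) N" for S :: "(nat \<times> nat \<times> nat) set" and N :: "'z measure"
    by (intro measurable_cong_sets sets_PiM_cong) simp_all
  have marg: "(\<integral>\<^sup>+g. H (restrict (hat g) S) \<partial>G) = (\<integral>\<^sup>+x. H x \<partial>chan_marg G S)"
    if "S \<subseteq> A \<union> B" "H \<in> borel_measurable (PiM S (\<lambda>_. lborel))" for H S
    unfolding chan_marg_def hat_def[symmetric] using that hatm by (subst nn_integral_distr) (auto simp: lb)
  have I1 [measurable]: "I \<in> borel_measurable (PiM (A \<union> B) (\<lambda>_. lborel))"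
    unfolding I_def by (intro borel_measurable_prod_ennreal measurable_compose[OF measurable_component_singleton]) auto
  note [measurable] = F f h
  have rest [measurable]: "(\<lambda>x. restrict x B) \<in> measurable (PiM (A \<union> B) (\<lambda>_. lborel :: complex measure)) (PiM B (\<lambda>_. lborel))"
    by (rule measurable_restrict_subset) simp
  \<comment> \<open>The indicator of the polydisc is inserted while the true law is still in force,
    where it is 1 almost surely. Later it confines the Lebesgue integral.\<close>
  have "(\<integral>\<^sup>+g. F (restrict (hat g) (A \<union> B)) \<partial>G) = (\<integral>\<^sup>+g. I (restrict (hat g) (A \<union> B)) * F (restrict (hat g) (A \<union> B)) \<partial>G)"
  proof (rule nn_integral_cong_AE)
    have "AE g in G. \<forall>j\<in>A. cmod (hat g j) \<le> dmax"
      using fin bnd by (subst AE_finite_all) (auto simp: hat_def split: prod.splits)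
    then show "AE g in G. F (restrict (hat g) (A \<union> B)) = I (restrict (hat g) (A \<union> B)) * F (restrict (hat g) (A \<union> B))"
      by eventually_elim (auto simp: I_def)
  qed
  also have "\<dots> = (\<integral>\<^sup>+x. I x * F x \<partial>chan_marg G (A \<union> B))"
    by (rule marg) measurable
  also have "\<dots> = (\<integral>\<^sup>+x. f x * (I x * F x) \<partial>PiM (A \<union> B) (\<lambda>_. lborel))"
    unfolding fG by (rule nn_integral_density) measurable
  also have "\<dots> \<le> (\<integral>\<^sup>+x. ennreal c * h (restrict x B) * (I x * F x) \<partial>PiM (A \<union> B) (\<lambda>_. lborel))"
    using fh by (intro nn_integral_mono_AE) (auto elim!: eventually_mono intro!: mult_right_mono)
  also have "\<dots> = ennreal c * (\<integral>\<^sup>+x. h (restrict x B) * (I x * F x) \<partial>PiM (B \<union> A) (\<lambda>_. lborel))"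
    by (simp add: mult.assoc Un_commute) (rule nn_integral_cmult, simp add: Un_commute, measurable)
  also have "(\<integral>\<^sup>+x. h (restrict x B) * (I x * F x) \<partial>PiM (B \<union> A) (\<lambda>_. lborel))
     = (\<integral>\<^sup>+y. (\<integral>\<^sup>+x. h (restrict (merge B A (y, x)) B) * (I (merge B A (y, x)) * F (merge B A (y, x)))
          \<partial>PiM A (\<lambda>_. lborel)) \<partial>PiM B (\<lambda>_. lborel))"
    using dj fin by (intro L.product_nn_integral_fold) (auto simp: Un_commute)
  also have "\<dots> = (\<integral>\<^sup>+y. h y * (\<integral>\<^sup>+x. I x * F (merge B A (y, x)) \<partial>PiM A (\<lambda>_. lborel)) \<partial>PiM B (\<lambda>_. lborel))"
  proof (rule nn_integral_cong)
    fix y assume y: "y \<in> space (PiM B (\<lambda>_. lborel :: complex measure))"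
    have 1: "restrict (merge B A (y, x)) B = y" for x
      using y by (auto simp: space_PiM PiE_def extensional_def restrict_def merge_def fun_eq_iff)
    have 2: "I (merge B A (y, x)) = I x" for x
      unfolding I_def using dj by (intro prod.cong) (auto simp: merge_def)
    have "(\<lambda>x. merge B A (y, x)) \<in> measurable (PiM A (\<lambda>_. lborel)) (PiM (B \<union> A) (\<lambda>_. lborel))"
      using y by measurable
    then have [measurable]: "(\<lambda>x. merge B A (y, x)) \<in> measurable (PiM A (\<lambda>_. lborel)) (PiM (A \<union> B) (\<lambda>_. lborel))"
      by (simp add: Un_commute)
    have [measurable]: "I \<in> borel_measurable (PiM A (\<lambda>_. lborel))"
      unfolding I_def by (intro borel_measurable_prod_ennreal measurable_compose[OF measurable_component_singleton]) auto
    show "(\<integral>\<^sup>+x. h (restrict (merge B A (y, x)) B) * (I (merge B A (y, x)) * F (merge B A (y, x))) \<partial>PiM A (\<lambda>_. lborel))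
       = h y * (\<integral>\<^sup>+x. I x * F (merge B A (y, x)) \<partial>PiM A (\<lambda>_. lborel))"
      unfolding 1 2 by (rule nn_integral_cmult) measurable
  qed
  also have "\<dots> = (\<integral>\<^sup>+y. (\<integral>\<^sup>+x. I x * F (merge B A (y, x)) \<partial>PiM A (\<lambda>_. lborel)) \<partial>chan_marg G B)"
  proof -
    have [measurable]: "I \<in> borel_measurable (PiM A (\<lambda>_. lborel))"
      unfolding I_def by (intro borel_measurable_prod_ennreal measurable_compose[OF measurable_component_singleton]) auto
    have "F \<in> borel_measurable (PiM (B \<union> A) (\<lambda>_. lborel))" by (simp add: Un_commute)
    note [measurable] = this
    show ?thesis unfolding hG by (rule nn_integral_density[symmetric]) measurable
  qed
  also have "\<dots> = (\<integral>\<^sup>+g. (\<integral>\<^sup>+x. I x * F (merge B A (restrict (hat g) B, x)) \<partial>PiM A (\<lambda>_. lborel)) \<partial>G)"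
  proof -
    have [measurable]: "I \<in> borel_measurable (PiM A (\<lambda>_. lborel))"
      unfolding I_def by (intro borel_measurable_prod_ennreal measurable_compose[OF measurable_component_singleton]) auto
    have "F \<in> borel_measurable (PiM (B \<union> A) (\<lambda>_. lborel))" by (simp add: Un_commute)
    note [measurable] = this
    show ?thesis by (rule marg[symmetric]) (simp, measurable)
  qed
  finally show ?thesis unfolding I_def .
qed

definition disc_vol :: "real \<Rightarrow> real" where
  "disc_vol d = measure lborel (cball (0::complex) d)"

lemma disc_vol: "emeasure lborel (cball (0::complex) d) = ennreal (disc_vol d)" "disc_vol d \<ge> 0"
proof -
  have "emeasure lborel (cball (0::complex) d) < \<infinity>"
    by (rule emeasure_bounded_finite) simp
  then show "emeasure lborel (cball (0::complex) d) = ennreal (disc_vol d)"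
    unfolding disc_vol_def by (intro emeasure_eq_ennreal_measure) auto
qed (simp add: disc_vol_def)

text \<open>Two bounds hold at once: the area of the disc, as \<open>gam\<close> is at most 1, and
  \<open>1 / (cmod h)\<^sup>2\<close> from the whole plane. The first covers small \<open>h\<close>,
  the second large \<open>h\<close>; adding \<open>v \<le> disc_vol d\<close> and
  \<open>v * (cmod h)\<^sup>2 \<le> 1\<close> merges them into one Cauchy-type factor.\<close>

lemma nn_integral_gam_disc:
  "(\<integral>\<^sup>+x. indicator (cball (0::complex) d) x * ennreal (gam (c - h * x)) \<partial>lborel) \<le> ennreal ((disc_vol d + 1) / (1 + (cmod h)\<^sup>2))"
proof -
  let ?I = "\<integral>\<^sup>+x. indicator (cball (0::complex) d) x * ennreal (gam (c - h * x)) \<partial>lborel"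
  have "?I \<le> (\<integral>\<^sup>+x. indicator (cball (0::complex) d) x \<partial>lborel)"
    using gam_le_1 by (intro nn_integral_mono) (auto simp: indicator_def)
  then have V: "?I \<le> ennreal (disc_vol d)"
    by (simp add: disc_vol)
  then obtain v where v: "?I = ennreal v" "0 \<le> v"
    by (metis ennreal_cases ennreal_neq_top neq_top_trans)
  have v1: "v \<le> disc_vol d" using V v disc_vol(2) by simp
  have v2: "v * (cmod h)\<^sup>2 \<le> 1"
  proof (cases "h = 0")
    case False
    have "?I \<le> (\<integral>\<^sup>+x. ennreal (gam (c - h * x)) \<partial>lborel)"
      by (intro nn_integral_mono) (auto simp: indicator_def)
    with False v have "v \<le> 1 / (cmod h)\<^sup>2"
      by (simp add: nn_integral_gam_affine)
    with False show ?thesis by (simp add: field_simps)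
  qed simp
  have "v * (1 + (cmod h)\<^sup>2) \<le> disc_vol d + 1"
    using v1 v2 by (simp add: algebra_simps)
  then have "v \<le> (disc_vol d + 1) / (1 + (cmod h)\<^sup>2)"
    by (simp add: pos_le_divide_eq add_pos_nonneg)
  then show ?thesis using v by (simp add: ennreal_leI)
qed

text \<open>In each time slot the integral is taken first over the coefficient of the selected input \<open>\<iota> t\<close>.\<close>
lemma nn_integral_fading:
  fixes c :: "nat \<Rightarrow> nat \<Rightarrow> complex" and z :: "nat \<Rightarrow> complex" and b :: nat
  assumes I: "I \<subseteq> {..<K}" and \<iota>: "\<And>t. t < n \<Longrightarrow> \<iota> t \<in> I"
  defines "A \<equiv> {..<n} \<times> {b} \<times> {..<K}"
  shows "(\<integral>\<^sup>+x. (\<Prod>j\<in>A. indicator (cball (0::complex) d) (x j)) * ennreal (\<Prod>t<n. gam (z t - (\<Sum>i\<in>I. c t i * x (t, b, i))))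
       \<partial>PiM A (\<lambda>_. lborel)) \<le> ennreal (((disc_vol d + 1) ^ K) ^ n * (\<Prod>t<n. 1 / (1 + (cmod (c t (\<iota> t)))\<^sup>2)))"
proof -
  interpret L: product_sigma_finite "\<lambda>_::nat \<times> nat \<times> nat. lborel :: complex measure" by (rule product_sigma_finite_lborel)
  \<comment> \<open>One coefficient per slot is reserved for the sharp integral; the remaining ones,
    \<open>A0\<close>, contribute only the areas of their discs.\<close>
  define A1 where "A1 = (\<lambda>t. (t, b, \<iota> t)) ` {..<n}"
  define A0 where "A0 = A - A1"
  have sub: "A1 \<subseteq> A" using I \<iota> by (auto simp: A1_def A_def)
  have U: "A = A0 \<union> A1" and dj: "A0 \<inter> A1 = {}" and fin: "finite A0" "finite A1" and fA: "finite A"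
    using sub by (auto simp: A0_def A_def A1_def)
  have inj: "inj_on (\<lambda>t. (t, b, \<iota> t)) {..<n}" by (auto simp: inj_on_def)
  have cA1: "card A1 = n" using inj by (simp add: A1_def card_image)
  have cA: "card A = n * K" by (simp add: A_def card_cartesian_product)
  have cA0: "card A0 = n * K - n"
    unfolding A0_def using sub fin by (simp add: card_Diff_subset cA cA1)
  define V where "V = disc_vol d"
  have V0: "V \<ge> 0" by (simp add: V_def disc_vol)
  define F where "F x = (\<Prod>j\<in>A. indicator (cball (0::complex) d) (x j)) * ennreal (\<Prod>t<n. gam (z t - (\<Sum>i\<in>I. c t i * x (t, b, i))))"
    for x :: "nat \<times> nat \<times> nat \<Rightarrow> complex"
  have comp: "(\<lambda>x. x j) \<in> borel_measurable (PiM A (\<lambda>_. lborel :: complex measure))" if "j \<in> A" for j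
    using measurable_component_singleton[OF that, of "\<lambda>_. lborel :: complex measure"] by simp
  have comp': "(\<lambda>x. x (t, b, i)) \<in> borel_measurable (PiM A (\<lambda>_. lborel :: complex measure))" if "t \<in> {..<n}" "i \<in> I" for t i
    using that I by (intro comp) (auto simp: A_def)
  have Fm: "F \<in> borel_measurable (PiM A (\<lambda>_. lborel))"
    unfolding F_def
    by (intro borel_measurable_times_ennreal borel_measurable_prod_ennreal borel_measurable_prod
        measurable_compose[OF _ measurable_ennreal] measurable_compose[OF _ borel_measurable_gam]
        borel_measurable_diff borel_measurable_sum borel_measurable_times borel_measurable_const comp'
        measurable_compose[OF comp borel_measurable_indicator]) auto
  have inner: "(\<integral>\<^sup>+y. F (merge A0 A1 (x, y)) \<partial>PiM A1 (\<lambda>_. lborel))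
      \<le> (\<Prod>j\<in>A0. indicator (cball (0::complex) d) (x j)) * ennreal (\<Prod>t<n. (V + 1) / (1 + (cmod (c t (\<iota> t)))\<^sup>2))" for x
  proof -
    define rest where "rest t = (\<Sum>i\<in>I - {\<iota> t}. c t i * x (t, b, i))" for t
    define f where "f j u = indicator (cball (0::complex) d) u * ennreal (gam ((z (fst j) - rest (fst j)) - c (fst j) (\<iota> (fst j)) * u))" for j :: "nat \<times> nat \<times> nat" and u
    have Feq: "F (merge A0 A1 (x, y)) = (\<Prod>j\<in>A0. indicator (cball (0::complex) d) (x j)) * (\<Prod>j\<in>A1. f j (y j))" for y
    proof -
      have m1: "merge A0 A1 (x, y) (t, b, \<iota> t) = y (t, b, \<iota> t)" if "t < n" for t
        using that dj by (auto simp: merge_def A1_def A0_def)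
      have m0: "merge A0 A1 (x, y) (t, b, i) = x (t, b, i)" if "t < n" "i \<in> I" "i \<noteq> \<iota> t" for t i
        using that I by (auto simp: merge_def A1_def A0_def A_def)
      have s: "(\<Sum>i\<in>I. c t i * merge A0 A1 (x, y) (t, b, i)) = rest t + c t (\<iota> t) * y (t, b, \<iota> t)" if "t < n" for t
      proof -
        have "finite I" using I finite_subset by blast
        then have "(\<Sum>i\<in>I. c t i * merge A0 A1 (x, y) (t, b, i)) = c t (\<iota> t) * merge A0 A1 (x, y) (t, b, \<iota> t)
            + (\<Sum>i\<in>I - {\<iota> t}. c t i * merge A0 A1 (x, y) (t, b, i))"
          using \<iota>[OF that] by (rule sum.remove)
        also have "(\<Sum>i\<in>I - {\<iota> t}. c t i * merge A0 A1 (x, y) (t, b, i)) = rest t"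
          unfolding rest_def using m0 that by (intro sum.cong) auto
        finally show ?thesis using m1 that by simp
      qed
      have p: "(\<Prod>j\<in>A. indicator (cball (0::complex) d) (merge A0 A1 (x, y) j) :: ennreal)
          = (\<Prod>j\<in>A0. indicator (cball (0::complex) d) (x j)) * (\<Prod>j\<in>A1. indicator (cball (0::complex) d) (y j))"
        unfolding U using fin dj
        by (subst prod.union_disjoint) (auto intro!: arg_cong2[where f = "(*)"] prod.cong simp: merge_def)
      have q: "ennreal (\<Prod>t<n. gam (z t - (\<Sum>i\<in>I. c t i * merge A0 A1 (x, y) (t, b, i))))
          = (\<Prod>j\<in>A1. ennreal (gam ((z (fst j) - rest (fst j)) - c (fst j) (\<iota> (fst j)) * y j)))"
        using inj s by (simp add: A1_def prod.reindex prod_ennreal diff_diff_add)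
      show ?thesis unfolding F_def p q f_def by (simp add: prod.distrib mult.assoc)
    qed
    have fm: "f j \<in> borel_measurable lborel" for j
    proof -
      have "(\<lambda>u. gam ((z (fst j) - rest (fst j)) - c (fst j) (\<iota> (fst j)) * u)) \<in> borel_measurable borel"
        by (rule measurable_compose[OF _ borel_measurable_gam]) simp
      then show ?thesis unfolding f_def by simp
    qed
    have fm': "(\<lambda>y. f j (y j)) \<in> borel_measurable (PiM A1 (\<lambda>_. lborel))" if "j \<in> A1" for j
      by (rule measurable_compose[OF measurable_component_singleton[OF that, of "\<lambda>_. lborel"] fm])
    have "(\<integral>\<^sup>+y. F (merge A0 A1 (x, y)) \<partial>PiM A1 (\<lambda>_. lborel))
       = (\<Prod>j\<in>A0. indicator (cball (0::complex) d) (x j)) * (\<integral>\<^sup>+y. (\<Prod>j\<in>A1. f j (y j)) \<partial>PiM A1 (\<lambda>_. lborel))"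
      unfolding Feq by (intro nn_integral_cmult borel_measurable_prod_ennreal fm')
    also have "(\<integral>\<^sup>+y. (\<Prod>j\<in>A1. f j (y j)) \<partial>PiM A1 (\<lambda>_. lborel)) = (\<Prod>j\<in>A1. \<integral>\<^sup>+u. f j u \<partial>lborel)"
      using fin fm by (intro L.product_nn_integral_prod)
    also have "\<dots> \<le> (\<Prod>j\<in>A1. ennreal ((V + 1) / (1 + (cmod (c (fst j) (\<iota> (fst j))))\<^sup>2)))"
      unfolding f_def V_def by (intro prod_mono_ennreal nn_integral_gam_disc)
    also have "\<dots> = ennreal (\<Prod>t<n. (V + 1) / (1 + (cmod (c t (\<iota> t)))\<^sup>2))"
      using inj V0 by (simp add: A1_def prod.reindex prod_ennreal divide_nonneg_nonneg)
    finally show ?thesis by (simp add: mult_left_mono)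
  qed
  have "(\<integral>\<^sup>+x. F x \<partial>PiM A (\<lambda>_. lborel)) = (\<integral>\<^sup>+x. (\<integral>\<^sup>+y. F (merge A0 A1 (x, y)) \<partial>PiM A1 (\<lambda>_. lborel)) \<partial>PiM A0 (\<lambda>_. lborel))"
    unfolding U using Fm fin dj by (intro L.product_nn_integral_fold) (auto simp: U[symmetric])
  also have "\<dots> \<le> (\<integral>\<^sup>+x. (\<Prod>j\<in>A0. indicator (cball (0::complex) d) (x j)) * ennreal (\<Prod>t<n. (V + 1) / (1 + (cmod (c t (\<iota> t)))\<^sup>2)) \<partial>PiM A0 (\<lambda>_. lborel))"
    by (intro nn_integral_mono inner)
  also have "\<dots> = (\<integral>\<^sup>+x. (\<Prod>j\<in>A0. indicator (cball (0::complex) d) (x j)) \<partial>PiM A0 (\<lambda>_. lborel)) * ennreal (\<Prod>t<n. (V + 1) / (1 + (cmod (c t (\<iota> t)))\<^sup>2))"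
    by (intro nn_integral_multc borel_measurable_prod_ennreal measurable_compose[OF measurable_component_singleton]) auto
  also have "(\<integral>\<^sup>+x. (\<Prod>j\<in>A0. indicator (cball (0::complex) d) (x j)) \<partial>PiM A0 (\<lambda>_. lborel)) = ennreal (V ^ (n * K - n))"
    using fin by (subst L.product_nn_integral_prod) (auto simp: disc_vol V_def cA0 ennreal_power)
  also have "ennreal (V ^ (n * K - n)) * ennreal (\<Prod>t<n. (V + 1) / (1 + (cmod (c t (\<iota> t)))\<^sup>2))
      = ennreal (V ^ (n * K - n) * (\<Prod>t<n. (V + 1) / (1 + (cmod (c t (\<iota> t)))\<^sup>2)))"
    using V0 by (intro ennreal_mult[symmetric]) (auto intro!: prod_nonneg divide_nonneg_nonneg)
  also have "\<dots> \<le> ennreal (((V + 1) ^ K) ^ n * (\<Prod>t<n. 1 / (1 + (cmod (c t (\<iota> t)))\<^sup>2)))"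
  proof (rule ennreal_leI)
    \<comment> \<open>The exponent \<open>n * K - n\<close> is a truncated difference; for
      \<open>n > 0\<close> the selected input witnesses \<open>K > 0\<close>.\<close>
    have "n \<le> n * K"
    proof (cases "n = 0")
      case False
      then have "\<iota> 0 < K" using \<iota>[of 0] I by auto
      then show ?thesis by simp
    qed simp
    have "V ^ (n * K - n) * (\<Prod>t<n. (V + 1) / (1 + (cmod (c t (\<iota> t)))\<^sup>2))
        = V ^ (n * K - n) * (V + 1) ^ n * (\<Prod>t<n. 1 / (1 + (cmod (c t (\<iota> t)))\<^sup>2))"
      by (simp add: prod_dividef)
    also have "\<dots> \<le> (V + 1) ^ (n * K - n) * (V + 1) ^ n * (\<Prod>t<n. 1 / (1 + (cmod (c t (\<iota> t)))\<^sup>2))"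
      using V0 by (intro mult_right_mono power_mono prod_nonneg) auto
    also have "(V + 1) ^ (n * K - n) * (V + 1) ^ n = ((V + 1) ^ K) ^ n"
      using \<open>n \<le> n * K\<close> by (simp add: power_add[symmetric] power_mult[symmetric] mult.commute)
    finally show "V ^ (n * K - n) * (\<Prod>t<n. (V + 1) / (1 + (cmod (c t (\<iota> t)))\<^sup>2)) \<le> ((V + 1) ^ K) ^ n * (\<Prod>t<n. 1 / (1 + (cmod (c t (\<iota> t)))\<^sup>2))" .
  qed
  finally show ?thesis by (simp add: F_def V_def)
qed

subsection \<open>Aligned images\<close>

declare measurable_rx_rows_component [measurable del]

text \<open>A dyadic mixture of Gaussians that dominates the truncated Cauchy-type kernel
  \<open>exp (- \<rho> / R\<^sup>2) / (1 + \<rho> / D\<^sup>2)\<close>; its integral is only logarithmically larger than \<open>D\<^sup>2\<close>.\<close>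
definition kern :: "real \<Rightarrow> nat \<Rightarrow> complex \<Rightarrow> real" where
  "kern D J u = (\<Sum>j\<le>J. 4 * exp 1 * (1 / 4 ^ j) * exp (- (cmod (u - 0))\<^sup>2 / (4 ^ j * D\<^sup>2)))"

lemma kern_nonneg: "kern D J u \<ge> 0"
  unfolding kern_def by (intro sum_nonneg) auto

lemma measurable_kern [measurable]: "kern D J \<in> borel_measurable borel"
  unfolding kern_def by measurable

text \<open>The summand with the least \<open>j\<close> such that
  \<open>(cmod u)\<^sup>2 \<le> 4 ^ j * D\<^sup>2\<close> does the work: its exponential is at least
  \<open>exp (- 1)\<close>, which the factor \<open>exp 1\<close> compensates, and by minimality the
  dyadic scale overshoots by at most the factor 4. Beyond the last scale the truncation at radius
  \<open>R\<close> is at least as strong as the last Gaussian.\<close>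

lemma kern_ge:
  assumes D: "D > 0" and R: "R > 0" and J: "R\<^sup>2 \<le> 4 ^ J * D\<^sup>2"
  shows "exp (- (cmod u)\<^sup>2 / R\<^sup>2) / (1 + (cmod u)\<^sup>2 / D\<^sup>2) \<le> kern D J u"
proof -
  define \<rho> where "\<rho> = (cmod u)\<^sup>2"
  define T where "T j = 4 * exp 1 * (1 / 4 ^ j) * exp (- \<rho> / (4 ^ j * D\<^sup>2))" for j :: nat
  have \<rho>: "\<rho> \<ge> 0" by (simp add: \<rho>_def)
  have Tk: "T j \<le> kern D J u" if "j \<le> J" for j
  proof -
    have "kern D J u = sum T {..J}" by (simp add: kern_def T_def \<rho>_def)
    moreover have "T j \<le> sum T {..J}"
      using that by (intro member_le_sum) (auto simp: T_def)
    ultimately show ?thesis by simp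
  qed
  have exp_le: "exp (- \<rho> / R\<^sup>2) \<le> 1" using \<rho> by simp
  have "\<exists>j\<le>J. exp (- \<rho> / R\<^sup>2) / (1 + \<rho> / D\<^sup>2) \<le> T j"
  proof (cases "\<rho> \<le> 4 ^ J * D\<^sup>2")
    case True
    define j where "j = (LEAST j. \<rho> \<le> 4 ^ j * D\<^sup>2)"
    have j1: "\<rho> \<le> 4 ^ j * D\<^sup>2" unfolding j_def using True by (rule LeastI)
    have j2: "j \<le> J" unfolding j_def using True by (rule Least_le)
    have e: "exp (- 1) \<le> exp (- \<rho> / (4 ^ j * D\<^sup>2))"
      using j1 D by (simp add: field_simps)
    have "4 * (1 / 4 ^ j) = 4 * exp 1 * (1 / 4 ^ j) * exp (- 1 :: real)"
      by (simp add: exp_minus)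
    also have "\<dots> \<le> T j"
      unfolding T_def using e by (intro mult_left_mono) auto
    finally have T: "4 * (1 / 4 ^ j) \<le> T j" .
    have "1 / (1 + \<rho> / D\<^sup>2) \<le> 4 * (1 / 4 ^ j)"
    proof (cases j)
      case 0
      have "1 / (1 + \<rho> / D\<^sup>2) \<le> 1 / 1" using \<rho> D
        by (intro divide_left_mono) (auto intro!: add_pos_nonneg)
      then show ?thesis using 0 by simp
    next
      case (Suc i)
      then have "\<not> \<rho> \<le> 4 ^ i * D\<^sup>2" using not_less_Least[of i "\<lambda>j. \<rho> \<le> 4 ^ j * D\<^sup>2"] by (simp add: j_def)
      then have "4 ^ i \<le> \<rho> / D\<^sup>2" using D by (simp add: pos_le_divide_eq)
      then have "4 ^ i \<le> 1 + \<rho> / D\<^sup>2" by linarith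
      then have "1 / (1 + \<rho> / D\<^sup>2) \<le> 1 / 4 ^ i" by (intro divide_left_mono) (auto intro!: mult_pos_pos add_pos_nonneg divide_nonneg_nonneg \<rho>)
      then show ?thesis using Suc by simp
    qed
    moreover have "exp (- \<rho> / R\<^sup>2) / (1 + \<rho> / D\<^sup>2) \<le> 1 / (1 + \<rho> / D\<^sup>2)"
      using exp_le \<rho> by (intro divide_right_mono) auto
    ultimately show ?thesis using T j2 by (meson order_trans)
  next
    case False
    then have "4 ^ J \<le> \<rho> / D\<^sup>2" using D by (simp add: pos_le_divide_eq)
    then have *: "4 ^ J \<le> 1 + \<rho> / D\<^sup>2" by linarith
    have "\<rho> / (4 ^ J * D\<^sup>2) \<le> \<rho> / R\<^sup>2"
      using \<rho> R D J by (intro divide_left_mono) auto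
    then have "exp (- \<rho> / R\<^sup>2) / (1 + \<rho> / D\<^sup>2) \<le> exp (- \<rho> / (4 ^ J * D\<^sup>2)) / 4 ^ J"
      using * by (intro frac_le) auto
    also have "\<dots> \<le> T J"
    proof -
      have "1 * (exp (- \<rho> / (4 ^ J * D\<^sup>2)) / 4 ^ J) \<le> (4 * exp 1) * (exp (- \<rho> / (4 ^ J * D\<^sup>2)) / 4 ^ J)"
        using exp_ge_add_one_self[of 1] by (intro mult_right_mono) auto
      then show ?thesis by (simp add: T_def)
    qed
    finally show ?thesis by blast
  qed
  then show ?thesis using Tk unfolding \<rho>_def by (meson order_trans)
qed

text \<open>The weight \<open>1 / 4 ^ j\<close> cancels the growth of the area, so that the
  \<open>J + 1\<close> scales contribute equally.\<close>

lemma nn_integral_kern: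
  assumes D: "D > 0"
  shows "(\<integral>\<^sup>+u. ennreal (kern D J (u - c)) \<partial>lborel) = ennreal (4 * exp 1 * pi * (real J + 1) * D\<^sup>2)"
proof -
  have "(\<integral>\<^sup>+u. ennreal (kern D J (u - c)) \<partial>lborel) =
      (\<integral>\<^sup>+u. (\<Sum>j\<le>J. ennreal (4 * exp 1 * (1 / 4 ^ j)) * ennreal (exp (- (cmod (u - c))\<^sup>2 / (4 ^ j * D\<^sup>2)))) \<partial>lborel)"
  proof (rule nn_integral_cong)
    fix u
    have "ennreal (kern D J (u - c)) = (\<Sum>j\<le>J. ennreal (4 * exp 1 * (1 / 4 ^ j) * exp (- (cmod (u - c))\<^sup>2 / (4 ^ j * D\<^sup>2))))"
      unfolding kern_def diff_zero by (rule sum_ennreal[symmetric]) auto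
    also have "\<dots> = (\<Sum>j\<le>J. ennreal (4 * exp 1 * (1 / 4 ^ j)) * ennreal (exp (- (cmod (u - c))\<^sup>2 / (4 ^ j * D\<^sup>2))))"
      by (intro sum.cong refl ennreal_mult) auto
    finally show "ennreal (kern D J (u - c)) = (\<Sum>j\<le>J. ennreal (4 * exp 1 * (1 / 4 ^ j)) * ennreal (exp (- (cmod (u - c))\<^sup>2 / (4 ^ j * D\<^sup>2))))" .
  qed
  also have "\<dots> = (\<Sum>j\<le>J. \<integral>\<^sup>+u. ennreal (4 * exp 1 * (1 / 4 ^ j)) * ennreal (exp (- (cmod (u - c))\<^sup>2 / (4 ^ j * D\<^sup>2))) \<partial>lborel)"
    by (rule nn_integral_sum) measurable
  also have "\<dots> = (\<Sum>j\<le>J. ennreal (4 * exp 1 * pi * D\<^sup>2))"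
  proof (rule sum.cong)
    fix j
    have "(\<integral>\<^sup>+u. ennreal (4 * exp 1 * (1 / 4 ^ j)) * ennreal (exp (- (cmod (u - c))\<^sup>2 / (4 ^ j * D\<^sup>2))) \<partial>lborel)
       = ennreal (4 * exp 1 * (1 / 4 ^ j)) * ennreal (pi * (4 ^ j * D\<^sup>2))"
      using D by (subst nn_integral_cmult) (simp, subst nn_integral_gaussian_complex, auto)
    also have "\<dots> = ennreal (4 * exp 1 * (1 / 4 ^ j) * (pi * (4 ^ j * D\<^sup>2)))"
      by (rule ennreal_mult[symmetric]) auto
    finally show "(\<integral>\<^sup>+u. ennreal (4 * exp 1 * (1 / 4 ^ j)) * ennreal (exp (- (cmod (u - c))\<^sup>2 / (4 ^ j * D\<^sup>2))) \<partial>lborel)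
       = ennreal (4 * exp 1 * pi * D\<^sup>2)" by (simp add: mult_ac)
  qed simp
  also have "\<dots> = ennreal (4 * exp 1 * pi * (real J + 1) * D\<^sup>2)"
    by (subst sum_ennreal) (auto simp: algebra_simps)
  finally show ?thesis .
qed

text \<open>Power and block length are fixed here, and \<open>a k i\<close> stands for the amplitude
  \<open>sqrt P powr \<alpha> k i\<close>. Codewords are indexed by an arbitrary finite set
  \<open>W\<close>, which also permits an empty codebook where only the estimates for noise and
  fading are wanted.\<close>

locale coded_channel =
  fixes K n :: nat and G :: "(nat \<Rightarrow> nat \<Rightarrow> nat \<Rightarrow> complex) measure" and fmax dmax :: real
    and a :: "nat \<Rightarrow> nat \<Rightarrow> real" and W :: "'w set" and E :: "'w \<Rightarrow> nat \<Rightarrow> nat \<Rightarrow> complex"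
  assumes prob_G: "prob_space G"
    and measurable_G: "\<And>t k i. k < K \<Longrightarrow> i < K \<Longrightarrow> (\<lambda>g. g t k i) \<in> borel_measurable G"
    and AE_le_dmax: "\<And>t k i. k < K \<Longrightarrow> i < K \<Longrightarrow> AE g in G. cmod (g t k i) \<le> dmax"
    and bounded_density: "\<And>A B. finite A \<Longrightarrow> finite B \<Longrightarrow> A \<subseteq> coords K \<Longrightarrow> B \<subseteq> coords K \<Longrightarrow> A \<inter> B = {} \<Longrightarrow>
       \<exists>f h. f \<in> borel_measurable (PiM (A \<union> B) (\<lambda>_. (lborel :: complex measure))) \<and>
             h \<in> borel_measurable (PiM B (\<lambda>_. (lborel :: complex measure))) \<and>
             chan_marg G (A \<union> B) = density (PiM (A \<union> B) (\<lambda>_. lborel)) f \<and>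
             chan_marg G B = density (PiM B (\<lambda>_. lborel)) h \<and>
             (AE x in PiM (A \<union> B) (\<lambda>_. lborel). f x \<le> ennreal (fmax ^ card A) * h (restrict x B))"
    and fmax: "fmax > 0" and dmax: "dmax > 0" and amp_nonneg: "\<And>k i. a k i \<ge> 0"
    and fin_W: "finite W"
    and power_le: "\<And>w i. w \<in> W \<Longrightarrow> i < K \<Longrightarrow> (\<Sum>t<n. (cmod (E w i t))\<^sup>2) \<le> real n"
begin

definition sg :: "nat \<Rightarrow> (nat \<Rightarrow> nat \<Rightarrow> nat \<Rightarrow> complex) \<Rightarrow> 'w \<Rightarrow> nat \<Rightarrow> complex" where
  "sg k g w t = (\<Sum>i<K. complex_of_real (a k i) * g t k i * E w i t)"

text \<open>The broadcast chain takes all inputs for \<open>I\<close>. The interference chain omits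
  the own input of the receiver, so that the own message leaves no trace in
  \<open>lik_on\<close>.\<close>

definition cross :: "nat \<Rightarrow> nat set \<Rightarrow> (nat \<Rightarrow> nat \<Rightarrow> nat \<Rightarrow> complex) \<Rightarrow> 'w \<Rightarrow> 'w \<Rightarrow> nat \<Rightarrow> complex" where
  "cross b I g w w' t = (\<Sum>i\<in>I. (complex_of_real (a b i) * (E w' i t - E w i t)) * g t b i)"

definition lik_on :: "nat \<Rightarrow> nat set \<Rightarrow> ('w \<Rightarrow> 'w \<Rightarrow> bool) \<Rightarrow> 'w \<Rightarrow> (nat \<Rightarrow> nat \<Rightarrow> nat \<Rightarrow> complex) \<Rightarrow> (nat \<times> nat \<Rightarrow> complex) \<Rightarrow> real" where
  "lik_on b I r w g z = (\<Sum>w'\<in>{w' \<in> W. r w w'}. \<Prod>t<n. gam (z (t, b) - cross b I g w w' t))"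

abbreviation Om :: "((nat \<Rightarrow> nat \<Rightarrow> nat \<Rightarrow> complex) \<times> (nat \<times> nat \<Rightarrow> complex)) measure" where
  "Om \<equiv> G \<Otimes>\<^sub>M noise n K"

definition good :: "real \<Rightarrow> ((nat \<Rightarrow> nat \<Rightarrow> nat \<Rightarrow> complex) \<times> (nat \<times> nat \<Rightarrow> complex)) set" where
  "good c0 = {gz \<in> space Om. (\<forall>t<n. \<forall>k<K. \<forall>i<K. cmod (fst gz t k i) \<le> dmax) \<and>
      (\<forall>k<K. (\<Sum>t<n. (cmod (snd gz (t, k)))\<^sup>2) \<le> c0 * real n)}"

lemma measurable_fst_Om: "k < K \<Longrightarrow> i < K \<Longrightarrow> (\<lambda>gz. fst gz t k i) \<in> borel_measurable Om"
  by (rule measurable_compose[OF measurable_fst measurable_G])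

lemma measurable_snd_Om: "t < n \<Longrightarrow> k < K \<Longrightarrow> (\<lambda>gz. snd gz (t, k)) \<in> borel_measurable Om"
  by (rule measurable_compose[OF measurable_snd measurable_noise_component]) auto

lemma good_sets: "good c0 \<in> sets Om"
proof -
  have [measurable]: "(\<lambda>gz. fst gz t k i) \<in> borel_measurable Om" if "k \<in> {..<K}" "i \<in> {..<K}" for t k i
    using that by (intro measurable_fst_Om) auto
  have [measurable]: "(\<lambda>gz. snd gz (t, k)) \<in> borel_measurable Om" if "t \<in> {..<n}" "k \<in> {..<K}" for t k
    using that by (intro measurable_snd_Om) auto
  have "good c0 = {gz \<in> space Om. (\<forall>t\<in>{..<n}. \<forall>k\<in>{..<K}. \<forall>i\<in>{..<K}. cmod (fst gz t k i) \<le> dmax) \<and>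
      (\<forall>k\<in>{..<K}. (\<Sum>t<n. (cmod (snd gz (t, k)))\<^sup>2) \<le> c0 * real n)}"
    by (auto simp: good_def)
  also have "\<dots> \<in> sets Om" by measurable
  finally show ?thesis .
qed

lemma measurable_sg:
  assumes "\<And>i. i < K \<Longrightarrow> (\<lambda>x. gf x t k i) \<in> borel_measurable M"
  shows "(\<lambda>x. sg k (gf x) w t) \<in> borel_measurable M"
  unfolding sg_def using assms by (intro borel_measurable_sum borel_measurable_times borel_measurable_const) auto

lemma measurable_lik:
  assumes "\<And>t i. t < n \<Longrightarrow> i < K \<Longrightarrow> (\<lambda>x. gf x t k i) \<in> borel_measurable M"
    and "\<And>t. t < n \<Longrightarrow> (\<lambda>x. zf x (t, k)) \<in> borel_measurable M"
  shows "(\<lambda>x. lik n k (sg k (gf x)) W r w (zf x)) \<in> borel_measurable M"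
  unfolding lik_def using assms
  by (intro borel_measurable_sum borel_measurable_prod measurable_compose[OF _ borel_measurable_gam]
      borel_measurable_diff borel_measurable_add measurable_sg) auto

lemma measurable_lik_on:
  assumes "\<And>t i. t < n \<Longrightarrow> i \<in> I \<Longrightarrow> (\<lambda>x. gf x t k i) \<in> borel_measurable M"
    and "\<And>t. t < n \<Longrightarrow> (\<lambda>x. zf x (t, k)) \<in> borel_measurable M"
  shows "(\<lambda>x. lik_on k I r w (gf x) (zf x)) \<in> borel_measurable M"
  unfolding lik_on_def cross_def using assms
  by (intro borel_measurable_sum borel_measurable_prod measurable_compose[OF _ borel_measurable_gam]
      borel_measurable_diff borel_measurable_times borel_measurable_const) auto

text \<open>The first factor is the constant \<open>L\<close> of the slotwise estimate in
  \<open>aligned_pointwise\<close>. The exponent collects the cost of a block: noise energy of at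
  most \<open>c0 * n\<close> counted three times, and squared input differences of total at most
  \<open>4 * K\<^sup>2 * n\<close>, once as such and once scaled by
  \<open>2 * dmax\<^sup>2\<close>.\<close>

definition pt_const :: "real \<Rightarrow> real" where
  "pt_const c0 = (2 + 4 * dmax\<^sup>2 * (real K)\<^sup>2 + 4 * dmax\<^sup>2) * exp (3 * c0 + 4 * (real K)\<^sup>2 + 8 * dmax\<^sup>2 * (real K)\<^sup>2)"

text \<open>The deterministic core of aligned images. Inputs in \<open>I\<close> are at most
  \<open>D\<close> times stronger at \<open>ka\<close> than at \<open>kb\<close>, and the others
  arrive at \<open>ka\<close> with amplitude at most \<open>D\<close>. So, up to noise and unscaled
  input differences, the output difference at \<open>ka\<close> is of the order of \<open>D\<close>
  times one plus the largest contribution to the difference at \<open>kb\<close>: codewords that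
  nearly coincide at \<open>kb\<close> are within the scale \<open>D\<close> at
  \<open>ka\<close>.\<close>

lemma aligned_pointwise:
  assumes k: "ka < K" and I: "I \<subseteq> {..<K}" and D: "D \<ge> 1" and R: "R \<ge> 1"
    and aI: "\<And>i. i \<in> I \<Longrightarrow> a ka i \<le> D * a kb i" and aN: "\<And>i. i < K \<Longrightarrow> i \<notin> I \<Longrightarrow> a ka i \<le> D"
    and aR: "\<And>i. i < K \<Longrightarrow> a ka i \<le> R" and J: "R\<^sup>2 \<le> 4 ^ J * D\<^sup>2"
    and \<iota>: "\<And>t. t < n \<Longrightarrow> \<iota> t \<in> I"
    and \<iota>max: "\<And>t i. t < n \<Longrightarrow> i \<in> I \<Longrightarrow> a kb i * cmod (E w' i t - E w i t) \<le> a kb (\<iota> t) * cmod (E w' (\<iota> t) t - E w (\<iota> t) t)"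
    and w: "w \<in> W" "w' \<in> W"
    and g: "\<And>t i. t < n \<Longrightarrow> i < K \<Longrightarrow> cmod (g t ka i) \<le> dmax"
    and z: "(\<Sum>t<n. (cmod (z (t, ka)))\<^sup>2) \<le> c0 * real n"
  shows "(\<Prod>t<n. 1 / (1 + (cmod (complex_of_real (a kb (\<iota> t)) * (E w' (\<iota> t) t - E w (\<iota> t) t)))\<^sup>2))
    \<le> pt_const c0 ^ n * (\<Prod>t<n. kern D J (z (t, ka) + sg ka g w t - sg ka g w' t))"
proof -
  define m where "m t = a kb (\<iota> t) * cmod (E w' (\<iota> t) t - E w (\<iota> t) t)" for t
  define \<Delta> where "\<Delta> i t = cmod (E w' i t - E w i t)" for i t
  define e where "e t = (\<Sum>i<K. \<Delta> i t)" for t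
  define u where "u t = z (t, ka) + sg ka g w t - sg ka g w' t" for t
  define \<zeta> where "\<zeta> t = cmod (z (t, ka))" for t
  define L where "L = 2 + 4 * dmax\<^sup>2 * (real K)\<^sup>2 + 4 * dmax\<^sup>2"
  have K1: "real K \<ge> 1" using k by simp
  have L0: "L > 0" unfolding L_def by (intro add_pos_nonneg) auto
  have m0: "m t \<ge> 0" for t unfolding m_def using amp_nonneg by simp
  have e0: "e t \<ge> 0" for t unfolding e_def \<Delta>_def by (intro sum_nonneg) simp
  have \<zeta>0: "\<zeta> t \<ge> 0" for t by (simp add: \<zeta>_def)
  have \<Delta>0: "\<Delta> i t \<ge> 0" for i t by (simp add: \<Delta>_def)
  have u_le: "cmod (u t) \<le> \<zeta> t + dmax * (\<Sum>i<K. a ka i * \<Delta> i t)" if t: "t < n" for t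
  proof -
    have "u t = z (t, ka) - (\<Sum>i<K. complex_of_real (a ka i) * g t ka i * (E w' i t - E w i t))"
      by (simp add: u_def sg_def algebra_simps sum_subtractf)
    then have "cmod (u t) \<le> \<zeta> t + cmod (\<Sum>i<K. complex_of_real (a ka i) * g t ka i * (E w' i t - E w i t))"
      unfolding \<zeta>_def by (metis norm_triangle_ineq4)
    also have "cmod (\<Sum>i<K. complex_of_real (a ka i) * g t ka i * (E w' i t - E w i t)) \<le> (\<Sum>i<K. dmax * (a ka i * \<Delta> i t))"
    proof (rule sum_norm_le)
      fix i assume "i \<in> {..<K}"
      then have "cmod (g t ka i) * (a ka i * \<Delta> i t) \<le> dmax * (a ka i * \<Delta> i t)"
        using g[OF t] amp_nonneg \<Delta>0 by (intro mult_right_mono mult_nonneg_nonneg) auto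
      then show "cmod (complex_of_real (a ka i) * g t ka i * (E w' i t - E w i t)) \<le> dmax * (a ka i * \<Delta> i t)"
        using amp_nonneg[of ka i] by (simp add: norm_mult \<Delta>_def mult_ac)
    qed
    finally show ?thesis by (simp add: sum_distrib_left)
  qed
  \<comment> \<open>Two bounds for the same sum: \<open>b1\<close> relates it to \<open>kb\<close>
    through \<open>D\<close> and yields the Cauchy-type factor, whereas \<open>b2\<close> uses only
    the largest amplitude \<open>R\<close> and pays for the truncation.\<close>
  have b1: "(\<Sum>i<K. a ka i * \<Delta> i t) \<le> D * (real K * m t + e t)" if t: "t < n" for t
  proof -
    have "(\<Sum>i<K. a ka i * \<Delta> i t) \<le> (\<Sum>i<K. D * m t + D * \<Delta> i t)"
    proof (rule sum_mono)
      fix i assume i: "i \<in> {..<K}"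
      show "a ka i * \<Delta> i t \<le> D * m t + D * \<Delta> i t"
      proof (cases "i \<in> I")
        case True
        have "a ka i * \<Delta> i t \<le> D * a kb i * \<Delta> i t" using aI[OF True] \<Delta>0 by (rule mult_right_mono)
        also have "\<dots> \<le> D * m t" using \<iota>max[OF t True] D by (simp add: m_def \<Delta>_def mult.assoc)
        finally show ?thesis using D \<Delta>0[of i t] by (simp add: add_increasing2)
      next
        case False
        then have "a ka i * \<Delta> i t \<le> D * \<Delta> i t" using aN i \<Delta>0 by (intro mult_right_mono) auto
        then show ?thesis using D m0[of t] by (simp add: add_increasing)
      qed
    qed
    also have "\<dots> = D * (real K * m t + e t)"
      by (simp add: sum.distrib e_def sum_distrib_left algebra_simps)
    finally show ?thesis .
  qed
  have b2: "(\<Sum>i<K. a ka i * \<Delta> i t) \<le> R * e t" for t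
    unfolding e_def sum_distrib_left using aR \<Delta>0 by (intro sum_mono mult_right_mono) auto
  have sq2: "(x + y)\<^sup>2 \<le> 2 * x\<^sup>2 + 2 * y\<^sup>2" for x y :: real
    using sum_squares_bound[of x y] by (simp add: power2_sum)
  \<comment> \<open>Everything except \<open>m t\<close> is absorbed by an exponential of the noise
    and the input differences of the slot, whose sums over the block are at most linear in
    \<open>n\<close>.\<close>
  have step: "1 / (1 + (m t)\<^sup>2) \<le> L * exp ((\<zeta> t)\<^sup>2 + (e t)\<^sup>2) / (1 + (cmod (u t))\<^sup>2 / D\<^sup>2)" if t: "t < n" for t
  proof -
    have "cmod (u t) \<le> \<zeta> t + D * (dmax * (real K * m t + e t))"
    proof -
      have "dmax * (\<Sum>i<K. a ka i * \<Delta> i t) \<le> dmax * (D * (real K * m t + e t))"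
        using dmax by (intro mult_left_mono b1[OF t]) simp
      also have "\<dots> = D * (dmax * (real K * m t + e t))" by (rule mult.left_commute)
      finally show ?thesis using u_le[OF t] by linarith
    qed
    also have "\<dots> \<le> D * (\<zeta> t + dmax * (real K * m t + e t))"
      using D \<zeta>0[of t] by (simp add: distrib_left mult_le_cancel_right1)
    finally have "cmod (u t) / D \<le> \<zeta> t + dmax * (real K * m t + e t)"
      using D by (simp add: field_simps)
    then have "(cmod (u t) / D)\<^sup>2 \<le> (\<zeta> t + dmax * (real K * m t + e t))\<^sup>2"
      using D by (intro power_mono) auto
    also have "\<dots> \<le> 2 * (\<zeta> t)\<^sup>2 + 2 * (dmax * (real K * m t + e t))\<^sup>2" by (rule sq2)
    also have "(dmax * (real K * m t + e t))\<^sup>2 \<le> dmax\<^sup>2 * (2 * (real K * m t)\<^sup>2 + 2 * (e t)\<^sup>2)"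
      unfolding power_mult_distrib[of dmax] by (intro mult_left_mono sq2) simp
    finally have "1 + (cmod (u t))\<^sup>2 / D\<^sup>2 \<le> 1 + 2 * (\<zeta> t)\<^sup>2 + 4 * dmax\<^sup>2 * (real K)\<^sup>2 * (m t)\<^sup>2 + 4 * dmax\<^sup>2 * (e t)\<^sup>2"
      by (simp add: power_divide power_mult_distrib algebra_simps)
    also have "\<dots> \<le> L * 1 + L * (\<zeta> t)\<^sup>2 + L * (m t)\<^sup>2 + L * (e t)\<^sup>2"
      unfolding L_def by (intro add_mono mult_right_mono) auto
    also have "\<dots> \<le> L * ((1 + (m t)\<^sup>2) * (1 + (\<zeta> t)\<^sup>2 + (e t)\<^sup>2))"
      using L0 by (simp add: algebra_simps)
    also have "\<dots> \<le> L * ((1 + (m t)\<^sup>2) * exp ((\<zeta> t)\<^sup>2 + (e t)\<^sup>2))"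
      using L0 exp_ge_add_one_self[of "(\<zeta> t)\<^sup>2 + (e t)\<^sup>2"] by (intro mult_left_mono) (auto simp: add.assoc)
    finally have *: "1 + (cmod (u t))\<^sup>2 / D\<^sup>2 \<le> L * exp ((\<zeta> t)\<^sup>2 + (e t)\<^sup>2) * (1 + (m t)\<^sup>2)" by (simp add: mult_ac)
    have "0 < 1 + (cmod (u t))\<^sup>2 / D\<^sup>2" "0 < 1 + (m t)\<^sup>2" by (auto intro!: add_pos_nonneg)
    then show ?thesis using * by (simp add: divide_simps mult_ac)
  qed
  have se: "(\<Sum>t<n. (e t)\<^sup>2) \<le> 4 * (real K)\<^sup>2 * real n"
  proof -
    have "(e t)\<^sup>2 \<le> real K * (\<Sum>i<K. 2 * (cmod (E w' i t))\<^sup>2 + 2 * (cmod (E w i t))\<^sup>2)" for t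
    proof -
      have "(e t)\<^sup>2 \<le> real K * (\<Sum>i<K. (\<Delta> i t)\<^sup>2)"
        unfolding e_def using sum_squared_le_sum_of_squares[of "\<lambda>i. \<Delta> i t" "{..<K}"] by (simp add: mult.commute)
      also have "\<dots> \<le> real K * (\<Sum>i<K. 2 * (cmod (E w' i t))\<^sup>2 + 2 * (cmod (E w i t))\<^sup>2)"
      proof (intro mult_left_mono sum_mono)
        fix i
        have "(\<Delta> i t)\<^sup>2 \<le> (cmod (E w' i t) + cmod (E w i t))\<^sup>2"
          unfolding \<Delta>_def by (intro power_mono norm_triangle_ineq4) simp
        also have "\<dots> \<le> 2 * (cmod (E w' i t))\<^sup>2 + 2 * (cmod (E w i t))\<^sup>2" by (rule sq2)
        finally show "(\<Delta> i t)\<^sup>2 \<le> 2 * (cmod (E w' i t))\<^sup>2 + 2 * (cmod (E w i t))\<^sup>2" .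
      qed simp
      finally show ?thesis .
    qed
    then have "(\<Sum>t<n. (e t)\<^sup>2) \<le> (\<Sum>t<n. real K * (\<Sum>i<K. 2 * (cmod (E w' i t))\<^sup>2 + 2 * (cmod (E w i t))\<^sup>2))"
      by (intro sum_mono)
    also have "\<dots> = real K * (\<Sum>i<K. 2 * (\<Sum>t<n. (cmod (E w' i t))\<^sup>2) + 2 * (\<Sum>t<n. (cmod (E w i t))\<^sup>2))"
      by (simp only: sum_distrib_left[symmetric] sum.swap[of _ "{..<K}" "{..<n}"] sum.distrib)
    also have "\<dots> \<le> real K * (\<Sum>i<K. 2 * real n + 2 * real n)"
      using power_le w by (intro mult_left_mono sum_mono add_mono) auto
    finally show ?thesis by (simp add: power2_eq_square)
  qed
  have sz: "(\<Sum>t<n. (\<zeta> t)\<^sup>2) \<le> c0 * real n" using z by (simp add: \<zeta>_def)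
  have su: "(\<Sum>t<n. (cmod (u t))\<^sup>2 / R\<^sup>2) \<le> (2 * c0 + 8 * dmax\<^sup>2 * (real K)\<^sup>2) * real n"
  proof -
    have "(cmod (u t))\<^sup>2 / R\<^sup>2 \<le> 2 * (\<zeta> t)\<^sup>2 + 2 * dmax\<^sup>2 * (e t)\<^sup>2" if t: "t < n" for t
    proof -
      have "cmod (u t) \<le> \<zeta> t + R * (dmax * e t)"
      proof -
        have "dmax * (\<Sum>i<K. a ka i * \<Delta> i t) \<le> dmax * (R * e t)"
          using dmax by (intro mult_left_mono b2) simp
        also have "\<dots> = R * (dmax * e t)" by (rule mult.left_commute)
        finally show ?thesis using u_le[OF t] by linarith
      qed
      also have "\<dots> \<le> R * (\<zeta> t + dmax * e t)"
        using R \<zeta>0[of t] by (simp add: distrib_left mult_le_cancel_right1)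
      finally have "cmod (u t) / R \<le> \<zeta> t + dmax * e t"
        using R by (simp add: field_simps)
      then have "(cmod (u t) / R)\<^sup>2 \<le> (\<zeta> t + dmax * e t)\<^sup>2"
        using R by (intro power_mono) auto
      also have "\<dots> \<le> 2 * (\<zeta> t)\<^sup>2 + 2 * (dmax * e t)\<^sup>2" by (rule sq2)
      finally show ?thesis by (simp add: power_divide power_mult_distrib)
    qed
    then have "(\<Sum>t<n. (cmod (u t))\<^sup>2 / R\<^sup>2) \<le> (\<Sum>t<n. 2 * (\<zeta> t)\<^sup>2 + 2 * dmax\<^sup>2 * (e t)\<^sup>2)"
      by (intro sum_mono) auto
    also have "\<dots> = 2 * (\<Sum>t<n. (\<zeta> t)\<^sup>2) + 2 * dmax\<^sup>2 * (\<Sum>t<n. (e t)\<^sup>2)"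
      by (simp add: sum.distrib sum_distrib_left)
    also have "\<dots> \<le> 2 * (c0 * real n) + 2 * dmax\<^sup>2 * (4 * (real K)\<^sup>2 * real n)"
      using se sz by (intro add_mono mult_left_mono) auto
    finally show ?thesis by (simp add: algebra_simps)
  qed
  have "(\<Prod>t<n. 1 / (1 + (cmod (complex_of_real (a kb (\<iota> t)) * (E w' (\<iota> t) t - E w (\<iota> t) t)))\<^sup>2)) = (\<Prod>t<n. 1 / (1 + (m t)\<^sup>2))"
    using amp_nonneg by (simp add: m_def norm_mult)
  also have "\<dots> \<le> (\<Prod>t<n. (L * exp ((\<zeta> t)\<^sup>2 + (e t)\<^sup>2 + (cmod (u t))\<^sup>2 / R\<^sup>2)) * kern D J (u t))"
  proof (rule prod_mono, intro conjI)
    fix t assume "t \<in> {..<n}"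
    then have t: "t < n" by simp
    have "1 / (1 + (m t)\<^sup>2) \<le> L * exp ((\<zeta> t)\<^sup>2 + (e t)\<^sup>2) / (1 + (cmod (u t))\<^sup>2 / D\<^sup>2)" by (rule step[OF t])
    \<comment> \<open>The Gaussian truncation is inserted together with its inverse; by
      \<open>su\<close> the inverse costs only an exponential in \<open>n\<close>.\<close>
    also have "\<dots> = (L * exp ((\<zeta> t)\<^sup>2 + (e t)\<^sup>2 + (cmod (u t))\<^sup>2 / R\<^sup>2)) * (exp (- (cmod (u t))\<^sup>2 / R\<^sup>2) / (1 + (cmod (u t))\<^sup>2 / D\<^sup>2))"
      by (simp add: exp_add exp_minus)
    also have "\<dots> \<le> (L * exp ((\<zeta> t)\<^sup>2 + (e t)\<^sup>2 + (cmod (u t))\<^sup>2 / R\<^sup>2)) * kern D J (u t)"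
      using D R J L0 by (intro mult_left_mono kern_ge) auto
    finally show "1 / (1 + (m t)\<^sup>2) \<le> (L * exp ((\<zeta> t)\<^sup>2 + (e t)\<^sup>2 + (cmod (u t))\<^sup>2 / R\<^sup>2)) * kern D J (u t)" .
  qed simp
  also have "\<dots> = L ^ n * exp (\<Sum>t<n. (\<zeta> t)\<^sup>2 + (e t)\<^sup>2 + (cmod (u t))\<^sup>2 / R\<^sup>2) * (\<Prod>t<n. kern D J (u t))"
    by (simp add: prod.distrib exp_sum)
  also have "\<dots> \<le> pt_const c0 ^ n * (\<Prod>t<n. kern D J (u t))"
  proof (intro mult_right_mono prod_nonneg kern_nonneg)
    have "(\<Sum>t<n. (\<zeta> t)\<^sup>2 + (e t)\<^sup>2 + (cmod (u t))\<^sup>2 / R\<^sup>2) \<le> real n * (3 * c0 + 4 * (real K)\<^sup>2 + 8 * dmax\<^sup>2 * (real K)\<^sup>2)"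
      using se sz su by (simp add: sum.distrib algebra_simps)
    then have "exp (\<Sum>t<n. (\<zeta> t)\<^sup>2 + (e t)\<^sup>2 + (cmod (u t))\<^sup>2 / R\<^sup>2) \<le> exp (3 * c0 + 4 * (real K)\<^sup>2 + 8 * dmax\<^sup>2 * (real K)\<^sup>2) ^ n"
      by (simp add: exp_of_nat_mult[symmetric])
    then show "L ^ n * exp (\<Sum>t<n. (\<zeta> t)\<^sup>2 + (e t)\<^sup>2 + (cmod (u t))\<^sup>2 / R\<^sup>2) \<le> pt_const c0 ^ n"
      using L0 unfolding pt_const_def L_def[symmetric] power_mult_distrib by (intro mult_left_mono) auto
  qed
  finally show ?thesis by (simp add: u_def)
qed

end

section \<open>Averages over fading and noise\<close>

lemma lik_cong:
  assumes "\<And>w t. t < n \<Longrightarrow> s w t = s' w t" "\<And>t. t < n \<Longrightarrow> x (t, k) = x' (t, k)"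
  shows "lik n k s W r w x = lik n k s' W r w x'"
  unfolding lik_def using assms by (intro sum.cong refl prod.cong) auto

context coded_channel
begin

lemma lik_sg_cong:
  assumes "\<And>t i. t < n \<Longrightarrow> i < K \<Longrightarrow> g t k i = g' t k i"
  shows "lik n k (sg k g) W r w x = lik n k (sg k g') W r w x"
  by (rule lik_cong) (auto simp: sg_def assms intro!: sum.cong)

lemma lik_on_cong:
  assumes "\<And>t i. t < n \<Longrightarrow> i \<in> I \<Longrightarrow> g t k i = g' t k i"
  shows "lik_on k I r w g x = lik_on k I r w g' x"
  unfolding lik_on_def cross_def using assms by (auto intro!: sum.cong prod.cong arg_cong[where f = gam])

text \<open>Collects, per slot, the density bound of \<open>K\<close> coefficients, the disc areas,
  the pointwise constant and the constant of the kernel integral.\<close>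

definition ais_const :: "real \<Rightarrow> real" where
  "ais_const c0 = fmax ^ K * (disc_vol dmax + 1) ^ K * pt_const c0 * (4 * exp 1 * pi)"

lemma pt_const_pos: "pt_const c0 > 0"
  unfolding pt_const_def by (intro mult_pos_pos add_pos_nonneg) auto

lemma ais_const_pos: "ais_const c0 > 0"
  unfolding ais_const_def using fmax disc_vol(2)[of dmax] pt_const_pos by (intro mult_pos_pos zero_less_power) auto

text \<open>The numerator depends on the fading only through receiver \<open>kb\<close>, the
  denominator and \<open>ok\<close> only through receiver \<open>ka\<close>. Conditioned on the
  coefficients of \<open>ka\<close>, those of \<open>kb\<close> have bounded density and are
  integrated out, which leaves the likelihood at \<open>ka\<close> untouched.\<close>

lemma fading_average:
  assumes k: "ka < K" "kb < K" "ka \<noteq> kb" and I: "I \<subseteq> {..<K}"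
    and \<iota>: "\<And>w' t. t < n \<Longrightarrow> \<iota> w' t \<in> I" and w: "w \<in> W" "r w w" and \<Lambda>: "\<Lambda> > 0"
    and ok: "\<And>g g'. (\<And>t i. t < n \<Longrightarrow> i < K \<Longrightarrow> g t ka i = g' t ka i) \<Longrightarrow> ok g = ok g'"
    and okm: "Measurable.pred (PiM (({..<n} \<times> {kb} \<times> {..<K}) \<union> ({..<n} \<times> {ka} \<times> {..<K})) (\<lambda>_. lborel)) (\<lambda>h. ok (\<lambda>t k i. h (t, k, i)))"
  shows "(\<integral>\<^sup>+g. (if ok g then ennreal (lik_on kb I r w g z / (\<Lambda> * lik n ka (sg ka g) W r w z)) else 0) \<partial>G)
   \<le> (\<integral>\<^sup>+g. (if ok g then ennreal ((fmax ^ K * (disc_vol dmax + 1) ^ K) ^ n *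
        (\<Sum>w'\<in>{w' \<in> W. r w w'}. \<Prod>t<n. 1 / (1 + (cmod (complex_of_real (a kb (\<iota> w' t)) * (E w' (\<iota> w' t) t - E w (\<iota> w' t) t)))\<^sup>2))
         / (\<Lambda> * lik n ka (sg ka g) W r w z)) else 0) \<partial>G)"
proof -
  define A where "A = {..<n} \<times> {kb} \<times> {..<K}"
  define B where "B = {..<n} \<times> {ka} \<times> {..<K}"
  define unh where "unh h = (\<lambda>t k i. h (t, k, i))" for h :: "nat \<times> nat \<times> nat \<Rightarrow> complex"
  define cls where "cls = {w' \<in> W. r w w'}"
  define lk where "lk g = \<Lambda> * lik n ka (sg ka g) W r w z" for g
  define F where "F h = (if ok (unh h) then ennreal (lik_on kb I r w (unh h) z / lk (unh h)) else 0)" for h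
  define \<kappa> where "\<kappa> w' = (\<Prod>t<n. 1 / (1 + (cmod (complex_of_real (a kb (\<iota> w' t)) * (E w' (\<iota> w' t) t - E w (\<iota> w' t) t)))\<^sup>2))" for w'
  define V where "V = disc_vol dmax"
  have V0: "V \<ge> 0" by (simp add: V_def disc_vol)
  have \<kappa>0: "\<kappa> w' \<ge> 0" for w' unfolding \<kappa>_def by (intro prod_nonneg) auto
  have finA: "finite A" "finite B" and dj: "A \<inter> B = {}" and cA: "card A = n * K"
    using k by (auto simp: A_def B_def card_cartesian_product)
  have sub: "A \<subseteq> coords K" "B \<subseteq> coords K" using k by (auto simp: A_def B_def coords_def)
  have fincls: "finite cls" using fin_W by (simp add: cls_def)
  have lkpos: "lk g > 0" for g
    unfolding lk_def using \<Lambda> w fin_W by (intro mult_pos_pos lik_pos) auto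
  obtain f h where fh: "f \<in> borel_measurable (PiM (A \<union> B) (\<lambda>_. (lborel :: complex measure)))"
      "h \<in> borel_measurable (PiM B (\<lambda>_. (lborel :: complex measure)))"
      "chan_marg G (A \<union> B) = density (PiM (A \<union> B) (\<lambda>_. lborel)) f"
      "chan_marg G B = density (PiM B (\<lambda>_. lborel)) h"
      "AE x in PiM (A \<union> B) (\<lambda>_. lborel). f x \<le> ennreal (fmax ^ card A) * h (restrict x B)"
    using bounded_density[OF finA sub dj] by blast
  have comp: "(\<lambda>x. unh x t k' i) \<in> borel_measurable (PiM (A \<union> B) (\<lambda>_. lborel))" if "(t, k', i) \<in> A \<union> B" for t k' i
    using measurable_component_singleton[OF that, of "\<lambda>_. lborel :: complex measure"] by (simp add: unh_def)
  have Fm: "F \<in> borel_measurable (PiM (A \<union> B) (\<lambda>_. lborel))"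
  proof -
    have [measurable]: "Measurable.pred (PiM (A \<union> B) (\<lambda>_. lborel)) (\<lambda>h. ok (unh h))"
      using okm by (simp add: A_def B_def unh_def)
    have [measurable]: "(\<lambda>x. lik_on kb I r w (unh x) z) \<in> borel_measurable (PiM (A \<union> B) (\<lambda>_. lborel))"
      using I by (intro measurable_lik_on comp) (auto simp: A_def)
    have [measurable]: "(\<lambda>x. lk (unh x)) \<in> borel_measurable (PiM (A \<union> B) (\<lambda>_. lborel))"
      unfolding lk_def by (intro borel_measurable_times borel_measurable_const measurable_lik comp) (auto simp: B_def)
    show ?thesis unfolding F_def by measurable
  qed
  have lk_cong: "lk g = lk g'" if "\<And>t i. t < n \<Longrightarrow> i < K \<Longrightarrow> g t ka i = g' t ka i" for g g'
    unfolding lk_def using lik_sg_cong[of g ka g'] that by simp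
  have F1: "F (restrict (hat g) (A \<union> B)) = (if ok g then ennreal (lik_on kb I r w g z / lk g) else 0)" for g
  proof -
    have "ok (unh (restrict (hat g) (A \<union> B))) = ok g" "lk (unh (restrict (hat g) (A \<union> B))) = lk g"
      by (rule ok lk_cong; simp add: unh_def B_def)+
    moreover have "lik_on kb I r w (unh (restrict (hat g) (A \<union> B))) z = lik_on kb I r w g z"
      using I by (intro lik_on_cong) (auto simp: unh_def A_def)
    ultimately show ?thesis by (simp add: F_def)
  qed
  have F2: "F (merge B A (restrict (hat g) B, x)) = (if ok g then ennreal (1 / lk g) else 0) *
      (\<Sum>w'\<in>cls. ennreal (\<Prod>t<n. gam (z (t, kb) - (\<Sum>i\<in>I. (complex_of_real (a kb i) * (E w' i t - E w i t)) * x (t, kb, i)))))" for g x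
  proof -
    let ?m = "merge B A (restrict (hat g) B, x)"
    let ?S = "\<Sum>w'\<in>cls. \<Prod>t<n. gam (z (t, kb) - (\<Sum>i\<in>I. (complex_of_real (a kb i) * (E w' i t - E w i t)) * x (t, kb, i)))"
    have 1: "ok (unh ?m) = ok g" "lk (unh ?m) = lk g"
      by (rule ok lk_cong; simp add: unh_def merge_def B_def)+
    have "lik_on kb I r w (unh ?m) z = lik_on kb I r w (unh x) z"
      using I k by (intro lik_on_cong) (auto simp: unh_def A_def B_def merge_def)
    also have "\<dots> = (\<Sum>w'\<in>cls. \<Prod>t<n. gam (z (t, kb) - (\<Sum>i\<in>I. (complex_of_real (a kb i) * (E w' i t - E w i t)) * x (t, kb, i))))"
      by (simp add: lik_on_def cross_def unh_def cls_def)
    finally have e: "lik_on kb I r w (unh ?m) z = ?S" .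
    have 2: "ennreal (lik_on kb I r w (unh ?m) z / lk g) = ennreal (1 / lk g) *
       (\<Sum>w'\<in>cls. ennreal (\<Prod>t<n. gam (z (t, kb) - (\<Sum>i\<in>I. (complex_of_real (a kb i) * (E w' i t - E w i t)) * x (t, kb, i)))))"
    proof -
      have "?S \<ge> 0" by (intro sum_nonneg prod_nonneg) simp
      then have "ennreal (?S / lk g) = ennreal (1 / lk g) * ennreal ?S"
        using lkpos[of g] by (subst ennreal_mult[symmetric]) simp_all
      then show ?thesis unfolding e by (subst sum_ennreal) (auto intro!: prod_nonneg)
    qed
    show ?thesis using 1 2 by (simp add: F_def)
  qed
  have gm: "(\<lambda>x. (\<Prod>j\<in>A. indicator (cball 0 dmax) (x j)) * ennreal (\<Prod>t<n. gam (z (t, kb) - (\<Sum>i\<in>I. (complex_of_real (a kb i) * (E w' i t - E w i t)) * x (t, kb, i)))))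
       \<in> borel_measurable (PiM A (\<lambda>_. lborel :: complex measure))" for w'
  proof -
    have c: "(\<lambda>x. x j) \<in> borel_measurable (PiM A (\<lambda>_. lborel :: complex measure))" if "j \<in> A" for j
      using measurable_component_singleton[OF that, of "\<lambda>_. lborel :: complex measure"] by simp
    have c': "(\<lambda>x. x (t, kb, i)) \<in> borel_measurable (PiM A (\<lambda>_. lborel :: complex measure))" if "t \<in> {..<n}" "i \<in> I" for t i
      using that I by (intro c) (auto simp: A_def)
    show ?thesis
      by (intro borel_measurable_times_ennreal borel_measurable_prod_ennreal borel_measurable_prod
        measurable_compose[OF _ measurable_ennreal] measurable_compose[OF _ borel_measurable_gam]
        borel_measurable_diff borel_measurable_sum borel_measurable_times borel_measurable_const c'
        measurable_compose[OF c measurable_indicator_cball]) auto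
  qed
  have inner: "(\<integral>\<^sup>+x. (\<Prod>j\<in>A. indicator (cball 0 dmax) (x j)) * F (merge B A (restrict (hat g) B, x)) \<partial>PiM A (\<lambda>_. lborel))
     \<le> (if ok g then ennreal (1 / lk g) else 0) * ennreal (((V + 1) ^ K) ^ n * (\<Sum>w'\<in>cls. \<kappa> w'))" for g
  proof -
    let ?c = "if ok g then ennreal (1 / lk g) else 0"
    let ?T = "\<lambda>w' x. (\<Prod>j\<in>A. indicator (cball 0 dmax) (x j)) * ennreal (\<Prod>t<n. gam (z (t, kb) - (\<Sum>i\<in>I. (complex_of_real (a kb i) * (E w' i t - E w i t)) * x (t, kb, i))))"
    have "(\<integral>\<^sup>+x. (\<Prod>j\<in>A. indicator (cball 0 dmax) (x j)) * F (merge B A (restrict (hat g) B, x)) \<partial>PiM A (\<lambda>_. lborel))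
       = (\<integral>\<^sup>+x. ?c * (\<Sum>w'\<in>cls. ?T w' x) \<partial>PiM A (\<lambda>_. lborel))"
      unfolding F2 by (simp only: sum_distrib_left mult_ac)
    also have "\<dots> = ?c * (\<Sum>w'\<in>cls. \<integral>\<^sup>+x. ?T w' x \<partial>PiM A (\<lambda>_. lborel))"
      using gm by (subst nn_integral_cmult) (auto intro!: borel_measurable_sum simp: nn_integral_sum)
    also have "\<dots> \<le> ?c * (\<Sum>w'\<in>cls. ennreal (((V + 1) ^ K) ^ n * \<kappa> w'))"
      unfolding A_def V_def \<kappa>_def using I \<iota> by (intro mult_left_mono sum_mono nn_integral_fading) auto
    also have "(\<Sum>w'\<in>cls. ennreal (((V + 1) ^ K) ^ n * \<kappa> w')) = ennreal (((V + 1) ^ K) ^ n * (\<Sum>w'\<in>cls. \<kappa> w'))"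
      using V0 \<kappa>0 by (subst sum_ennreal) (auto simp: sum_distrib_left)
    finally show ?thesis .
  qed
  have "(\<integral>\<^sup>+g. (if ok g then ennreal (lik_on kb I r w g z / lk g) else 0) \<partial>G) = (\<integral>\<^sup>+g. F (restrict (hat g) (A \<union> B)) \<partial>G)"
    by (simp only: F1)
  also have "\<dots> \<le> ennreal (fmax ^ card A) * (\<integral>\<^sup>+g. (\<integral>\<^sup>+x. (\<Prod>j\<in>A. indicator (cball 0 dmax) (x j))
      * F (merge B A (restrict (hat g) B, x)) \<partial>PiM A (\<lambda>_. lborel)) \<partial>G)"
    by (rule nn_integral_bounded_density[OF finA dj _ _ fh Fm])
       (use k in \<open>auto simp: A_def B_def intro: measurable_G AE_le_dmax\<close>)
  also have "\<dots> \<le> ennreal (fmax ^ card A) * (\<integral>\<^sup>+g. (if ok g then ennreal (1 / lk g) else 0) * ennreal (((V + 1) ^ K) ^ n * (\<Sum>w'\<in>cls. \<kappa> w')) \<partial>G)"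
    by (intro mult_left_mono nn_integral_mono inner) simp
  also have "\<dots> = (\<integral>\<^sup>+g. ennreal (fmax ^ card A) * ((if ok g then ennreal (1 / lk g) else 0) * ennreal (((V + 1) ^ K) ^ n * (\<Sum>w'\<in>cls. \<kappa> w'))) \<partial>G)"
  proof (rule nn_integral_cmult[symmetric])
    have gh: "(\<lambda>g. restrict (hat g) (A \<union> B)) \<in> measurable G (PiM (A \<union> B) (\<lambda>_. borel))"
      using k by (intro measurable_restrict) (auto simp: hat_def A_def B_def intro: measurable_G)
    have "sets (PiM (A \<union> B) (\<lambda>_. borel :: complex measure)) = sets (PiM (A \<union> B) (\<lambda>_. lborel))"
      by (rule sets_PiM_cong) simp_all
    then have gh': "(\<lambda>g. restrict (hat g) (A \<union> B)) \<in> measurable G (PiM (A \<union> B) (\<lambda>_. lborel))"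
      using gh by (simp cong: measurable_cong_sets)
    have "Measurable.pred (PiM (A \<union> B) (\<lambda>_. lborel)) (\<lambda>h. ok (unh h))"
      using okm by (simp add: A_def B_def unh_def)
    from measurable_compose[OF gh' this]
    have "Measurable.pred G (\<lambda>g. ok (unh (restrict (hat g) (A \<union> B))))" .
    moreover have "ok (unh (restrict (hat g) (A \<union> B))) = ok g" for g
      by (rule ok) (simp add: unh_def B_def)
    ultimately have [measurable]: "Measurable.pred G ok" by simp
    have [measurable]: "lk \<in> borel_measurable G"
      unfolding lk_def using k by (intro borel_measurable_times borel_measurable_const measurable_lik measurable_G) auto
    show "(\<lambda>g. (if ok g then ennreal (1 / lk g) else 0) * ennreal (((V + 1) ^ K) ^ n * (\<Sum>w'\<in>cls. \<kappa> w'))) \<in> borel_measurable G"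
      by measurable
  qed
  also have "\<dots> = (\<integral>\<^sup>+g. (if ok g then ennreal ((fmax ^ K * (V + 1) ^ K) ^ n * (\<Sum>w'\<in>cls. \<kappa> w') / lk g) else 0) \<partial>G)"
  proof (rule nn_integral_cong)
    fix g
    have S: "(\<Sum>w'\<in>cls. \<kappa> w') \<ge> 0" using \<kappa>0 by (intro sum_nonneg)
    have "ennreal (fmax ^ card A) * (ennreal (1 / lk g) * ennreal (((V + 1) ^ K) ^ n * (\<Sum>w'\<in>cls. \<kappa> w')))
       = ennreal (fmax ^ card A * (1 / lk g * (((V + 1) ^ K) ^ n * (\<Sum>w'\<in>cls. \<kappa> w'))))"
      using fmax lkpos[of g] V0 S by (simp add: ennreal_mult[symmetric])
    also have "fmax ^ card A * (1 / lk g * (((V + 1) ^ K) ^ n * (\<Sum>w'\<in>cls. \<kappa> w'))) = (fmax ^ K * (V + 1) ^ K) ^ n * (\<Sum>w'\<in>cls. \<kappa> w') / lk g"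
      by (simp add: cA power_mult_distrib power_mult mult.commute[of n K])
    finally show "ennreal (fmax ^ card A) * ((if ok g then ennreal (1 / lk g) else 0) * ennreal (((V + 1) ^ K) ^ n * (\<Sum>w'\<in>cls. \<kappa> w')))
       = (if ok g then ennreal ((fmax ^ K * (V + 1) ^ K) ^ n * (\<Sum>w'\<in>cls. \<kappa> w') / lk g) else 0)" by simp
  qed
  finally show ?thesis by (simp only: lk_def V_def \<kappa>_def cls_def)
qed

text \<open>The form of \<open>nn_integral_posterior\<close> for the full noise and for numerators
  that are products over slots: the mean ratio to the likelihood reduces to integrals over single
  symbols.\<close>

lemma sum_nn_integral_posterior:
  fixes \<kappa> :: "'w \<Rightarrow> nat \<Rightarrow> complex \<Rightarrow> real"
  assumes ka: "ka < K" and r: "equivp r" and C: "C \<ge> 0"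
    and \<kappa>m [measurable]: "\<And>w t. \<kappa> w t \<in> borel_measurable borel" and \<kappa>0: "\<And>w t u. \<kappa> w t u \<ge> 0"
  shows "(\<Sum>w\<in>W. \<integral>\<^sup>+z. ennreal (C * (\<Sum>w'\<in>{w' \<in> W. r w w'}. \<Prod>t<n. \<kappa> w' t (z (t, ka) + sg ka g w t))
       / lik n ka (sg ka g) W r w z) \<partial>noise n K)
     = (\<Sum>w\<in>W. ennreal C * (\<Prod>t<n. \<integral>\<^sup>+u. ennreal (\<kappa> w t u) \<partial>lborel))"
proof -
  let ?L = "PiM (rx_rows n ka) (\<lambda>_. lborel :: complex measure)"
  note [measurable] = measurable_rx_rows_component
  define H where "H w' y = C * (\<Prod>t<n. \<kappa> w' t (y (t, ka)))" for w' and y :: "nat \<times> nat \<Rightarrow> complex"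
  define F where "F w x = ennreal (C * (\<Sum>w'\<in>{w' \<in> W. r w w'}. \<Prod>t<n. \<kappa> w' t (x (t, ka) + sg ka g w t))
       / lik n ka (sg ka g) W r w x)" for w x
  have Hm: "H w \<in> borel_measurable ?L" for w unfolding H_def by measurable
  have H0: "H w x \<ge> 0" for w x unfolding H_def using C \<kappa>0 by (intro mult_nonneg_nonneg prod_nonneg) auto
  have Fm: "F w \<in> borel_measurable ?L" for w
    unfolding F_def lik_def by measurable
  have "(\<integral>\<^sup>+z. F w z \<partial>noise n K)
      = (\<integral>\<^sup>+x. ennreal ((\<Prod>t<n. gam (x (t, ka))) * (\<Sum>w'\<in>{w' \<in> W. r w w'}. H w' (shift_row n ka (sg ka g w) x))
        / lik n ka (sg ka g) W r w x) \<partial>?L)" if w: "w \<in> W" for w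
  proof -
    have "F w z = F w (restrict z (rx_rows n ka))" for z
    proof -
      have "lik n ka (sg ka g) W r w z = lik n ka (sg ka g) W r w (restrict z (rx_rows n ka))"
        by (rule lik_cong) (auto simp: rx_rows_def)
      moreover have "(\<Prod>t<n. \<kappa> w' t (z (t, ka) + sg ka g w t))
          = (\<Prod>t<n. \<kappa> w' t (restrict z (rx_rows n ka) (t, ka) + sg ka g w t))" for w'
        by (rule prod.cong) (auto simp: rx_rows_def)
      ultimately show ?thesis unfolding F_def by simp
    qed
    then have "(\<integral>\<^sup>+z. F w z \<partial>noise n K) = (\<integral>\<^sup>+z. F w (restrict z (rx_rows n ka)) \<partial>noise n K)" by metis
    also have "\<dots> = (\<integral>\<^sup>+x. ennreal (\<Prod>t<n. gam (x (t, ka))) * F w x \<partial>?L)"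
      by (rule nn_integral_noise_row[OF ka Fm])
    also have "\<dots> = (\<integral>\<^sup>+x. ennreal ((\<Prod>t<n. gam (x (t, ka))) * (\<Sum>w'\<in>{w' \<in> W. r w w'}. H w' (shift_row n ka (sg ka g w) x))
        / lik n ka (sg ka g) W r w x) \<partial>?L)"
    proof (rule nn_integral_cong)
      fix x
      have "lik n ka (sg ka g) W r w x > 0" using fin_W w r by (intro lik_pos) (auto simp: equivp_reflp)
      moreover have "0 \<le> C * (\<Sum>w'\<in>{w' \<in> W. r w w'}. \<Prod>t<n. \<kappa> w' t (x (t, ka) + sg ka g w t))"
        using C \<kappa>0 by (intro mult_nonneg_nonneg sum_nonneg prod_nonneg) auto
      ultimately show "ennreal (\<Prod>t<n. gam (x (t, ka))) * F w x
        = ennreal ((\<Prod>t<n. gam (x (t, ka))) * (\<Sum>w'\<in>{w' \<in> W. r w w'}. H w' (shift_row n ka (sg ka g w) x)) / lik n ka (sg ka g) W r w x)"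
        unfolding F_def H_def by (subst ennreal_mult[symmetric]) (auto intro!: prod_nonneg simp: sum_distrib_left)
    qed
    finally show ?thesis .
  qed
  then have "(\<Sum>w\<in>W. \<integral>\<^sup>+z. F w z \<partial>noise n K) = (\<Sum>w\<in>W. \<integral>\<^sup>+y. ennreal (H w y) \<partial>?L)"
    using nn_integral_posterior[OF fin_W r Hm H0, where s = "sg ka g"] by simp
  also have "\<dots> = (\<Sum>w\<in>W. ennreal C * (\<Prod>t<n. \<integral>\<^sup>+u. ennreal (\<kappa> w t u) \<partial>lborel))"
  proof (rule sum.cong)
    fix w
    have "(\<integral>\<^sup>+y. ennreal (H w y) \<partial>?L) = (\<integral>\<^sup>+y. ennreal C * (\<Prod>t<n. ennreal (\<kappa> w t (y (t, ka)))) \<partial>?L)"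
      unfolding H_def using C \<kappa>0 by (intro nn_integral_cong) (simp add: ennreal_mult prod_ennreal prod_nonneg)
    also have "\<dots> = ennreal C * (\<Prod>t<n. \<integral>\<^sup>+u. ennreal (\<kappa> w t u) \<partial>lborel)"
      by (subst nn_integral_cmult) (measurable, subst nn_integral_rx_rows_prod, auto)
    finally show "(\<integral>\<^sup>+y. ennreal (H w y) \<partial>?L) = ennreal C * (\<Prod>t<n. \<integral>\<^sup>+u. ennreal (\<kappa> w t u) \<partial>lborel)" .
  qed simp
  finally show ?thesis by (simp add: F_def)
qed

lemma pair_sigma_finite_Om: "pair_sigma_finite G (noise n K)"
proof -
  interpret G: prob_space G by (rule prob_G)
  interpret N: prob_space "noise n K" by (rule prob_space_noise)
  show ?thesis ..
qed

text \<open>Markov's inequality for the ratio \<open>U0\<close> of the likelihood at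
  \<open>kb\<close> to that at \<open>ka\<close>. For every fixed noise, averaging over the fading
  of \<open>kb\<close> gives \<open>U1\<close>; \<open>aligned_pointwise\<close> turns this into
  \<open>U2\<close>, whose numerator is a kernel in the output of \<open>ka\<close>; and integrating
  over the noise of \<open>ka\<close> leaves one kernel integral per slot in place of a sum over
  pairs of codewords.\<close>

lemma aligned_images:
  assumes k: "ka < K" "kb < K" "ka \<noteq> kb" and I: "I \<subseteq> {..<K}" "I \<noteq> {}" and r: "equivp r"
    and D: "D \<ge> 1" and R: "R \<ge> 1"
    and aI: "\<And>i. i \<in> I \<Longrightarrow> a ka i \<le> D * a kb i" and aN: "\<And>i. i < K \<Longrightarrow> i \<notin> I \<Longrightarrow> a ka i \<le> D"
    and aR: "\<And>i. i < K \<Longrightarrow> a ka i \<le> R" and J: "R\<^sup>2 \<le> 4 ^ J * D\<^sup>2" and \<Lambda>: "\<Lambda> > 0"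
  shows "(\<Sum>w\<in>W. emeasure Om {gz \<in> good c0. \<Lambda> * lik n ka (sg ka (fst gz)) W r w (snd gz) < lik_on kb I r w (fst gz) (snd gz)})
     \<le> ennreal ((ais_const c0 * (real J + 1) * D\<^sup>2) ^ n * real (card W) / \<Lambda>)"
proof -
  interpret pair_sigma_finite G "noise n K" by (rule pair_sigma_finite_Om)
  interpret G: prob_space G by (rule prob_G)
  define cls where "cls w = {w' \<in> W. r w w'}" for w
  define Cf where "Cf = fmax ^ K * (disc_vol dmax + 1) ^ K"
  have Cf0: "Cf \<ge> 0" unfolding Cf_def using fmax disc_vol(2)[of dmax] by simp
  have finI: "finite I" using I finite_subset by blast
  have ex: "\<exists>i\<in>I. \<forall>j\<in>I. a kb j * cmod (E w' j t - E w j t) \<le> a kb i * cmod (E w' i t - E w i t)" for w w' t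
  proof -
    let ?f = "\<lambda>j. a kb j * cmod (E w' j t - E w j t)"
    have "Max (?f ` I) \<in> ?f ` I" using finI I by (intro Max_in) auto
    then obtain i where "i \<in> I" "?f i = Max (?f ` I)" by auto
    then show ?thesis using finI by (intro bexI[of _ i] ballI) auto
  qed
  \<comment> \<open>In each slot the average is taken over the coefficient of the input whose
    difference is largest at \<open>kb\<close>. The choice depends on the pair of codewords and on
    the slot.\<close>
  define \<iota> where "\<iota> w w' t = (SOME i. i \<in> I \<and> (\<forall>j\<in>I. a kb j * cmod (E w' j t - E w j t) \<le> a kb i * cmod (E w' i t - E w i t)))" for w w' t
  have \<iota>all: "\<iota> w w' t \<in> I \<and> (\<forall>j\<in>I. a kb j * cmod (E w' j t - E w j t) \<le> a kb (\<iota> w w' t) * cmod (E w' (\<iota> w w' t) t - E w (\<iota> w w' t) t))" for w w' t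
    unfolding \<iota>_def by (rule someI_ex) (use ex in blast)
  then have \<iota>: "\<iota> w w' t \<in> I" for w w' t by blast
  have \<iota>max: "a kb j * cmod (E w' j t - E w j t) \<le> a kb (\<iota> w w' t) * cmod (E w' (\<iota> w w' t) t - E w (\<iota> w w' t) t)"
    if "j \<in> I" for w w' t j
    using \<iota>all that by blast
  define \<kappa> where "\<kappa> w w' = (\<Prod>t<n. 1 / (1 + (cmod (complex_of_real (a kb (\<iota> w w' t)) * (E w' (\<iota> w w' t) t - E w (\<iota> w w' t) t)))\<^sup>2))" for w w'
  have \<kappa>0: "\<kappa> w w' \<ge> 0" for w w' unfolding \<kappa>_def by (intro prod_nonneg) auto
  define okg where "okg g \<longleftrightarrow> (\<forall>t\<in>{..<n}. \<forall>i\<in>{..<K}. cmod (g t ka i) \<le> dmax)" for g :: "nat \<Rightarrow> nat \<Rightarrow> nat \<Rightarrow> complex"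
  define okz where "okz z \<longleftrightarrow> (\<Sum>t<n. (cmod (z (t, ka)))\<^sup>2) \<le> c0 * real n" for z :: "nat \<times> nat \<Rightarrow> complex"
  define lk where "lk w g z = lik n ka (sg ka g) W r w z" for w g z
  have lkpos: "lk w g z > 0" if "w \<in> W" for w g z
    unfolding lk_def using fin_W that r by (intro lik_pos) (auto simp: equivp_reflp)
  define U0 where "U0 w g z = (if okg g \<and> okz z then ennreal (lik_on kb I r w g z / (\<Lambda> * lk w g z)) else 0)" for w g z
  define U1 where "U1 w g z = (if okg g \<and> okz z then ennreal (Cf ^ n * (\<Sum>w'\<in>cls w. \<kappa> w w') / (\<Lambda> * lk w g z)) else 0)" for w g z
  define U2 where "U2 w g z = ennreal ((Cf * pt_const c0) ^ n / \<Lambda> * (\<Sum>w'\<in>cls w. \<Prod>t<n. kern D J (z (t, ka) + sg ka g w t - sg ka g w' t)) / lk w g z)" for w g z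
  have fm [measurable]: "(\<lambda>gz. fst gz t k' i) \<in> borel_measurable Om" if "k' \<in> {..<K}" "i \<in> {..<K}" for t k' i
    using that by (intro measurable_fst_Om) auto
  have fma [measurable]: "(\<lambda>gz. fst gz t ka i) \<in> borel_measurable Om" if "i \<in> {..<K}" for t i
    using that k by (intro measurable_fst_Om) auto
  have sm [measurable]: "(\<lambda>gz. snd gz (t, ka)) \<in> borel_measurable Om" if "t \<in> {..<n}" for t
    using that k by (intro measurable_snd_Om) auto
  have ok1 [measurable]: "Measurable.pred Om (\<lambda>gz. okg (fst gz) \<and> okz (snd gz))"
    unfolding okg_def okz_def by measurable
  have lkm [measurable]: "(\<lambda>gz. lk w (fst gz) (snd gz)) \<in> borel_measurable Om" for w
    unfolding lk_def using k by (intro measurable_lik measurable_fst_Om measurable_snd_Om) auto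
  have lom [measurable]: "(\<lambda>gz. lik_on kb I r w (fst gz) (snd gz)) \<in> borel_measurable Om" for w
    using k I by (intro measurable_lik_on measurable_fst_Om measurable_snd_Om) auto
  have U0m: "(\<lambda>(g, z). U0 w g z) \<in> borel_measurable Om" for w
    unfolding U0_def case_prod_beta by measurable
  have U1m: "(\<lambda>(g, z). U1 w g z) \<in> borel_measurable Om" for w
    unfolding U1_def case_prod_beta by measurable
  have sgm [measurable]: "(\<lambda>gz. sg ka (fst gz) w t) \<in> borel_measurable Om" for w t
    using k by (intro measurable_sg measurable_fst_Om) auto
  have U2m: "(\<lambda>(g, z). U2 w g z) \<in> borel_measurable Om" for w
    unfolding U2_def case_prod_beta by measurable
  have A: "emeasure Om {gz \<in> good c0. \<Lambda> * lik n ka (sg ka (fst gz)) W r w (snd gz) < lik_on kb I r w (fst gz) (snd gz)}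
      \<le> (\<integral>\<^sup>+z. \<integral>\<^sup>+g. U0 w g z \<partial>G \<partial>noise n K)" if w: "w \<in> W" for w
  proof -
    let ?S = "{gz \<in> good c0. \<Lambda> * lik n ka (sg ka (fst gz)) W r w (snd gz) < lik_on kb I r w (fst gz) (snd gz)}"
    have "?S = good c0 \<inter> {gz \<in> space Om. \<Lambda> * lk w (fst gz) (snd gz) < lik_on kb I r w (fst gz) (snd gz)}"
      by (auto simp: good_def lk_def)
    also have "\<dots> \<in> sets Om" by (intro sets.Int good_sets) measurable
    finally have "emeasure Om ?S = (\<integral>\<^sup>+gz. indicator ?S gz \<partial>Om)" by simp
    also have "\<dots> \<le> (\<integral>\<^sup>+gz. (case gz of (g, z) \<Rightarrow> U0 w g z) \<partial>Om)"
    proof (rule nn_integral_mono)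
      fix gz
      show "indicator ?S gz \<le> (case gz of (g, z) \<Rightarrow> U0 w g z)"
      proof (cases "gz \<in> ?S")
        case True
        then have ok: "okg (fst gz)" "okz (snd gz)" using k by (auto simp: good_def okg_def okz_def)
        have "1 \<le> lik_on kb I r w (fst gz) (snd gz) / (\<Lambda> * lk w (fst gz) (snd gz))"
          using True \<Lambda> lkpos[OF w] by (simp add: lk_def pos_le_divide_eq)
        then have "1 \<le> ennreal (lik_on kb I r w (fst gz) (snd gz) / (\<Lambda> * lk w (fst gz) (snd gz)))"
          using ennreal_leI by fastforce
        with ok show ?thesis by (simp add: U0_def case_prod_beta indicator_def)
      qed simp
    qed
    also have "\<dots> = (\<integral>\<^sup>+z. \<integral>\<^sup>+g. U0 w g z \<partial>G \<partial>noise n K)"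
      using nn_integral_snd[OF U0m] by simp
    finally show ?thesis .
  qed
  have B: "(\<integral>\<^sup>+g. U0 w g z \<partial>G) \<le> (\<integral>\<^sup>+g. U1 w g z \<partial>G)" if w: "w \<in> W" for w z
  proof (cases "okz z")
    case True
    have "(\<integral>\<^sup>+g. (if okg g then ennreal (lik_on kb I r w g z / (\<Lambda> * lik n ka (sg ka g) W r w z)) else 0) \<partial>G)
     \<le> (\<integral>\<^sup>+g. (if okg g then ennreal ((fmax ^ K * (disc_vol dmax + 1) ^ K) ^ n *
        (\<Sum>w'\<in>{w' \<in> W. r w w'}. \<Prod>t<n. 1 / (1 + (cmod (complex_of_real (a kb (\<iota> w w' t)) * (E w' (\<iota> w w' t) t - E w (\<iota> w w' t) t)))\<^sup>2))
         / (\<Lambda> * lik n ka (sg ka g) W r w z)) else 0) \<partial>G)"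
    proof (rule fading_average[OF k I(1) \<iota> w _ \<Lambda>])
      let ?M = "PiM (({..<n} \<times> {kb} \<times> {..<K}) \<union> ({..<n} \<times> {ka} \<times> {..<K})) (\<lambda>_. lborel :: complex measure)"
      have [measurable]: "(\<lambda>h. h (t, ka, i)) \<in> borel_measurable ?M" if "t \<in> {..<n}" "i \<in> {..<K}" for t i
        using measurable_component_singleton[of "(t, ka, i)" _ "\<lambda>_. lborel :: complex measure"] that by simp
      show "Measurable.pred ?M (\<lambda>h. okg (\<lambda>t k i. h (t, k, i)))"
        unfolding okg_def by measurable
    qed (use r in \<open>auto simp: okg_def equivp_reflp\<close>)
    then show ?thesis using True by (simp only: U0_def U1_def lk_def Cf_def \<kappa>_def cls_def simp_thms)
  qed (simp add: U0_def U1_def)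
  have C: "U1 w g z \<le> U2 w g z" if w: "w \<in> W" for w g z
  proof (cases "okg g \<and> okz z")
    case True
    have "\<kappa> w w' \<le> pt_const c0 ^ n * (\<Prod>t<n. kern D J (z (t, ka) + sg ka g w t - sg ka g w' t))" if "w' \<in> cls w" for w'
      unfolding \<kappa>_def using True that
      by (intro aligned_pointwise[OF k(1) I(1) D R aI aN aR J \<iota> \<iota>max w]) (auto simp: cls_def okg_def okz_def)
    then have "(\<Sum>w'\<in>cls w. \<kappa> w w') \<le> pt_const c0 ^ n * (\<Sum>w'\<in>cls w. \<Prod>t<n. kern D J (z (t, ka) + sg ka g w t - sg ka g w' t))"
      unfolding sum_distrib_left by (rule sum_mono)
    then have "Cf ^ n * (\<Sum>w'\<in>cls w. \<kappa> w w') / (\<Lambda> * lk w g z)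
       \<le> Cf ^ n * (pt_const c0 ^ n * (\<Sum>w'\<in>cls w. \<Prod>t<n. kern D J (z (t, ka) + sg ka g w t - sg ka g w' t))) / (\<Lambda> * lk w g z)"
      using Cf0 \<Lambda> lkpos[OF w, of g z] by (intro divide_right_mono mult_left_mono) auto
    also have "\<dots> = (Cf * pt_const c0) ^ n / \<Lambda> * (\<Sum>w'\<in>cls w. \<Prod>t<n. kern D J (z (t, ka) + sg ka g w t - sg ka g w' t)) / lk w g z"
      by (simp add: power_mult_distrib mult_ac)
    finally show ?thesis using True by (simp add: U1_def U2_def ennreal_leI)
  qed (auto simp: U1_def)
  have D0: "D > 0" using D by simp
  have "(\<Sum>w\<in>W. emeasure Om {gz \<in> good c0. \<Lambda> * lik n ka (sg ka (fst gz)) W r w (snd gz) < lik_on kb I r w (fst gz) (snd gz)})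
     \<le> (\<Sum>w\<in>W. \<integral>\<^sup>+z. \<integral>\<^sup>+g. U1 w g z \<partial>G \<partial>noise n K)"
    using A B by (intro sum_mono) (meson nn_integral_mono order_trans)
  also have "\<dots> \<le> (\<Sum>w\<in>W. \<integral>\<^sup>+z. \<integral>\<^sup>+g. U2 w g z \<partial>G \<partial>noise n K)"
    using C by (intro sum_mono nn_integral_mono)
  \<comment> \<open>The two averages need opposite orders: the fading of \<open>kb\<close> with the
    noise fixed, then the noise of \<open>ka\<close> with the fading fixed.\<close>
  also have "\<dots> = (\<Sum>w\<in>W. \<integral>\<^sup>+g. \<integral>\<^sup>+z. U2 w g z \<partial>noise n K \<partial>G)"
    by (intro sum.cong refl Fubini' U2m)
  also have "\<dots> = (\<integral>\<^sup>+g. (\<Sum>w\<in>W. \<integral>\<^sup>+z. U2 w g z \<partial>noise n K) \<partial>G)"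
    by (intro nn_integral_sum[symmetric] M2.borel_measurable_nn_integral U2m)
  also have "\<dots> = (\<integral>\<^sup>+g. ennreal ((Cf * pt_const c0) ^ n / \<Lambda> * (4 * exp 1 * pi * (real J + 1) * D\<^sup>2) ^ n * real (card W)) \<partial>G)"
  proof (rule nn_integral_cong)
    fix g
    let ?C = "(Cf * pt_const c0) ^ n / \<Lambda>"
    have C0: "?C \<ge> 0" using Cf0 pt_const_pos[of c0] \<Lambda> by simp
    have "(\<Sum>w\<in>W. \<integral>\<^sup>+z. U2 w g z \<partial>noise n K)
        = (\<Sum>w\<in>W. \<integral>\<^sup>+z. ennreal (?C * (\<Sum>w'\<in>{w' \<in> W. r w w'}. \<Prod>t<n. (\<lambda>w' t u. kern D J (u - sg ka g w' t)) w' t (z (t, ka) + sg ka g w t))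
       / lik n ka (sg ka g) W r w z) \<partial>noise n K)"
      by (simp add: U2_def cls_def lk_def)
    also have "\<dots> = (\<Sum>w\<in>W. ennreal ?C * (\<Prod>t<n. \<integral>\<^sup>+u. ennreal ((\<lambda>w' t u. kern D J (u - sg ka g w' t)) w t u) \<partial>lborel))"
      using C0 kern_nonneg by (intro sum_nn_integral_posterior k r) auto
    also have "\<dots> = (\<Sum>w\<in>W. ennreal ?C * ennreal ((4 * exp 1 * pi * (real J + 1) * D\<^sup>2) ^ n))"
      using D0 by (simp only: nn_integral_kern) (simp add: ennreal_power)
    also have "\<dots> = (\<Sum>w\<in>W. ennreal (?C * (4 * exp 1 * pi * (real J + 1) * D\<^sup>2) ^ n))"
      using C0 by (simp only: ennreal_mult') 
    also have "\<dots> = ennreal (?C * (4 * exp 1 * pi * (real J + 1) * D\<^sup>2) ^ n * real (card W))"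
    proof -
      have "0 \<le> ?C * (4 * exp 1 * pi * (real J + 1) * D\<^sup>2) ^ n"
        using D0 by (intro mult_nonneg_nonneg C0 zero_le_power) auto
      then show ?thesis by (subst sum_ennreal) (simp_all only: sum_constant mult.commute)
    qed
    finally show "(\<Sum>w\<in>W. \<integral>\<^sup>+z. U2 w g z \<partial>noise n K) = ennreal (?C * (4 * exp 1 * pi * (real J + 1) * D\<^sup>2) ^ n * real (card W))" .
  qed
  also have "\<dots> = ennreal ((Cf * pt_const c0) ^ n / \<Lambda> * (4 * exp 1 * pi * (real J + 1) * D\<^sup>2) ^ n * real (card W))"
    by (simp add: G.emeasure_space_1)
  also have "(Cf * pt_const c0) ^ n / \<Lambda> * (4 * exp 1 * pi * (real J + 1) * D\<^sup>2) ^ n * real (card W)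
     = (ais_const c0 * (real J + 1) * D\<^sup>2) ^ n * real (card W) / \<Lambda>"
  proof -
    have "ais_const c0 * (real J + 1) * D\<^sup>2 = (Cf * pt_const c0) * (4 * exp 1 * pi * (real J + 1) * D\<^sup>2)"
      by (simp add: ais_const_def Cf_def algebra_simps)
    then show ?thesis by (simp only: power_mult_distrib[of "Cf * pt_const c0"] times_divide_eq_left)
  qed
  finally show ?thesis .
qed

text \<open>The likelihood of a class is compared with its size times a Gaussian density of variance
  \<open>R\<^sup>2\<close> at the output. That density is the same for all members, so its sum over
  the class is the size times the density, and its integral is 1; Markov's inequality does the rest.
  This starts the broadcast chain, as it bounds the first likelihood below by the number of messages
  over a volume.\<close>

lemma atypical_output:
  assumes k: "k < K" and r: "equivp r" and c: "c \<ge> 0" and R: "R > 0"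
  shows "(\<Sum>w\<in>W. emeasure Om {gz \<in> space Om. lik n k (sg k (fst gz)) W r w (snd gz)
       < c * (real (card {w' \<in> W. r w w'}) * (\<Prod>t<n. exp (- (cmod (snd gz (t, k) + sg k (fst gz) w t - 0))\<^sup>2 / R\<^sup>2) / (pi * R\<^sup>2)))})
     \<le> ennreal (c * real (card W))"
proof -
  interpret pair_sigma_finite G "noise n K" by (rule pair_sigma_finite_Om)
  interpret G: prob_space G by (rule prob_G)
  define \<psi> where "\<psi> u = exp (- (cmod (u - 0))\<^sup>2 / R\<^sup>2) / (pi * R\<^sup>2)" for u :: complex
  have \<psi>0: "\<psi> u \<ge> 0" for u by (simp add: \<psi>_def)
  have \<psi>m [measurable]: "\<psi> \<in> borel_measurable borel" unfolding \<psi>_def by measurable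
  have \<psi>1: "(\<integral>\<^sup>+u. ennreal (\<psi> u) \<partial>lborel) = 1"
  proof -
    have "(\<integral>\<^sup>+u. ennreal (\<psi> u) \<partial>lborel) = (\<integral>\<^sup>+u. ennreal (1 / (pi * R\<^sup>2)) * ennreal (exp (- (cmod (u - 0))\<^sup>2 / R\<^sup>2)) \<partial>lborel)"
      by (intro nn_integral_cong, subst ennreal_mult[symmetric]) (simp_all add: \<psi>_def)
    also have "\<dots> = ennreal (1 / (pi * R\<^sup>2)) * ennreal (pi * R\<^sup>2)"
      using R by (subst nn_integral_cmult) (simp, subst nn_integral_gaussian_complex, auto)
    also have "\<dots> = 1" using R by (simp add: ennreal_mult[symmetric])
    finally show ?thesis .
  qed
  define U where "U w g z = ennreal (c * (\<Sum>w'\<in>{w' \<in> W. r w w'}. \<Prod>t<n. (\<lambda>w t. \<psi>) w' t (z (t, k) + sg k g w t)) / lik n k (sg k g) W r w z)" for w g z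
  have fma: "(\<lambda>gz. fst gz t k i) \<in> borel_measurable Om" if "i < K" for t i
    using that k by (intro measurable_fst_Om) auto
  have sm [measurable]: "(\<lambda>gz. snd gz (t, k)) \<in> borel_measurable Om" if "t \<in> {..<n}" for t
    using that k by (intro measurable_snd_Om) auto
  have sgm [measurable]: "(\<lambda>gz. sg k (fst gz) w t) \<in> borel_measurable Om" for w t
    using fma by (intro measurable_sg)
  have lkm [measurable]: "(\<lambda>gz. lik n k (sg k (fst gz)) W r w (snd gz)) \<in> borel_measurable Om" for w
    using k by (intro measurable_lik measurable_fst_Om measurable_snd_Om) auto
  have Um: "(\<lambda>(g, z). U w g z) \<in> borel_measurable Om" for w
    unfolding U_def case_prod_beta by measurable
  have lkpos: "lik n k (sg k g) W r w z > 0" if "w \<in> W" for w g z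
    using fin_W that r by (intro lik_pos) (auto simp: equivp_reflp)
  have "(\<Sum>w\<in>W. emeasure Om {gz \<in> space Om. lik n k (sg k (fst gz)) W r w (snd gz)
       < c * (real (card {w' \<in> W. r w w'}) * (\<Prod>t<n. \<psi> (snd gz (t, k) + sg k (fst gz) w t)))})
     \<le> (\<Sum>w\<in>W. \<integral>\<^sup>+gz. (case gz of (g, z) \<Rightarrow> U w g z) \<partial>Om)"
  proof (rule sum_mono)
    fix w assume w: "w \<in> W"
    let ?S = "{gz \<in> space Om. lik n k (sg k (fst gz)) W r w (snd gz)
       < c * (real (card {w' \<in> W. r w w'}) * (\<Prod>t<n. \<psi> (snd gz (t, k) + sg k (fst gz) w t)))}"
    have "?S \<in> sets Om" by measurable
    then have "emeasure Om ?S = (\<integral>\<^sup>+gz. indicator ?S gz \<partial>Om)" by simp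
    also have "\<dots> \<le> (\<integral>\<^sup>+gz. (case gz of (g, z) \<Rightarrow> U w g z) \<partial>Om)"
    proof (rule nn_integral_mono)
      fix gz
      show "indicator ?S gz \<le> (case gz of (g, z) \<Rightarrow> U w g z)"
      proof (cases "gz \<in> ?S")
        case True
        then have "1 \<le> c * (real (card {w' \<in> W. r w w'}) * (\<Prod>t<n. \<psi> (snd gz (t, k) + sg k (fst gz) w t))) / lik n k (sg k (fst gz)) W r w (snd gz)"
          using lkpos[OF w] by (simp add: pos_le_divide_eq)
        then have "1 \<le> U w (fst gz) (snd gz)"
          unfolding U_def using ennreal_leI by fastforce
        then show ?thesis by (simp add: case_prod_beta indicator_def)
      qed simp
    qed
    finally show "emeasure Om ?S \<le> (\<integral>\<^sup>+gz. (case gz of (g, z) \<Rightarrow> U w g z) \<partial>Om)" .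
  qed
  also have "\<dots> = (\<Sum>w\<in>W. \<integral>\<^sup>+g. \<integral>\<^sup>+z. U w g z \<partial>noise n K \<partial>G)"
    using M2.nn_integral_fst[OF Um] by simp
  also have "\<dots> = (\<integral>\<^sup>+g. (\<Sum>w\<in>W. \<integral>\<^sup>+z. U w g z \<partial>noise n K) \<partial>G)"
    by (intro nn_integral_sum[symmetric] M2.borel_measurable_nn_integral Um)
  also have "\<dots> = (\<integral>\<^sup>+g. ennreal (c * real (card W)) \<partial>G)"
  proof (rule nn_integral_cong)
    fix g
    have "(\<Sum>w\<in>W. \<integral>\<^sup>+z. U w g z \<partial>noise n K) = (\<Sum>w\<in>W. ennreal c * (\<Prod>t<n. \<integral>\<^sup>+u. ennreal ((\<lambda>w t. \<psi>) w t u) \<partial>lborel))"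
      unfolding U_def using c \<psi>0 by (intro sum_nn_integral_posterior k r) auto
    also have "\<dots> = ennreal (c * real (card W))"
      using c by (simp add: \<psi>1 ennreal_mult ennreal_of_nat_eq_real_of_nat mult_ac)
    finally show "(\<Sum>w\<in>W. \<integral>\<^sup>+z. U w g z \<partial>noise n K) = ennreal (c * real (card W))" .
  qed
  also have "\<dots> = ennreal (c * real (card W))" by (simp add: G.emeasure_space_1)
  finally show ?thesis by (simp add: \<psi>_def)
qed

text \<open>The success event \<open>S w\<close> may involve the noise of all receivers, but the
  decoder of \<open>k\<close> uses only its own output and the channel. So the channel and the other
  noise rows are frozen, and \<open>nn_integral_unconfident\<close> is applied to the sections
  \<open>T w\<close>.\<close>

lemma unconfident_decoding:
  fixes lab :: "'w \<Rightarrow> 'l"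
  assumes k: "k < K" and r: "equivp r" and c: "c \<ge> 0"
    and S: "\<And>w. w \<in> W \<Longrightarrow> S w \<in> sets Om"
    and dec: "\<And>w gz. w \<in> W \<Longrightarrow> gz \<in> S w \<Longrightarrow> dec (\<lambda>t. if t < n then sg k (fst gz) w t + snd gz (t, k) else 0) (fst gz) = lab w"
  shows "(\<Sum>w\<in>W. emeasure Om {gz \<in> S w. lik n k (sg k (fst gz)) W (\<lambda>w w'. r w w' \<and> lab w = lab w') w (snd gz)
       < c * lik n k (sg k (fst gz)) W r w (snd gz)}) \<le> ennreal (c * real (card W))"
proof -
  interpret pair_sigma_finite G "noise n K" by (rule pair_sigma_finite_Om)
  interpret G: prob_space G by (rule prob_G)
  let ?r1 = "\<lambda>w w'. r w w' \<and> lab w = lab w'"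
  define X where "X w = {gz \<in> S w. lik n k (sg k (fst gz)) W ?r1 w (snd gz) < c * lik n k (sg k (fst gz)) W r w (snd gz)}" for w
  have lkm [measurable]: "(\<lambda>gz. lik n k (sg k (fst gz)) W r' w (snd gz)) \<in> borel_measurable Om" for w r'
    using k by (intro measurable_lik measurable_fst_Om measurable_snd_Om) auto
  have Xs: "X w \<in> sets Om" if w: "w \<in> W" for w
  proof -
    have "X w = S w \<inter> {gz \<in> space Om. lik n k (sg k (fst gz)) W ?r1 w (snd gz) < c * lik n k (sg k (fst gz)) W r w (snd gz)}"
      using S[OF w] by (auto simp: X_def dest: sets.sets_into_space)
    also have "\<dots> \<in> sets Om" by (intro sets.Int S w) measurable
    finally show ?thesis .
  qed
  have Xm: "(indicator (X w) :: _ \<Rightarrow> ennreal) \<in> borel_measurable Om" if "w \<in> W" for w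
    using Xs[OF that] by simp
  define J' where "J' = {..<n} \<times> {..<K} - rx_rows n k"
  interpret N': prob_space "PiM J' (\<lambda>_. CN01)" by (rule prob_space_PiM) (rule prob_space_CN01)
  have inner: "(\<integral>\<^sup>+z. (\<Sum>w\<in>W. indicator (X w) (g, z)) \<partial>noise n K) \<le> ennreal (c * real (card W))" if g: "g \<in> space G" for g
  proof -
    have secm: "(\<lambda>z. indicator (X w) (g, z) :: ennreal) \<in> borel_measurable (noise n K)" if "w \<in> W" for w
      using Xm[OF that] g by (rule measurable_Pair2)
    have "(\<integral>\<^sup>+z. (\<Sum>w\<in>W. indicator (X w) (g, z)) \<partial>noise n K) =
        (\<integral>\<^sup>+z'. (\<integral>\<^sup>+x. ennreal (\<Prod>t<n. gam (x (t, k))) * (\<Sum>w\<in>W. indicator (X w) (g, merge J' (rx_rows n k) (z', x)))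
        \<partial>PiM (rx_rows n k) (\<lambda>_. lborel)) \<partial>PiM J' (\<lambda>_. CN01))"
      unfolding J'_def using secm by (intro nn_integral_noise_split k borel_measurable_sum) auto
    also have "\<dots> \<le> (\<integral>\<^sup>+z'. ennreal (c * real (card W)) \<partial>PiM J' (\<lambda>_. CN01))"
    proof (rule nn_integral_mono)
      fix z' assume z': "z' \<in> space (PiM J' (\<lambda>_. CN01))"
      let ?L = "PiM (rx_rows n k) (\<lambda>_. lborel :: complex measure)"
      let ?m = "\<lambda>x. merge J' (rx_rows n k) (z', x)"
      have U: "J' \<union> rx_rows n k = {..<n} \<times> {..<K}" using k by (auto simp: J'_def rx_rows_def)
      have mm: "?m \<in> measurable ?L (noise n K)"
      proof -
        have "?m \<in> measurable (PiM (rx_rows n k) (\<lambda>_. CN01)) (PiM (J' \<union> rx_rows n k) (\<lambda>_. CN01))"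
          using z' by measurable
        then have "?m \<in> measurable (PiM (rx_rows n k) (\<lambda>_. CN01)) (noise n K)" by (simp add: U noise_def)
        moreover have "sets (PiM (rx_rows n k) (\<lambda>_. CN01)) = sets ?L" by (rule sets_PiM_cong) simp_all
        ultimately show ?thesis by (simp cong: measurable_cong_sets)
      qed
      have pm: "(\<lambda>x. (g, ?m x)) \<in> measurable ?L Om"
        using g mm by (intro measurable_Pair measurable_const)
      define T where "T w = {x \<in> space ?L. (g, ?m x) \<in> S w}" for w
      have T: "T w \<in> sets ?L" if w: "w \<in> W" for w
      proof -
        have "T w = (\<lambda>x. (g, ?m x)) -` S w \<inter> space ?L" by (auto simp: T_def)
        also have "\<dots> \<in> sets ?L" using pm S[OF w] by (rule measurable_sets)
        finally show ?thesis .
      qed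
      have mrow: "?m x (t, k) = x (t, k)" if "t < n" for x t
        using that by (auto simp: merge_def J'_def rx_rows_def)
      have lm: "lik n k (sg k g) W r' w (?m x) = lik n k (sg k g) W r' w x" for r' w x
        by (rule lik_cong) (auto simp: mrow)
      have ind: "(indicator (X w) (g, ?m x) :: ennreal) = indicator (T w) x *
          indicator {x. lik n k (sg k g) W ?r1 w x < c * lik n k (sg k g) W r w x} x" if "x \<in> space ?L" for w x
        using that by (auto simp: X_def T_def lm indicator_def)
      have "(\<integral>\<^sup>+x. ennreal (\<Prod>t<n. gam (x (t, k))) * (\<Sum>w\<in>W. indicator (X w) (g, ?m x)) \<partial>?L)
        = (\<integral>\<^sup>+x. (\<Sum>w\<in>W. ennreal (\<Prod>t<n. gam (x (t, k))) * (indicator (T w) x *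
          indicator {x. lik n k (sg k g) W ?r1 w x < c * lik n k (sg k g) W r w x} x)) \<partial>?L)"
        by (intro nn_integral_cong) (simp add: ind sum_distrib_left)
      also have "\<dots> = (\<Sum>w\<in>W. \<integral>\<^sup>+x. ennreal (\<Prod>t<n. gam (x (t, k))) * (indicator (T w) x *
          indicator {x. lik n k (sg k g) W ?r1 w x < c * lik n k (sg k g) W r w x} x) \<partial>?L)"
      proof (rule nn_integral_sum)
        fix w assume w: "w \<in> W"
        note [measurable] = measurable_rx_rows_component T[OF w]
        show "(\<lambda>x. ennreal (\<Prod>t<n. gam (x (t, k))) * (indicator (T w) x *
          indicator {x. lik n k (sg k g) W ?r1 w x < c * lik n k (sg k g) W r w x} x)) \<in> borel_measurable ?L"
          unfolding lik_def by measurable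
      qed
      also have "\<dots> \<le> ennreal (c * real (card W))"
      proof (rule nn_integral_unconfident[OF fin_W r c T])
        fix w w' x x' assume w: "w \<in> W" "w' \<in> W" and x: "x \<in> T w" "x' \<in> T w'"
          and eq: "\<And>t. t < n \<Longrightarrow> x (t, k) + sg k g w t = x' (t, k) + sg k g w' t"
        have "(\<lambda>t. if t < n then sg k g w t + ?m x (t, k) else 0) = (\<lambda>t. if t < n then sg k g w' t + ?m x' (t, k) else 0)"
          using eq by (auto simp: mrow add.commute)
        moreover have "dec (\<lambda>t. if t < n then sg k g w t + ?m x (t, k) else 0) g = lab w"
          using dec[of w "(g, ?m x)"] w x unfolding T_def fst_conv snd_conv by blast
        moreover have "dec (\<lambda>t. if t < n then sg k g w' t + ?m x' (t, k) else 0) g = lab w'"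
          using dec[of w' "(g, ?m x')"] w x unfolding T_def fst_conv snd_conv by blast
        ultimately show "lab w = lab w'" by simp
      qed
      finally show "(\<integral>\<^sup>+x. ennreal (\<Prod>t<n. gam (x (t, k))) * (\<Sum>w\<in>W. indicator (X w) (g, ?m x)) \<partial>?L) \<le> ennreal (c * real (card W))" .
    qed
    also have "\<dots> = ennreal (c * real (card W))" by (simp add: N'.emeasure_space_1)
    finally show ?thesis .
  qed
  have "(\<Sum>w\<in>W. emeasure Om (X w)) = (\<Sum>w\<in>W. \<integral>\<^sup>+gz. indicator (X w) gz \<partial>Om)"
    using Xs by simp
  also have "\<dots> = (\<integral>\<^sup>+gz. (\<Sum>w\<in>W. indicator (X w) gz) \<partial>Om)"
    using Xm by (intro nn_integral_sum[symmetric])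
  also have "\<dots> = (\<integral>\<^sup>+g. \<integral>\<^sup>+z. (\<Sum>w\<in>W. indicator (X w) (g, z)) \<partial>noise n K \<partial>G)"
    using Xm by (intro M2.nn_integral_fst[symmetric] borel_measurable_sum)
  also have "\<dots> \<le> (\<integral>\<^sup>+g. ennreal (c * real (card W)) \<partial>G)"
    by (intro nn_integral_mono inner)
  also have "\<dots> = ennreal (c * real (card W))" by (simp add: G.emeasure_space_1)
  finally show ?thesis by (simp add: X_def)
qed

end

subsection \<open>Converse bounds for a fixed code\<close>

text \<open>Success is a lower integral, because decoders may fail to be measurable. It is a
  supremum over simple functions below the indicator, and the support of a nearly optimal one is a
  measurable subset of \<open>C\<close> carrying almost all of the mass.\<close>

lemma measurable_kernel_approx:
  assumes fin: "emeasure M (space M) \<noteq> \<infinity>" and \<delta>: "\<delta> > 0"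
  shows "\<exists>S\<in>sets M. S \<subseteq> C \<and> (\<integral>\<^sup>+x. indicator C x \<partial>M) \<le> emeasure M S + ennreal \<delta>"
proof (cases "(\<integral>\<^sup>+x. indicator C x \<partial>M) = 0")
  case True
  then show ?thesis by (intro bexI[of _ "{}"]) auto
next
  case False
  let ?I = "\<integral>\<^sup>+x. indicator C x \<partial>M"
  have "?I \<le> (\<integral>\<^sup>+x. 1 \<partial>M)" by (intro nn_integral_mono) (auto simp: indicator_def)
  also have "\<dots> < \<infinity>" using fin by (simp add: less_top[symmetric])
  finally have finI: "?I < top" by simp
  have "?I - ennreal \<delta> < ?I"
    using False finI \<delta> by (intro ennreal_between(1)) (auto simp: zero_less_iff_neq_zero)
  then obtain s where s: "simple_function M s" "s \<le> indicator C" "?I - ennreal \<delta> < integral\<^sup>S M s"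
    unfolding nn_integral_def[of M "indicator C"] less_SUP_iff by auto
  define S where "S = {x \<in> space M. s x \<noteq> 0}"
  have [measurable]: "s \<in> borel_measurable M" using s(1) by (rule borel_measurable_simple_function)
  have Ss: "S \<in> sets M" unfolding S_def by measurable
  have SC: "S \<subseteq> C"
  proof
    fix x assume "x \<in> S"
    then have "s x \<noteq> 0" "s x \<le> indicator C x" using s(2) by (auto simp: S_def le_fun_def)
    then show "x \<in> C" by (cases "x \<in> C") auto
  qed
  have "integral\<^sup>S M s = integral\<^sup>N M s" using s(1) by (rule nn_integral_eq_simple_integral[symmetric])
  also have "\<dots> \<le> (\<integral>\<^sup>+x. indicator S x \<partial>M)"
  proof (rule nn_integral_mono)
    fix x assume x: "x \<in> space M"
    have "s x \<le> 1" using s(2) by (auto simp: le_fun_def indicator_def split: if_splits intro: order_trans)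
    then show "s x \<le> indicator S x" using x by (auto simp: S_def indicator_def)
  qed
  also have "\<dots> = emeasure M S" using Ss by simp
  finally have "?I - ennreal \<delta> \<le> emeasure M S" using s(3) by simp
  then have "?I \<le> emeasure M S + ennreal \<delta>" by (simp add: ennreal_minus_le_iff add.commute)
  then show ?thesis using Ss SC by blast
qed

context coded_channel
begin

lemma emeasure_not_good:
  "emeasure Om (space Om - good c0) \<le> ennreal (real K * (2 * exp (- c0 / 2)) ^ n)"
proof -
  interpret pair_sigma_finite G "noise n K" by (rule pair_sigma_finite_Om)
  interpret G: prob_space G by (rule prob_G)
  define X where "X k = {z \<in> space (noise n K). (\<Sum>t<n. (cmod (z (t, k)))\<^sup>2) > c0 * real n}" for k
  define Y where "Y = {g \<in> space G. \<not> (\<forall>t\<in>{..<n}. \<forall>k\<in>{..<K}. \<forall>i\<in>{..<K}. cmod (g t k i) \<le> dmax)}"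
  have [measurable]: "(\<lambda>z. z (t, k)) \<in> borel_measurable (noise n K)" if "t \<in> {..<n}" "k < K" for t k
    using that by (intro measurable_noise_component) auto
  have Xs: "X k \<in> sets (noise n K)" if [measurable]: "k < K" for k
    unfolding X_def by measurable
  have [measurable]: "(\<lambda>g. g t k i) \<in> borel_measurable G" if "k \<in> {..<K}" "i \<in> {..<K}" for t k i
    using that by (intro measurable_G) auto
  have Ys: "Y \<in> sets G" unfolding Y_def by measurable
  have Y0: "emeasure G Y = 0"
  proof -
    have "AE g in G. \<forall>t\<in>{..<n}. \<forall>k\<in>{..<K}. \<forall>i\<in>{..<K}. cmod (g t k i) \<le> dmax"
      using AE_le_dmax by (simp add: AE_finite_all)
    then show ?thesis
      unfolding Y_def using Ys by (subst (asm) AE_iff_measurable[OF _ refl]) (auto simp: Y_def)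
  qed
  have "space Om - good c0 \<subseteq> (\<Union>k\<in>{..<K}. space G \<times> X k) \<union> Y \<times> space (noise n K)"
    by (auto simp: good_def X_def Y_def space_pair_measure not_le)
  then have "emeasure Om (space Om - good c0) \<le> emeasure Om ((\<Union>k\<in>{..<K}. space G \<times> X k) \<union> Y \<times> space (noise n K))"
    using Xs Ys by (intro emeasure_mono sets.Un sets.finite_UN pair_measureI) auto
  also have "\<dots> \<le> emeasure Om (\<Union>k\<in>{..<K}. space G \<times> X k) + emeasure Om (Y \<times> space (noise n K))"
    using Xs Ys by (intro emeasure_subadditive sets.finite_UN pair_measureI) auto
  also have "emeasure Om (Y \<times> space (noise n K)) = 0"
    using Ys Y0 by (subst M2.emeasure_pair_measure_Times) auto
  also have "emeasure Om (\<Union>k\<in>{..<K}. space G \<times> X k) \<le> (\<Sum>k\<in>{..<K}. emeasure Om (space G \<times> X k))"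
    using Xs by (intro emeasure_subadditive_finite) auto
  also have "\<dots> \<le> (\<Sum>k\<in>{..<K}. ennreal ((2 * exp (- c0 / 2)) ^ n))"
  proof (rule sum_mono)
    fix k assume "k \<in> {..<K}"
    then have k: "k < K" by simp
    have "emeasure Om (space G \<times> X k) = emeasure (noise n K) (X k)"
      using Xs[OF k] by (subst M2.emeasure_pair_measure_Times) (auto simp: G.emeasure_space_1)
    also have "\<dots> \<le> ennreal ((2 * exp (- c0 / 2)) ^ n)"
      unfolding X_def using k by (rule noise_tail)
    finally show "emeasure Om (space G \<times> X k) \<le> ennreal ((2 * exp (- c0 / 2)) ^ n)" .
  qed
  also have "\<dots> = ennreal (real K * (2 * exp (- c0 / 2)) ^ n)"
    by (subst sum_ennreal) auto
  finally show ?thesis by simp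
qed

text \<open>A union bound averaged over the transmitted tuple: if every success lay in some bad
  event, the mean success probability, at least one half, would be at most
  \<open>length Bs * c\<close>.\<close>

lemma ex_avoiding_bad_events:
  assumes W: "W \<noteq> {}" and S: "\<And>w. w \<in> W \<Longrightarrow> S w \<in> sets Om"
    and S1: "ennreal (real (card W) / 2) \<le> (\<Sum>w\<in>W. emeasure Om (S w))"
    and B: "\<And>B w. B \<in> set Bs \<Longrightarrow> w \<in> W \<Longrightarrow> B w \<in> sets Om"
    and B1: "\<And>B. B \<in> set Bs \<Longrightarrow> (\<Sum>w\<in>W. emeasure Om (B w)) \<le> ennreal (c * real (card W))"
    and c: "c \<ge> 0" "real (length Bs) * c < 1 / 2"
  shows "\<exists>w\<in>W. \<exists>gz\<in>S w. \<forall>B\<in>set Bs. gz \<notin> B w"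
proof (rule ccontr)
  assume "\<not> ?thesis"
  then have sub: "S w \<subseteq> (\<Union>i\<in>{..<length Bs}. (Bs ! i) w)" if "w \<in> W" for w
    using that by (fastforce simp: in_set_conv_nth)
  have cW: "card W > 0" using W fin_W by (simp add: card_gt_0_iff)
  have "ennreal (real (card W) / 2) \<le> (\<Sum>w\<in>W. emeasure Om (S w))" by (rule S1)
  also have "\<dots> \<le> (\<Sum>w\<in>W. \<Sum>i<length Bs. emeasure Om ((Bs ! i) w))"
  proof (rule sum_mono)
    fix w assume w: "w \<in> W"
    have "emeasure Om (S w) \<le> emeasure Om (\<Union>i\<in>{..<length Bs}. (Bs ! i) w)"
      using w B sub by (intro emeasure_mono sets.finite_UN) auto
    also have "\<dots> \<le> (\<Sum>i<length Bs. emeasure Om ((Bs ! i) w))"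
      using w B by (intro emeasure_subadditive_finite) auto
    finally show "emeasure Om (S w) \<le> (\<Sum>i<length Bs. emeasure Om ((Bs ! i) w))" .
  qed
  also have "\<dots> = (\<Sum>i<length Bs. \<Sum>w\<in>W. emeasure Om ((Bs ! i) w))" by (rule sum.swap)
  also have "\<dots> \<le> (\<Sum>i<length Bs. ennreal (c * real (card W)))"
    using B1 by (intro sum_mono) auto
  also have "\<dots> = ennreal (real (length Bs) * c * real (card W))"
    using c by (subst sum_ennreal) (auto simp: mult_ac)
  finally have "real (card W) / 2 \<le> real (length Bs) * c * real (card W)"
    using c by (subst (asm) ennreal_le_iff) auto
  moreover have "real (length Bs) * c * real (card W) < 1 / 2 * real (card W)"
    using c(2) cW by (intro mult_strict_right_mono) auto
  ultimately show False by simp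
qed

lemma lik_on_UNIV: "lik_on k {..<K} r w g z = lik n k (sg k g) W r w z"
proof -
  have "z (t, k) - cross k {..<K} g w w' t = z (t, k) + sg k g w t - sg k g w' t" for w' t
    by (simp add: cross_def sg_def algebra_simps sum_subtractf)
  then show ?thesis by (simp only: lik_on_def lik_def)
qed

text \<open>On the typical event the output energy at \<open>k\<close> is at most a constant times
  \<open>n * R\<^sup>2\<close>, so the Gaussian reference density falls below its peak only by a
  factor exponential in \<open>n\<close>.\<close>

lemma output_density_ge:
  assumes k: "k < K" and w: "w \<in> W" and gz: "gz \<in> good c0" and R: "R \<ge> 1" and aR: "\<And>i. i < K \<Longrightarrow> a k i \<le> R"
  shows "(\<Prod>t<n. exp (- (cmod (snd gz (t, k) + sg k (fst gz) w t - 0))\<^sup>2 / R\<^sup>2) / (pi * R\<^sup>2))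
     \<ge> (1 / (pi * R\<^sup>2 * exp (2 * c0 + 2 * dmax\<^sup>2 * (real K)\<^sup>2))) ^ n"
proof -
  obtain g z where [simp]: "gz = (g, z)" by (cases gz)
  have g: "cmod (g t k i) \<le> dmax" if "t < n" "i < K" for t i
    using gz that k by (auto simp: good_def)
  have z: "(\<Sum>t<n. (cmod (z (t, k)))\<^sup>2) \<le> c0 * real n"
    using gz k by (auto simp: good_def)
  have sq2: "(x + y)\<^sup>2 \<le> 2 * x\<^sup>2 + 2 * y\<^sup>2" for x y :: real
    using sum_squares_bound[of x y] by (simp add: power2_sum)
  have "(cmod (z (t, k) + sg k g w t))\<^sup>2 / R\<^sup>2 \<le> 2 * (cmod (z (t, k)))\<^sup>2 + 2 * dmax\<^sup>2 * real K * (\<Sum>i<K. (cmod (E w i t))\<^sup>2)" if t: "t < n" for t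
  proof -
    have "cmod (sg k g w t) \<le> (\<Sum>i<K. R * dmax * cmod (E w i t))"
      unfolding sg_def
    proof (rule sum_norm_le)
      fix i assume "i \<in> {..<K}"
      then show "cmod (complex_of_real (a k i) * g t k i * E w i t) \<le> R * dmax * cmod (E w i t)"
        using g[OF t] aR amp_nonneg[of k i] R by (auto simp: norm_mult intro!: mult_right_mono mult_mono)
    qed
    then have s: "cmod (sg k g w t) \<le> R * (dmax * (\<Sum>i<K. cmod (E w i t)))"
      by (simp add: sum_distrib_left mult.assoc)
    have "cmod (z (t, k) + sg k g w t) \<le> cmod (z (t, k)) + R * (dmax * (\<Sum>i<K. cmod (E w i t)))"
      using norm_triangle_ineq[of "z (t, k)" "sg k g w t"] s by linarith
    also have "\<dots> \<le> R * (cmod (z (t, k)) + dmax * (\<Sum>i<K. cmod (E w i t)))"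
      using R by (simp add: distrib_left mult_le_cancel_right1)
    finally have "cmod (z (t, k) + sg k g w t) / R \<le> cmod (z (t, k)) + dmax * (\<Sum>i<K. cmod (E w i t))"
      using R by (simp add: field_simps)
    then have "(cmod (z (t, k) + sg k g w t) / R)\<^sup>2 \<le> (cmod (z (t, k)) + dmax * (\<Sum>i<K. cmod (E w i t)))\<^sup>2"
      using R by (intro power_mono) auto
    also have "\<dots> \<le> 2 * (cmod (z (t, k)))\<^sup>2 + 2 * (dmax * (\<Sum>i<K. cmod (E w i t)))\<^sup>2" by (rule sq2)
    also have "(dmax * (\<Sum>i<K. cmod (E w i t)))\<^sup>2 \<le> dmax\<^sup>2 * ((\<Sum>i<K. (cmod (E w i t))\<^sup>2) * real K)"
      unfolding power_mult_distrib using sum_squared_le_sum_of_squares[of "\<lambda>i. cmod (E w i t)" "{..<K}"]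
      by (intro mult_left_mono) auto
    finally show ?thesis by (simp add: power_divide mult_ac)
  qed
  then have "(\<Sum>t<n. (cmod (z (t, k) + sg k g w t))\<^sup>2 / R\<^sup>2) \<le> (\<Sum>t<n. 2 * (cmod (z (t, k)))\<^sup>2 + 2 * dmax\<^sup>2 * real K * (\<Sum>i<K. (cmod (E w i t))\<^sup>2))"
    by (intro sum_mono) auto
  also have "\<dots> = 2 * (\<Sum>t<n. (cmod (z (t, k)))\<^sup>2) + 2 * dmax\<^sup>2 * real K * (\<Sum>i<K. \<Sum>t<n. (cmod (E w i t))\<^sup>2)"
    by (simp only: sum.distrib sum_distrib_left[symmetric] sum.swap[of _ "{..<K}" "{..<n}"])
  also have "\<dots> \<le> 2 * (c0 * real n) + 2 * dmax\<^sup>2 * real K * (\<Sum>i<K. real n)"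
    using z power_le[OF w] by (intro add_mono mult_left_mono sum_mono) auto
  also have "\<dots> = real n * (2 * c0 + 2 * dmax\<^sup>2 * (real K)\<^sup>2)"
    by (simp add: power2_eq_square algebra_simps)
  finally have le: "(\<Sum>t<n. (cmod (z (t, k) + sg k g w t))\<^sup>2 / R\<^sup>2) \<le> real n * (2 * c0 + 2 * dmax\<^sup>2 * (real K)\<^sup>2)" .
  have "(1 / (pi * R\<^sup>2 * exp (2 * c0 + 2 * dmax\<^sup>2 * (real K)\<^sup>2))) ^ n
      = exp (- (real n * (2 * c0 + 2 * dmax\<^sup>2 * (real K)\<^sup>2))) * (1 / (pi * R\<^sup>2)) ^ n"
    by (simp add: exp_minus exp_of_nat_mult power_mult_distrib power_divide divide_simps)
  also have "\<dots> \<le> exp (- (\<Sum>t<n. (cmod (z (t, k) + sg k g w t))\<^sup>2 / R\<^sup>2)) * (1 / (pi * R\<^sup>2)) ^ n"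
    using le by (intro mult_right_mono) auto
  also have "\<dots> = (\<Prod>t<n. exp (- (cmod (z (t, k) + sg k g w t - 0))\<^sup>2 / R\<^sup>2) / (pi * R\<^sup>2))"
    by (simp add: sum_negf[symmetric] exp_sum prod_dividef power_divide)
  finally show ?thesis by simp
qed

end

section \<open>Codes indexed by message tuples\<close>

definition agree :: "nat set \<Rightarrow> (nat \<Rightarrow> nat) \<Rightarrow> (nat \<Rightarrow> nat) \<Rightarrow> bool" where
  "agree J w w' \<longleftrightarrow> (\<forall>j\<in>J. w j = w' j)"

lemma equivp_agree: "equivp (agree J)"
  by (rule equivpI) (auto simp: agree_def reflp_def symp_def transp_def)

lemma agree_insert: "agree (insert k J) = (\<lambda>w w'. agree J w w' \<and> w k = w' k)"
  by (auto simp: agree_def fun_eq_iff)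

lemma finite_msg_set: "finite (msg_set K M)"
  unfolding msg_set_def by (intro finite_PiE) auto

lemma card_class_ge:
  assumes w: "w \<in> msg_set K M" and S: "S \<subseteq> {..<K}"
  shows "(\<Prod>k\<in>S. M k) \<le> card {w' \<in> msg_set K M. agree ({..<K} - S) w w'}"
proof -
  have finS: "finite S" using S finite_subset by blast
  let ?f = "\<lambda>f k. if k \<in> S then f k else w k"
  have "(\<Prod>k\<in>S. M k) = card (Pi\<^sub>E S (\<lambda>k. {..<M k}))"
    using finS by (simp add: card_PiE)
  also have "\<dots> \<le> card {w' \<in> msg_set K M. agree ({..<K} - S) w w'}"
  proof (rule card_inj_on_le[where f = ?f])
    show "inj_on ?f (Pi\<^sub>E S (\<lambda>k. {..<M k}))"
    proof (rule inj_onI)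
      fix f f' assume f: "f \<in> Pi\<^sub>E S (\<lambda>k. {..<M k})" "f' \<in> Pi\<^sub>E S (\<lambda>k. {..<M k})" and eq: "?f f = ?f f'"
      show "f = f'"
      proof (rule PiE_ext[OF f])
        fix k assume "k \<in> S"
        then show "f k = f' k" using fun_cong[OF eq, of k] by simp
      qed
    qed
    show "?f ` Pi\<^sub>E S (\<lambda>k. {..<M k}) \<subseteq> {w' \<in> msg_set K M. agree ({..<K} - S) w w'}"
      using w S by (auto simp: msg_set_def agree_def PiE_def Pi_def extensional_def)
  qed (simp add: finite_msg_set)
  finally show ?thesis .
qed

locale coded_msgs = coded_channel K n G fmax dmax a "msg_set K M" E
  for K n G fmax dmax a and M :: "nat \<Rightarrow> nat" and E +
  fixes dec :: "nat \<Rightarrow> (nat \<Rightarrow> complex) \<Rightarrow> (nat \<Rightarrow> nat \<Rightarrow> nat \<Rightarrow> complex) \<Rightarrow> nat"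
  assumes n1: "n \<ge> 1" and K1: "K \<ge> 1" and M1: "\<And>k. k < K \<Longrightarrow> M k \<ge> 1"
    and success: "ennreal (3 / 4) \<le> (\<Sum>w\<in>msg_set K M. \<integral>\<^sup>+gz. indicator {gz. \<forall>k<K. dec k (\<lambda>t. if t < n then sg k (fst gz) w t + snd gz (t, k) else 0) (fst gz) = w k} gz
         \<partial>(G \<Otimes>\<^sub>M noise n K)) / of_nat (card (msg_set K M))"
begin

abbreviation "W \<equiv> msg_set K M"

text \<open>Chosen so that \<open>K * (2 * exp (- c0 / 2)) = c\<close>: the noise tails of all
  receivers together then stay within the probability allotted to each bad event.\<close>

definition c0 :: real where "c0 = 2 * ln (32 * (real K)\<^sup>2)"
text \<open>A chain meets at most \<open>2 * K + 1\<close> bad events, and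
  \<open>(2 * K + 1) / (16 * K)\<close> stays below the success mass \<open>1 / 2\<close>. The same
  number serves as the confidence threshold of the decoders.\<close>

definition c :: real where "c = 1 / (16 * real K)"

lemma c_pos: "c > 0" using K1 by (simp add: c_def)

lemma W_nonempty: "W \<noteq> {}"
  unfolding msg_set_def PiE_eq_empty_iff lessThan_empty_iff using M1 by fastforce

lemma card_W: "card W > 0"
  using W_nonempty finite_msg_set by (simp add: card_gt_0_iff)

text \<open>Measurable parts of the success events. The mass \<open>1 / 2\<close> is what remains of
  \<open>3 / 4\<close> after \<open>1 / 4\<close> per tuple is given up in the
  approximation.\<close>

definition success_sets where
  "success_sets S \<longleftrightarrow> (\<forall>w\<in>W. S w \<in> sets Om) \<and> (\<forall>w\<in>W. \<forall>gz\<in>S w. \<forall>k<K. dec k (\<lambda>t. if t < n then sg k (fst gz) w t + snd gz (t, k) else 0) (fst gz) = w k)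
     \<and> ennreal (real (card W) / 2) \<le> (\<Sum>w\<in>W. emeasure Om (S w))"

lemma ex_success_sets: "\<exists>S. success_sets S"
proof -
  interpret pair_sigma_finite G "noise n K" by (rule pair_sigma_finite_Om)
  interpret G: prob_space G by (rule prob_G)
  interpret N: prob_space "noise n K" by (rule prob_space_noise)
  interpret pair_prob_space G "noise n K" ..
  define C where "C w = {gz. \<forall>k<K. dec k (\<lambda>t. if t < n then sg k (fst gz) w t + snd gz (t, k) else 0) (fst gz) = w k}" for w
  have "\<exists>S\<in>sets Om. S \<subseteq> C w \<and> (\<integral>\<^sup>+gz. indicator (C w) gz \<partial>Om) \<le> emeasure Om S + ennreal (1 / 4)" for w
    by (rule measurable_kernel_approx) auto
  then obtain S where S: "\<And>w. S w \<in> sets Om" "\<And>w. S w \<subseteq> C w"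
      "\<And>w. (\<integral>\<^sup>+gz. indicator (C w) gz \<partial>Om) \<le> emeasure Om (S w) + ennreal (1 / 4)"
    by metis
  have "ennreal (3 / 4 * real (card W)) = ennreal (3 / 4) * of_nat (card W)"
    unfolding ennreal_of_nat_eq_real_of_nat by (rule ennreal_mult) auto
  also have "\<dots> \<le> (\<Sum>w\<in>W. \<integral>\<^sup>+gz. indicator (C w) gz \<partial>Om) / of_nat (card W) * of_nat (card W)"
    using success by (intro mult_right_mono) (auto simp: C_def)
  also have "\<dots> = (\<Sum>w\<in>W. \<integral>\<^sup>+gz. indicator (C w) gz \<partial>Om)"
    using card_W by (intro ennreal_divide_times[THEN trans]) (simp add: divide_ennreal_def mult.assoc ennreal_of_nat_eq_real_of_nat inverse_ennreal ennreal_mult[symmetric])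
  also have "\<dots> \<le> (\<Sum>w\<in>W. emeasure Om (S w) + ennreal (1 / 4))"
    by (intro sum_mono S)
  also have "\<dots> = (\<Sum>w\<in>W. emeasure Om (S w)) + ennreal (real (card W) / 4)"
  proof -
    have "(\<Sum>w\<in>W. ennreal (1 / 4)) = ennreal (real (card W) / 4)"
      by (subst sum_ennreal) auto
    then show ?thesis by (simp only: sum.distrib)
  qed
  finally have "ennreal (3 / 4 * real (card W)) - ennreal (real (card W) / 4) \<le> (\<Sum>w\<in>W. emeasure Om (S w))"
    by (simp add: ennreal_minus_le_iff add.commute)
  moreover have "ennreal (3 / 4 * real (card W)) - ennreal (real (card W) / 4) = ennreal (real (card W) / 2)"
    by (subst ennreal_minus) auto
  ultimately show ?thesis
    using S unfolding success_sets_def by (intro exI[of _ S]) (auto simp: C_def subset_eq)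
qed

lemma sum_not_good: "(\<Sum>w\<in>W. emeasure Om (space Om - good c0)) \<le> ennreal (c * real (card W))"
proof -
  have "2 * exp (- c0 / 2) = 1 / (16 * (real K)\<^sup>2)"
    using K1 by (simp add: c0_def exp_minus field_simps)
  moreover have "(1 / (16 * (real K)\<^sup>2)) ^ n \<le> (1 / (16 * (real K)\<^sup>2)) ^ 1"
  proof (rule power_decreasing)
    have "1 \<le> (real K)\<^sup>2" using K1 by simp
    then show "1 / (16 * (real K)\<^sup>2) \<le> 1" by (simp add: divide_simps)
  qed (use n1 in auto)
  ultimately have "real K * (2 * exp (- c0 / 2)) ^ n \<le> real K * (1 / (16 * (real K)\<^sup>2))"
    by (intro mult_left_mono) auto
  also have "\<dots> = c" using K1 by (simp add: c_def power2_eq_square)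
  finally have "emeasure Om (space Om - good c0) \<le> ennreal c"
    using emeasure_not_good[of c0] by (meson ennreal_leI order_trans)
  then have "(\<Sum>w\<in>W. emeasure Om (space Om - good c0)) \<le> (\<Sum>w\<in>W. ennreal c)"
    by (intro sum_mono)
  also have "\<dots> = ennreal (c * real (card W))"
    using c_pos by (subst sum_ennreal) (auto simp: mult.commute)
  finally show ?thesis .
qed

text \<open>The threshold at which the bound of \<open>aligned_images\<close> equals the allotted
  \<open>c * card W\<close>; it is the price, in likelihood, of one hop between receivers.\<close>

definition Lam :: "real \<Rightarrow> nat \<Rightarrow> real" where
  "Lam D J = (ais_const c0 * (real J + 1) * D\<^sup>2) ^ n / c"

lemma Lam_pos: "D \<ge> 1 \<Longrightarrow> Lam D J > 0"
  unfolding Lam_def using ais_const_pos[of c0] c_pos by (intro divide_pos_pos zero_less_power mult_pos_pos) auto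

lemma sum_aligned_images:
  assumes k: "ka < K" "kb < K" "ka \<noteq> kb" and I: "I \<subseteq> {..<K}" "I \<noteq> {}" and r: "equivp r"
    and D: "D \<ge> 1" and R: "R \<ge> 1"
    and aI: "\<And>i. i \<in> I \<Longrightarrow> a ka i \<le> D * a kb i" and aN: "\<And>i. i < K \<Longrightarrow> i \<notin> I \<Longrightarrow> a ka i \<le> D"
    and aR: "\<And>i. i < K \<Longrightarrow> a ka i \<le> R" and J: "R\<^sup>2 \<le> 4 ^ J"
  shows "(\<Sum>w\<in>W. emeasure Om {gz \<in> good c0. Lam D J * lik n ka (sg ka (fst gz)) W r w (snd gz) < lik_on kb I r w (fst gz) (snd gz)})
     \<le> ennreal (c * real (card W))"
proof -
  have "R\<^sup>2 \<le> 4 ^ J * 1" using J by simp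
  also have "\<dots> \<le> 4 ^ J * D\<^sup>2" using D by (intro mult_left_mono) auto
  finally have "(\<Sum>w\<in>W. emeasure Om {gz \<in> good c0. Lam D J * lik n ka (sg ka (fst gz)) W r w (snd gz) < lik_on kb I r w (fst gz) (snd gz)})
     \<le> ennreal ((ais_const c0 * (real J + 1) * D\<^sup>2) ^ n * real (card W) / Lam D J)"
    by (intro aligned_images[where R = R] k I r D R aI aN aR Lam_pos)
  also have "(ais_const c0 * (real J + 1) * D\<^sup>2) ^ n * real (card W) / Lam D J = c * real (card W)"
  proof -
    define X where "X = (ais_const c0 * (real J + 1) * D\<^sup>2) ^ n"
    have "X > 0" unfolding X_def using ais_const_pos[of c0] D by (intro zero_less_power mult_pos_pos) auto
    then show ?thesis using c_pos unfolding Lam_def X_def[symmetric] by (simp add: field_simps)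
  qed
  finally show ?thesis .
qed

lemma sets_aligned_images:
  assumes "ka < K" "kb < K" "I \<subseteq> {..<K}"
  shows "{gz \<in> good c0. \<Lambda> * lik n ka (sg ka (fst gz)) W r w (snd gz) < lik_on kb I r w (fst gz) (snd gz)} \<in> sets Om"
proof -
  have [measurable]: "(\<lambda>gz. lik n ka (sg ka (fst gz)) W r w (snd gz)) \<in> borel_measurable Om"
    using assms by (intro measurable_lik measurable_fst_Om measurable_snd_Om) auto
  have [measurable]: "(\<lambda>gz. lik_on kb I r w (fst gz) (snd gz)) \<in> borel_measurable Om"
    using assms by (intro measurable_lik_on measurable_fst_Om measurable_snd_Om) auto
  have "{gz \<in> good c0. \<Lambda> * lik n ka (sg ka (fst gz)) W r w (snd gz) < lik_on kb I r w (fst gz) (snd gz)}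
    = good c0 \<inter> {gz \<in> space Om. \<Lambda> * lik n ka (sg ka (fst gz)) W r w (snd gz) < lik_on kb I r w (fst gz) (snd gz)}"
    by (auto simp: good_def)
  also have "\<dots> \<in> sets Om" by (intro sets.Int good_sets) measurable
  finally show ?thesis .
qed

lemma sets_unconfident:
  assumes "k < K" "S \<in> sets Om"
  shows "{gz \<in> S. lik n k (sg k (fst gz)) W r1 w (snd gz) < c' * lik n k (sg k (fst gz)) W r w (snd gz)} \<in> sets Om"
proof -
  have [measurable]: "(\<lambda>gz. lik n k (sg k (fst gz)) W r' w (snd gz)) \<in> borel_measurable Om" for r'
    using assms by (intro measurable_lik measurable_fst_Om measurable_snd_Om) auto
  have "{gz \<in> S. lik n k (sg k (fst gz)) W r1 w (snd gz) < c' * lik n k (sg k (fst gz)) W r w (snd gz)}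
    = S \<inter> {gz \<in> space Om. lik n k (sg k (fst gz)) W r1 w (snd gz) < c' * lik n k (sg k (fst gz)) W r w (snd gz)}"
    using assms(2) by (auto dest: sets.sets_into_space)
  also have "\<dots> \<in> sets Om" by (intro sets.Int assms(2)) measurable
  finally show ?thesis .
qed

lemma sets_atypical:
  assumes k: "k < K"
  shows "{gz \<in> space Om. lik n k (sg k (fst gz)) W r w (snd gz)
       < c' * (x * (\<Prod>t<n. exp (- (cmod (snd gz (t, k) + sg k (fst gz) w t - 0))\<^sup>2 / R\<^sup>2) / (pi * R\<^sup>2)))} \<in> sets Om"
proof -
  have [measurable]: "(\<lambda>gz. lik n k (sg k (fst gz)) W r w (snd gz)) \<in> borel_measurable Om"
    using k by (intro measurable_lik measurable_fst_Om measurable_snd_Om) auto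
  have [measurable]: "(\<lambda>gz. snd gz (t, k)) \<in> borel_measurable Om" if "t \<in> {..<n}" for t
    using that k by (intro measurable_snd_Om) auto
  have [measurable]: "(\<lambda>gz. sg k (fst gz) w t) \<in> borel_measurable Om" for w t
    using k by (intro measurable_sg measurable_fst_Om) auto
  show ?thesis by measurable
qed

text \<open>Messages are revealed one at a time along \<open>ks\<close>. In the proof,
  \<open>q gz w l l'\<close> is the likelihood at receiver \<open>ks ! l\<close> of the tuples that
  agree with \<open>w\<close> outside \<open>ks\<close> and on the first \<open>l'\<close> messages
  of \<open>ks\<close>. Learning the own message costs a receiver only the factor \<open>c\<close>
  (\<open>corr\<close>), and passing to the next receiver with the same messages known costs
  \<open>Lam (D l) J\<close> (\<open>align\<close>). The first likelihood is at least the number of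
  messages over a volume; at the end all messages are known and a single likelihood, at most 1, is
  left.\<close>

lemma broadcast_chain:
  assumes ks: "ks \<noteq> []" "distinct ks" "set ks \<subseteq> {..<K}"
    and D: "\<And>l. D l \<ge> 1"
    and aD: "\<And>l i. Suc l < length ks \<Longrightarrow> i < K \<Longrightarrow> a (ks ! Suc l) i \<le> D l * a (ks ! l) i"
    and R: "R \<ge> 1" and aR: "\<And>k i. k < K \<Longrightarrow> i < K \<Longrightarrow> a k i \<le> R" and J: "R\<^sup>2 \<le> 4 ^ J"
    and R0: "R0 \<ge> 1" and aR0: "\<And>i. i < K \<Longrightarrow> a (ks ! 0) i \<le> R0"
  shows "real (\<Prod>k\<in>set ks. M k) \<le> (1 / c) ^ (length ks + 1) * (\<Prod>l<length ks - 1. Lam (D l) J)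
     * (pi * R0\<^sup>2 * exp (2 * c0 + 2 * dmax\<^sup>2 * (real K)\<^sup>2)) ^ n"
proof -
  define m where "m = length ks"
  have m1: "m \<ge> 1" using ks(1) by (simp add: m_def Suc_le_eq)
  have mK: "m \<le> K" using ks card_mono[of "{..<K}" "set ks"] by (simp add: m_def distinct_card)
  have ksK: "ks ! l < K" if "l < m" for l using ks(3) that nth_mem unfolding m_def by blast
  define Jl where "Jl l = ({..<K} - set ks) \<union> set (take l ks)" for l
  have JS: "agree (Jl (Suc l)) = (\<lambda>w w'. agree (Jl l) w w' \<and> w (ks ! l) = w' (ks ! l))" if "l < m" for l
  proof -
    have "Jl (Suc l) = insert (ks ! l) (Jl l)"
      using that by (auto simp: Jl_def m_def take_Suc_conv_app_nth)
    then show ?thesis by (simp only: agree_insert)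
  qed
  obtain S where SS: "success_sets S" using ex_success_sets by blast
  have S: "\<And>w. w \<in> W \<Longrightarrow> S w \<in> sets Om"
    and Sdec: "\<And>w gz k. w \<in> W \<Longrightarrow> gz \<in> S w \<Longrightarrow> k < K \<Longrightarrow> dec k (\<lambda>t. if t < n then sg k (fst gz) w t + snd gz (t, k) else 0) (fst gz) = w k"
    and S1: "ennreal (real (card W) / 2) \<le> (\<Sum>w\<in>W. emeasure Om (S w))"
    using SS unfolding success_sets_def by auto
  define q where "q gz w l l' = lik n (ks ! l) (sg (ks ! l) (fst gz)) W (agree (Jl l')) w (snd gz)" for gz w l l'
  define \<psi> where "\<psi> gz w = (\<Prod>t<n. exp (- (cmod (snd gz (t, ks ! 0) + sg (ks ! 0) (fst gz) w t - 0))\<^sup>2 / R0\<^sup>2) / (pi * R0\<^sup>2))" for gz w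
  define cl where "cl w = real (card {w' \<in> W. agree (Jl 0) w w'})" for w
  define Bg where "Bg w = space Om - good c0" for w :: "nat \<Rightarrow> nat"
  define Br where "Br w = {gz \<in> space Om. q gz w 0 0 < c * (cl w * \<psi> gz w)}" for w
  define Bc where "Bc l w = {gz \<in> S w. q gz w l (Suc l) < c * q gz w l l}" for l w
  define Ba where "Ba l w = {gz \<in> good c0. Lam (D l) J * q gz w (Suc l) (Suc l) < lik_on (ks ! l) {..<K} (agree (Jl (Suc l))) w (fst gz) (snd gz)}" for l w
  \<comment> \<open>One typicality event, one start, \<open>m\<close> decodings and
    \<open>m - 1\<close> hops, which makes \<open>2 * m + 1\<close> bad events.\<close>
  define Bs where "Bs = [Bg, Br] @ map Bc [0..<m] @ map Ba [0..<m - 1]"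
  have BsE: "B = Bg \<or> B = Br \<or> (\<exists>l<m. B = Bc l) \<or> (\<exists>l<m - 1. B = Ba l)" if "B \<in> set Bs" for B
  proof -
    have "B \<in> {Bg, Br} \<union> (Bc ` {..<m} \<union> Ba ` {..<m - 1})"
      using that unfolding Bs_def set_append set_map set_upt list.set(2) list.set(1) atLeast0LessThan .
    then show ?thesis by blast
  qed
  have "\<exists>w\<in>W. \<exists>gz\<in>S w. \<forall>B\<in>set Bs. gz \<notin> B w"
  proof (rule ex_avoiding_bad_events[OF W_nonempty S S1])
    show "B w \<in> sets Om" if Bin: "B \<in> set Bs" and win: "w \<in> W" for B w
    proof -
      consider "B = Bg" | "B = Br" | l where "l < m" "B = Bc l" | l where "l < m - 1" "B = Ba l"
        using BsE[OF Bin] by blast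
      then show ?thesis
      proof cases
        case 1
        show ?thesis unfolding 1 Bg_def by (intro sets.compl_sets good_sets)
      next
        case 2
        show ?thesis unfolding 2 Br_def q_def \<psi>_def using m1 by (intro sets_atypical ksK) simp
      next
        case 3
        show ?thesis unfolding 3 Bc_def q_def by (intro sets_unconfident ksK 3 S win)
      next
        case 4
        then have "ks ! Suc l < K" "ks ! l < K" by (auto intro!: ksK)
        then show ?thesis unfolding 4 Ba_def q_def by (intro sets_aligned_images) auto
      qed
    qed
    show "real (length Bs) * c < 1 / 2"
    proof -
      have "length Bs = 2 * m + 1" using m1 by (simp add: Bs_def)
      then have "real (length Bs) * c \<le> (3 * real K) * c"
        using mK m1 K1 c_pos by (intro mult_right_mono) auto
      also have "\<dots> < 1 / 2" using K1 by (simp add: c_def)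
      finally show ?thesis .
    qed
    fix B assume "B \<in> set Bs"
    then consider "B = Bg" | "B = Br" | l where "l < m" "B = Bc l" | l where "l < m - 1" "B = Ba l"
      using BsE by blast
    then show "(\<Sum>w\<in>W. emeasure Om (B w)) \<le> ennreal (c * real (card W))"
    proof cases
      case 1
      then show ?thesis using sum_not_good by (simp add: Bg_def)
    next
      case 2
      show ?thesis
        unfolding 2 Br_def q_def \<psi>_def cl_def using m1 c_pos R0 by (intro atypical_output ksK equivp_agree) auto
    next
      case 3
      have "(\<Sum>w\<in>W. emeasure Om {gz \<in> S w. lik n (ks ! l) (sg (ks ! l) (fst gz)) W (\<lambda>w w'. agree (Jl l) w w' \<and> w (ks ! l) = w' (ks ! l)) w (snd gz)
         < c * lik n (ks ! l) (sg (ks ! l) (fst gz)) W (agree (Jl l)) w (snd gz)}) \<le> ennreal (c * real (card W))"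
        using c_pos ksK[OF 3(1)] Sdec by (intro unconfident_decoding[where lab = "\<lambda>w. w (ks ! l)" and dec = "dec (ks ! l)"] equivp_agree S) auto
      then show ?thesis unfolding 3(2) Bc_def q_def JS[OF 3(1)] .
    next
      case 4
      then have l: "l < m" "Suc l < m" by auto
      have "ks ! Suc l \<noteq> ks ! l" using l ks(2) by (simp add: nth_eq_iff_index_eq m_def)
      then have "(\<Sum>w\<in>W. emeasure Om {gz \<in> good c0. Lam (D l) J * lik n (ks ! Suc l) (sg (ks ! Suc l) (fst gz)) W (agree (Jl (Suc l))) w (snd gz)
           < lik_on (ks ! l) {..<K} (agree (Jl (Suc l))) w (fst gz) (snd gz)}) \<le> ennreal (c * real (card W))"
        using l ksK K1 aD aR by (intro sum_aligned_images[where R = R] equivp_agree D R J) (auto simp: m_def lessThan_empty_iff)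
      then show ?thesis unfolding 4(2) Ba_def q_def .
    qed
  qed (use c_pos in auto)
  then obtain w gz where w: "w \<in> W" and gz: "gz \<in> S w" and nb: "\<And>B. B \<in> set Bs \<Longrightarrow> gz \<notin> B w" by blast
  have sp: "gz \<in> space Om" using gz S[OF w] sets.sets_into_space by blast
  have good: "gz \<in> good c0" using nb[of Bg] sp by (auto simp: Bs_def Bg_def)
  have range: "c * (cl w * \<psi> gz w) \<le> q gz w 0 0" using nb[of Br] sp by (auto simp: Bs_def Br_def)
  have corr: "c * q gz w l l \<le> q gz w l (Suc l)" if "l < m" for l
    using nb[of "Bc l"] that gz by (auto simp: Bs_def Bc_def not_less)
  have align: "q gz w l (Suc l) \<le> Lam (D l) J * q gz w (Suc l) (Suc l)" if "l < m - 1" for l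
  proof -
    have "Ba l \<in> set Bs" using that by (simp add: Bs_def)
    from nb[OF this] good have "lik_on (ks ! l) {..<K} (agree (Jl (Suc l))) w (fst gz) (snd gz) \<le> Lam (D l) J * q gz w (Suc l) (Suc l)"
      by (auto simp: Ba_def not_less)
    then show ?thesis by (simp add: lik_on_UNIV q_def)
  qed
  have chain: "c * (cl w * \<psi> gz w) \<le> (1 / c) ^ l * (\<Prod>j<l. Lam (D j) J) * q gz w l l" if "l < m" for l
    using that
  proof (induction l)
    case 0
    then show ?case using range by simp
  next
    case (Suc l)
    have "c * q gz w l l \<le> Lam (D l) J * q gz w (Suc l) (Suc l)"
    proof -
      have "l < m" "l < m - 1" using Suc.prems by auto
      then show ?thesis using corr[of l] align[of l] by linarith
    qed
    then have "q gz w l l \<le> (1 / c) * (Lam (D l) J * q gz w (Suc l) (Suc l))"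
      using c_pos by (simp add: field_simps)
    then have "(1 / c) ^ l * (\<Prod>j<l. Lam (D j) J) * q gz w l l \<le> (1 / c) ^ l * (\<Prod>j<l. Lam (D j) J) * ((1 / c) * (Lam (D l) J * q gz w (Suc l) (Suc l)))"
      using c_pos Lam_pos[OF D] by (intro mult_left_mono mult_nonneg_nonneg prod_nonneg) (auto intro: less_imp_le)
    then show ?case using Suc by (simp add: mult_ac)
  qed
  have last: "q gz w (m - 1) (m - 1) \<le> 1 / c"
  proof -
    have "Jl m = {..<K}" using ks(3) by (auto simp: Jl_def m_def)
    moreover have "w' = w" if "w' \<in> W" "agree {..<K} w w'" for w'
    proof -
      have "w' j = w j" for j
        using that w unfolding agree_def msg_set_def by (cases "j < K") (auto simp: PiE_def extensional_def)
      then show ?thesis by blast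
    qed
    ultimately have "{w' \<in> W. agree (Jl m) w w'} = {w}"
      using w by (auto simp: agree_def)
    then have "q gz w (m - 1) m = (\<Prod>t<n. gam (snd gz (t, ks ! (m - 1))))"
      by (simp add: q_def lik_def)
    also have "\<dots> \<le> 1" by (intro prod_le_1) (auto simp: gam_le_1)
    finally have "c * q gz w (m - 1) (m - 1) \<le> 1" using corr[of "m - 1"] m1 by simp
    then show ?thesis using c_pos by (simp add: field_simps)
  qed
  define X where "X = pi * R0\<^sup>2 * exp (2 * c0 + 2 * dmax\<^sup>2 * (real K)\<^sup>2)"
  have X0: "X > 0" using R0 by (simp add: X_def)
  have P0: "(1 / c) ^ (m - 1) * (\<Prod>j<m - 1. Lam (D j) J) \<ge> 0"
    using c_pos Lam_pos[OF D] by (intro mult_nonneg_nonneg prod_nonneg) (auto intro: less_imp_le)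
  have psi: "(1 / X) ^ n \<le> \<psi> gz w"
    unfolding X_def \<psi>_def using m1 aR0 by (intro output_density_ge ksK w good R0) auto
  have "real (\<Prod>k\<in>set ks. M k) \<le> cl w"
    unfolding cl_def Jl_def using card_class_ge[OF w ks(3)] by (simp del: of_nat_prod)
  then have "c * (real (\<Prod>k\<in>set ks. M k) * (1 / X) ^ n) \<le> c * (cl w * \<psi> gz w)"
    using c_pos psi X0 by (intro mult_left_mono mult_mono) (auto simp: cl_def)
  also have "\<dots> \<le> (1 / c) ^ (m - 1) * (\<Prod>j<m - 1. Lam (D j) J) * q gz w (m - 1) (m - 1)"
    using chain[of "m - 1"] m1 by simp
  also have "\<dots> \<le> (1 / c) ^ (m - 1) * (\<Prod>j<m - 1. Lam (D j) J) * (1 / c)"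
    using last P0 by (intro mult_left_mono) auto
  finally have "c * real (\<Prod>k\<in>set ks. M k) \<le> (1 / c) ^ (m - 1) * (\<Prod>j<m - 1. Lam (D j) J) * (1 / c) * X ^ n"
    using X0 by (simp add: power_divide field_simps)
  then have "real (\<Prod>k\<in>set ks. M k) \<le> (1 / c) * ((1 / c) ^ (m - 1) * (\<Prod>j<m - 1. Lam (D j) J) * (1 / c) * X ^ n)"
    using c_pos by (simp add: field_simps)
  also have "\<dots> = (1 / c) ^ (m + 1) * (\<Prod>j<m - 1. Lam (D j) J) * X ^ n"
  proof -
    have "(1 / c) ^ (m + 1) = (1 / c) * ((1 / c) ^ (m - 1) * (1 / c))"
      using m1 by (cases m) auto
    then show ?thesis by (simp only: mult_ac)
  qed
  finally show ?thesis by (simp add: m_def X_def)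
qed

text \<open>In the interference channel the own message moves only the own input, which
  \<open>lik_on\<close> ignores here. So each tuple with the true own message has \<open>M k\<close>
  variants with the same summand.\<close>

lemma lik_on_own_message:
  assumes IC: "\<And>w w' i. w \<in> W \<Longrightarrow> w' \<in> W \<Longrightarrow> i < K \<Longrightarrow> w i = w' i \<Longrightarrow> E w i = E w' i"
    and k: "k < K" and w: "w \<in> W"
  shows "real (M k) * lik n k (sg k g) W (\<lambda>w w'. agree {} w w' \<and> w k = w' k) w z \<le> lik_on k ({..<K} - {k}) (agree {}) w g z"
proof -
  define V where "V = {w' \<in> W. w k = w' k}"
  define f where "f w' = (\<Prod>t<n. gam (z (t, k) - cross k ({..<K} - {k}) g w w' t))" for w'
  have f0: "f w' \<ge> 0" for w' unfolding f_def by (intro prod_nonneg) simp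
  have finV: "finite V" unfolding V_def using finite_msg_set by simp
  have "lik n k (sg k g) W (\<lambda>w w'. agree {} w w' \<and> w k = w' k) w z = sum f V"
  proof -
    have "z (t, k) + sg k g w t - sg k g w' t = z (t, k) - cross k ({..<K} - {k}) g w w' t" if "w' \<in> V" for w' t
    proof -
      have "E w' k = E w k" using IC[of w' w k] that w k by (simp add: V_def)
      then have "cross k ({..<K} - {k}) g w w' t = cross k {..<K} g w w' t"
        using k by (simp add: cross_def sum.remove[of "{..<K}" k])
      moreover have "cross k {..<K} g w w' t = sg k g w' t - sg k g w t"
        by (simp add: cross_def sg_def algebra_simps sum_subtractf)
      ultimately show ?thesis by simp
    qed
    note e = this
    show ?thesis unfolding lik_def
    proof (rule sum.cong)
      fix w' assume "w' \<in> V"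
      then show "(\<Prod>t<n. gam (z (t, k) + sg k g w t - sg k g w' t)) = f w'"
        unfolding f_def by (simp only: e)
    qed (auto simp: agree_def V_def)
  qed
  moreover have "real (M k) * sum f V \<le> sum f W"
  proof -
    have eq: "f (w'(k := v)) = f w'" if "w' \<in> V" "v < M k" for w' v
    proof -
      have "w'(k := v) \<in> W" using that k by (auto simp: V_def msg_set_def PiE_def Pi_def extensional_def)
      then have "E (w'(k := v)) i = E w' i" if "i < K" "i \<noteq> k" for i
        using IC[of "w'(k := v)" w' i] \<open>w' \<in> V\<close> that by (simp add: V_def)
      then show ?thesis unfolding f_def cross_def by (auto intro!: prod.cong arg_cong[where f = gam] sum.cong)
    qed
    have "real (M k) * sum f V = (\<Sum>(v, w')\<in>{..<M k} \<times> V. f w')"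
      by (simp add: sum.cartesian_product[symmetric])
    also have "\<dots> = (\<Sum>p\<in>{..<M k} \<times> V. f ((snd p)(k := fst p)))"
      using eq by (intro sum.cong) auto
    also have "\<dots> = sum f ((\<lambda>p. (snd p)(k := fst p)) ` ({..<M k} \<times> V))"
    proof (rule sum.reindex[symmetric, unfolded o_def])
      show "inj_on (\<lambda>p. (snd p)(k := fst p)) ({..<M k} \<times> V)"
      proof (rule inj_onI)
        fix p p' assume p: "p \<in> {..<M k} \<times> V" "p' \<in> {..<M k} \<times> V" and e: "(snd p)(k := fst p) = (snd p')(k := fst p')"
        have "fst p = fst p'" using fun_cong[OF e, of k] by simp
        moreover have "snd p j = snd p' j" for j
          using fun_cong[OF e, of j] p by (cases "j = k") (auto simp: V_def)
        ultimately show "p = p'" by (simp add: prod_eq_iff fun_eq_iff)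
      qed
    qed
    also have "\<dots> \<le> sum f W"
      using k f0 finite_msg_set by (intro sum_mono2) (auto simp: V_def msg_set_def PiE_def Pi_def extensional_def)
    finally show ?thesis .
  qed
  moreover have "lik_on k ({..<K} - {k}) (agree {}) w g z = sum f W"
    by (simp add: lik_on_def f_def agree_def)
  ultimately show ?thesis by simp
qed

text \<open>Each receiver \<open>k\<close> removes its decoded codeword, which gains the factor
  \<open>M k\<close>, and the interference that remains is compared with the full output of receiver
  \<open>pr k\<close>. All likelihoods \<open>T\<close> belong to the class where no message is
  known, so the inequalities close up: multiplied over the permutation \<open>pr\<close>, the
  \<open>T\<close> cancel and no starting term is left.\<close>

lemma interference_chain:
  assumes IC: "\<And>w w' i. w \<in> W \<Longrightarrow> w' \<in> W \<Longrightarrow> i < K \<Longrightarrow> w i = w' i \<Longrightarrow> E w i = E w' i"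
    and K2: "K \<ge> 2" and D: "D \<ge> 1"
    and pr: "bij_betw pr {..<K} {..<K}" "\<And>k. k < K \<Longrightarrow> pr k \<noteq> k"
    and aD: "\<And>k i. k < K \<Longrightarrow> i < K \<Longrightarrow> i \<noteq> k \<Longrightarrow> a (pr k) i \<le> D * a k i" and aN: "\<And>k. k < K \<Longrightarrow> a (pr k) k \<le> D"
    and R: "R \<ge> 1" and aR: "\<And>k i. k < K \<Longrightarrow> i < K \<Longrightarrow> a k i \<le> R" and J: "R\<^sup>2 \<le> 4 ^ J"
  shows "real (\<Prod>k<K. M k) \<le> (Lam D J / c) ^ K"
proof -
  have prK: "pr k < K" if "k < K" for k using pr(1) that by (auto simp: bij_betw_def)
  obtain S where SS: "success_sets S" using ex_success_sets by blast
  have S: "\<And>w. w \<in> W \<Longrightarrow> S w \<in> sets Om"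
    and Sdec: "\<And>w gz k. w \<in> W \<Longrightarrow> gz \<in> S w \<Longrightarrow> k < K \<Longrightarrow> dec k (\<lambda>t. if t < n then sg k (fst gz) w t + snd gz (t, k) else 0) (fst gz) = w k"
    and S1: "ennreal (real (card W) / 2) \<le> (\<Sum>w\<in>W. emeasure Om (S w))"
    using SS unfolding success_sets_def by auto
  define T where "T gz w k = lik n k (sg k (fst gz)) W (agree {}) w (snd gz)" for gz w k
  define q where "q gz w k = lik n k (sg k (fst gz)) W (\<lambda>w w'. agree {} w w' \<and> w k = w' k) w (snd gz)" for gz w k
  define Bg where "Bg w = space Om - good c0" for w :: "nat \<Rightarrow> nat"
  define Bc where "Bc k w = {gz \<in> S w. q gz w k < c * T gz w k}" for k w
  define Ba where "Ba k w = {gz \<in> good c0. Lam D J * T gz w (pr k) < lik_on k ({..<K} - {k}) (agree {}) w (fst gz) (snd gz)}" for k w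
  define Bs where "Bs = [Bg] @ map Bc [0..<K] @ map Ba [0..<K]"
  have "\<exists>w\<in>W. \<exists>gz\<in>S w. \<forall>B\<in>set Bs. gz \<notin> B w"
  proof (rule ex_avoiding_bad_events[OF W_nonempty S S1])
    show "B w \<in> sets Om" if "B \<in> set Bs" "w \<in> W" for B w
      using that prK unfolding Bs_def
      by (auto simp: Bg_def Bc_def Ba_def q_def T_def intro!: sets.compl_sets good_sets sets_unconfident S sets_aligned_images)
    show "real (length Bs) * c < 1 / 2"
      using K1 by (simp add: Bs_def c_def field_simps)
    fix B assume "B \<in> set Bs"
    then consider "B = Bg" | k where "k < K" "B = Bc k" | k where "k < K" "B = Ba k"
      by (auto simp: Bs_def)
    then show "(\<Sum>w\<in>W. emeasure Om (B w)) \<le> ennreal (c * real (card W))"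
    proof cases
      case 1
      then show ?thesis using sum_not_good by (simp add: Bg_def)
    next
      case 2
      have "(\<Sum>w\<in>W. emeasure Om {gz \<in> S w. lik n k (sg k (fst gz)) W (\<lambda>w w'. agree {} w w' \<and> w k = w' k) w (snd gz)
         < c * lik n k (sg k (fst gz)) W (agree {}) w (snd gz)}) \<le> ennreal (c * real (card W))"
        using c_pos 2(1) Sdec by (intro unconfident_decoding[where lab = "\<lambda>w. w k" and dec = "dec k"] equivp_agree S) auto
      then show ?thesis using 2 by (simp add: Bc_def q_def T_def)
    next
      case 3
      have "(if k = 0 then 1 else 0) \<in> {..<K} - {k}" using K2 3(1) by auto
      then have "{..<K} - {k} \<noteq> {}" by blast
      then have "(\<Sum>w\<in>W. emeasure Om {gz \<in> good c0. Lam D J * lik n (pr k) (sg (pr k) (fst gz)) W (agree {}) w (snd gz)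
           < lik_on k ({..<K} - {k}) (agree {}) w (fst gz) (snd gz)}) \<le> ennreal (c * real (card W))"
        using 3(1) prK pr(2) aD aN aR by (intro sum_aligned_images[where R = R] equivp_agree D R J) auto
      then show ?thesis using 3 by (simp add: Ba_def T_def)
    qed
  qed (use c_pos in auto)
  then obtain w gz where w: "w \<in> W" and gz: "gz \<in> S w" and nb: "\<And>B. B \<in> set Bs \<Longrightarrow> gz \<notin> B w" by blast
  have sp: "gz \<in> space Om" using gz S[OF w] sets.sets_into_space by blast
  have good: "gz \<in> good c0" using nb[of Bg] sp by (auto simp: Bs_def Bg_def)
  have Tpos: "T gz w k > 0" for k
    unfolding T_def using w finite_msg_set by (intro lik_pos) (auto simp: agree_def)
  have step: "real (M k) * T gz w k \<le> (Lam D J / c) * T gz w (pr k)" if k: "k < K" for k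
  proof -
    have "c * T gz w k \<le> q gz w k"
      using nb[of "Bc k"] k gz by (auto simp: Bs_def Bc_def not_less)
    then have "real (M k) * (c * T gz w k) \<le> real (M k) * q gz w k" by (intro mult_left_mono) auto
    also have "\<dots> \<le> lik_on k ({..<K} - {k}) (agree {}) w (fst gz) (snd gz)"
      unfolding q_def using IC k w by (intro lik_on_own_message)
    also have "\<dots> \<le> Lam D J * T gz w (pr k)"
      using nb[of "Ba k"] k good by (auto simp: Bs_def Ba_def not_less)
    finally show ?thesis using c_pos by (simp add: field_simps)
  qed
  have "(\<Prod>k<K. real (M k)) * (\<Prod>k<K. T gz w k) = (\<Prod>k<K. real (M k) * T gz w k)"
    by (simp add: prod.distrib)
  also have "\<dots> \<le> (\<Prod>k<K. (Lam D J / c) * T gz w (pr k))"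
    using step Tpos by (intro prod_mono conjI mult_nonneg_nonneg) (auto intro: less_imp_le)
  also have "\<dots> = (Lam D J / c) ^ K * (\<Prod>k<K. T gz w (pr k))"
    by (simp only: prod.distrib prod_constant card_lessThan)
  also have "(\<Prod>k<K. T gz w (pr k)) = (\<Prod>k<K. T gz w k)"
    by (rule prod.reindex_bij_betw[OF pr(1)])
  finally show ?thesis
    using prod_pos[of "{..<K}" "T gz w"] Tpos by (simp add: mult_le_cancel_right)
qed

end

subsection \<open>Converse bounds on GDoF tuples\<close>

lemma sqrt_powr_square:
  fixes P e :: real
  assumes "P > 0"
  shows "(sqrt P powr e)\<^sup>2 = P powr e"
  using assms by (simp add: powr_half_sqrt[symmetric] powr_powr power2_eq_square powr_add[symmetric])

text \<open>The part of \<open>admissible_channel\<close> that concerns a single law, with the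
  constants exposed so that they stay the same while \<open>P\<close> varies.\<close>

definition admissible_law :: "nat \<Rightarrow> real \<Rightarrow> real \<Rightarrow> real \<Rightarrow> (nat \<Rightarrow> nat \<Rightarrow> nat \<Rightarrow> complex) measure \<Rightarrow> bool" where
  "admissible_law K fmax dmin dmax G \<longleftrightarrow> prob_space G \<and>
       (\<forall>t k i. k < K \<longrightarrow> i < K \<longrightarrow> (\<lambda>g. g t k i) \<in> borel_measurable G) \<and>
       (\<forall>t k i. k < K \<longrightarrow> i < K \<longrightarrow>
          (AE g in G. dmin \<le> cmod (g t k i) \<and> cmod (g t k i) \<le> dmax)) \<and>
       (\<forall>A B. finite A \<and> finite B \<and> A \<subseteq> coords K \<and> B \<subseteq> coords K \<and> A \<inter> B = {} \<longrightarrow>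
          (\<exists>f h. f \<in> borel_measurable (PiM (A \<union> B) (\<lambda>_. (lborel :: complex measure))) \<and>
                 h \<in> borel_measurable (PiM B (\<lambda>_. (lborel :: complex measure))) \<and>
                 chan_marg G (A \<union> B) = density (PiM (A \<union> B) (\<lambda>_. lborel)) f \<and>
                 chan_marg G B = density (PiM B (\<lambda>_. lborel)) h \<and>
                 (AE x in PiM (A \<union> B) (\<lambda>_. lborel).
                    f x \<le> ennreal (fmax ^ card A) * h (restrict x B))))"

lemma admissible_channelE:
  assumes "admissible_channel K Gm"
  obtains fmax dmin dmax where "fmax > 0" "dmin > 0" "dmin \<le> dmax" "\<And>P. P > 1 \<Longrightarrow> admissible_law K fmax dmin dmax (Gm P)"
proof -
  have "\<exists>fmax dmin dmax. fmax > 0 \<and> dmin > 0 \<and> dmin \<le> dmax \<and> (\<forall>P>1. admissible_law K fmax dmin dmax (Gm P))"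
    using assms unfolding admissible_channel_def admissible_law_def .
  then show ?thesis using that by blast
qed

text \<open>The converse is not asymptotic in the block length: success probability
  \<open>3 / 4\<close> at one positive block length is enough, so the definition is used with
  \<open>1 / 4\<close> for the error.\<close>

lemma achievable_code:
  assumes adm: "admissible_law K fmax dmin dmax G"
    and pos: "fmax > 0" "dmin > 0" "dmin \<le> dmax" and K: "K \<ge> 1"
    and ach: "achievable is_bc K \<alpha> G P R"
  shows "\<exists>n M E dec. coded_msgs K n G fmax dmax (\<lambda>k i. sqrt P powr \<alpha> k i) M E dec \<and>
    (\<forall>k<K. 2 powr (real n * R k) \<le> real (M k)) \<and>
    (\<not> is_bc \<longrightarrow> (\<forall>w\<in>msg_set K M. \<forall>w'\<in>msg_set K M. \<forall>i<K. w i = w' i \<longrightarrow> E w i = E w' i))"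
proof -
  from ach obtain N where N: "\<forall>n\<ge>N. \<exists>M E dec.
        (\<forall>k<K. 2 powr (real n * R k) \<le> real (M k)) \<and>
        (\<forall>w\<in>msg_set K M. \<forall>i<K. (\<Sum>t<n. (cmod (E w i t))\<^sup>2) \<le> real n) \<and>
        (\<not> is_bc \<longrightarrow> (\<forall>w\<in>msg_set K M. \<forall>w'\<in>msg_set K M. \<forall>i<K. w i = w' i \<longrightarrow> E w i = E w' i)) \<and>
        ennreal (1 - 1 / 4) \<le> success_prob K \<alpha> P G n M E dec"
    unfolding achievable_def by (auto dest: spec[of _ "1 / 4"])
  define n where "n = max N 1"
  obtain M E dec where c: "\<forall>k<K. 2 powr (real n * R k) \<le> real (M k)"
      "\<forall>w\<in>msg_set K M. \<forall>i<K. (\<Sum>t<n. (cmod (E w i t))\<^sup>2) \<le> real n"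
      "\<not> is_bc \<longrightarrow> (\<forall>w\<in>msg_set K M. \<forall>w'\<in>msg_set K M. \<forall>i<K. w i = w' i \<longrightarrow> E w i = E w' i)"
      "ennreal (1 - 1 / 4) \<le> success_prob K \<alpha> P G n M E dec"
    using N[rule_format, of n] by (auto simp: n_def)
  interpret coded_channel K n G fmax dmax "\<lambda>k i. sqrt P powr \<alpha> k i" "msg_set K M" E
  proof (rule coded_channel.intro, goal_cases)
    case 1
    show ?case using adm by (simp add: admissible_law_def)
  next
    case (2 t k i)
    then show ?case using adm by (simp add: admissible_law_def)
  next
    case (3 t k i)
    then have "AE g in G. dmin \<le> cmod (g t k i) \<and> cmod (g t k i) \<le> dmax" using adm by (simp add: admissible_law_def)
    then show ?case by eventually_elim simp
  next
    case (4 A B)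
    have "finite A \<and> finite B \<and> A \<subseteq> coords K \<and> B \<subseteq> coords K \<and> A \<inter> B = {}" using 4 by simp
    then show ?case
      by (rule adm[unfolded admissible_law_def, THEN conjunct2, THEN conjunct2, THEN conjunct2, THEN spec[of _ A], THEN spec[of _ B], THEN mp])
  next
    case 5
    show ?case by (rule pos)
  next
    case 6
    show ?case using pos by linarith
  next
    case (7 k i)
    show ?case by simp
  next
    case 8
    show ?case by (rule finite_msg_set)
  next
    case (9 w i)
    then show ?case using c(2) by blast
  qed
  have M1: "M k \<ge> 1" if "k < K" for k
  proof -
    have "0 < 2 powr (real n * R k)" by simp
    also have "\<dots> \<le> real (M k)" using c(1) that by blast
    finally show ?thesis by simp
  qed
  have "rx_signal K \<alpha> P n E w g z k = (\<lambda>t. if t < n then sg k g w t + z (t, k) else 0)" for w g z k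
    by (auto simp: fun_eq_iff rx_signal_def sg_def)
  then have "coded_msgs K n G fmax dmax (\<lambda>k i. sqrt P powr \<alpha> k i) M E (\<lambda>k y g. dec k y (restrict_time n g))"
    using c(4) K M1 by unfold_locales (auto simp: n_def success_prob_def)
  with c(1,3) show ?thesis by (intro exI conjI)
qed

text \<open>As \<open>n \<ge> 1\<close> and \<open>c1 \<ge> 1\<close>, a factor that is not an
  \<open>n\<close>-th power can be charged fully to every slot, and no limit in \<open>n\<close> is
  taken.\<close>

lemma rate_le_of_power_bound:
  fixes S c1 Y :: real
  assumes "2 powr (real n * S) \<le> c1 * Y ^ n" "n \<ge> 1" "c1 \<ge> 1" "Y > 0"
  shows "S \<le> log 2 c1 + log 2 Y"
proof -
  have "real n * S = log 2 (2 powr (real n * S))" by simp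
  also have "\<dots> \<le> log 2 (c1 * Y ^ n)" using assms by (subst log_le_cancel_iff) auto
  also have "\<dots> = log 2 c1 + real n * log 2 Y"
    using assms by (simp add: log_mult log_nat_power)
  also have "log 2 c1 \<le> real n * log 2 c1"
    using assms mult_right_mono[of 1 "real n" "log 2 c1"] by simp
  finally have "real n * S \<le> real n * (log 2 c1 + log 2 Y)" by (simp add: algebra_simps)
  then show ?thesis using assms by simp
qed

text \<open>The number of dyadic scales grows like \<open>log P\<close>, so after taking logarithms
  it enters the rates only as \<open>log (log P)\<close>.\<close>

lemma dyadic_exponent:
  fixes P A :: real
  assumes "P > 1" "A \<ge> 0"
  obtains J :: nat where "(sqrt P powr A)\<^sup>2 \<le> 4 ^ J" "real J + 1 \<le> A * log 2 P + 2"
proof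
  define J where "J = nat \<lceil>A * log 2 P\<rceil>"
  have l: "A * log 2 P \<ge> 0" using assms by simp
  have "(sqrt P powr A)\<^sup>2 = P powr A" using assms by (simp add: sqrt_powr_square)
  also have "\<dots> = 2 powr (A * log 2 P)"
    using assms by (simp add: powr_def log_def)
  also have "\<dots> \<le> 2 powr real J" unfolding J_def by (intro powr_mono) (auto simp: real_nat_ceiling_ge)
  also have "\<dots> = 2 ^ J" by (simp add: powr_realpow)
  also have "\<dots> \<le> 4 ^ J" by (intro power_mono) auto
  finally show "(sqrt P powr A)\<^sup>2 \<le> 4 ^ J" .
  have "real J < A * log 2 P + 1" unfolding J_def using l by linarith
  then show "real J + 1 \<le> A * log 2 P + 2" by simp
qed

context coded_msgs
begin

lemma c_le_1: "1 / c \<ge> 1"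
  using K1 by (simp add: c_def)

lemma broadcast_rate:
  assumes P: "P > 1" and a: "a = (\<lambda>k i. sqrt P powr \<alpha> k i)"
    and R: "\<And>k. k < K \<Longrightarrow> 2 powr (real n * R k) \<le> real (M k)"
    and ks: "ks \<noteq> []" "distinct ks" "set ks \<subseteq> {..<K}"
    and e: "\<And>l. e l \<ge> 0" "\<And>l i. Suc l < length ks \<Longrightarrow> i < K \<Longrightarrow> \<alpha> (ks ! Suc l) i - \<alpha> (ks ! l) i \<le> e l"
    and e0: "e0 \<ge> 0" "\<And>i. i < K \<Longrightarrow> \<alpha> (ks ! 0) i \<le> e0"
    and A: "A \<ge> 0" "\<And>k i. k < K \<Longrightarrow> i < K \<Longrightarrow> \<alpha> k i \<le> A"
  shows "(\<Sum>k\<in>set ks. R k) \<le> log 2 ((1 / c) ^ (2 * length ks)) + log 2 (ais_const c0 ^ (length ks - 1) * (pi * exp (2 * c0 + 2 * dmax\<^sup>2 * (real K)\<^sup>2)))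
      + real (length ks) * log 2 (A * log 2 P + 2) + (e0 + (\<Sum>l<length ks - 1. e l)) * log 2 P"
proof -
  define m where "m = length ks"
  have m1: "m \<ge> 1" using ks by (simp add: m_def Suc_le_eq)
  have sP: "sqrt P > 1" using P by simp
  obtain J where J: "(sqrt P powr A)\<^sup>2 \<le> 4 ^ J" "real J + 1 \<le> A * log 2 P + 2"
    using dyadic_exponent[OF P A(1)] by blast
  define X where "X = pi * exp (2 * c0 + 2 * dmax\<^sup>2 * (real K)\<^sup>2)"
  have X0: "X > 0" by (simp add: X_def)
  have ksK: "ks ! l < K" if "l < m" for l using ks(3) that nth_mem unfolding m_def by blast
  have "real (\<Prod>k\<in>set ks. M k) \<le> (1 / c) ^ (length ks + 1) * (\<Prod>l<length ks - 1. Lam (sqrt P powr e l) J)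
     * (pi * (sqrt P powr e0)\<^sup>2 * exp (2 * c0 + 2 * dmax\<^sup>2 * (real K)\<^sup>2)) ^ n"
  proof (rule broadcast_chain[OF ks])
    show "sqrt P powr e l \<ge> 1" for l using sP e(1)[of l] by (intro ge_one_powr_ge_zero) auto
    show "a (ks ! Suc l) i \<le> sqrt P powr e l * a (ks ! l) i" if "Suc l < length ks" "i < K" for l i
      using e(2)[OF that] sP by (simp add: a powr_add[symmetric] powr_mono)
    show "sqrt P powr A \<ge> 1" using sP A(1) by (intro ge_one_powr_ge_zero) auto
    show "sqrt P powr e0 \<ge> 1" using sP e0(1) by (intro ge_one_powr_ge_zero) auto
    show "a k i \<le> sqrt P powr A" if "k < K" "i < K" for k i using A(2)[OF that] sP by (simp add: a)
    show "a (ks ! 0) i \<le> sqrt P powr e0" if "i < K" for i using e0(2)[OF that] sP by (simp add: a)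
  qed (rule J)
  also have "\<dots> = (1 / c) ^ (2 * m) * (ais_const c0 ^ (m - 1) * (real J + 1) ^ (m - 1) * P powr (\<Sum>l<m - 1. e l) * (X * P powr e0)) ^ n"
  proof -
    have "(\<Prod>l<m - 1. Lam (sqrt P powr e l) J) = (1 / c) ^ (m - 1) * (\<Prod>l<m - 1. ais_const c0 * (real J + 1) * P powr e l) ^ n"
      using P by (simp add: Lam_def sqrt_powr_square prod_dividef power_divide prod_power_distrib)
    also have "(\<Prod>l<m - 1. ais_const c0 * (real J + 1) * P powr e l) = ais_const c0 ^ (m - 1) * (real J + 1) ^ (m - 1) * P powr (\<Sum>l<m - 1. e l)"
      using P by (simp add: prod.distrib powr_sum power_mult_distrib)
    finally have "(\<Prod>l<m - 1. Lam (sqrt P powr e l) J) = (1 / c) ^ (m - 1) * (ais_const c0 ^ (m - 1) * (real J + 1) ^ (m - 1) * P powr (\<Sum>l<m - 1. e l)) ^ n" .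
    moreover have "(1 / c) ^ (2 * m) = (1 / c) ^ (m + 1) * (1 / c) ^ (m - 1)"
    proof -
      have "2 * m = (m + 1) + (m - 1)" using m1 by simp
      then show ?thesis by (simp only: power_add)
    qed
    moreover have "pi * (sqrt P powr e0)\<^sup>2 * exp (2 * c0 + 2 * dmax\<^sup>2 * (real K)\<^sup>2) = X * P powr e0"
      using P by (simp add: X_def sqrt_powr_square)
    ultimately show ?thesis unfolding m_def by (simp only: power_mult_distrib mult_ac)
  qed
  finally have *: "real (\<Prod>k\<in>set ks. M k) \<le> (1 / c) ^ (2 * m) * (ais_const c0 ^ (m - 1) * (real J + 1) ^ (m - 1) * P powr (\<Sum>l<m - 1. e l) * (X * P powr e0)) ^ n" .
  have "2 powr (real n * (\<Sum>k\<in>set ks. R k)) = (\<Prod>k\<in>set ks. 2 powr (real n * R k))"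
    by (simp add: sum_distrib_left powr_sum)
  also have "\<dots> \<le> (\<Prod>k\<in>set ks. real (M k))"
    using R ks(3) by (intro prod_mono) auto
  finally have "2 powr (real n * (\<Sum>k\<in>set ks. R k)) \<le> (1 / c) ^ (2 * m) * (ais_const c0 ^ (m - 1) * (real J + 1) ^ (m - 1) * P powr (\<Sum>l<m - 1. e l) * (X * P powr e0)) ^ n"
    using * by simp
  then have "(\<Sum>k\<in>set ks. R k) \<le> log 2 ((1 / c) ^ (2 * m)) + log 2 (ais_const c0 ^ (m - 1) * (real J + 1) ^ (m - 1) * P powr (\<Sum>l<m - 1. e l) * (X * P powr e0))"
    by (rule rate_le_of_power_bound[OF _ n1 one_le_power[OF c_le_1]])
      (use ais_const_pos[of c0] P X0 in \<open>auto intro!: mult_pos_pos zero_less_power\<close>)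
  also have "log 2 (ais_const c0 ^ (m - 1) * (real J + 1) ^ (m - 1) * P powr (\<Sum>l<m - 1. e l) * (X * P powr e0))
     = log 2 (ais_const c0 ^ (m - 1) * X) + real (m - 1) * log 2 (real J + 1) + (e0 + (\<Sum>l<m - 1. e l)) * log 2 P"
    using ais_const_pos[of c0] P X0 by (simp add: log_mult log_powr log_nat_power algebra_simps add_pos_nonneg)
  also have "real (m - 1) * log 2 (real J + 1) \<le> real m * log 2 (A * log 2 P + 2)"
  proof (rule mult_mono)
    have "A * log 2 P \<ge> 0" using P A by simp
    then show "log 2 (real J + 1) \<le> log 2 (A * log 2 P + 2)" using J(2) by (subst log_le_cancel_iff) auto
  qed auto
  finally show ?thesis by (simp add: m_def X_def)
qed

lemma interference_rate:
  assumes P: "P > 1" and a: "a = (\<lambda>k i. sqrt P powr \<alpha> k i)"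
    and R: "\<And>k. k < K \<Longrightarrow> 2 powr (real n * R k) \<le> real (M k)"
    and IC: "\<And>w w' i. w \<in> W \<Longrightarrow> w' \<in> W \<Longrightarrow> i < K \<Longrightarrow> w i = w' i \<Longrightarrow> E w i = E w' i"
    and K2: "K \<ge> 2" and e: "e \<ge> 0"
    and pr: "bij_betw pr {..<K} {..<K}" "\<And>k. k < K \<Longrightarrow> pr k \<noteq> k"
    and al: "\<And>k i. k < K \<Longrightarrow> i < K \<Longrightarrow> i \<noteq> k \<Longrightarrow> \<alpha> (pr k) i - \<alpha> k i \<le> e" "\<And>k. k < K \<Longrightarrow> \<alpha> (pr k) k \<le> e"
    and A: "A \<ge> 0" "\<And>k i. k < K \<Longrightarrow> i < K \<Longrightarrow> \<alpha> k i \<le> A"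
  shows "(\<Sum>k<K. R k) \<le> log 2 ((1 / c) ^ (2 * K)) + log 2 (ais_const c0 ^ K) + real K * log 2 (A * log 2 P + 2) + real K * e * log 2 P"
proof -
  have sP: "sqrt P > 1" using P by simp
  obtain J where J: "(sqrt P powr A)\<^sup>2 \<le> 4 ^ J" "real J + 1 \<le> A * log 2 P + 2"
    using dyadic_exponent[OF P A(1)] by blast
  have "real (\<Prod>k<K. M k) \<le> (Lam (sqrt P powr e) J / c) ^ K"
  proof (rule interference_chain[where D = "sqrt P powr e" and R = "sqrt P powr A" and J = J, OF _ K2 _ pr])
    show "sqrt P powr e \<ge> 1" using sP e by (intro ge_one_powr_ge_zero) auto
    show "a (pr k) i \<le> sqrt P powr e * a k i" if "k < K" "i < K" "i \<noteq> k" for k i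
      using al(1)[OF that] sP by (simp add: a powr_add[symmetric] powr_mono)
    show "a (pr k) k \<le> sqrt P powr e" if "k < K" for k using al(2)[OF that] sP by (simp add: a)
    show "sqrt P powr A \<ge> 1" using sP A(1) by (intro ge_one_powr_ge_zero) auto
    show "a k i \<le> sqrt P powr A" if "k < K" "i < K" for k i using A(2)[OF that] sP by (simp add: a)
    show "(sqrt P powr A)\<^sup>2 \<le> 4 ^ J" by (rule J(1))
  qed (rule IC)
  also have "\<dots> = (1 / c) ^ (2 * K) * (ais_const c0 ^ K * (real J + 1) ^ K * (P powr e) ^ K) ^ n"
  proof -
    have L: "Lam (sqrt P powr e) J / c = (1 / c)\<^sup>2 * (ais_const c0 * (real J + 1) * P powr e) ^ n"
    proof -
      have "(sqrt P powr e)\<^sup>2 = P powr e" using P by (intro sqrt_powr_square) simp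
      then show ?thesis unfolding Lam_def by (simp add: power2_eq_square[of "1 / c"])
    qed
    define Y where "Y = ais_const c0 * (real J + 1) * P powr e"
    have "(Y ^ n) ^ K = (Y ^ K) ^ n" by (simp add: power_mult[symmetric] mult.commute)
    then have "((1 / c)\<^sup>2 * Y ^ n) ^ K = (1 / c) ^ (2 * K) * (Y ^ K) ^ n"
      by (simp only: power_mult_distrib[of "(1 / c)\<^sup>2"] power_mult)
    then show ?thesis unfolding L Y_def by (simp only: power_mult_distrib)
  qed
  finally have *: "real (\<Prod>k<K. M k) \<le> (1 / c) ^ (2 * K) * (ais_const c0 ^ K * (real J + 1) ^ K * (P powr e) ^ K) ^ n" .
  have "2 powr (real n * (\<Sum>k<K. R k)) = (\<Prod>k<K. 2 powr (real n * R k))"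
    by (simp add: sum_distrib_left powr_sum)
  also have "\<dots> \<le> (\<Prod>k<K. real (M k))"
    using R by (intro prod_mono) auto
  finally have "2 powr (real n * (\<Sum>k<K. R k)) \<le> (1 / c) ^ (2 * K) * (ais_const c0 ^ K * (real J + 1) ^ K * (P powr e) ^ K) ^ n"
    using * by simp
  then have "(\<Sum>k<K. R k) \<le> log 2 ((1 / c) ^ (2 * K)) + log 2 (ais_const c0 ^ K * (real J + 1) ^ K * (P powr e) ^ K)"
    by (rule rate_le_of_power_bound[OF _ n1 one_le_power[OF c_le_1]])
      (use ais_const_pos[of c0] P in \<open>auto intro!: mult_pos_pos zero_less_power\<close>)
  also have "log 2 (ais_const c0 ^ K * (real J + 1) ^ K * (P powr e) ^ K) = log 2 (ais_const c0 ^ K) + real K * log 2 (real J + 1) + real K * e * log 2 P"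
    using ais_const_pos[of c0] P by (simp add: log_mult log_powr log_nat_power algebra_simps add_pos_nonneg)
  also have "real K * log 2 (real J + 1) \<le> real K * log 2 (A * log 2 P + 2)"
  proof (rule mult_left_mono)
    have "A * log 2 P \<ge> 0" using P A by simp
    then show "log 2 (real J + 1) \<le> log 2 (A * log 2 P + 2)" using J(2) by (subst log_le_cancel_iff) auto
  qed auto
  finally show ?thesis by simp
qed

end

section \<open>From rates to GDoF\<close>

lemma tendsto_log_overhead:
  fixes A B C :: real
  assumes A: "A \<ge> 0"
  shows "((\<lambda>x. (B + C * log 2 (A * x + 2)) / x) \<longlongrightarrow> 0) at_top"
proof -
  have inv: "((\<lambda>x::real. 1 / x) \<longlongrightarrow> 0) at_top"
    by (rule tendsto_divide_0[OF tendsto_const]) (simp add: filterlim_at_top_imp_at_infinity filterlim_ident)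
  \<comment> \<open>\<open>A\<close> may be 0, whereas the substitution below needs an argument that
    tends to infinity.\<close>
  define A' where "A' = A + 1"
  have A': "A' > 0" "A \<le> A'" using A by (auto simp: A'_def)
  have up: "((\<lambda>x. ln (A' * x + 2) / x) \<longlongrightarrow> 0) at_top"
  proof -
    have "filterlim (\<lambda>x. A' * x) at_top at_top"
      using A' by (intro filterlim_tendsto_pos_mult_at_top[OF tendsto_const _ filterlim_ident])
    from filterlim_tendsto_add_at_top[OF tendsto_const[of 2] this]
    have "filterlim (\<lambda>x. A' * x + 2) at_top at_top" by (simp add: add.commute)
    from filterlim_compose[OF ln_x_over_x_tendsto_0 this]
    have "((\<lambda>x. ln (A' * x + 2) / (A' * x + 2) * (A' + 2 * (1 / x))) \<longlongrightarrow> 0 * (A' + 2 * 0)) at_top"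
      by (intro tendsto_intros inv)
    moreover have "\<forall>\<^sub>F x in at_top. ln (A' * x + 2) / (A' * x + 2) * (A' + 2 * (1 / x)) = ln (A' * x + 2) / x"
      using eventually_gt_at_top[of 0]
    proof eventually_elim
      case (elim x)
      then have "A' * x + 2 > 0" using A' by (intro add_pos_pos mult_pos_pos) auto
      moreover have "A' + 2 * (1 / x) = (A' * x + 2) / x" using elim by (simp add: field_simps)
      ultimately show ?case by simp
    qed
    ultimately show ?thesis by (auto elim: Lim_transform_eventually)
  qed
  have "((\<lambda>x. ln (A * x + 2) / x) \<longlongrightarrow> 0) at_top"
  proof (rule tendsto_sandwich[OF _ _ tendsto_const up])
    show "\<forall>\<^sub>F x in at_top. 0 \<le> ln (A * x + 2) / x"
      using eventually_gt_at_top[of 0] by eventually_elim (use A in \<open>auto intro!: divide_nonneg_nonneg ln_ge_zero\<close>)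
    show "\<forall>\<^sub>F x in at_top. ln (A * x + 2) / x \<le> ln (A' * x + 2) / x"
      using eventually_gt_at_top[of 0]
    proof eventually_elim
      case (elim x)
      then have "A * x + 2 \<le> A' * x + 2" "0 < A * x + 2" using A A' by (auto intro!: mult_right_mono add_nonneg_pos)
      then have "ln (A * x + 2) \<le> ln (A' * x + 2)" by (subst ln_le_cancel_iff) linarith+
      then show ?case using elim by (intro divide_right_mono) auto
    qed
  qed
  then have "((\<lambda>x. B * (1 / x) + C / ln 2 * (ln (A * x + 2) / x)) \<longlongrightarrow> B * 0 + C / ln 2 * 0) at_top"
    by (intro tendsto_intros inv)
  then show ?thesis by (simp add: log_def add_divide_distrib)
qed

lemma GDoF_le_of_rate_le:
  fixes S :: "real \<Rightarrow> real"
  assumes lim: "((\<lambda>P. S P / log 2 P) \<longlongrightarrow> s) at_top" and A: "A \<ge> 0"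
    and le: "\<And>P. P > 1 \<Longrightarrow> S P \<le> B + C * log 2 (A * log 2 P + 2) + e * log 2 P"
  shows "s \<le> e"
proof -
  have "filterlim (\<lambda>P::real. 1 / ln 2 * ln P) at_top at_top"
    by (rule filterlim_tendsto_pos_mult_at_top[OF tendsto_const _ ln_at_top]) simp
  then have "filterlim (log 2) at_top at_top" by (simp add: log_def[abs_def])
  from filterlim_compose[OF tendsto_log_overhead[OF A, of B C] this]
  have "((\<lambda>P. (B + C * log 2 (A * log 2 P + 2)) / log 2 P + e) \<longlongrightarrow> 0 + e) at_top"
    by (intro tendsto_intros)
  then have *: "((\<lambda>P. (B + C * log 2 (A * log 2 P + 2)) / log 2 P + e) \<longlongrightarrow> e) at_top" by simp
  show ?thesis
  proof (rule tendsto_le[OF _ * lim])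
    show "\<forall>\<^sub>F P in at_top. S P / log 2 P \<le> (B + C * log 2 (A * log 2 P + 2)) / log 2 P + e"
      using eventually_gt_at_top[of 1]
    proof eventually_elim
      case (elim P)
      then have "log 2 P > 0" by simp
      then show ?case using le[OF elim] by (simp add: divide_simps)
    qed
  qed simp
qed

lemma GDoF_broadcast_bound:
  assumes K: "K \<ge> 1" and adm: "admissible_channel K Gm" and d: "d \<in> GDoF_region is_bc K \<alpha> Gm"
    and ks: "ks \<noteq> []" "distinct ks" "set ks \<subseteq> {..<K}"
    and e: "\<And>l. e l \<ge> 0" "\<And>l i. Suc l < length ks \<Longrightarrow> i < K \<Longrightarrow> \<alpha> (ks ! Suc l) i - \<alpha> (ks ! l) i \<le> e l"
    and e0: "e0 \<ge> 0" "\<And>i. i < K \<Longrightarrow> \<alpha> (ks ! 0) i \<le> e0"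
  shows "(\<Sum>k\<in>set ks. d k) \<le> e0 + (\<Sum>l<length ks - 1. e l)"
proof -
  obtain R where R: "\<And>P. P > 1 \<Longrightarrow> achievable is_bc K \<alpha> (Gm P) P (R P)"
      "\<And>k. k < K \<Longrightarrow> ((\<lambda>P. R P k / log 2 P) \<longlongrightarrow> d k) at_top"
    using d unfolding GDoF_region_def by blast
  obtain fmax dmin dmax where c: "fmax > 0" "dmin > 0" "dmin \<le> dmax"
    and ad: "\<And>P. P > 1 \<Longrightarrow> admissible_law K fmax dmin dmax (Gm P)"
    using admissible_channelE[OF adm] by blast
  \<comment> \<open>A crude common bound for all exponents, which enters the rates only inside an
    iterated logarithm.\<close>
  define A where "A = (\<Sum>k<K. \<Sum>i<K. \<bar>\<alpha> k i\<bar>)"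
  have A0: "A \<ge> 0" unfolding A_def by (intro sum_nonneg) auto
  have A: "\<alpha> k i \<le> A" if "k < K" "i < K" for k i
  proof -
    have "\<alpha> k i \<le> \<bar>\<alpha> k i\<bar>" by simp
    also have "\<dots> \<le> (\<Sum>i<K. \<bar>\<alpha> k i\<bar>)" using that by (intro member_le_sum) auto
    also have "\<dots> \<le> A" unfolding A_def using that by (intro member_le_sum[of k "{..<K}" "\<lambda>k. \<Sum>i<K. \<bar>\<alpha> k i\<bar>"]) (auto intro!: sum_nonneg)
    finally show ?thesis .
  qed
  define B where "B = log 2 ((1 / coded_msgs.c K) ^ (2 * length ks)) + log 2 (coded_channel.ais_const K fmax dmax (coded_msgs.c0 K) ^ (length ks - 1) * (pi * exp (2 * coded_msgs.c0 K + 2 * dmax\<^sup>2 * (real K)\<^sup>2)))"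
  have "((\<lambda>P. (\<Sum>k\<in>set ks. R P k) / log 2 P) \<longlongrightarrow> (\<Sum>k\<in>set ks. d k)) at_top"
    unfolding sum_divide_distrib using R(2) ks(3) by (intro tendsto_sum) auto
  then show ?thesis
  proof (rule GDoF_le_of_rate_le[where B = B and A = A, OF _ A0])
    fix P :: real assume P: "P > 1"
    obtain n M E dec where cm: "coded_msgs K n (Gm P) fmax dmax (\<lambda>k i. sqrt P powr \<alpha> k i) M E dec"
      and M: "\<forall>k<K. 2 powr (real n * R P k) \<le> real (M k)"
      using achievable_code[OF ad[OF P] c K R(1)[OF P]] by (elim exE conjE) (rule that)
    interpret coded_msgs K n "Gm P" fmax dmax "\<lambda>k i. sqrt P powr \<alpha> k i" M E dec by (rule cm)
    show "(\<Sum>k\<in>set ks. R P k) \<le> B + real (length ks) * log 2 (A * log 2 P + 2) + (e0 + (\<Sum>l<length ks - 1. e l)) * log 2 P"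
      using broadcast_rate[OF P refl M[rule_format] ks e e0 A0 A] unfolding B_def .
  qed
qed

lemma GDoF_interference_bound:
  assumes K: "K \<ge> 2" and adm: "admissible_channel K Gm" and d: "d \<in> GDoF_region False K \<alpha> Gm"
    and e: "e \<ge> 0"
    and pr: "bij_betw pr {..<K} {..<K}" "\<And>k. k < K \<Longrightarrow> pr k \<noteq> k"
    and al: "\<And>k i. k < K \<Longrightarrow> i < K \<Longrightarrow> i \<noteq> k \<Longrightarrow> \<alpha> (pr k) i - \<alpha> k i \<le> e" "\<And>k. k < K \<Longrightarrow> \<alpha> (pr k) k \<le> e"
  shows "(\<Sum>k<K. d k) \<le> real K * e"
proof -
  have K1: "K \<ge> 1" using K by simp
  obtain R where R: "\<And>P. P > 1 \<Longrightarrow> achievable False K \<alpha> (Gm P) P (R P)"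
      "\<And>k. k < K \<Longrightarrow> ((\<lambda>P. R P k / log 2 P) \<longlongrightarrow> d k) at_top"
    using d unfolding GDoF_region_def by blast
  obtain fmax dmin dmax where c: "fmax > 0" "dmin > 0" "dmin \<le> dmax"
    and ad: "\<And>P. P > 1 \<Longrightarrow> admissible_law K fmax dmin dmax (Gm P)"
    using admissible_channelE[OF adm] by blast
  define A where "A = (\<Sum>k<K. \<Sum>i<K. \<bar>\<alpha> k i\<bar>)"
  have A0: "A \<ge> 0" unfolding A_def by (intro sum_nonneg) auto
  have A: "\<alpha> k i \<le> A" if "k < K" "i < K" for k i
  proof -
    have "\<alpha> k i \<le> \<bar>\<alpha> k i\<bar>" by simp
    also have "\<dots> \<le> (\<Sum>i<K. \<bar>\<alpha> k i\<bar>)" using that by (intro member_le_sum) auto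
    also have "\<dots> \<le> A" unfolding A_def using that by (intro member_le_sum[of k "{..<K}" "\<lambda>k. \<Sum>i<K. \<bar>\<alpha> k i\<bar>"]) (auto intro!: sum_nonneg)
    finally show ?thesis .
  qed
  define B where "B = log 2 ((1 / coded_msgs.c K) ^ (2 * K)) + log 2 (coded_channel.ais_const K fmax dmax (coded_msgs.c0 K) ^ K)"
  have "((\<lambda>P. (\<Sum>k<K. R P k) / log 2 P) \<longlongrightarrow> (\<Sum>k<K. d k)) at_top"
    unfolding sum_divide_distrib using R(2) by (intro tendsto_sum) auto
  then show ?thesis
  proof (rule GDoF_le_of_rate_le[where B = B and A = A, OF _ A0])
    fix P :: real assume P: "P > 1"
    obtain n M E dec where cm: "coded_msgs K n (Gm P) fmax dmax (\<lambda>k i. sqrt P powr \<alpha> k i) M E dec"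
      and M: "\<forall>k<K. 2 powr (real n * R P k) \<le> real (M k)"
      and IC: "\<not> False \<longrightarrow> (\<forall>w\<in>msg_set K M. \<forall>w'\<in>msg_set K M. \<forall>i<K. w i = w' i \<longrightarrow> E w i = E w' i)"
      using achievable_code[OF ad[OF P] c K1 R(1)[OF P]] by (elim exE conjE) (rule that)
    interpret coded_msgs K n "Gm P" fmax dmax "\<lambda>k i. sqrt P powr \<alpha> k i" M E dec by (rule cm)
    show "(\<Sum>k<K. R P k) \<le> B + real K * log 2 (A * log 2 P + 2) + real K * e * log 2 P"
      using interference_rate[OF P refl M[rule_format] _ K e pr al A0 A] IC unfolding B_def by blast
  qed
qed

subsection \<open>Codes of large minimum distance\<close>

text \<open>Truncated subtraction in both directions gives the absolute difference; this way sums of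
  distances remain natural numbers.\<close>

definition nd :: "nat \<Rightarrow> nat \<Rightarrow> nat" where
  "nd x y = (x - y) + (y - x)"

lemma nd_le_square: "real (nd x y) \<le> (real x - real y)\<^sup>2"
proof -
  have "real (nd x y) = \<bar>real x - real y\<bar>" by (auto simp: nd_def)
  moreover have "\<bar>real x - real y\<bar> = real (nd x y)" using calculation by simp
  moreover have "real (nd x y) \<le> (real (nd x y))\<^sup>2" by (cases "nd x y") (auto simp: power2_eq_square)
  ultimately show ?thesis by (metis power2_abs)
qed

lemma sum_half_power_nd: "(\<Sum>v<N. (1 / 2 :: real) ^ nd c v) \<le> 3"
proof -
  have geo: "(\<Sum>i<m. (1 / 2 :: real) ^ i) \<le> 2" for m
    by (subst geometric_sum) (auto simp: field_simps)
  have "(\<Sum>v<N. (1 / 2 :: real) ^ nd c v) \<le> (\<Sum>v\<in>{..c} \<union> {c<..c + N}. (1 / 2 :: real) ^ nd c v)"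
    by (intro sum_mono2) auto
  also have "\<dots> = (\<Sum>v\<in>{..c}. (1 / 2 :: real) ^ nd c v) + (\<Sum>v\<in>{c<..c + N}. (1 / 2 :: real) ^ nd c v)"
    by (rule sum.union_disjoint) auto
  also have "(\<Sum>v\<in>{..c}. (1 / 2 :: real) ^ nd c v) = (\<Sum>i<Suc c. (1 / 2 :: real) ^ i)"
    by (rule sum.reindex_bij_witness[of _ "\<lambda>i. c - i" "\<lambda>v. c - v"]) (auto simp: nd_def)
  also have "(\<Sum>v\<in>{c<..c + N}. (1 / 2 :: real) ^ nd c v) = (\<Sum>i<N. (1 / 2 :: real) ^ Suc i)"
    by (rule sum.reindex_bij_witness[of _ "\<lambda>i. c + Suc i" "\<lambda>v. v - c - 1"]) (auto simp: nd_def Suc_diff_Suc simp del: power_Suc)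
  also have "(\<Sum>i<N. (1 / 2 :: real) ^ Suc i) = 1 / 2 * (\<Sum>i<N. (1 / 2 :: real) ^ i)"
    by (simp add: sum_distrib_left)
  finally show ?thesis using geo[of "Suc c"] geo[of N] by linarith
qed

text \<open>A Chernoff-type count: every point of the ball has weight at least 1 under
  \<open>2 ^ m\<close> times \<open>1 / 2\<close> to the power of its distance. This weight
  factorises over the coordinates, each of which contributes at most \<open>2 * 3\<close>.\<close>

lemma card_nd_ball:
  "real (card {y \<in> Pi\<^sub>E {..<m} (\<lambda>_. {..<N}). (\<Sum>j<m. nd (x j) (y j)) \<le> m}) \<le> 6 ^ m"
proof -
  let ?X = "Pi\<^sub>E {..<m} (\<lambda>_. {..<N})"
  have fin: "finite ?X" by (intro finite_PiE) auto
  have "real (card {y \<in> ?X. (\<Sum>j<m. nd (x j) (y j)) \<le> m}) = (\<Sum>y\<in>{y \<in> ?X. (\<Sum>j<m. nd (x j) (y j)) \<le> m}. 1)" by simp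
  also have "\<dots> \<le> (\<Sum>y\<in>{y \<in> ?X. (\<Sum>j<m. nd (x j) (y j)) \<le> m}. 2 ^ m * (1 / 2) ^ (\<Sum>j<m. nd (x j) (y j)))"
  proof (rule sum_mono)
    fix y assume y: "y \<in> {y \<in> ?X. (\<Sum>j<m. nd (x j) (y j)) \<le> m}"
    have "(1 :: real) = 2 ^ m * (1 / 2) ^ m" by (simp add: power_divide)
    also have "\<dots> \<le> 2 ^ m * (1 / 2) ^ (\<Sum>j<m. nd (x j) (y j))"
      using y by (intro mult_left_mono power_decreasing) auto
    finally show "1 \<le> (2 :: real) ^ m * (1 / 2) ^ (\<Sum>j<m. nd (x j) (y j))" .
  qed
  also have "\<dots> \<le> (\<Sum>y\<in>?X. 2 ^ m * (1 / 2) ^ (\<Sum>j<m. nd (x j) (y j)))"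
    using fin by (intro sum_mono2) auto
  also have "\<dots> = 2 ^ m * (\<Sum>y\<in>?X. \<Prod>j<m. (1 / 2) ^ nd (x j) (y j))"
    by (simp add: sum_distrib_left power_sum)
  also have "(\<Sum>y\<in>?X. \<Prod>j<m. (1 / 2) ^ nd (x j) (y j)) = (\<Prod>j<m. \<Sum>v<N. (1 / 2 :: real) ^ nd (x j) v)"
    by (subst prod_sum_PiE) auto
  also have "\<dots> \<le> (\<Prod>j<m. 3)"
    by (intro prod_mono conjI sum_half_power_nd sum_nonneg) auto
  finally show ?thesis by (simp add: power_mult_distrib[symmetric])
qed

text \<open>The Gilbert-Varshamov argument: the balls of radius \<open>m\<close> around a maximal
  code with distances above \<open>m\<close> cover the whole box, and each of them has at most
  \<open>6 ^ m\<close> points.\<close>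

lemma ex_integer_code:
  obtains C where "C \<subseteq> Pi\<^sub>E {..<m} (\<lambda>_. {..<N})" "(real N / 6) ^ m \<le> real (card C)"
    "\<And>x y. x \<in> C \<Longrightarrow> y \<in> C \<Longrightarrow> x \<noteq> y \<Longrightarrow> m < (\<Sum>j<m. nd (x j) (y j))"
proof -
  let ?X = "Pi\<^sub>E {..<m} (\<lambda>_. {..<N})"
  define \<C> where "\<C> = {C. C \<subseteq> ?X \<and> (\<forall>x\<in>C. \<forall>y\<in>C. x \<noteq> y \<longrightarrow> m < (\<Sum>j<m. nd (x j) (y j)))}"
  have fin: "finite ?X" by (intro finite_PiE) auto
  have "finite \<C>" by (rule finite_subset[of _ "Pow ?X"]) (auto simp: \<C>_def fin)
  moreover have "{} \<in> \<C>" by (simp add: \<C>_def)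
  ultimately obtain C where C: "C \<in> \<C>" and max: "\<And>B. B \<in> \<C> \<Longrightarrow> C \<subseteq> B \<Longrightarrow> C = B"
    using finite_has_maximal[of \<C>] by blast
  have CX: "C \<subseteq> ?X" using C by (simp add: \<C>_def)
  have finC: "finite C" using CX fin finite_subset by blast
  have ndc: "nd u v = nd v u" for u v by (simp add: nd_def)
  have cover: "?X \<subseteq> (\<Union>x\<in>C. {y \<in> ?X. (\<Sum>j<m. nd (x j) (y j)) \<le> m})"
  proof
    fix y assume y: "y \<in> ?X"
    show "y \<in> (\<Union>x\<in>C. {y \<in> ?X. (\<Sum>j<m. nd (x j) (y j)) \<le> m})"
    proof (rule ccontr)
      assume "\<not> ?thesis"
      then have far: "m < (\<Sum>j<m. nd (x j) (y j))" if "x \<in> C" for x using that y by (auto simp: not_le)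
      then have far': "m < (\<Sum>j<m. nd (y j) (x j))" if "x \<in> C" for x using that by (simp add: ndc)
      have "insert y C \<in> \<C>" using C y far far' by (auto simp: \<C>_def)
      then have "y \<in> C" using max[of "insert y C"] by auto
      then show False using far[of y] by (simp add: nd_def)
    qed
  qed
  have "real N ^ m = real (card ?X)" by (simp add: card_PiE)
  also have "\<dots> \<le> real (card (\<Union>x\<in>C. {y \<in> ?X. (\<Sum>j<m. nd (x j) (y j)) \<le> m}))"
    using cover finC fin by (intro of_nat_mono card_mono) auto
  also have "\<dots> \<le> (\<Sum>x\<in>C. real (card {y \<in> ?X. (\<Sum>j<m. nd (x j) (y j)) \<le> m}))"
    unfolding of_nat_sum[symmetric] of_nat_le_iff by (rule card_UN_le[OF finC])
  also have "\<dots> \<le> (\<Sum>x\<in>C. 6 ^ m)" by (intro sum_mono card_nd_ball)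
  finally have "(real N / 6) ^ m \<le> real (card C)" by (simp add: power_divide field_simps)
  then show ?thesis using that CX C by (auto simp: \<C>_def)
qed

text \<open>Two integer coordinates form the real and imaginary part of one symbol, and division by
  \<open>2 * N\<close> keeps symbols in the unit disc. An integer distance is at most its square, so
  the integer code also has a large squared distance.\<close>

lemma ex_complex_code:
  assumes N: "N \<ge> 1"
  obtains code :: "nat \<Rightarrow> nat \<Rightarrow> complex" and L :: nat
  where "(real N / 6) ^ (2 * n) \<le> real L" "\<And>u t. u < L \<Longrightarrow> t < n \<Longrightarrow> cmod (code u t) \<le> 1"
    "\<And>u v. u < L \<Longrightarrow> v < L \<Longrightarrow> u \<noteq> v \<Longrightarrow> real n / (2 * (real N)\<^sup>2) < (\<Sum>t<n. (cmod (code u t - code v t))\<^sup>2)"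
proof -
  obtain C where C: "C \<subseteq> Pi\<^sub>E {..<2 * n} (\<lambda>_. {..<N})" "(real N / 6) ^ (2 * n) \<le> real (card C)"
    "\<And>x y. x \<in> C \<Longrightarrow> y \<in> C \<Longrightarrow> x \<noteq> y \<Longrightarrow> 2 * n < (\<Sum>j<2 * n. nd (x j) (y j))"
    using ex_integer_code[of "2 * n" N] by blast
  have "finite C" using C(1) by (rule finite_subset) (intro finite_PiE; simp)
  then obtain h where h: "bij_betw h {..<card C} C"
    using ex_bij_betw_nat_finite[of C] by (auto simp: atLeast0LessThan)
  have hC: "h u \<in> C" if "u < card C" for u using h that by (auto simp: bij_betw_def)
  define code where "code u t = Complex (real (h u (2 * t)) / (2 * real N)) (real (h u (2 * t + 1)) / (2 * real N))" for u t
  have N0: "real N > 0" using N by simp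
  show ?thesis
  proof (rule that[of "card C" code])
    show "(real N / 6) ^ (2 * n) \<le> real (card C)" by (rule C)
    show "cmod (code u t) \<le> 1" if "u < card C" "t < n" for u t
    proof -
      have "h u \<in> Pi\<^sub>E {..<2 * n} (\<lambda>_. {..<N})" using hC[OF that(1)] C(1) by blast
      then have lt: "h u j < N" if "j < 2 * n" for j using that by auto
      have "cmod (code u t) \<le> \<bar>real (h u (2 * t)) / (2 * real N)\<bar> + \<bar>real (h u (2 * t + 1)) / (2 * real N)\<bar>"
        using cmod_le[of "code u t"] by (simp add: code_def)
      also have "\<dots> \<le> 1 / 2 + 1 / 2"
        using lt[of "2 * t"] lt[of "2 * t + 1"] that(2) N0 by (intro add_mono) (auto simp: divide_simps)
      finally show ?thesis by simp
    qed
    show "real n / (2 * (real N)\<^sup>2) < (\<Sum>t<n. (cmod (code u t - code v t))\<^sup>2)" if uv: "u < card C" "v < card C" "u \<noteq> v" for u v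
    proof -
      have "h u \<noteq> h v" using h uv by (auto simp: bij_betw_def inj_on_def)
      then have "2 * n < (\<Sum>j<2 * n. nd (h u j) (h v j))" using C(3) hC uv by blast
      then have "real (2 * n) < real (\<Sum>j<2 * n. nd (h u j) (h v j))" by (rule of_nat_less_iff[THEN iffD2])
      also have "\<dots> \<le> (\<Sum>j<2 * n. (real (h u j) - real (h v j))\<^sup>2)"
        unfolding of_nat_sum by (intro sum_mono nd_le_square)
      also have "\<dots> = (\<Sum>t<n. (real (h u (2 * t)) - real (h v (2 * t)))\<^sup>2 + (real (h u (2 * t + 1)) - real (h v (2 * t + 1)))\<^sup>2)"
        by (induction n) (auto simp: algebra_simps)
      also have "\<dots> = (\<Sum>t<n. (2 * real N)\<^sup>2 * (cmod (code u t - code v t))\<^sup>2)"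
        using N0 by (intro sum.cong refl)
          (simp add: code_def cmod_power2 diff_divide_distrib[symmetric] power_divide add_divide_distrib[symmetric])
      also have "\<dots> = (2 * real N)\<^sup>2 * (\<Sum>t<n. (cmod (code u t - code v t))\<^sup>2)" by (rule sum_distrib_left[symmetric])
      finally show ?thesis using N0 by (simp add: field_simps power2_eq_square)
    qed
  qed
qed

text \<open>Rate 0 allows a single codeword only. Demanding \<open>R > 0\<close> as soon as two
  codewords differ records this, and later shows that a rate of the form \<open>max 0 r\<close> was
  not cut off. The constant is \<open>98 = 2 * 49\<close>, from an alphabet of at most
  \<open>7 * 2 powr (R / 2)\<close> integers.\<close>

definition good_code :: "nat \<Rightarrow> real \<Rightarrow> (nat \<Rightarrow> nat \<Rightarrow> complex) \<Rightarrow> nat \<Rightarrow> bool" where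
  "good_code n R code L \<longleftrightarrow> 2 powr (real n * R) \<le> real L \<and> L \<ge> 1 \<and> (\<forall>u<L. \<forall>t<n. cmod (code u t) \<le> 1) \<and>
    (\<forall>u<L. \<forall>v<L. u \<noteq> v \<longrightarrow> R > 0 \<and> real n / (98 * 2 powr R) \<le> (\<Sum>t<n. (cmod (code u t - code v t))\<^sup>2))"

lemma ex_good_code:
  assumes R: "R \<ge> 0"
  shows "\<exists>code L. good_code n R code L"
proof (cases "R = 0")
  case True
  show ?thesis by (intro exI[of _ "\<lambda>_ _. 0"] exI[of _ 1]) (simp add: True good_code_def)
next
  case False
  \<comment> \<open>The construction guarantees \<open>(N / 6) ^ (2 * n)\<close> codewords, and this
    has to reach \<open>2 powr (n * R)\<close>.\<close>
  define N where "N = nat \<lceil>6 * 2 powr (R / 2)\<rceil>"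
  have p1: "2 powr (R / 2) \<ge> 1" using R by (intro ge_one_powr_ge_zero) auto
  have N1: "6 * 2 powr (R / 2) \<le> real N" unfolding N_def by (rule real_nat_ceiling_ge)
  have "real N < 6 * 2 powr (R / 2) + 1" unfolding N_def using p1 by linarith
  then have N2: "real N \<le> 7 * 2 powr (R / 2)" using p1 by linarith
  have sq: "(2 powr (R / 2))\<^sup>2 = 2 powr R" by (simp add: power2_eq_square powr_add[symmetric])
  have N0: "N \<ge> 1" using N1 p1 by linarith
  obtain code L where c: "(real N / 6) ^ (2 * n) \<le> real L" "\<And>u t. u < L \<Longrightarrow> t < n \<Longrightarrow> cmod (code u t) \<le> 1"
    "\<And>u v. u < L \<Longrightarrow> v < L \<Longrightarrow> u \<noteq> v \<Longrightarrow> real n / (2 * (real N)\<^sup>2) < (\<Sum>t<n. (cmod (code u t - code v t))\<^sup>2)"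
    by (rule ex_complex_code[OF N0, where n = n]) (rule that)
  have "2 powr (real n * R) = (2 powr R) powr real n" by (simp add: powr_powr mult.commute)
  also have "\<dots> = (2 powr R) ^ n" by (rule powr_realpow) simp
  also have "\<dots> = ((2 powr (R / 2))\<^sup>2) ^ n" by (simp only: sq)
  also have "\<dots> = (2 powr (R / 2)) ^ (2 * n)" by (simp only: power_mult)
  also have "\<dots> \<le> (real N / 6) ^ (2 * n)" using N1 by (intro power_mono) auto
  finally have L: "2 powr (real n * R) \<le> real L" using c(1) by linarith
  have "(real N)\<^sup>2 \<le> (7 * 2 powr (R / 2))\<^sup>2" using N2 by (intro power_mono) auto
  also have "\<dots> = 49 * 2 powr R" by (simp only: power_mult_distrib sq) simp
  finally have NN: "(real N)\<^sup>2 \<le> 49 * 2 powr R" .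
  have "0 < 2 powr (real n * R)" by simp
  with L have "L \<ge> 1" by linarith
  moreover have "real n / (98 * 2 powr R) \<le> (\<Sum>t<n. (cmod (code u t - code v t))\<^sup>2)" if "u < L" "v < L" "u \<noteq> v" for u v
  proof -
    have "real n / (98 * 2 powr R) \<le> real n / (2 * (real N)\<^sup>2)"
      using NN N0 by (intro divide_left_mono) auto
    then show ?thesis using c(3)[OF that] by linarith
  qed
  ultimately have "good_code n R code L"
    using L c(2) R False by (simp add: good_code_def)
  then show ?thesis by blast
qed

subsection \<open>Achievability from minimum distance\<close>

text \<open>With noise energy at most \<open>4 * n\<close> at a receiver, two tuples that explain
  the same output have signals within squared distance \<open>2 * (4 * n) + 2 * (4 * n)\<close>. A
  distance above \<open>16 * n\<close> therefore makes every explanation carry the right own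
  message. Pairs with equal own message are not constrained, while the other messages may vary
  freely in a pair that is; this is how interference is accounted for.\<close>

lemma achievable_of_distance:
  assumes adm: "admissible_law K fmax dmin dmax G" and pos: "fmax > 0" "dmin > 0" "dmin \<le> dmax"
    and R: "\<And>k. k < K \<Longrightarrow> R k \<ge> 0"
    and code: "\<And>n. n \<ge> 1 \<Longrightarrow> \<exists>M E. (\<forall>k<K. 2 powr (real n * R k) \<le> real (M k)) \<and>
        (\<forall>w\<in>msg_set K M. \<forall>i<K. \<forall>t<n. cmod (E w i t) \<le> 1) \<and>
        (\<not> is_bc \<longrightarrow> (\<forall>w\<in>msg_set K M. \<forall>w'\<in>msg_set K M. \<forall>i<K. w i = w' i \<longrightarrow> E w i = E w' i)) \<and>
        (\<forall>g w w' k. (\<forall>t<n. \<forall>k<K. \<forall>i<K. dmin \<le> cmod (g t k i) \<and> cmod (g t k i) \<le> dmax) \<longrightarrow>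
            w \<in> msg_set K M \<longrightarrow> w' \<in> msg_set K M \<longrightarrow> k < K \<longrightarrow> w k \<noteq> w' k \<longrightarrow>
            16 * real n < (\<Sum>t<n. (cmod (\<Sum>i<K. complex_of_real (sqrt P powr \<alpha> k i) * g t k i * (E w i t - E w' i t)))\<^sup>2))"
  shows "achievable is_bc K \<alpha> G P R"
  unfolding achievable_def
proof (intro conjI allI impI)
  show "R k \<ge> 0" if "k < K" for k by (rule R[OF that])
  fix \<epsilon> :: real assume \<epsilon>: "\<epsilon> > 0"
  \<comment> \<open>The base of the noise tail at level 4; it is below 1 because
    \<open>exp 2 \<ge> 3\<close>.\<close>
  define q where "q = 2 * exp (- (4 :: real) / 2)"
  have q: "0 \<le> q" "q < 1"
  proof -
    have "exp (2 :: real) \<ge> 1 + 2" by (rule exp_ge_add_one_self)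
    then have "exp (- 2 :: real) \<le> 1 / 3" by (simp add: exp_minus divide_simps)
    then show "q < 1" by (simp add: q_def)
  qed (simp add: q_def)
  have "(\<lambda>n. real K * q ^ n) \<longlonglongrightarrow> real K * 0"
    using q by (intro tendsto_intros LIMSEQ_realpow_zero) auto
  then have "\<forall>\<^sub>F n in sequentially. real K * q ^ n < \<epsilon>" using \<epsilon> by (simp add: order_tendstoD(2))
  then obtain N where N: "\<And>n. n \<ge> N \<Longrightarrow> real K * q ^ n < \<epsilon>"
    unfolding eventually_sequentially by blast
  show "\<exists>N. \<forall>n\<ge>N. \<exists>M E dec.
        (\<forall>k<K. 2 powr (real n * R k) \<le> real (M k)) \<and>
        (\<forall>w\<in>msg_set K M. \<forall>i<K. (\<Sum>t<n. (cmod (E w i t))\<^sup>2) \<le> real n) \<and>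
        (\<not> is_bc \<longrightarrow> (\<forall>w\<in>msg_set K M. \<forall>w'\<in>msg_set K M. \<forall>i<K. w i = w' i \<longrightarrow> E w i = E w' i)) \<and>
        ennreal (1 - \<epsilon>) \<le> success_prob K \<alpha> P G n M E dec"
  proof (intro exI[of _ "max N 1"] allI impI)
    fix n assume "n \<ge> max N 1"
    then have n: "n \<ge> N" "n \<ge> 1" by auto
    obtain M E where M: "\<forall>k<K. 2 powr (real n * R k) \<le> real (M k)"
      and E1: "\<forall>w\<in>msg_set K M. \<forall>i<K. \<forall>t<n. cmod (E w i t) \<le> 1"
      and IC: "\<not> is_bc \<longrightarrow> (\<forall>w\<in>msg_set K M. \<forall>w'\<in>msg_set K M. \<forall>i<K. w i = w' i \<longrightarrow> E w i = E w' i)"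
      and dist: "\<forall>g w w' k. (\<forall>t<n. \<forall>k<K. \<forall>i<K. dmin \<le> cmod (g t k i) \<and> cmod (g t k i) \<le> dmax) \<longrightarrow>
            w \<in> msg_set K M \<longrightarrow> w' \<in> msg_set K M \<longrightarrow> k < K \<longrightarrow> w k \<noteq> w' k \<longrightarrow>
            16 * real n < (\<Sum>t<n. (cmod (\<Sum>i<K. complex_of_real (sqrt P powr \<alpha> k i) * g t k i * (E w i t - E w' i t)))\<^sup>2)"
      using code[OF n(2)] by (elim exE conjE) (rule that)
    define s where "s k w g t = (\<Sum>i<K. complex_of_real (sqrt P powr \<alpha> k i) * g t k i * E w i t)" for k w and g :: "nat \<Rightarrow> nat \<Rightarrow> nat \<Rightarrow> complex" and t
    \<comment> \<open>Any tuple that explains the output with small noise is accepted. For typical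
      noise and bounded fading all such tuples have the same own message.\<close>
    define dec where "dec k y g = (SOME v. \<exists>w\<in>msg_set K M. \<exists>z. v = w k \<and> (\<Sum>t<n. (cmod (z t))\<^sup>2) \<le> 4 * real n \<and> (\<forall>t<n. y t = s k w g t + z t))"
      for k and y :: "nat \<Rightarrow> complex" and g
    \<comment> \<open>The empty codebook gives access to the estimates for noise and fading from the
      converse.\<close>
    interpret coded_channel K n G fmax dmax "\<lambda>_ _. 0" "{} :: nat set" "\<lambda>_ _ _. 0"
    proof (rule coded_channel.intro, goal_cases)
      case 1
      show ?case using adm by (simp add: admissible_law_def)
    next
      case (2 t k i)
      then show ?case using adm by (simp add: admissible_law_def)
    next
      case (3 t k i)
      then have "AE g in G. dmin \<le> cmod (g t k i) \<and> cmod (g t k i) \<le> dmax" using adm by (simp add: admissible_law_def)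
      then show ?case by eventually_elim simp
    next
      case (4 A B)
      have "finite A \<and> finite B \<and> A \<subseteq> coords K \<and> B \<subseteq> coords K \<and> A \<inter> B = {}" using 4 by simp
      then show ?case
        by (rule adm[unfolded admissible_law_def, THEN conjunct2, THEN conjunct2, THEN conjunct2, THEN spec[of _ A], THEN spec[of _ B], THEN mp])
    qed (use pos in auto)
    interpret pair_sigma_finite G "noise n K" by (rule pair_sigma_finite_Om)
    interpret G: prob_space G by (rule prob_G)
    interpret N: prob_space "noise n K" by (rule prob_space_noise)
    interpret pair_prob_space G "noise n K" ..
    have correct: "dec k (rx_signal K \<alpha> P n E w g z k) (restrict_time n g) = w k"
      if w: "w \<in> msg_set K M" and k: "k < K" and z: "(\<Sum>t<n. (cmod (z (t, k)))\<^sup>2) \<le> 4 * real n"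
        and g: "\<forall>t<n. \<forall>k<K. \<forall>i<K. dmin \<le> cmod (g t k i) \<and> cmod (g t k i) \<le> dmax" for w g z k
    proof -
      let ?y = "rx_signal K \<alpha> P n E w g z k"
      let ?Q = "\<lambda>v. \<exists>w\<in>msg_set K M. \<exists>z. v = w k \<and> (\<Sum>t<n. (cmod (z t))\<^sup>2) \<le> 4 * real n \<and> (\<forall>t<n. ?y t = s k w (restrict_time n g) t + z t)"
      have sr: "s k w' (restrict_time n g) t = s k w' g t" if "t < n" for w' t
        using that by (simp add: s_def restrict_time_def)
      have y: "?y t = s k w g t + z (t, k)" if "t < n" for t
        using that by (simp add: rx_signal_def s_def)
      have "?Q (w k)"
        using w z y sr by (intro bexI[of _ w] exI[of _ "\<lambda>t. z (t, k)"]) auto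
      moreover have "v = w k" if "?Q v" for v
      proof (rule ccontr)
        assume ne: "v \<noteq> w k"
        from that obtain w' z' where w': "w' \<in> msg_set K M" "v = w' k" "(\<Sum>t<n. (cmod (z' t))\<^sup>2) \<le> 4 * real n"
          "\<And>t. t < n \<Longrightarrow> ?y t = s k w' (restrict_time n g) t + z' t" by blast
        have "16 * real n < (\<Sum>t<n. (cmod (\<Sum>i<K. complex_of_real (sqrt P powr \<alpha> k i) * g t k i * (E w i t - E w' i t)))\<^sup>2)"
          using ne w'(2)
          by (intro dist[THEN spec, THEN spec, THEN spec, THEN spec, THEN mp, THEN mp, THEN mp, THEN mp, THEN mp, OF g w w'(1) k]) auto
        also have "\<dots> = (\<Sum>t<n. (cmod (z' t - z (t, k)))\<^sup>2)"
        proof (rule sum.cong)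
          fix t assume "t \<in> {..<n}"
          then have t: "t < n" by simp
          have "(\<Sum>i<K. complex_of_real (sqrt P powr \<alpha> k i) * g t k i * (E w i t - E w' i t)) = s k w g t - s k w' g t"
            by (simp add: s_def algebra_simps sum_subtractf)
          also have "\<dots> = z' t - z (t, k)" using y[OF t] w'(4)[OF t] sr[OF t] by (simp add: algebra_simps)
          finally show "(cmod (\<Sum>i<K. complex_of_real (sqrt P powr \<alpha> k i) * g t k i * (E w i t - E w' i t)))\<^sup>2 = (cmod (z' t - z (t, k)))\<^sup>2" by simp
        qed simp
        also have "\<dots> \<le> (\<Sum>t<n. 2 * (cmod (z' t))\<^sup>2 + 2 * (cmod (z (t, k)))\<^sup>2)"
        proof (rule sum_mono)
          fix t
          have "(cmod (z' t - z (t, k)))\<^sup>2 \<le> (cmod (z' t) + cmod (z (t, k)))\<^sup>2"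
            by (intro power_mono norm_triangle_ineq4) simp
          also have "\<dots> \<le> 2 * (cmod (z' t))\<^sup>2 + 2 * (cmod (z (t, k)))\<^sup>2"
            using sum_squares_bound[of "cmod (z' t)" "cmod (z (t, k))"] by (simp add: power2_sum)
          finally show "(cmod (z' t - z (t, k)))\<^sup>2 \<le> 2 * (cmod (z' t))\<^sup>2 + 2 * (cmod (z (t, k)))\<^sup>2" .
        qed
        also have "\<dots> = 2 * (\<Sum>t<n. (cmod (z' t))\<^sup>2) + 2 * (\<Sum>t<n. (cmod (z (t, k)))\<^sup>2)"
          by (simp add: sum.distrib sum_distrib_left)
        also have "\<dots> \<le> 16 * real n" using z w'(3) by linarith
        finally show False by simp
      qed
      ultimately show ?thesis unfolding dec_def by (rule some_equality)
    qed
    have AEd: "AE gz in Om. \<forall>t\<in>{..<n}. \<forall>k\<in>{..<K}. \<forall>i\<in>{..<K}. dmin \<le> cmod (fst gz t k i)"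
    proof (rule AE_pair_measure)
      have [measurable]: "(\<lambda>gz. fst gz t k i) \<in> borel_measurable Om" if "k \<in> {..<K}" "i \<in> {..<K}" for t k i
        using that by (intro measurable_fst_Om) auto
      show "{gz \<in> space Om. \<forall>t\<in>{..<n}. \<forall>k\<in>{..<K}. \<forall>i\<in>{..<K}. dmin \<le> cmod (fst gz t k i)} \<in> sets Om"
        by measurable
      have "AE g in G. \<forall>t\<in>{..<n}. \<forall>k\<in>{..<K}. \<forall>i\<in>{..<K}. dmin \<le> cmod (g t k i)"
        using adm by (simp add: AE_finite_all admissible_law_def)
      then show "AE g in G. AE z in noise n K. \<forall>t\<in>{..<n}. \<forall>k\<in>{..<K}. \<forall>i\<in>{..<K}. dmin \<le> cmod (fst (g, z) t k i)"
        by eventually_elim simp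
    qed
    have good_prob: "ennreal (1 - \<epsilon>) \<le> emeasure Om (good 4)"
    proof -
      have "emeasure Om (space Om - good 4) \<le> ennreal (real K * q ^ n)"
        using emeasure_not_good[of 4] by (simp add: q_def)
      also have "\<dots> \<le> ennreal \<epsilon>" using N[OF n(1)] by (intro ennreal_leI) simp
      finally have le: "emeasure Om (space Om - good 4) \<le> ennreal \<epsilon>" .
      have "good 4 \<union> (space Om - good 4) = space Om"
        using sets.sets_into_space[OF good_sets[of 4]] by auto
      moreover have "emeasure Om (space Om) = 1"
        by (subst space_pair_measure, subst M2.emeasure_pair_measure_Times) (auto simp: G.emeasure_space_1 N.emeasure_space_1)
      moreover have "emeasure Om (good 4) + emeasure Om (space Om - good 4) = emeasure Om (good 4 \<union> (space Om - good 4))"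
        by (intro plus_emeasure good_sets sets.compl_sets) auto
      ultimately have "1 = emeasure Om (good 4) + emeasure Om (space Om - good 4)" by simp
      also have "\<dots> \<le> emeasure Om (good 4) + ennreal \<epsilon>" using le by (intro add_left_mono)
      finally have "1 - ennreal \<epsilon> \<le> emeasure Om (good 4)" by (simp add: ennreal_minus_le_iff add.commute)
      moreover have "ennreal (1 - \<epsilon>) = 1 - ennreal \<epsilon>" using \<epsilon> by (simp add: ennreal_minus[symmetric])
      ultimately show ?thesis by simp
    qed
    have int: "ennreal (1 - \<epsilon>) \<le> (\<integral>\<^sup>+gz. indicator {gz. \<forall>k<K. dec k (rx_signal K \<alpha> P n E w (fst gz) (snd gz) k) (restrict_time n (fst gz)) = w k} gz \<partial>Om)"
      if w: "w \<in> msg_set K M" for w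
    proof -
      have "ennreal (1 - \<epsilon>) \<le> (\<integral>\<^sup>+gz. indicator (good 4) gz \<partial>Om)" using good_prob good_sets[of 4] by simp
      also have "\<dots> \<le> (\<integral>\<^sup>+gz. indicator {gz. \<forall>k<K. dec k (rx_signal K \<alpha> P n E w (fst gz) (snd gz) k) (restrict_time n (fst gz)) = w k} gz \<partial>Om)"
        using AEd
      proof (intro nn_integral_mono_AE, eventually_elim)
        case (elim gz)
        show ?case
        proof (cases "gz \<in> good 4")
          case True
          then have "dec k (rx_signal K \<alpha> P n E w (fst gz) (snd gz) k) (restrict_time n (fst gz)) = w k" if "k < K" for k
            using elim that by (intro correct w) (auto simp: good_def)
          then show ?thesis by (simp add: indicator_def)
        qed simp
      qed
      finally show ?thesis .
    qed
    have Wne: "card (msg_set K M) > 0"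
    proof -
      have "M k > 0" if "k < K" for k
      proof -
        have "0 < 2 powr (real n * R k)" by simp
        also have "\<dots> \<le> real (M k)" using M that by blast
        finally show ?thesis by simp
      qed
      then have "msg_set K M \<noteq> {}" unfolding msg_set_def PiE_eq_empty_iff lessThan_empty_iff by auto
      then show ?thesis using finite_msg_set by (simp add: card_gt_0_iff)
    qed
    have "ennreal (1 - \<epsilon>) * of_nat (card (msg_set K M)) = (\<Sum>w\<in>msg_set K M. ennreal (1 - \<epsilon>))" by (simp add: mult.commute)
    also have "\<dots> \<le> (\<Sum>w\<in>msg_set K M. \<integral>\<^sup>+gz. indicator {gz. \<forall>k<K. dec k (rx_signal K \<alpha> P n E w (fst gz) (snd gz) k) (restrict_time n (fst gz)) = w k} gz \<partial>Om)"
      using int by (rule sum_mono)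
    finally have "ennreal (1 - \<epsilon>) * of_nat (card (msg_set K M)) / of_nat (card (msg_set K M)) \<le> success_prob K \<alpha> P G n M E dec"
      unfolding success_prob_def by (rule divide_right_mono_ennreal)
    then have "ennreal (1 - \<epsilon>) \<le> success_prob K \<alpha> P G n M E dec"
      using Wne by (subst (asm) mult_divide_eq_ennreal) (auto simp: ennreal_of_nat_eq_real_of_nat)
    moreover have "\<forall>w\<in>msg_set K M. \<forall>i<K. (\<Sum>t<n. (cmod (E w i t))\<^sup>2) \<le> real n"
    proof (intro ballI allI impI)
      fix w i assume "w \<in> msg_set K M" "i < K"
      then have "(\<Sum>t<n. (cmod (E w i t))\<^sup>2) \<le> (\<Sum>t<n. 1)"
        using E1 by (intro sum_mono) (auto simp: power_le_one)
      then show "(\<Sum>t<n. (cmod (E w i t))\<^sup>2) \<le> real n" by simp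
    qed
    ultimately show "\<exists>M E dec.
        (\<forall>k<K. 2 powr (real n * R k) \<le> real (M k)) \<and>
        (\<forall>w\<in>msg_set K M. \<forall>i<K. (\<Sum>t<n. (cmod (E w i t))\<^sup>2) \<le> real n) \<and>
        (\<not> is_bc \<longrightarrow> (\<forall>w\<in>msg_set K M. \<forall>w'\<in>msg_set K M. \<forall>i<K. w i = w' i \<longrightarrow> E w i = E w' i)) \<and>
        ennreal (1 - \<epsilon>) \<le> success_prob K \<alpha> P G n M E dec"
      using M IC by (intro exI[of _ M] exI[of _ E] exI[of _ dec] conjI)
  qed
qed

text \<open>Here \<open>p\<close> is the wanted difference and \<open>q\<close> the interference,
  whose level is \<open>Z\<close>. Since the square of a sum is at most twice the sum of the
  squares, the total retains \<open>17 * Z\<^sup>2 * n\<close>; taking 17 instead of 16 makes the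
  inequality strict.\<close>

lemma separation:
  fixes p q :: "nat \<Rightarrow> complex"
  assumes n: "n \<ge> 1" and Z: "Z \<ge> 1" and q: "\<And>t. t < n \<Longrightarrow> cmod (q t) \<le> Q * Z"
    and p: "2 * (17 + Q\<^sup>2) * Z\<^sup>2 * real n \<le> (\<Sum>t<n. (cmod (p t))\<^sup>2)"
  shows "16 * real n < (\<Sum>t<n. (cmod (p t + q t))\<^sup>2)"
proof -
  have "(\<Sum>t<n. (cmod (p t))\<^sup>2) \<le> (\<Sum>t<n. 2 * (cmod (p t + q t))\<^sup>2 + 2 * (Q * Z)\<^sup>2)"
  proof (rule sum_mono)
    fix t assume "t \<in> {..<n}"
    then have t: "t < n" by simp
    have "cmod (p t) \<le> cmod (p t + q t) + cmod (q t)"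
      using norm_triangle_ineq4[of "p t + q t" "q t"] by simp
    then have "(cmod (p t))\<^sup>2 \<le> (cmod (p t + q t) + cmod (q t))\<^sup>2" by (intro power_mono) auto
    also have "\<dots> \<le> 2 * (cmod (p t + q t))\<^sup>2 + 2 * (cmod (q t))\<^sup>2"
      using sum_squares_bound[of "cmod (p t + q t)" "cmod (q t)"] by (simp add: power2_sum)
    also have "(cmod (q t))\<^sup>2 \<le> (Q * Z)\<^sup>2" using q[OF t] by (intro power_mono) auto
    finally show "(cmod (p t))\<^sup>2 \<le> 2 * (cmod (p t + q t))\<^sup>2 + 2 * (Q * Z)\<^sup>2" by simp
  qed
  also have "\<dots> = 2 * (\<Sum>t<n. (cmod (p t + q t))\<^sup>2) + 2 * Q\<^sup>2 * Z\<^sup>2 * real n"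
    by (simp add: sum.distrib sum_distrib_left power_mult_distrib)
  finally have *: "17 * Z\<^sup>2 * real n \<le> (\<Sum>t<n. (cmod (p t + q t))\<^sup>2)"
    using p by (simp add: algebra_simps)
  have "1 \<le> Z\<^sup>2" using Z by simp
  then have "17 * real n \<le> 17 * Z\<^sup>2 * real n" by (intro mult_right_mono) auto
  then show ?thesis using * n by linarith
qed

text \<open>Lowering a rate by a constant pays for all constants in the distance estimates and is
  invisible in GDoF. The maximum with 0 keeps rates legitimate at small power.\<close>

lemma tendsto_rate:
  assumes "d \<ge> 0"
  shows "((\<lambda>P. max 0 (d * log 2 P - C) / log 2 P) \<longlongrightarrow> d) at_top"
proof -
  have "filterlim (\<lambda>P::real. 1 / ln 2 * ln P) at_top at_top"
    by (rule filterlim_tendsto_pos_mult_at_top[OF tendsto_const _ ln_at_top]) simp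
  then have "filterlim (log 2) at_top at_top" by (simp add: log_def[abs_def])
  then have "((\<lambda>P. C / log 2 P) \<longlongrightarrow> 0) at_top"
    by (intro tendsto_divide_0[OF tendsto_const] filterlim_at_top_imp_at_infinity)
  then have "((\<lambda>P. max 0 (d - C / log 2 P)) \<longlongrightarrow> max 0 (d - 0)) at_top"
    by (intro tendsto_intros)
  then have lim: "((\<lambda>P. max 0 (d - C / log 2 P)) \<longlongrightarrow> d) at_top" using assms by simp
  have ev: "\<forall>\<^sub>F P in at_top. max 0 (d - C / log 2 P) = max 0 (d * log 2 P - C) / log 2 P"
    using eventually_gt_at_top[of 1]
  proof eventually_elim
    case (elim P)
    then have "log 2 P > 0" by simp
    then show ?case by (simp add: max_def divide_simps)
  qed
  show ?thesis using Lim_transform_eventually[OF lim ev] .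
qed

lemma powr_rate:
  assumes "P > 1" "B > 0" "max 0 (d * log 2 P - log 2 B) > (0::real)"
  shows "2 powr (max 0 (d * log 2 P - log 2 B)) = P powr d / B"
proof -
  have "max 0 (d * log 2 P - log 2 B) = d * log 2 P - log 2 B" using assms(3) by linarith
  moreover have "2 powr (d * log 2 P) = P powr d"
    using assms(1) by (simp add: powr_def log_def)
  ultimately show ?thesis using assms(2) by (simp add: powr_diff)
qed

subsection \<open>Treating interference as noise\<close>

text \<open>\<open>u i\<close> is the exponent at which user \<open>i\<close> arrives at its own
  receiver, so its transmit power has exponent \<open>u i - \<alpha> i i\<close>, at most 0.
  Receiver \<open>j\<close> needs \<open>d j\<close> of its level \<open>u j\<close> and tolerates
  interference up to \<open>u j - d j\<close>; the last assumption says that every other active user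
  stays below that.\<close>

lemma tin_achievable:
  assumes K: "K \<ge> 1" and adm: "admissible_channel K Gm" and S: "S \<subseteq> {..<K}"
    and d0: "\<And>k. k \<notin> S \<Longrightarrow> d k = 0" and d: "\<And>k. d k \<ge> 0"
    and u: "\<And>i. i \<in> S \<Longrightarrow> d i \<le> u i" "\<And>i. i \<in> S \<Longrightarrow> u i \<le> \<alpha> i i"
    and ud: "\<And>i j. i \<in> S \<Longrightarrow> j \<in> S \<Longrightarrow> i \<noteq> j \<Longrightarrow> u i - (\<alpha> i i - \<alpha> j i) \<le> u j - d j"
  shows "d \<in> GDoF_region False K \<alpha> Gm"
proof -
  obtain fmax dmin dmax where c: "fmax > 0" "dmin > 0" "dmin \<le> dmax"
    and ad: "\<And>P. P > 1 \<Longrightarrow> admissible_law K fmax dmin dmax (Gm P)"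
    using admissible_channelE[OF adm] by blast
  have dmax0: "dmax > 0" using c by linarith
  \<comment> \<open>There are at most \<open>K\<close> interferers, each with a codeword difference
    of modulus at most 2 and a coefficient of modulus at most \<open>dmax\<close>.\<close>
  define Q where "Q = 2 * real K * dmax"
  \<comment> \<open>Solved from \<open>separation\<close>: with the constant 98 of
    \<open>good_code\<close>, the wanted difference has guaranteed energy exactly
    \<open>2 * (17 + Q\<^sup>2) * Z\<^sup>2 * n\<close>.\<close>
  define B where "B = 98 * 2 * (17 + Q\<^sup>2) / dmin\<^sup>2"
  have B0: "B > 0" using c by (simp add: B_def add_pos_nonneg)
  define R where "R P k = (if k \<in> S then max 0 (d k * log 2 P - log 2 B) else 0)" for P k
  have R0: "R P k \<ge> 0" for P k by (simp add: R_def)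
  have "achievable False K \<alpha> (Gm P) P (R P)" if P: "P > 1" for P
  proof (rule achievable_of_distance[OF ad[OF P] c R0])
    fix n :: nat assume n: "n \<ge> 1"
    have sP: "sqrt P > 1" using P by simp
    have "\<forall>k. \<exists>cl. good_code n (R P k) (fst cl) (snd cl)"
      using ex_good_code[OF R0] by (metis fst_conv snd_conv)
    then obtain cl where cl: "\<And>k. good_code n (R P k) (fst (cl k)) (snd (cl k))" by (metis choice)
    define code where "code k = fst (cl k)" for k
    define M where "M k = snd (cl k)" for k
    have gc: "good_code n (R P k) (code k) (M k)" for k using cl by (simp add: code_def M_def)
    define E where "E w i t = (if i \<in> S then complex_of_real (sqrt P powr (u i - \<alpha> i i)) * code i (w i) t else 0)" for w :: "nat \<Rightarrow> nat" and i t
    have wM: "w i < M i" if "w \<in> msg_set K M" "i < K" for w i using that by (auto simp: msg_set_def)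
    have c1: "cmod (code i (w i) t) \<le> 1" if "w \<in> msg_set K M" "i < K" "t < n" for w i t
      using gc[of i] wM[OF that(1,2)] that(3) by (simp add: good_code_def)
    have "\<forall>k<K. 2 powr (real n * R P k) \<le> real (M k)" using gc by (simp add: good_code_def)
    moreover have "\<forall>w\<in>msg_set K M. \<forall>i<K. \<forall>t<n. cmod (E w i t) \<le> 1"
    proof (intro ballI allI impI)
      fix w i t assume w: "w \<in> msg_set K M" "i < K" "t < n"
      have "sqrt P powr (u i - \<alpha> i i) \<le> 1" if "i \<in> S"
        using u(2)[OF that] sP powr_mono[of "u i - \<alpha> i i" 0 "sqrt P"] by simp
      then show "cmod (E w i t) \<le> 1"
        using c1[OF w] by (auto simp: E_def norm_mult intro!: mult_le_one)
    qed
    moreover have "\<not> False \<longrightarrow> (\<forall>w\<in>msg_set K M. \<forall>w'\<in>msg_set K M. \<forall>i<K. w i = w' i \<longrightarrow> E w i = E w' i)"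
      by (auto simp: E_def fun_eq_iff)
    moreover have "\<forall>g w w' k. (\<forall>t<n. \<forall>k<K. \<forall>i<K. dmin \<le> cmod (g t k i) \<and> cmod (g t k i) \<le> dmax) \<longrightarrow>
            w \<in> msg_set K M \<longrightarrow> w' \<in> msg_set K M \<longrightarrow> k < K \<longrightarrow> w k \<noteq> w' k \<longrightarrow>
            16 * real n < (\<Sum>t<n. (cmod (\<Sum>i<K. complex_of_real (sqrt P powr \<alpha> k i) * g t k i * (E w i t - E w' i t)))\<^sup>2)"
    proof (intro allI impI)
      fix g :: "nat \<Rightarrow> nat \<Rightarrow> nat \<Rightarrow> complex" and w w' k
      assume g: "\<forall>t<n. \<forall>k<K. \<forall>i<K. dmin \<le> cmod (g t k i) \<and> cmod (g t k i) \<le> dmax"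
        and w: "w \<in> msg_set K M" "w' \<in> msg_set K M" and k: "k < K" and ne: "w k \<noteq> w' k"
      define \<Delta> where "\<Delta> t = code k (w k) t - code k (w' k) t" for t
      have gk: "R P k > 0" "real n / (98 * 2 powr (R P k)) \<le> (\<Sum>t<n. (cmod (\<Delta> t))\<^sup>2)"
        using gc[of k] wM[OF w(1) k] wM[OF w(2) k] ne by (auto simp: good_code_def \<Delta>_def)
      \<comment> \<open>Two different codewords exist only at a positive rate, so the user must be
        active.\<close>
      have kS: "k \<in> S" using gk(1) by (auto simp: R_def split: if_splits)
      define Z where "Z = sqrt P powr (u k - d k)"
      have Z1: "Z \<ge> 1" unfolding Z_def using sP u(1)[OF kS] by (intro ge_one_powr_ge_zero) auto
      have ZZ: "Z\<^sup>2 = P powr (u k - d k)" unfolding Z_def using P by (intro sqrt_powr_square) simp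
      define T where "T t i = complex_of_real (sqrt P powr \<alpha> k i) * g t k i * (E w i t - E w' i t)" for t i
      have Ediff: "E w i t - E w' i t = complex_of_real (sqrt P powr (u i - \<alpha> i i)) * (code i (w i) t - code i (w' i) t)" if "i \<in> S" for i t
        using that by (simp add: E_def right_diff_distrib)
      have split: "(\<Sum>i<K. T t i) = T t k + (\<Sum>i\<in>{..<K} - {k}. T t i)" for t
        using k by (intro sum.remove) auto
      have Tle: "cmod (T t i) \<le> 2 * dmax * Z" if t: "t < n" and i: "i < K" "i \<noteq> k" for t i
      proof (cases "i \<in> S")
        case True
        have "cmod (T t i) = (sqrt P powr \<alpha> k i * sqrt P powr (u i - \<alpha> i i)) * (cmod (g t k i) * cmod (code i (w i) t - code i (w' i) t))"
          unfolding T_def Ediff[OF True] by (simp add: norm_mult)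
        also have "sqrt P powr \<alpha> k i * sqrt P powr (u i - \<alpha> i i) \<le> Z"
          unfolding Z_def powr_add[symmetric] using ud[OF True kS i(2)] sP by (intro powr_mono) auto
        also have "cmod (g t k i) * cmod (code i (w i) t - code i (w' i) t) \<le> dmax * 2"
        proof (rule mult_mono)
          show "cmod (code i (w i) t - code i (w' i) t) \<le> 2"
            using norm_triangle_ineq4[of "code i (w i) t" "code i (w' i) t"] c1[OF w(1) i(1) t] c1[OF w(2) i(1) t] by linarith
        qed (use g t k i dmax0 in auto)
        finally show ?thesis using Z1 by (simp add: mult_ac mult_left_mono mult_right_mono)
      next
        case False
        then show ?thesis using Z1 dmax0 by (simp add: T_def E_def)
      qed
      have "16 * real n < (\<Sum>t<n. (cmod (T t k + (\<Sum>i\<in>{..<K} - {k}. T t i)))\<^sup>2)"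
      proof (rule separation[OF n Z1])
        fix t assume t: "t < n"
        have "cmod (\<Sum>i\<in>{..<K} - {k}. T t i) \<le> (\<Sum>i\<in>{..<K} - {k}. 2 * dmax * Z)"
          using Tle[OF t] by (intro sum_norm_le) auto
        also have "\<dots> \<le> (\<Sum>i\<in>{..<K}. 2 * dmax * Z)" using dmax0 Z1 by (intro sum_mono2) auto
        also have "\<dots> = Q * Z" by (simp add: Q_def)
        finally show "cmod (\<Sum>i\<in>{..<K} - {k}. T t i) \<le> Q * Z" .
      next
        have "2 powr (R P k) = P powr d k / B"
          using gk(1) kS P B0 powr_rate[of P B "d k"] by (simp add: R_def)
        then have "real n * B / (98 * P powr d k) \<le> (\<Sum>t<n. (cmod (\<Delta> t))\<^sup>2)" using gk(2) by simp
        then have "dmin\<^sup>2 * P powr u k * (real n * B / (98 * P powr d k)) \<le> dmin\<^sup>2 * P powr u k * (\<Sum>t<n. (cmod (\<Delta> t))\<^sup>2)"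
          by (intro mult_left_mono) auto
        moreover have "dmin\<^sup>2 * P powr u k * (real n * B / (98 * P powr d k)) = 2 * (17 + Q\<^sup>2) * Z\<^sup>2 * real n"
          using c(2) P by (simp add: ZZ B_def powr_diff field_simps)
        moreover have "dmin\<^sup>2 * P powr u k * (\<Sum>t<n. (cmod (\<Delta> t))\<^sup>2) \<le> (\<Sum>t<n. (cmod (T t k))\<^sup>2)"
          unfolding sum_distrib_left
        proof (rule sum_mono)
          fix t assume "t \<in> {..<n}"
          then have t: "t < n" by simp
          have "cmod (T t k) = (sqrt P powr \<alpha> k k * sqrt P powr (u k - \<alpha> k k)) * (cmod (g t k k) * cmod (\<Delta> t))"
            unfolding T_def Ediff[OF kS] \<Delta>_def by (simp add: norm_mult)
          also have "sqrt P powr \<alpha> k k * sqrt P powr (u k - \<alpha> k k) = sqrt P powr u k"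
            by (simp add: powr_add[symmetric])
          finally have Tk: "cmod (T t k) = sqrt P powr u k * (cmod (g t k k) * cmod (\<Delta> t))" .
          have "dmin * cmod (\<Delta> t) \<le> cmod (g t k k) * cmod (\<Delta> t)" using g t k by (intro mult_right_mono) auto
          then have "(sqrt P powr u k * (dmin * cmod (\<Delta> t)))\<^sup>2 \<le> (cmod (T t k))\<^sup>2"
            unfolding Tk using c(2) by (intro power_mono mult_left_mono) auto
          moreover have "(sqrt P powr u k * (dmin * cmod (\<Delta> t)))\<^sup>2 = dmin\<^sup>2 * P powr u k * (cmod (\<Delta> t))\<^sup>2"
            using P sqrt_powr_square[of P "u k"] by (simp add: power_mult_distrib)
          ultimately show "dmin\<^sup>2 * P powr u k * (cmod (\<Delta> t))\<^sup>2 \<le> (cmod (T t k))\<^sup>2" by simp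
        qed
        ultimately show "2 * (17 + Q\<^sup>2) * Z\<^sup>2 * real n \<le> (\<Sum>t<n. (cmod (T t k))\<^sup>2)" by linarith
      qed
      then show "16 * real n < (\<Sum>t<n. (cmod (\<Sum>i<K. complex_of_real (sqrt P powr \<alpha> k i) * g t k i * (E w i t - E w' i t)))\<^sup>2)"
        unfolding split[symmetric] by (simp only: T_def[abs_def])
    qed
    ultimately show "\<exists>M E. (\<forall>k<K. 2 powr (real n * R P k) \<le> real (M k)) \<and>
        (\<forall>w\<in>msg_set K M. \<forall>i<K. \<forall>t<n. cmod (E w i t) \<le> 1) \<and>
        (\<not> False \<longrightarrow> (\<forall>w\<in>msg_set K M. \<forall>w'\<in>msg_set K M. \<forall>i<K. w i = w' i \<longrightarrow> E w i = E w' i)) \<and>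
        (\<forall>g w w' k. (\<forall>t<n. \<forall>k<K. \<forall>i<K. dmin \<le> cmod (g t k i) \<and> cmod (g t k i) \<le> dmax) \<longrightarrow>
            w \<in> msg_set K M \<longrightarrow> w' \<in> msg_set K M \<longrightarrow> k < K \<longrightarrow> w k \<noteq> w' k \<longrightarrow>
            16 * real n < (\<Sum>t<n. (cmod (\<Sum>i<K. complex_of_real (sqrt P powr \<alpha> k i) * g t k i * (E w i t - E w' i t)))\<^sup>2))"
      by (intro exI[of _ M] exI[of _ E] conjI)
  qed
  moreover have "((\<lambda>P. R P k / log 2 P) \<longlongrightarrow> d k) at_top" for k
    using tendsto_rate[OF d[of k], of "log 2 B"] d0[of k] by (cases "k \<in> S") (simp_all add: R_def)
  moreover have "\<forall>k. k \<ge> K \<longrightarrow> d k = 0" using S d0 by fastforce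
  ultimately show ?thesis unfolding GDoF_region_def by blast
qed

subsection \<open>The extremal channel\<close>

text \<open>The link from \<open>i\<close> to \<open>k\<close> weakens linearly with the number of
  steps from \<open>i\<close> to \<open>k\<close> around the cycle in one direction; adding
  \<open>K\<close> keeps the difference natural. Thus \<open>delta (cyc K) i j\<close> is the length
  of the directed arc from \<open>i\<close> to \<open>j\<close> on a circle of circumference 1. For
  the cycle through all users in their natural order, the estimates of
  \<open>broadcast_cycle_bound\<close> are then equalities.\<close>

definition cyc :: "nat \<Rightarrow> nat \<Rightarrow> nat \<Rightarrow> real" where
  "cyc K k i = 1 - real ((k + K - i) mod K) / real K"

lemma cyc_diag [simp]: "cyc K k k = 1"
  by (simp add: cyc_def)

lemma cyc_le_1: "cyc K k i \<le> 1"
  by (simp add: cyc_def)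

lemma cyc_nonneg:
  assumes "K \<ge> 1"
  shows "cyc K k i \<ge> 0"
proof -
  have "(k + K - i) mod K \<le> K" using assms by (simp add: less_imp_le)
  then show ?thesis using assms by (simp add: cyc_def divide_simps)
qed

lemma cyc_off_diag:
  assumes "k < K" "i < K" "i \<noteq> k"
  shows "cyc K k i \<le> 1 - 1 / real K"
proof -
  have "(k + K - i) mod K \<noteq> 0"
  proof (cases "i < k")
    case True
    then have "k + K - i = (k - i) + K" using assms by simp
    then have "(k + K - i) mod K = k - i" using assms True by (simp only: mod_add_self2) simp
    then show ?thesis using True by simp
  next
    case False
    then have "k + K - i < K" using assms by simp
    then show ?thesis using assms by simp
  qed
  then have "1 \<le> real ((k + K - i) mod K)" by linarith
  then show ?thesis using assms by (simp add: cyc_def divide_right_mono)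
qed

text \<open>Common codeword at full power, private codewords received at noise level by the other
  users. The common message is carried as part of the message of user 0.\<close>
lemma cyc_broadcast_achievable:
  assumes K: "K \<ge> 1" and adm: "admissible_channel K Gm"
  shows "(\<lambda>k. if k < K then (if k = 0 then 1 else 1 / real K) else 0) \<in> GDoF_region True K (cyc K) Gm"
proof -
  obtain fmax dmin dmax where c: "fmax > 0" "dmin > 0" "dmin \<le> dmax"
    and ad: "\<And>P. P > 1 \<Longrightarrow> admissible_law K fmax dmin dmax (Gm P)"
    using admissible_channelE[OF adm] by blast
  have dmax0: "dmax > 0" using c by linarith
  define Q where "Q = real K * dmax"
  \<comment> \<open>The first summand serves the distance estimates, with
    \<open>3136 = 2 * 16 * 98\<close>. The second ensures that a positive common rate forces
    \<open>sqrt P powr (1 / K) \<ge> 2 * Q / dmin\<close>, so that the direct link outweighs all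
    others together.\<close>
  define B where "B = 3136 * (17 + Q\<^sup>2) / dmin\<^sup>2 + (2 * Q / dmin) ^ (2 * K)"
  have Qd: "2 * Q / dmin \<ge> 1"
  proof -
    have "dmin \<le> 1 * dmax" using c by simp
    also have "\<dots> \<le> real K * dmax" using K dmax0 by (intro mult_right_mono) auto
    finally show ?thesis using c dmax0 by (simp add: Q_def divide_simps)
  qed
  have Bl: "1 \<le> (2 * Q / dmin) ^ (2 * K)" using Qd by (rule one_le_power)
  have B1: "3136 * (17 + Q\<^sup>2) / dmin\<^sup>2 \<ge> 0" using c by simp
  have B0: "B \<ge> 1" unfolding B_def using Bl B1 by linarith
  have Bq: "(2 * Q / dmin) ^ (2 * K) \<le> B" unfolding B_def using B1 by linarith
  have Bd: "3136 * (17 + Q\<^sup>2) \<le> B * dmin\<^sup>2"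
  proof -
    have "3136 * (17 + Q\<^sup>2) / dmin\<^sup>2 \<le> B" unfolding B_def using Bl by linarith
    then show ?thesis using c by (simp add: divide_simps mult.commute)
  qed
  define \<beta> where "\<beta> = 1 / real K"
  have \<beta>: "0 < \<beta>" "\<beta> \<le> 1" using K by (auto simp: \<beta>_def)
  define Rc where "Rc P = max 0 ((1 - \<beta>) * log 2 P - log 2 B)" for P
  define Rp where "Rp P = max 0 (\<beta> * log 2 P - log 2 B)" for P
  define R where "R P k = (if k = 0 then Rc P + Rp P else Rp P)" for P and k :: nat
  have "achievable True K (cyc K) (Gm P) P (R P)" if P: "P > 1" for P
  proof (rule achievable_of_distance[OF ad[OF P] c])
    show "R P k \<ge> 0" for k by (simp add: R_def Rc_def Rp_def)
    fix n :: nat assume n: "n \<ge> 1"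
    have sP: "sqrt P > 1" using P by simp
    have "Rc P \<ge> 0" "Rp P \<ge> 0" by (simp_all add: Rc_def Rp_def)
    then obtain cc Lc cp Lp where gc: "good_code n (Rc P) cc Lc" and gp: "good_code n (Rp P) cp Lp"
      using ex_good_code[of "Rc P" n] ex_good_code[of "Rp P" n] by blast
    have Lp1: "Lp \<ge> 1" using gp by (simp add: good_code_def)
    define M where "M k = (if k = 0 then Lc * Lp else Lp)" for k :: nat
    \<comment> \<open>The index of message 0 encodes a pair: the quotient by \<open>Lp\<close> is
      the common part, the remainder the private part.\<close>
    define com where "com w = w 0 div Lp" for w :: "nat \<Rightarrow> nat"
    define priv where "priv w i = (if i = 0 then w 0 mod Lp else w i)" for w :: "nat \<Rightarrow> nat" and i
    \<comment> \<open>Private power has exponent \<open>- (1 - 1 / K)\<close>: cross links have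
      exponent at most \<open>1 - 1 / K\<close> and deliver private signals at noise level, while
      the direct link leaves \<open>1 / K\<close>.\<close>
    define b where "b = sqrt P powr (- (1 - \<beta>))"
    have b0: "b > 0" unfolding b_def using sP by simp
    have b1: "b \<le> 1" unfolding b_def using sP \<beta> powr_mono[of "- (1 - \<beta>)" 0 "sqrt P"] by simp
    define E where "E w i t = complex_of_real (1 / 2) * cc (com w) t + complex_of_real (b / 2) * cp (priv w i) t" for w i t
    have wM: "w i < M i" if "w \<in> msg_set K M" "i < K" for w i using that by (auto simp: msg_set_def)
    have comL: "com w < Lc" if "w \<in> msg_set K M" for w
      using wM[OF that, of 0] K by (simp add: M_def com_def less_mult_imp_div_less)
    have privL: "priv w i < Lp" if "w \<in> msg_set K M" "i < K" for w i
      using wM[OF that] Lp1 by (auto simp: M_def priv_def)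
    have cc1: "cmod (cc (com w) t) \<le> 1" if "w \<in> msg_set K M" "t < n" for w t
      using gc comL[OF that(1)] that(2) by (simp add: good_code_def)
    have cp1: "cmod (cp (priv w i) t) \<le> 1" if "w \<in> msg_set K M" "i < K" "t < n" for w i t
      using gp privL[OF that(1,2)] that(3) by (simp add: good_code_def)
    have "\<forall>k<K. 2 powr (real n * R P k) \<le> real (M k)"
    proof (intro allI impI)
      fix k
      have "2 powr (real n * Rc P) \<le> real Lc" "2 powr (real n * Rp P) \<le> real Lp"
        using gc gp by (auto simp: good_code_def)
      then show "2 powr (real n * R P k) \<le> real (M k)"
        by (auto simp: R_def M_def distrib_left powr_add intro!: mult_mono)
    qed
    moreover have "\<forall>w\<in>msg_set K M. \<forall>i<K. \<forall>t<n. cmod (E w i t) \<le> 1"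
    proof (intro ballI allI impI)
      fix w i t assume w: "w \<in> msg_set K M" "i < K" "t < n"
      have "cmod (E w i t) \<le> cmod (complex_of_real (1 / 2) * cc (com w) t) + cmod (complex_of_real (b / 2) * cp (priv w i) t)"
        unfolding E_def by (rule norm_triangle_ineq)
      also have "\<dots> = 1 / 2 * cmod (cc (com w) t) + b / 2 * cmod (cp (priv w i) t)"
        using b0 unfolding norm_mult norm_of_real by simp
      also have "\<dots> \<le> 1 / 2 * 1 + 1 / 2 * 1"
        using cc1[OF w(1,3)] cp1[OF w] b0 b1 by (intro add_mono mult_mono) auto
      finally show "cmod (E w i t) \<le> 1" by simp
    qed
    moreover have "\<not> True \<longrightarrow> (\<forall>w\<in>msg_set K M. \<forall>w'\<in>msg_set K M. \<forall>i<K. w i = w' i \<longrightarrow> E w i = E w' i)" by simp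
    moreover have "\<forall>g w w' k. (\<forall>t<n. \<forall>k<K. \<forall>i<K. dmin \<le> cmod (g t k i) \<and> cmod (g t k i) \<le> dmax) \<longrightarrow>
            w \<in> msg_set K M \<longrightarrow> w' \<in> msg_set K M \<longrightarrow> k < K \<longrightarrow> w k \<noteq> w' k \<longrightarrow>
            16 * real n < (\<Sum>t<n. (cmod (\<Sum>i<K. complex_of_real (sqrt P powr cyc K k i) * g t k i * (E w i t - E w' i t)))\<^sup>2)"
    proof (intro allI impI)
      fix g :: "nat \<Rightarrow> nat \<Rightarrow> nat \<Rightarrow> complex" and w w' k
      assume g: "\<forall>t<n. \<forall>k<K. \<forall>i<K. dmin \<le> cmod (g t k i) \<and> cmod (g t k i) \<le> dmax"
        and w: "w \<in> msg_set K M" "w' \<in> msg_set K M" and k: "k < K" and ne: "w k \<noteq> w' k"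
      define h where "h t i = complex_of_real (sqrt P powr cyc K k i) * g t k i" for t i
      define \<Delta>c where "\<Delta>c t = cc (com w) t - cc (com w') t" for t
      define \<Delta>p where "\<Delta>p i t = cp (priv w i) t - cp (priv w' i) t" for i t
      have \<Delta>p2: "cmod (\<Delta>p i t) \<le> 2" if "i < K" "t < n" for i t
        using norm_triangle_ineq4[of "cp (priv w i) t" "cp (priv w' i) t"] cp1[OF w(1) that] cp1[OF w(2) that]
        unfolding \<Delta>p_def by linarith
      have h_le: "cmod (h t i) \<le> sqrt P powr e * dmax" if "t < n" "i < K" "cyc K k i \<le> e" for t i e
      proof -
        have "cmod (h t i) = sqrt P powr cyc K k i * cmod (g t k i)" by (simp add: h_def norm_mult)
        also have "\<dots> \<le> sqrt P powr e * dmax"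
          using that g k sP by (intro mult_mono powr_mono) auto
        finally show ?thesis .
      qed
      have hkk: "dmin * sqrt P \<le> cmod (h t k)" if "t < n" for t
        using that g k sP by (simp add: h_def norm_mult)
      have bP: "b * sqrt P = sqrt P powr \<beta>"
      proof -
        have "b * sqrt P = sqrt P powr (- (1 - \<beta>)) * sqrt P powr 1" using sP by (simp add: b_def)
        also have "\<dots> = sqrt P powr \<beta>" unfolding powr_add[symmetric] by simp
        finally show ?thesis .
      qed
      have bP': "b * sqrt P powr (1 - \<beta>) = 1"
        unfolding b_def powr_add[symmetric] using sP by simp
      have sum_eq: "(\<Sum>i<K. h t i * (E w i t - E w' i t)) = (1 / 2) * (\<Sum>i<K. h t i) * \<Delta>c t + (\<Sum>i<K. h t i * (complex_of_real (b / 2) * \<Delta>p i t))" for t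
      proof -
        have "E w i t - E w' i t = (1 / 2) * \<Delta>c t + complex_of_real (b / 2) * \<Delta>p i t" for i
          by (simp add: E_def \<Delta>c_def \<Delta>p_def algebra_simps)
        then show ?thesis by (simp add: distrib_left sum.distrib sum_distrib_left sum_distrib_right mult_ac)
      qed
      have priv_term: "cmod (h t i * (complex_of_real (b / 2) * \<Delta>p i t)) \<le> dmax * (b * sqrt P powr e)" if "t < n" "i < K" "cyc K k i \<le> e" for t i e
      proof -
        have "cmod (h t i * (complex_of_real (b / 2) * \<Delta>p i t)) = cmod (h t i) * (b / 2 * cmod (\<Delta>p i t))"
          using b0 unfolding norm_mult norm_of_real by simp
        also have "\<dots> \<le> (sqrt P powr e * dmax) * (b / 2 * 2)"
          using h_le[OF that] \<Delta>p2[OF that(2,1)] b0 dmax0 by (intro mult_mono) auto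
        finally show ?thesis by (simp add: mult_ac)
      qed
      have "16 * real n < (\<Sum>t<n. (cmod (\<Sum>i<K. h t i * (E w i t - E w' i t)))\<^sup>2)"
      \<comment> \<open>If the common parts differ, they separate the outputs whatever the private
        parts are. Otherwise the common codeword cancels, and the private parts of user
        \<open>k\<close> must differ.\<close>
      proof (cases "com w = com w'")
        case False
        have gk: "Rc P > 0" "real n / (98 * 2 powr (Rc P)) \<le> (\<Sum>t<n. (cmod (\<Delta>c t))\<^sup>2)"
          using gc comL[OF w(1)] comL[OF w(2)] False by (auto simp: good_code_def \<Delta>c_def)
        have lP: "log 2 P > 0" using P by simp
        have "log 2 B < (1 - \<beta>) * log 2 P" using gk(1) by (simp add: Rc_def)
        also have "\<dots> \<le> 1 * log 2 P" using \<beta> lP by (intro mult_right_mono) auto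
        finally have PB: "B < P" using B0 P by (simp add: log_less_cancel_iff)
        have root: "2 * Q / dmin \<le> sqrt P powr \<beta>"
        proof -
          have "(2 * Q / dmin) ^ (2 * K) \<le> P" using Bq PB by linarith
          also have "P = (sqrt P powr \<beta>) ^ (2 * K)"
          proof -
            have "(sqrt P powr \<beta>) ^ (2 * K) = ((sqrt P powr \<beta>)\<^sup>2) ^ K" by (rule power_mult)
            also have "\<dots> = (P powr \<beta>) ^ K" using P by (subst sqrt_powr_square) auto
            also have "\<dots> = (P powr \<beta>) powr real K" using P by (subst powr_realpow) auto
            also have "\<dots> = P" using P K by (simp add: powr_powr \<beta>_def)
            finally show ?thesis by simp
          qed
          finally show ?thesis using K by (subst (asm) power_mono_iff) (use Qd in auto)
        qed
        \<comment> \<open>The common codeword leaves all antennas, so its effective coefficient is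
          the sum of row \<open>k\<close>. By \<open>root\<close> the direct term is at least twice
          the bound on the rest.\<close>
        have H: "dmin * sqrt P / 2 \<le> cmod (\<Sum>i<K. h t i)" if t: "t < n" for t
        proof -
          have "(\<Sum>i<K. h t i) = h t k + (\<Sum>i\<in>{..<K} - {k}. h t i)" using k by (intro sum.remove) auto
          then have "cmod (h t k) - cmod (\<Sum>i\<in>{..<K} - {k}. h t i) \<le> cmod (\<Sum>i<K. h t i)"
            using norm_diff_ineq[of "h t k" "\<Sum>i\<in>{..<K} - {k}. h t i"] by simp
          moreover have "cmod (\<Sum>i\<in>{..<K} - {k}. h t i) \<le> (\<Sum>i\<in>{..<K} - {k}. sqrt P powr (1 - \<beta>) * dmax)"
            using k t by (intro sum_norm_le h_le) (auto simp: \<beta>_def intro: cyc_off_diag)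
          moreover have "(\<Sum>i\<in>{..<K} - {k}. sqrt P powr (1 - \<beta>) * dmax) \<le> (\<Sum>i\<in>{..<K}. sqrt P powr (1 - \<beta>) * dmax)"
            using dmax0 by (intro sum_mono2) auto
          moreover have "(\<Sum>i\<in>{..<K}. sqrt P powr (1 - \<beta>) * dmax) = Q * sqrt P powr (1 - \<beta>)" by (simp add: Q_def)
          moreover have "Q * sqrt P powr (1 - \<beta>) \<le> dmin * sqrt P / 2"
          proof -
            have "2 * Q \<le> dmin * sqrt P powr \<beta>" using root c by (simp add: divide_simps mult.commute)
            then have "2 * Q * sqrt P powr (1 - \<beta>) \<le> dmin * sqrt P powr \<beta> * sqrt P powr (1 - \<beta>)"
              by (intro mult_right_mono) auto
            also have "\<dots> = dmin * sqrt P" using sP by (simp add: mult.assoc powr_add[symmetric])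
            finally show ?thesis by simp
          qed
          ultimately show ?thesis using hkk[OF t] by linarith
        qed
        \<comment> \<open>Private signals arrive with amplitude of order
          \<open>sqrt P powr (1 / K)\<close> and act as interference for the common
          codeword.\<close>
        define Z where "Z = sqrt P powr \<beta>"
        have Z1: "Z \<ge> 1" unfolding Z_def using sP \<beta> by (intro ge_one_powr_ge_zero) auto
        have ZZ: "Z\<^sup>2 = P powr \<beta>" unfolding Z_def using P by (intro sqrt_powr_square) simp
        show ?thesis unfolding sum_eq
        proof (rule separation[OF n Z1, where Q = Q and p = "\<lambda>t. (1 / 2) * (\<Sum>i<K. h t i) * \<Delta>c t"])
          fix t assume t: "t < n"
          have "cmod (\<Sum>i<K. h t i * (complex_of_real (b / 2) * \<Delta>p i t)) \<le> (\<Sum>i<K. dmax * (b * sqrt P powr 1))"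
            using t by (intro sum_norm_le priv_term) (auto simp: cyc_le_1)
          also have "\<dots> = Q * Z" using bP sP by (simp add: Q_def Z_def)
          finally show "cmod (\<Sum>i<K. h t i * (complex_of_real (b / 2) * \<Delta>p i t)) \<le> Q * Z" .
        next
          have "2 powr (Rc P) = P powr (1 - \<beta>) / B"
            using gk(1) P B0 powr_rate[of P B "1 - \<beta>"] by (simp add: Rc_def)
          then have "real n * B / (98 * P powr (1 - \<beta>)) \<le> (\<Sum>t<n. (cmod (\<Delta>c t))\<^sup>2)" using gk(2) by simp
          then have "dmin\<^sup>2 * P / 16 * (real n * B / (98 * P powr (1 - \<beta>))) \<le> dmin\<^sup>2 * P / 16 * (\<Sum>t<n. (cmod (\<Delta>c t))\<^sup>2)"
            using P by (intro mult_left_mono) auto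
          moreover have "2 * (17 + Q\<^sup>2) * Z\<^sup>2 * real n \<le> dmin\<^sup>2 * P / 16 * (real n * B / (98 * P powr (1 - \<beta>)))"
          proof -
            have "P / P powr (1 - \<beta>) = P powr \<beta>" using P powr_diff[of P 1 "1 - \<beta>"] by simp
            moreover have "dmin\<^sup>2 * P / 16 * (real n * B / (98 * P powr (1 - \<beta>))) = (B * dmin\<^sup>2) / 1568 * (P / P powr (1 - \<beta>) * real n)"
              by (simp add: field_simps)
            ultimately have "dmin\<^sup>2 * P / 16 * (real n * B / (98 * P powr (1 - \<beta>))) = (B * dmin\<^sup>2) / 1568 * (P powr \<beta> * real n)"
              by (simp only:)
            also have "\<dots> \<ge> (3136 * (17 + Q\<^sup>2)) / 1568 * (P powr \<beta> * real n)"
              using Bd by (intro mult_right_mono divide_right_mono) auto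
            also have "(3136 * (17 + Q\<^sup>2)) / 1568 * (P powr \<beta> * real n) = 2 * (17 + Q\<^sup>2) * Z\<^sup>2 * real n" by (simp add: ZZ)
            finally show ?thesis .
          qed
          moreover have "dmin\<^sup>2 * P / 16 * (\<Sum>t<n. (cmod (\<Delta>c t))\<^sup>2) \<le> (\<Sum>t<n. (cmod ((1 / 2) * (\<Sum>i<K. h t i) * \<Delta>c t))\<^sup>2)"
            unfolding sum_distrib_left[of "dmin\<^sup>2 * P / 16"]
          proof (rule sum_mono)
            fix t assume "t \<in> {..<n}"
            then have t: "t < n" by simp
            have "dmin * sqrt P / 2 * cmod (\<Delta>c t) / 2 \<le> cmod (\<Sum>i<K. h t i) * cmod (\<Delta>c t) / 2"
              using H[OF t] by (intro divide_right_mono mult_right_mono) auto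
            also have "\<dots> = cmod ((1 / 2) * (\<Sum>i<K. h t i) * \<Delta>c t)" unfolding norm_mult by simp
            finally have "(dmin * sqrt P / 2 * cmod (\<Delta>c t) / 2)\<^sup>2 \<le> (cmod ((1 / 2) * (\<Sum>i<K. h t i) * \<Delta>c t))\<^sup>2"
              using c P by (intro power_mono) auto
            moreover have "(dmin * sqrt P / 2 * cmod (\<Delta>c t) / 2)\<^sup>2 = dmin\<^sup>2 * P / 16 * (cmod (\<Delta>c t))\<^sup>2"
              using P by (simp add: power_mult_distrib power_divide)
            ultimately show "dmin\<^sup>2 * P / 16 * (cmod (\<Delta>c t))\<^sup>2 \<le> (cmod ((1 / 2) * (\<Sum>i<K. h t i) * \<Delta>c t))\<^sup>2" by simp
          qed
          ultimately show "2 * (17 + Q\<^sup>2) * Z\<^sup>2 * real n \<le> (\<Sum>t<n. (cmod ((1 / 2) * (\<Sum>i<K. h t i) * \<Delta>c t))\<^sup>2)" by linarith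
        qed
      next
        case True
        have pne: "priv w k \<noteq> priv w' k"
        proof (cases "k = 0")
          case True
          show ?thesis
          proof
            assume "priv w k = priv w' k"
            then have "w 0 mod Lp = w' 0 mod Lp" using True by (simp add: priv_def)
            moreover have "w 0 div Lp = w' 0 div Lp" using \<open>com w = com w'\<close> by (simp add: com_def)
            ultimately have "w 0 = w' 0" by (metis div_mod_decomp)
            then show False using ne True by simp
          qed
        qed (use ne in \<open>simp add: priv_def\<close>)
        have gk: "Rp P > 0" "real n / (98 * 2 powr (Rp P)) \<le> (\<Sum>t<n. (cmod (\<Delta>p k t))\<^sup>2)"
          using gp privL[OF w(1) k] privL[OF w(2) k] pne by (auto simp: good_code_def \<Delta>p_def)
        have c0: "\<Delta>c t = 0" for t using True by (simp add: \<Delta>c_def)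
        define T where "T t i = h t i * (complex_of_real (b / 2) * \<Delta>p i t)" for t i
        have split: "(\<Sum>i<K. h t i * (E w i t - E w' i t)) = T t k + (\<Sum>i\<in>{..<K} - {k}. T t i)" for t
        proof -
          have "(\<Sum>i<K. h t i * (E w i t - E w' i t)) = (\<Sum>i<K. T t i)" unfolding sum_eq c0 T_def by simp
          also have "\<dots> = T t k + (\<Sum>i\<in>{..<K} - {k}. T t i)" using k by (intro sum.remove) auto
          finally show ?thesis .
        qed
        show ?thesis unfolding split
        proof (rule separation[OF n order_refl, where Q = Q and p = "\<lambda>t. T t k"])
          fix t assume t: "t < n"
          have "cmod (\<Sum>i\<in>{..<K} - {k}. T t i) \<le> (\<Sum>i\<in>{..<K} - {k}. dmax * (b * sqrt P powr (1 - \<beta>)))"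
            unfolding T_def using t k by (intro sum_norm_le priv_term) (auto simp: \<beta>_def intro: cyc_off_diag)
          also have "\<dots> \<le> (\<Sum>i\<in>{..<K}. dmax)" unfolding bP' mult_1_right using dmax0 by (intro sum_mono2) auto
          also have "\<dots> = Q * 1" by (simp add: Q_def)
          finally show "cmod (\<Sum>i\<in>{..<K} - {k}. T t i) \<le> Q * 1" .
        next
          have "2 powr (Rp P) = P powr \<beta> / B"
            using gk(1) P B0 powr_rate[of P B \<beta>] by (simp add: Rp_def)
          then have "real n * B / (98 * P powr \<beta>) \<le> (\<Sum>t<n. (cmod (\<Delta>p k t))\<^sup>2)" using gk(2) by simp
          then have "dmin\<^sup>2 * P powr \<beta> / 4 * (real n * B / (98 * P powr \<beta>)) \<le> dmin\<^sup>2 * P powr \<beta> / 4 * (\<Sum>t<n. (cmod (\<Delta>p k t))\<^sup>2)"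
            using P by (intro mult_left_mono) auto
          moreover have "2 * (17 + Q\<^sup>2) * 1\<^sup>2 * real n \<le> dmin\<^sup>2 * P powr \<beta> / 4 * (real n * B / (98 * P powr \<beta>))"
          proof -
            have "dmin\<^sup>2 * P powr \<beta> / 4 * (real n * B / (98 * P powr \<beta>)) = (B * dmin\<^sup>2) / 392 * real n"
              using P by (simp add: field_simps)
            also have "\<dots> \<ge> (3136 * (17 + Q\<^sup>2)) / 392 * real n"
              using Bd by (intro mult_right_mono divide_right_mono) auto
            also have "(3136 * (17 + Q\<^sup>2)) / 392 * real n = 4 * (2 * (17 + Q\<^sup>2) * 1\<^sup>2 * real n)" by simp
            also have "\<dots> \<ge> 1 * (2 * (17 + Q\<^sup>2) * 1\<^sup>2 * real n)" by (intro mult_right_mono) auto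
            finally show ?thesis by (simp only: mult_1)
          qed
          moreover have "dmin\<^sup>2 * P powr \<beta> / 4 * (\<Sum>t<n. (cmod (\<Delta>p k t))\<^sup>2) \<le> (\<Sum>t<n. (cmod (T t k))\<^sup>2)"
            unfolding sum_distrib_left
          proof (rule sum_mono)
            fix t assume "t \<in> {..<n}"
            then have t: "t < n" by simp
            have "(dmin * sqrt P) * (b / 2 * cmod (\<Delta>p k t)) \<le> cmod (h t k) * (b / 2 * cmod (\<Delta>p k t))"
              using hkk[OF t] b0 by (intro mult_right_mono) auto
            also have "\<dots> = cmod (T t k)" using b0 unfolding T_def norm_mult norm_of_real by simp
            finally have "((dmin * sqrt P) * (b / 2 * cmod (\<Delta>p k t)))\<^sup>2 \<le> (cmod (T t k))\<^sup>2"
              using c P b0 by (intro power_mono) auto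
            moreover have "((dmin * sqrt P) * (b / 2 * cmod (\<Delta>p k t)))\<^sup>2 = dmin\<^sup>2 * P powr \<beta> / 4 * (cmod (\<Delta>p k t))\<^sup>2"
            proof -
              have "(dmin * sqrt P) * (b / 2 * cmod (\<Delta>p k t)) = dmin * (b * sqrt P) / 2 * cmod (\<Delta>p k t)" by simp
              also have "\<dots> = dmin * sqrt P powr \<beta> / 2 * cmod (\<Delta>p k t)" by (simp only: bP)
              finally have "((dmin * sqrt P) * (b / 2 * cmod (\<Delta>p k t)))\<^sup>2 = (dmin * sqrt P powr \<beta> / 2 * cmod (\<Delta>p k t))\<^sup>2" by (simp only:)
              then show ?thesis using P sqrt_powr_square[of P \<beta>] by (simp only: power_mult_distrib power_divide) simp
            qed
            ultimately show "dmin\<^sup>2 * P powr \<beta> / 4 * (cmod (\<Delta>p k t))\<^sup>2 \<le> (cmod (T t k))\<^sup>2" by simp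
          qed
          ultimately show "2 * (17 + Q\<^sup>2) * 1\<^sup>2 * real n \<le> (\<Sum>t<n. (cmod (T t k))\<^sup>2)" by linarith
        qed
      qed
      then show "16 * real n < (\<Sum>t<n. (cmod (\<Sum>i<K. complex_of_real (sqrt P powr cyc K k i) * g t k i * (E w i t - E w' i t)))\<^sup>2)"
        by (simp only: h_def)
    qed
    ultimately show "\<exists>M E. (\<forall>k<K. 2 powr (real n * R P k) \<le> real (M k)) \<and>
        (\<forall>w\<in>msg_set K M. \<forall>i<K. \<forall>t<n. cmod (E w i t) \<le> 1) \<and>
        (\<not> True \<longrightarrow> (\<forall>w\<in>msg_set K M. \<forall>w'\<in>msg_set K M. \<forall>i<K. w i = w' i \<longrightarrow> E w i = E w' i)) \<and>
        (\<forall>g w w' k. (\<forall>t<n. \<forall>k<K. \<forall>i<K. dmin \<le> cmod (g t k i) \<and> cmod (g t k i) \<le> dmax) \<longrightarrow>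
            w \<in> msg_set K M \<longrightarrow> w' \<in> msg_set K M \<longrightarrow> k < K \<longrightarrow> w k \<noteq> w' k \<longrightarrow>
            16 * real n < (\<Sum>t<n. (cmod (\<Sum>i<K. complex_of_real (sqrt P powr cyc K k i) * g t k i * (E w i t - E w' i t)))\<^sup>2))"
      by (intro exI[of _ M] exI[of _ E] conjI)
  qed
  moreover have "((\<lambda>P. R P k / log 2 P) \<longlongrightarrow> (if k < K then (if k = 0 then 1 else 1 / real K) else 0)) at_top" if "k < K" for k
  proof -
    have rc: "((\<lambda>P. Rc P / log 2 P) \<longlongrightarrow> 1 - \<beta>) at_top" unfolding Rc_def using \<beta> by (intro tendsto_rate) simp
    have rp: "((\<lambda>P. Rp P / log 2 P) \<longlongrightarrow> \<beta>) at_top" unfolding Rp_def using \<beta> by (intro tendsto_rate) simp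
    show ?thesis
    proof (cases "k = 0")
      case True
      then show ?thesis using tendsto_add[OF rc rp] K by (simp add: R_def add_divide_distrib)
    next
      case False
      then show ?thesis using rp that by (simp add: R_def \<beta>_def)
    qed
  qed
  ultimately show ?thesis unfolding GDoF_region_def by (intro CollectI conjI exI[of _ R] allI impI) simp_all
qed

subsection \<open>Paths and cycles in the CTIN regime\<close>

lemma CTIN_nonneg: "\<alpha> \<in> A_CTIN K \<Longrightarrow> i < K \<Longrightarrow> j < K \<Longrightarrow> \<alpha> i j \<ge> 0"
  by (simp add: A_CTIN_def)

lemma CTIN_pair: "\<alpha> \<in> A_CTIN K \<Longrightarrow> i < K \<Longrightarrow> j < K \<Longrightarrow> i \<noteq> j \<Longrightarrow> \<alpha> i j + \<alpha> j i \<le> \<alpha> i i"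
  unfolding A_CTIN_def by (metis (mono_tags, lifting) max.bounded_iff mem_Collect_eq)

lemma CTIN_triple:
  "\<alpha> \<in> A_CTIN K \<Longrightarrow> i < K \<Longrightarrow> j < K \<Longrightarrow> k < K \<Longrightarrow> i \<noteq> j \<Longrightarrow> i \<noteq> k \<Longrightarrow> \<alpha> i k + \<alpha> j i - \<alpha> j k \<le> \<alpha> i i"
  unfolding A_CTIN_def by (metis (mono_tags, lifting) max.bounded_iff mem_Collect_eq)

lemma CTIN_row_le:
  assumes "\<alpha> \<in> A_CTIN K" "i < K" "j < K"
  shows "\<alpha> i j \<le> \<alpha> i i"
  using CTIN_pair[OF assms] CTIN_nonneg[OF assms(1,3,2)] by (cases "i = j") auto

lemma delta_nonneg:
  assumes "\<alpha> \<in> A_CTIN K" "i < K" "j < K"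
  shows "delta \<alpha> i j \<ge> 0"
  using CTIN_pair[OF assms] CTIN_nonneg[OF assms] by (cases "i = j") (auto simp: delta_def)

text \<open>By the triple condition receiver \<open>i\<close> has its largest advantage over
  \<open>j\<close> at its own input. So \<open>delta \<alpha> i j\<close> is the exponent gap that
  aligned images charge for a hop from \<open>j\<close> to \<open>i\<close>.\<close>

lemma row_diff_le_delta:
  assumes "\<alpha> \<in> A_CTIN K" "i < K" "j < K" "m < K" "i \<noteq> j"
  shows "\<alpha> i m - \<alpha> j m \<le> delta \<alpha> i j"
  using CTIN_triple[OF assms(1-5)] assms(5) by (cases "m = i") (auto simp: delta_def)

lemma delta_pair_ge:
  assumes "\<alpha> \<in> A_CTIN K" "i < K" "j < K" "i \<noteq> j"
  shows "\<alpha> i i \<le> delta \<alpha> i j + delta \<alpha> j i"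
  using CTIN_pair[of \<alpha> K j i] assms by (simp add: delta_def)

text \<open>The triple condition at the middle vertex \<open>k\<close>; coinciding indices need only
  nonnegativity.\<close>

lemma delta_triangle:
  assumes "\<alpha> \<in> A_CTIN K" "i < K" "j < K" "k < K"
  shows "delta \<alpha> i j \<le> delta \<alpha> i k + delta \<alpha> k j"
proof -
  consider "i = j" | "k = i" | "k = j" | "i \<noteq> j" "k \<noteq> i" "k \<noteq> j" by blast
  then show ?thesis
  proof cases
    case 1
    then show ?thesis using delta_nonneg[OF assms(1,2,4)] delta_nonneg[OF assms(1,4,3)] by (simp add: delta_def)
  next
    case 4
    then show ?thesis using CTIN_triple[OF assms(1,4,3,2)] by (simp add: delta_def)
  qed (simp_all add: delta_def)
qed

section \<open>Weights of paths and cycles\<close>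

fun dpath :: "(nat \<Rightarrow> nat \<Rightarrow> real) \<Rightarrow> nat list \<Rightarrow> real" where
  "dpath \<alpha> (x # y # zs) = delta \<alpha> x y + dpath \<alpha> (y # zs)"
| "dpath \<alpha> _ = 0"

lemma dpath_sum: "dpath \<alpha> xs = (\<Sum>m<length xs - 1. delta \<alpha> (xs ! m) (xs ! Suc m))"
proof (induction \<alpha> xs rule: dpath.induct)
  case (1 \<alpha> x y zs)
  have "(\<Sum>m<Suc (length zs). delta \<alpha> ((x # y # zs) ! m) ((x # y # zs) ! Suc m))
      = delta \<alpha> x y + (\<Sum>m<length zs. delta \<alpha> ((y # zs) ! m) ((y # zs) ! Suc m))"
    by (subst sum.lessThan_Suc_shift) simp
  then show ?case using 1 by simp
qed auto

lemma dpath_append: "dpath \<alpha> (as @ i # bs) = dpath \<alpha> (as @ [i]) + dpath \<alpha> (i # bs)"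
proof (induction as)
  case (Cons x as)
  then show ?case by (cases as) auto
qed simp

lemma delta_le_dpath:
  assumes "\<alpha> \<in> A_CTIN K" "xs \<noteq> []" "set xs \<subseteq> {..<K}"
  shows "delta \<alpha> (hd xs) (last xs) \<le> dpath \<alpha> xs"
  using assms(2,3)
proof (induction \<alpha>' \<equiv> \<alpha> xs rule: dpath.induct)
  case (1 x y zs)
  have "last (y # zs) \<in> set (y # zs)" by (rule last_in_set) simp
  then have "last (y # zs) < K" using "1.prems" by auto
  then have "delta \<alpha> x (last (y # zs)) \<le> delta \<alpha> x y + delta \<alpha> y (last (y # zs))"
    using "1.prems" by (intro delta_triangle[OF assms(1)]) auto
  also have "delta \<alpha> y (last (y # zs)) \<le> dpath \<alpha> (y # zs)" using 1 by simp
  finally show ?case by simp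
qed (auto simp: delta_def)

text \<open>\<open>Delta\<close> without its special case: a singleton gets weight 0 here instead of
  its direct link.\<close>

definition csum :: "(nat \<Rightarrow> nat \<Rightarrow> real) \<Rightarrow> nat list \<Rightarrow> real" where
  "csum \<alpha> xs = (\<Sum>m<length xs. delta \<alpha> (xs ! m) (xs ! ((m + 1) mod length xs)))"

lemma csum_eq:
  assumes "xs \<noteq> []"
  shows "csum \<alpha> xs = dpath \<alpha> xs + delta \<alpha> (last xs) (hd xs)"
proof -
  obtain l where l: "length xs = Suc l" using assms by (cases xs) auto
  have "csum \<alpha> xs = (\<Sum>m<l. delta \<alpha> (xs ! m) (xs ! ((m + 1) mod Suc l))) + delta \<alpha> (xs ! l) (xs ! ((l + 1) mod Suc l))"
    by (simp add: csum_def l)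
  also have "(\<Sum>m<l. delta \<alpha> (xs ! m) (xs ! ((m + 1) mod Suc l))) = dpath \<alpha> xs"
    by (simp add: dpath_sum l)
  finally show ?thesis using assms l by (simp add: last_conv_nth hd_conv_nth)
qed

lemma Delta_eq: "length \<pi> \<noteq> 1 \<Longrightarrow> Delta \<alpha> \<pi> = csum \<alpha> \<pi>"
  by (simp add: Delta_def csum_def)

text \<open>Rotation only permutes the edges. The list \<open>rotate r [0..<M]\<close> enumerates
  the same indices without repetition, which turns the cyclic reindexing into a sum over a
  set.\<close>

lemma csum_rotate: "csum \<alpha> (rotate r xs) = csum \<alpha> xs"
proof (cases "xs = []")
  case False
  define M where "M = length xs"
  have M: "M > 0" using False by (simp add: M_def)
  define f where "f m = delta \<alpha> (xs ! m) (xs ! ((m + 1) mod M))" for m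
  have "csum \<alpha> (rotate r xs) = (\<Sum>m<M. f ((r + m) mod M))"
    unfolding csum_def f_def length_rotate M_def[symmetric]
  proof (rule sum.cong)
    fix m assume "m \<in> {..<M}"
    then show "delta \<alpha> (rotate r xs ! m) (rotate r xs ! ((m + 1) mod M)) = delta \<alpha> (xs ! ((r + m) mod M)) (xs ! (((r + m) mod M + 1) mod M))"
      using M by (simp add: nth_rotate M_def[symmetric] mod_simps add.commute add.left_commute)
  qed simp
  also have "\<dots> = (\<Sum>m<M. f (rotate r [0..<M] ! m))"
    using M by (intro sum.cong refl) (simp add: nth_rotate)
  also have "\<dots> = sum_list (map f (rotate r [0..<M]))"
    by (simp add: sum_list_sum_nth atLeast0LessThan)
  also have "\<dots> = (\<Sum>m<M. f m)"
    by (subst sum_list_distinct_conv_sum_set) (auto simp: atLeast0LessThan)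
  finally show ?thesis by (simp add: csum_def f_def M_def)
qed simp

section \<open>Broadcast tuples, the TIN polyhedron and the interference channel\<close>

lemma GDoF_nonneg:
  assumes "d \<in> GDoF_region b K \<alpha> Gm" "k < K"
  shows "d k \<ge> 0"
proof -
  obtain R where R: "\<And>P. P > 1 \<Longrightarrow> achievable b K \<alpha> (Gm P) P (R P)"
      "((\<lambda>P. R P k / log 2 P) \<longlongrightarrow> d k) at_top"
    using assms unfolding GDoF_region_def by blast
  have "\<forall>\<^sub>F P in at_top. 0 \<le> R P k / log 2 P"
    using eventually_gt_at_top[of 1]
  proof eventually_elim
    case (elim P)
    then show ?case using R(1)[OF elim] assms(2) by (simp add: achievable_def)
  qed
  then show ?thesis by (rule tendsto_lowerbound[OF R(2)]) simp
qed

lemma GDoF_IC_subset_BC: "GDoF_region False K \<alpha> Gm \<subseteq> GDoF_region True K \<alpha> Gm"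
proof -
  have "achievable False K \<alpha> G P R \<Longrightarrow> achievable True K \<alpha> G P R" for G P R
  proof -
    \<comment> \<open>The conjuncts are abstracted to predicates, so that changing the flag becomes
      a propositional step under the quantifiers.\<close>
    have *: "\<forall>\<epsilon>>0::real. \<exists>N. \<forall>n\<ge>N::nat. \<exists>M E D. p n M \<and> q n M E \<and> (\<not> True \<longrightarrow> r M E) \<and> s \<epsilon> n M E D"
      if *: "\<forall>\<epsilon>>0::real. \<exists>N. \<forall>n\<ge>N::nat. \<exists>M E D. p n M \<and> q n M E \<and> (\<not> False \<longrightarrow> r M E) \<and> s \<epsilon> n M E D"
      for p :: "nat \<Rightarrow> 'm \<Rightarrow> bool" and q :: "nat \<Rightarrow> 'm \<Rightarrow> 'e \<Rightarrow> bool" and r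
        and s :: "real \<Rightarrow> nat \<Rightarrow> 'm \<Rightarrow> 'e \<Rightarrow> 'd \<Rightarrow> bool"
    proof (intro allI impI)
      fix \<epsilon> :: real
      assume "\<epsilon> > 0"
      then obtain N where "\<forall>n\<ge>N. \<exists>M E D. p n M \<and> q n M E \<and> (\<not> False \<longrightarrow> r M E) \<and> s \<epsilon> n M E D" using * by blast
      then show "\<exists>N. \<forall>n\<ge>N. \<exists>M E D. p n M \<and> q n M E \<and> (\<not> True \<longrightarrow> r M E) \<and> s \<epsilon> n M E D" by fast
    qed
    assume "achievable False K \<alpha> G P R"
    then show "achievable True K \<alpha> G P R"
      unfolding achievable_def by (elim conjE) (rule conjI, assumption, rule *)
  qed
  then show ?thesis unfolding GDoF_region_def by blast
qed

text \<open>The chain of receivers runs against the path. It starts at \<open>last xs\<close>, whose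
  output is bounded by its direct link, the largest entry of its row; a hop from a vertex back to
  its predecessor costs the weight of the edge between them.\<close>

lemma broadcast_path_bound:
  assumes \<alpha>: "\<alpha> \<in> A_CTIN K" and K: "K \<ge> 1" and adm: "admissible_channel K Gm" and d: "d \<in> GDoF_region b K \<alpha> Gm"
    and xs: "xs \<noteq> []" "distinct xs" "set xs \<subseteq> {..<K}"
  shows "(\<Sum>k\<in>set xs. d k) \<le> \<alpha> (last xs) (last xs) + dpath \<alpha> xs"
proof -
  define ks where "ks = rev xs"
  define M where "M = length xs"
  have ks: "ks \<noteq> []" "distinct ks" "set ks \<subseteq> {..<K}" using xs by (auto simp: ks_def)
  have ksK: "ks ! l < K" if "l < M" for l
    using ks(3) nth_mem[of l ks] that by (auto simp: ks_def M_def)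
  have k0: "ks ! 0 = last xs" using xs(1) by (simp add: ks_def rev_nth last_conv_nth)
  \<comment> \<open>The value 0 past the last hop meets the demand for nonnegativity at every
    index.\<close>
  define e where "e l = (if Suc l < M then delta \<alpha> (ks ! Suc l) (ks ! l) else 0)" for l
  have "(\<Sum>k\<in>set ks. d k) \<le> \<alpha> (last xs) (last xs) + (\<Sum>l<length ks - 1. e l)"
  proof (rule GDoF_broadcast_bound[OF K adm d ks])
    show "e l \<ge> 0" for l using ksK by (auto simp: e_def intro!: delta_nonneg[OF \<alpha>])
    show "\<alpha> (ks ! Suc l) i - \<alpha> (ks ! l) i \<le> e l" if "Suc l < length ks" "i < K" for l i
    proof -
      have l: "Suc l < M" "l < M" using that(1) by (auto simp: ks_def M_def)
      have "ks ! Suc l \<noteq> ks ! l" using ks(2) that(1) by (simp add: nth_eq_iff_index_eq)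
      then show ?thesis using l ksK that(2) by (auto simp: e_def intro!: row_diff_le_delta[OF \<alpha>])
    qed
    have lK: "last xs < K" using xs last_in_set by blast
    show "\<alpha> (last xs) (last xs) \<ge> 0" using CTIN_nonneg[OF \<alpha> lK lK] .
    show "\<alpha> (ks ! 0) i \<le> \<alpha> (last xs) (last xs)" if "i < K" for i
      unfolding k0 using CTIN_row_le[OF \<alpha> lK that] .
  qed
  also have "(\<Sum>l<length ks - 1. e l) = dpath \<alpha> xs"
  proof -
    have "(\<Sum>l<length ks - 1. e l) = (\<Sum>l<M - 1. delta \<alpha> (xs ! (M - 1 - Suc l)) (xs ! Suc (M - 1 - Suc l)))"
      by (intro sum.cong) (auto simp: ks_def M_def e_def rev_nth Suc_diff_Suc)
    also have "\<dots> = (\<Sum>m<M - 1. delta \<alpha> (xs ! m) (xs ! Suc m))"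
      by (rule sum.nat_diff_reindex)
    finally show ?thesis by (simp add: dpath_sum M_def)
  qed
  finally show ?thesis by (simp add: ks_def)
qed

text \<open>The path bounds for the rotations of a cycle omit one edge each; omitting a longest edge saves
  at least the fraction \<open>1 / M\<close> of the cycle, while the starting term \<open>\<alpha> i i\<close> is at most the whole cycle.\<close>
lemma broadcast_cycle_bound:
  assumes \<alpha>: "\<alpha> \<in> A_CTIN K" and K: "K \<ge> 1" and adm: "admissible_channel K Gm" and d: "d \<in> GDoF_region b K \<alpha> Gm"
    and \<pi>: "is_cycle K \<pi>"
  shows "(\<Sum>k\<in>set \<pi>. d k) \<le> (2 - 1 / real K) * Delta \<alpha> \<pi>"
proof (cases "length \<pi> = 1")
  case True
  then obtain i where i: "\<pi> = [i]" by (auto simp: length_Suc_conv)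
  then have iK: "i < K" using \<pi> by (simp add: is_cycle_def)
  have "(\<Sum>k\<in>set \<pi>. d k) \<le> \<alpha> i i"
    using broadcast_path_bound[OF \<alpha> K adm d, of "[i]"] iK i by simp
  also have "\<dots> = 1 * \<alpha> i i" by simp
  also have "\<dots> \<le> (2 - 1 / real K) * \<alpha> i i"
    using K CTIN_nonneg[OF \<alpha> iK iK] by (intro mult_right_mono) (auto simp: divide_simps)
  finally show ?thesis by (simp add: Delta_def i)
next
  case False
  define M where "M = length \<pi>"
  have M2: "M \<ge> 2" using False \<pi> by (cases \<pi>) (auto simp: M_def is_cycle_def Suc_le_eq)
  have MK: "M \<le> K" using \<pi> card_mono[of "{..<K}" "set \<pi>"] by (simp add: M_def is_cycle_def distinct_card)
  define S where "S = csum \<alpha> \<pi>"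
  define f where "f m = delta \<alpha> (\<pi> ! m) (\<pi> ! ((m + 1) mod M))" for m
  have Sf: "S = (\<Sum>m<M. f m)" by (simp add: S_def csum_def f_def M_def)
  have "\<exists>m<M. S / real M \<le> f m"
  proof (rule ccontr)
    assume "\<not> ?thesis"
    then have "(\<Sum>m<M. f m) < (\<Sum>m<M. S / real M)" using M2 by (intro sum_strict_mono) (auto simp: not_le lessThan_empty_iff)
    then show False using Sf M2 by simp
  qed
  then obtain m where m: "m < M" "S / real M \<le> f m" by blast
  \<comment> \<open>This rotation starts right after the heavy edge, which thereby becomes the
    closing edge that the path bound omits.\<close>
  define ys where "ys = rotate (Suc m) \<pi>"
  have ys: "ys \<noteq> []" "distinct ys" "set ys \<subseteq> {..<K}" "length ys = M" "set ys = set \<pi>"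
    using \<pi> by (auto simp: ys_def is_cycle_def M_def)
  have lst: "last ys = \<pi> ! m"
  proof -
    have "last ys = ys ! (M - 1)" using ys by (simp add: last_conv_nth)
    also have "\<dots> = \<pi> ! ((Suc m + (M - 1)) mod M)" unfolding ys_def M_def
      using M2 by (intro nth_rotate) (simp add: M_def)
    also have "Suc m + (M - 1) = m + M" using M2 by simp
    also have "(m + M) mod M = m" using m(1) by simp
    finally show ?thesis .
  qed
  have hds: "hd ys = \<pi> ! ((m + 1) mod M)"
  proof -
    have "hd ys = ys ! 0" using ys by (simp add: hd_conv_nth)
    also have "\<dots> = \<pi> ! ((Suc m + 0) mod M)" unfolding ys_def M_def
      using M2 by (intro nth_rotate) (auto simp: M_def)
    finally show ?thesis by simp
  qed
  have Sy: "S = dpath \<alpha> ys + delta \<alpha> (last ys) (hd ys)"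
    using csum_eq[OF ys(1), of \<alpha>] csum_rotate[of \<alpha> "Suc m" \<pi>] by (simp only: S_def ys_def)
  have lK: "last ys < K" "hd ys < K" using ys(1,3) last_in_set hd_in_set by blast+
  have hl: "last ys \<noteq> hd ys"
    using ys(1,2,4) M2 by (simp add: last_conv_nth hd_conv_nth nth_eq_iff_index_eq)
  \<comment> \<open>The pair condition gives a closed walk of two edges. One is the closing edge of
    the cycle, the other is at most the path by the triangle inequality.\<close>
  have "\<alpha> (last ys) (last ys) \<le> delta \<alpha> (last ys) (hd ys) + delta \<alpha> (hd ys) (last ys)"
    by (rule delta_pair_ge[OF \<alpha> lK hl])
  also have "delta \<alpha> (hd ys) (last ys) \<le> dpath \<alpha> ys" by (rule delta_le_dpath[OF \<alpha> ys(1,3)])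
  finally have aS: "\<alpha> (last ys) (last ys) \<le> S" using Sy by simp
  have S0: "S \<ge> 0" using aS CTIN_nonneg[OF \<alpha> lK(1) lK(1)] by linarith
  have "(\<Sum>k\<in>set \<pi>. d k) \<le> \<alpha> (last ys) (last ys) + dpath \<alpha> ys"
    using broadcast_path_bound[OF \<alpha> K adm d ys(1-3)] ys(5) by simp
  also have "\<dots> \<le> S + (S - S / real M)"
    using aS Sy m(2) by (simp add: f_def lst hds)
  also have "\<dots> = (2 - 1 / real M) * S" by (simp add: algebra_simps)
  also have "\<dots> \<le> (2 - 1 / real K) * S"
    using S0 MK M2 by (intro mult_right_mono) (auto simp: frac_le)
  finally show ?thesis using False by (simp add: Delta_eq S_def)
qed

lemma broadcast_scaled_in_PTIN:
  assumes \<alpha>: "\<alpha> \<in> A_CTIN K" and K: "K \<ge> 1" and adm: "admissible_channel K Gm" and d: "d \<in> GDoF_region b K \<alpha> Gm"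
  shows "(\<lambda>k. d k / (2 - 1 / real K)) \<in> D_PTIN K \<alpha> {..<K}"
proof -
  have \<beta>: "2 - 1 / real K > 0" using K by (simp add: divide_simps)
  have "(\<Sum>k\<in>set \<pi>. d k / (2 - 1 / real K)) \<le> Delta \<alpha> \<pi>" if "is_cycle K \<pi>" for \<pi>
    using broadcast_cycle_bound[OF \<alpha> K adm d that] \<beta>
    by (simp add: sum_divide_distrib[symmetric] pos_divide_le_eq mult.commute)
  moreover have "\<forall>k. k \<ge> K \<longrightarrow> d k = 0" using d by (simp add: GDoF_region_def)
  ultimately show ?thesis
    using GDoF_nonneg[OF d] \<beta> by (auto simp: D_PTIN_def intro!: divide_nonneg_nonneg)
qed

text \<open>The received power levels \<open>u i\<close> are shortest-path potentials for the edge weights \<open>delta i j - d j\<close>;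
  the cycle constraints say that there is no negative cycle.\<close>
lemma PTIN_subset_IC:
  assumes \<alpha>: "\<alpha> \<in> A_CTIN K" and K: "K \<ge> 1" and adm: "admissible_channel K Gm" and S: "S \<subseteq> {..<K}"
    and dP: "d \<in> D_PTIN K \<alpha> S"
  shows "d \<in> GDoF_region False K \<alpha> Gm"
proof -
  have d0: "d k = 0" if "k \<notin> S" for k using dP that by (cases "k < K") (auto simp: D_PTIN_def)
  have dpos: "d k \<ge> 0" for k using dP d0 by (cases "k \<in> S") (auto simp: D_PTIN_def)
  have cyc: "(\<Sum>k\<in>set xs. d k) \<le> Delta \<alpha> xs" if "xs \<noteq> []" "distinct xs" "set xs \<subseteq> S" for xs
    using dP that S by (auto simp: D_PTIN_def is_cycle_def)
  define paths where "paths i = {xs. xs \<noteq> [] \<and> distinct xs \<and> set xs \<subseteq> S \<and> hd xs = i}" for i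
  \<comment> \<open>The cost of a walk that follows a path and then stops, where each vertex entered
    after the first is credited its \<open>d\<close> and stopping at \<open>v\<close> costs
    \<open>\<alpha> v v\<close>. Stopping at once is what gives
    \<open>u i \<le> \<alpha> i i\<close>.\<close>
  define val where "val xs = dpath \<alpha> xs - (\<Sum>k\<in>set (tl xs). d k) + \<alpha> (last xs) (last xs)" for xs
  define u where "u i = Min (val ` paths i)" for i
  have finS: "finite S" using S finite_subset by blast
  have finp: "finite (paths i)" for i
  proof (rule finite_subset)
    show "paths i \<subseteq> {xs. set xs \<subseteq> S \<and> length xs \<le> card S}"
    proof
      fix xs assume "xs \<in> paths i"
      then have "distinct xs" "set xs \<subseteq> S" by (auto simp: paths_def)
      then show "xs \<in> {xs. set xs \<subseteq> S \<and> length xs \<le> card S}"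
        using card_mono[OF finS, of "set xs"] by (simp add: distinct_card)
    qed
  qed (rule finite_lists_length_le[OF finS])
  have triv: "[i] \<in> paths i" if "i \<in> S" for i using that by (simp add: paths_def)
  have ule: "u i \<le> val xs" if "xs \<in> paths i" for i xs
    unfolding u_def using finp that by (intro Min_le) auto
  have uex: "\<exists>xs\<in>paths i. u i = val xs" if "i \<in> S" for i
  proof -
    have "Min (val ` paths i) \<in> val ` paths i" using finp triv[OF that] by (intro Min_in) auto
    then show ?thesis by (auto simp: u_def)
  qed
  show ?thesis
  proof (rule tin_achievable[OF K adm S d0 dpos])
    fix i assume i: "i \<in> S"
    show "u i \<le> \<alpha> i i" using ule[OF triv[OF i]] by (simp add: val_def)
    obtain xs where xs: "xs \<in> paths i" "u i = val xs" using uex[OF i] by blast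
    have x: "xs \<noteq> []" "distinct xs" "set xs \<subseteq> S" "hd xs = i" using xs by (auto simp: paths_def)
    obtain ys where ys: "xs = i # ys" using x by (cases xs) auto
    \<comment> \<open>This is \<open>d i \<le> u i\<close> with the credits moved to the left.
      Closing the path to a cycle adds an edge that costs no more than stopping.\<close>
    have "(\<Sum>k\<in>set xs. d k) \<le> dpath \<alpha> xs + \<alpha> (last xs) (last xs)"
    proof (cases "length xs = 1")
      case True
      then show ?thesis using cyc[OF x(1-3)] ys by (simp add: Delta_def)
    next
      case False
      have lK: "last xs < K" "hd xs < K" using x S last_in_set hd_in_set by blast+
      have "(\<Sum>k\<in>set xs. d k) \<le> dpath \<alpha> xs + delta \<alpha> (last xs) (hd xs)"
        using cyc[OF x(1-3)] Delta_eq[OF False] csum_eq[OF x(1)] by simp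
      also have "delta \<alpha> (last xs) (hd xs) \<le> \<alpha> (last xs) (last xs)"
        using CTIN_nonneg[OF \<alpha> lK(2,1)] CTIN_nonneg[OF \<alpha> lK(1,1)]
        by (cases "last xs = hd xs") (auto simp: delta_def)
      finally show ?thesis by simp
    qed
    then show "d i \<le> u i" using x(2) unfolding xs(2) val_def ys by simp
  next
    fix i j assume i: "i \<in> S" and j: "j \<in> S" and ne: "i \<noteq> j"
    obtain xs where xs: "xs \<in> paths j" "u j = val xs" using uex[OF j] by blast
    have x: "xs \<noteq> []" "distinct xs" "set xs \<subseteq> S" "hd xs = j" using xs by (auto simp: paths_def)
    obtain zs where zs: "xs = j # zs" using x by (cases xs) auto
    have "u i \<le> delta \<alpha> i j - d j + val xs"
    \<comment> \<open>If \<open>i\<close> already occurs on the optimal path, prepending it creates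
      a loop. The loop has nonnegative cost by the cycle constraint, and cutting it off leaves a
      simple path from \<open>i\<close>.\<close>
    proof (cases "i \<in> set xs")
      case False
      then have "i # xs \<in> paths i" using x i by (auto simp: paths_def)
      then have "u i \<le> val (i # xs)" by (rule ule)
      also have "\<dots> = delta \<alpha> i j - d j + val xs" using x(2) by (simp add: val_def zs)
      finally show ?thesis .
    next
      case True
      then obtain as bs where ab: "xs = as @ i # bs" by (meson split_list)
      then obtain as' where as': "as = j # as'" using zs ne by (cases as) auto
      have "i # bs \<in> paths i" using x ab by (auto simp: paths_def)
      then have 1: "u i \<le> val (i # bs)" by (rule ule)
      have c: "(\<Sum>k\<in>set (as @ [i]). d k) \<le> Delta \<alpha> (as @ [i])"
        using x ab by (intro cyc) auto
      also have "\<dots> = dpath \<alpha> (as @ [i]) + delta \<alpha> i j"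
        using as' by (subst Delta_eq) (auto simp: csum_eq)
      finally have 2: "(\<Sum>k\<in>set (as @ [i]). d k) \<le> dpath \<alpha> (as @ [i]) + delta \<alpha> i j" .
      have di: "i \<notin> set as" "j \<notin> set as'" "j \<notin> set bs" "set as' \<inter> set bs = {}" "i \<notin> set as'" "i \<notin> set bs"
        using x(2) unfolding ab as' by auto
      have "set (tl xs) = insert i (set as' \<union> set bs)" using ab as' by auto
      then have "(\<Sum>k\<in>set (tl xs). d k) = d i + (\<Sum>k\<in>set as'. d k) + (\<Sum>k\<in>set bs. d k)"
        using di by (simp add: sum.union_disjoint)
      moreover have "(\<Sum>k\<in>set (as @ [i]). d k) = d j + (\<Sum>k\<in>set as'. d k) + d i"
        using di ne as' by simp
      moreover have "dpath \<alpha> xs = dpath \<alpha> (as @ [i]) + dpath \<alpha> (i # bs)"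
        unfolding ab by (rule dpath_append)
      moreover have "last xs = last (i # bs)" using ab by simp
      ultimately show ?thesis using 1 2 by (simp add: val_def)
    qed
    then show "u i - (\<alpha> i i - \<alpha> j i) \<le> u j - d j" using ne xs(2) by (simp add: delta_def)
  qed
qed

subsection \<open>The cyclic channel\<close>

text \<open>Directed arcs on a circle: two arcs in succession exceed the direct one by a multiple of
  the circumference.\<close>

lemma cyc_mod_triangle:
  fixes i j k K :: nat
  assumes "i < K" "j < K" "k < K"
  shows "(j + K - k) mod K \<le> (i + K - k) mod K + (j + K - i) mod K"
proof -
  have "(i + K - k) + (j + K - i) = (j + K - k) + K" using assms by simp
  then have "(j + K - k) mod K = ((i + K - k) + (j + K - i)) mod K" by simp
  also have "\<dots> = ((i + K - k) mod K + (j + K - i) mod K) mod K" by (rule mod_add_eq[symmetric])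
  also have "\<dots> \<le> (i + K - k) mod K + (j + K - i) mod K" by (rule mod_less_eq_dividend)
  finally show ?thesis .
qed

lemma cyc_mod_pair:
  fixes i j K :: nat
  assumes "i < K" "j < K" "i \<noteq> j"
  shows "(i + K - j) mod K + (j + K - i) mod K = K"
proof -
  have *: "(i + K - j) mod K + (j + K - i) mod K = K" if "i < j" "j < K" for i j :: nat
  proof -
    have "(i + K - j) mod K = i + K - j" using that by simp
    moreover have "(j + K - i) mod K = j - i"
    proof -
      have "j + K - i = (j - i) + K" using that by simp
      then have "(j + K - i) mod K = (j - i) mod K" by (simp only: mod_add_self2)
      then show ?thesis using that by simp
    qed
    ultimately show ?thesis using that by simp
  qed
  show ?thesis using *[of i j] *[of j i] assms by (cases "i < j") (auto simp: add.commute)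
qed

lemma cyc_pair:
  assumes "i < K" "j < K" "i \<noteq> j"
  shows "cyc K i j + cyc K j i = 1"
proof -
  have "real ((i + K - j) mod K) + real ((j + K - i) mod K) = real K"
    using cyc_mod_pair[OF assms] by (metis of_nat_add)
  then have "(real ((i + K - j) mod K) + real ((j + K - i) mod K)) / real K = 1" using assms by simp
  then show ?thesis unfolding cyc_def add_divide_distrib by linarith
qed

lemma cyc_triangle:
  assumes "i < K" "j < K" "k < K"
  shows "cyc K i k + cyc K j i \<le> 1 + cyc K j k"
proof -
  have "real ((j + K - k) mod K) \<le> real ((i + K - k) mod K) + real ((j + K - i) mod K)"
    using cyc_mod_triangle[OF assms] by (metis of_nat_add of_nat_le_iff)
  then have "real ((j + K - k) mod K) / real K \<le> real ((i + K - k) mod K) / real K + real ((j + K - i) mod K) / real K"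
    unfolding add_divide_distrib[symmetric] by (intro divide_right_mono) auto
  then show ?thesis unfolding cyc_def by linarith
qed

lemma cyc_CTIN: "K \<ge> 1 \<Longrightarrow> cyc K \<in> A_CTIN K"
  unfolding A_CTIN_def using cyc_nonneg[of K] cyc_pair[of _ K] cyc_triangle[of _ K]
  by (auto simp: algebra_simps)

text \<open>The predecessor \<open>pr k\<close> hears inputs other than \<open>k\<close> at most
  \<open>1 / K\<close> stronger than \<open>k\<close> does, and it hears the input of
  \<open>k\<close> with exponent only \<open>1 / K\<close>. So each of the \<open>K\<close> hops of
  the interference chain costs \<open>1 / K\<close>.\<close>

lemma cyc_IC_bound:
  assumes K: "K \<ge> 1" and adm: "admissible_channel K Gm" and d: "d \<in> GDoF_region False K (cyc K) Gm"
  shows "(\<Sum>k<K. d k) \<le> 1"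
\<comment> \<open>A single user has no interferer with which the chain could work; the path bound
  for one vertex takes its place.\<close>
proof (cases "K = 1")
  case True
  have "(\<Sum>k\<in>set [0]. d k) \<le> cyc K (last [0]) (last [0]) + dpath (cyc K) [0]"
    by (rule broadcast_path_bound[OF cyc_CTIN[OF K] K adm d]) (use True in auto)
  then show ?thesis using True by simp
next
  case False
  then have K2: "K \<ge> 2" using K by simp
  define pr where "pr k = (if k = 0 then K - 1 else k - 1)" for k
  have prK: "pr k < K" "pr k \<noteq> k" if "k < K" for k using that K2 by (auto simp: pr_def)
  have "(k + K - pr k) mod K = 1" if "k < K" for k
  proof (cases "k = 0")
    case True
    then show ?thesis using K2 by (simp add: pr_def)
  next
    case k: False
    then have "k + K - pr k = 1 + K" using that by (simp add: pr_def)
    then have "(k + K - pr k) mod K = 1 mod K" by (simp only: mod_add_self2)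
    then show ?thesis using K2 by simp
  qed
  then have one: "cyc K k (pr k) = 1 - 1 / real K" if "k < K" for k using that by (simp add: cyc_def)
  have "(\<Sum>k<K. d k) \<le> real K * (1 / real K)"
  proof (rule GDoF_interference_bound[OF K2 adm d])
    show "bij_betw pr {..<K} {..<K}"
      by (rule bij_betw_byWitness[where f' = "\<lambda>k. if k = K - 1 then 0 else k + 1"]) (use K2 in \<open>auto simp: pr_def\<close>)
    show "cyc K (pr k) i - cyc K k i \<le> 1 / real K" if "k < K" "i < K" for k i
      using cyc_triangle[OF prK(1)[OF that(1)] that] one[OF that(1)] by simp
    show "cyc K (pr k) k \<le> 1 / real K" if "k < K" for k
      using cyc_pair[OF prK(1)[OF that] that prK(2)[OF that]] one[OF that] by simp
  qed (use prK in auto)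
  then show ?thesis using K by simp
qed

subsection \<open>The extremal ratio\<close>

lemma sum_PTIN_le:
  assumes "d \<in> D_PTIN K \<alpha> S" "S \<subseteq> {..<K}" "\<alpha> \<in> A_CTIN K"
  shows "(\<Sum>k<K. d k) \<le> (\<Sum>k<K. \<alpha> k k)"
proof (rule sum_mono)
  fix k assume "k \<in> {..<K}"
  then have k: "k < K" by simp
  show "d k \<le> \<alpha> k k"
  proof (cases "k \<in> S")
    case True
    have "\<forall>\<pi>. is_cycle K \<pi> \<and> set \<pi> \<subseteq> S \<longrightarrow> (\<Sum>k\<in>set \<pi>. d k) \<le> Delta \<alpha> \<pi>"
      using assms(1) unfolding D_PTIN_def by simp
    from this[rule_format, of "[k]"] have "(\<Sum>k\<in>set [k]. d k) \<le> Delta \<alpha> [k]"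
      using True k by (simp add: is_cycle_def)
    then show ?thesis by (simp add: Delta_def)
  next
    case False
    then have "d k = 0" using assms(1) k by (simp add: D_PTIN_def)
    then show ?thesis using CTIN_nonneg[OF assms(3) k k] by simp
  qed
qed

text \<open>The TINA, interference and broadcast regions are nested, and division by
  \<open>2 - 1 / K\<close> leads from the last back into the first. Nonemptiness and boundedness
  accompany this because a real supremum is meaningful only with them.\<close>

lemma sum_GDoF_comparison:
  assumes K: "K \<ge> 1" and adm: "admissible_channel K Gm" and \<alpha>: "\<alpha> \<in> A_CTIN K"
  shows "D_sum_BC K \<alpha> Gm \<le> (2 - 1 / real K) * D_sum_TINA K \<alpha>" "D_sum_TINA K \<alpha> \<le> D_sum_IC K \<alpha> Gm"
    "0 \<le> D_sum_TINA K \<alpha>" "bdd_above {(\<Sum>k<K. d k) | d. d \<in> GDoF_region True K \<alpha> Gm}"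
    "{(\<Sum>k<K. d k) | d. d \<in> GDoF_region False K \<alpha> Gm} \<noteq> {}"
proof -
  define \<beta> where "\<beta> = 2 - 1 / real K"
  have \<beta>: "\<beta> > 0" using K by (simp add: \<beta>_def divide_simps)
  let ?T = "{(\<Sum>k<K. d k) | d. d \<in> D_TINA_region K \<alpha>}"
  let ?I = "{(\<Sum>k<K. d k) | d. d \<in> GDoF_region False K \<alpha> Gm}"
  let ?B = "{(\<Sum>k<K. d k) | d. d \<in> GDoF_region True K \<alpha> Gm}"
  have z: "(\<lambda>_. 0) \<in> D_PTIN K \<alpha> {}" by (auto simp: D_PTIN_def is_cycle_def)
  then have "(\<lambda>_. 0) \<in> D_TINA_region K \<alpha>" by (auto simp: D_TINA_region_def)
  then have zT: "0 \<in> ?T" by (intro CollectI exI[of _ "\<lambda>_. 0"]) simp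
  have TI: "?T \<subseteq> ?I" using PTIN_subset_IC[OF \<alpha> K adm] by (auto simp: D_TINA_region_def)
  have IB: "?I \<subseteq> ?B" using GDoF_IC_subset_BC by blast
  have bT: "bdd_above ?T"
    using sum_PTIN_le[OF _ _ \<alpha>] by (intro bdd_aboveI[of _ "\<Sum>k<K. \<alpha> k k"]) (auto simp: D_TINA_region_def)
  have BT: "x / \<beta> \<in> ?T" if xB: "x \<in> ?B" for x
  proof -
    obtain d where d: "x = (\<Sum>k<K. d k)" "d \<in> GDoF_region True K \<alpha> Gm" using xB by blast
    have "(\<lambda>k. d k / \<beta>) \<in> D_TINA_region K \<alpha>"
      using broadcast_scaled_in_PTIN[OF \<alpha> K adm d(2)] by (auto simp: D_TINA_region_def \<beta>_def)
    then show ?thesis unfolding d(1) sum_divide_distrib by blast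
  qed
  have le: "x \<le> \<beta> * Sup ?T" if "x \<in> ?B" for x
    using cSup_upper[OF BT[OF that] bT] \<beta> by (simp add: pos_divide_le_eq mult.commute)
  show bB: "bdd_above ?B" using le by (rule bdd_aboveI)
  have neB: "?B \<noteq> {}" using zT TI IB by blast
  show "D_sum_BC K \<alpha> Gm \<le> (2 - 1 / real K) * D_sum_TINA K \<alpha>"
    unfolding D_sum_BC_def D_sum_TINA_def \<beta>_def[symmetric] using neB le by (rule cSup_least)
  show "D_sum_TINA K \<alpha> \<le> D_sum_IC K \<alpha> Gm"
    unfolding D_sum_TINA_def D_sum_IC_def using zT TI bdd_above_mono[OF bB IB] by (intro cSup_subset_mono) auto
  show "0 \<le> D_sum_TINA K \<alpha>" unfolding D_sum_TINA_def by (rule cSup_upper[OF zT bT])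
  show "?I \<noteq> {}" using zT TI by blast
qed

theorem theorem3:
  fixes K :: nat
    and Gm :: "real \<Rightarrow> (nat \<Rightarrow> nat \<Rightarrow> nat \<Rightarrow> complex) measure"
  assumes "K \<ge> 1"
    and "admissible_channel K Gm"
  shows "is_max {D_sum_BC K \<alpha> Gm / D_sum_TINA K \<alpha> | \<alpha>.
                   \<alpha> \<in> A_CTIN K \<and> (\<exists>i<K. \<alpha> i i \<noteq> 0)} (2 - 1 / real K) \<and>
         is_max {D_sum_BC K \<alpha> Gm / D_sum_IC K \<alpha> Gm | \<alpha>.
                   \<alpha> \<in> A_CTIN K \<and> (\<exists>i<K. \<alpha> i i \<noteq> 0)} (2 - 1 / real K)"
proof -
  define \<beta> where "\<beta> = 2 - 1 / real K"
  have \<beta>: "\<beta> > 0" using assms(1) by (simp add: \<beta>_def divide_simps)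
  note cmp = sum_GDoF_comparison[OF assms]
  have upT: "D_sum_BC K \<alpha> Gm / D_sum_TINA K \<alpha> \<le> \<beta>" if "\<alpha> \<in> A_CTIN K" for \<alpha>
  proof -
    have "D_sum_BC K \<alpha> Gm \<le> \<beta> * D_sum_TINA K \<alpha>" using cmp(1)[OF that] by (simp add: \<beta>_def)
    \<comment> \<open>A vanishing denominator makes the quotient 0 by convention, which is still at
      most \<open>\<beta>\<close>.\<close>
    then show ?thesis using cmp(3)[OF that] \<beta> by (cases "D_sum_TINA K \<alpha> = 0") (auto simp: divide_simps)
  qed
  have upI: "D_sum_BC K \<alpha> Gm / D_sum_IC K \<alpha> Gm \<le> \<beta>" if "\<alpha> \<in> A_CTIN K" for \<alpha>
  proof -
    have "D_sum_BC K \<alpha> Gm \<le> \<beta> * D_sum_TINA K \<alpha>" using cmp(1)[OF that] by (simp add: \<beta>_def)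
    also have "\<dots> \<le> \<beta> * D_sum_IC K \<alpha> Gm" using cmp(2)[OF that] \<beta> by (intro mult_left_mono) auto
    finally show ?thesis
      using cmp(2,3)[OF that] \<beta> by (cases "D_sum_IC K \<alpha> Gm = 0") (auto simp: divide_simps)
  qed
  have ctin: "cyc K \<in> A_CTIN K" by (rule cyc_CTIN[OF assms(1)])
  define d where "d = (\<lambda>k. if k < K then (if k = 0 then 1 else 1 / real K) else 0)"
  have "(\<Sum>k<K. d k) = \<beta>"
  proof -
    have "(\<Sum>k<K. d k) = d 0 + (\<Sum>k\<in>{..<K} - {0}. d k)" using assms(1) by (intro sum.remove) auto
    also have "(\<Sum>k\<in>{..<K} - {0}. d k) = (\<Sum>k\<in>{..<K} - {0}. 1 / real K)" by (rule sum.cong) (auto simp: d_def)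
    also have "\<dots> = real (K - 1) / real K" using assms(1) by simp
    finally show ?thesis using assms(1) by (simp add: d_def \<beta>_def divide_simps of_nat_diff)
  qed
  then have "\<beta> \<in> {(\<Sum>k<K. d k) | d. d \<in> GDoF_region True K (cyc K) Gm}"
    using cyc_broadcast_achievable[OF assms] unfolding d_def[symmetric] by blast
  then have lo: "\<beta> \<le> D_sum_BC K (cyc K) Gm"
    unfolding D_sum_BC_def using cmp(4)[OF ctin] by (intro cSup_upper)
  have hi: "D_sum_IC K (cyc K) Gm \<le> 1"
    unfolding D_sum_IC_def using cyc_IC_bound[OF assms] cmp(5)[OF ctin] by (intro cSup_least) auto
  \<comment> \<open>The value is squeezed rather than computed from the polyhedron: it is at most
    the interference sum and at least the broadcast sum divided by \<open>\<beta>\<close>.\<close>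
  have T: "D_sum_TINA K (cyc K) = 1"
  proof (rule antisym)
    show "D_sum_TINA K (cyc K) \<le> 1" using cmp(2)[OF ctin] hi by linarith
    have "\<beta> * 1 \<le> \<beta> * D_sum_TINA K (cyc K)" using lo cmp(1)[OF ctin] by (simp add: \<beta>_def)
    then show "1 \<le> D_sum_TINA K (cyc K)" using \<beta> by (simp only: mult_le_cancel_left_pos)
  qed
  have I: "D_sum_IC K (cyc K) Gm = 1" using cmp(2)[OF ctin] hi T by linarith
  have B: "D_sum_BC K (cyc K) Gm = \<beta>" using lo cmp(1)[OF ctin] T by (simp add: \<beta>_def)
  have nz: "\<exists>i<K. cyc K i i \<noteq> 0" using assms(1) by (intro exI[of _ 0]) simp
  show ?thesis
    unfolding is_max_def \<beta>_def[symmetric]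
  proof (intro conjI ballI)
    show "\<beta> \<in> {D_sum_BC K \<alpha> Gm / D_sum_TINA K \<alpha> | \<alpha>. \<alpha> \<in> A_CTIN K \<and> (\<exists>i<K. \<alpha> i i \<noteq> 0)}"
      using ctin nz T B by (intro CollectI exI[of _ "cyc K"]) simp
    show "\<beta> \<in> {D_sum_BC K \<alpha> Gm / D_sum_IC K \<alpha> Gm | \<alpha>. \<alpha> \<in> A_CTIN K \<and> (\<exists>i<K. \<alpha> i i \<noteq> 0)}"
      using ctin nz I B by (intro CollectI exI[of _ "cyc K"]) simp
  qed (use upT upI in auto)
qed

end
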